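(* Let $\Gamma$ be a finite group, $(G,g,f)$ a third-type datum, $A=k[\Gamma]$, $H=\mathfrak A^3_G(g,f)$. Let $D=(\triangleright,\triangleleft,\gamma)$ and $D'=(\triangleright',\triangleleft',\gamma')$ be two matched-pair data for $(\Gamma,G,g,f)$, with corresponding matched pairs of $A$ and $H$, bicrossed products $E_D$ and $E_{D'}$, and associated group/function pairs $(L,F)$ and $(L',F')$, so that $E_D\cong\mathfrak A^3_L(g,F)$ and $E_{D'}\cong\mathfrak A^3_{L'}(g,F')$. Then $$\mathfrak A^3_L(g,F)\cong\mathfrak A^3_{L'}(g,F')$$ as Hopf algebras (equivalently $E_D\cong E_{D'}$ as Hopf algebras) if and only if there is a group isomorphism $\Theta:L\to L'$ such that $\Theta(g)=g$ and $F'\circ\Theta=F$. If, in addition, both matched pairs have trivial left action, with parameters $(\phi,\gamma)$ and $(\phi',\gamma')$ respectively, then there exists a factor-preserving Hopf algebra isomorphism $E_D\to E_{D'}$ if and only if there exist $\sigma\in\operatorname{Aut}_{g,f}(G)$ and $\psi\in\operatorname{Aut}(\Gamma)$ such that $$\phi'_h=\sigma\circ\phi_{\psi^{-1}(h)}\circ\sigma^{-1},\qquad \gamma'_h=\gamma_{\psi^{-1}(h)}\qquad\text{for all }h\in\Gamma.$$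
   Context: $k$ is an algebraically closed field of characteristic $p>0$; all algebras, tensor products etc. are over $k$; all groups are finite. A third-type datum is a triple $(G,g,f)$ where $G$ is a finite group, $g\in Z(G)$, $f:G\to(k,+)$ is a group homomorphism with $f(g)=1$, and $(f(t)^p-f(t))(1-g^p)=0$ in $k[G]$ for all $t\in G$. The Hopf algebra $\mathfrak A^3_G(g,f)$ is generated as an algebra by $k[G]$ and an element $x$ subject to $tx-xt=f(t)\,t(1-g)$ for $t\in G$ and $x^p=x$, with $\Delta(t)=t\otimes t$, $\varepsilon(t)=1$, $S(t)=t^{-1}$ for $t\in G$, and $\Delta(x)=x\otimes 1+g\otimes x$, $\varepsilon(x)=0$, $S(x)=-g^{-1}x$. It has basis $\{tx^i\mid t\in G,\ 0\le i<p\}$. A matched pair of Hopf algebras $(A,H,\triangleright,\triangleleft)$ consists of a left action $\triangleright:H\otimes A\to A$ making $A$ a left $H$-module coalgebra and a right action $\triangleleft:H\otimes A\to H$ making $H$ a right $A$-module coalgebra such that: $u\triangleright 1=\varepsilon(u)1$, $1\triangleleft a=\varepsilon(a)1$; $u\triangleright(ab)=(u_{(1)}\triangleright a_{(1)})((u_{(2)}\triangleleft a_{(2)})\triangleright b)$; $(uv)\triangleleft a=(u\triangleleft(v_{(1)}\triangleright a_{(1)}))(v_{(2)}\triangleleft a_{(2)})$; $u_{(1)}\triangleleft a_{(1)}\otimes u_{(2)}\triangleright a_{(2)}=u_{(2)}\triangleleft a_{(2)}\otimes u_{(1)}\triangleright a_{(1)}$. The bicrossed product $A\bowtie H$ is the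 tensor coalgebra $A\otimes H$ with multiplication $(a\bowtie u)(b\bowtie v)=a(u_{(1)}\triangleright b_{(1)})\bowtie(u_{(2)}\triangleleft b_{(2)})v$. A matched pair of groups $(\Gamma,G,\triangleright,\triangleleft)$ consists of a left action of $G$ on the set $\Gamma$ and a right action of $\Gamma$ on the set $G$ with $t\triangleright(hk)=(t\triangleright h)((t\triangleleft h)\triangleright k)$ and $(ts)\triangleleft h=(t\triangleleft(s\triangleright h))(s\triangleleft h)$; the group bicrossed product $\Gamma\bowtie G$ is $\Gamma\times G$ with multiplication $(h,t)(k,s)=(h(t\triangleright k),(t\triangleleft k)s)$. Let $k_g=\{a\in k\mid (a^p-a)(1-g^p)=0\}$, an additive group. A matched-pair datum for $(\Gamma,G,g,f)$ is a triple $(\triangleright,\triangleleft,\gamma)$ where $(\Gamma,G,\triangleright,\triangleleft)$ is a matched pair of groups with $g\triangleright h=h$ and $g\triangleleft h=g$ for all $h\in\Gamma$, and $\gamma:\Gamma\to k_g^+$ is a group homomorphism with $f(t\triangleleft h)=f(t)+\gamma_{t\triangleright h}-\gamma_h$ for all $t\in G,h\in\Gamma$. The corresponding matched pair of Hopf algebras of $A=k[\Gamma]$ and $H=\mathfrak A^3_G(g,f)$ is the unique one extending the group actions with $x\triangleright h=0$, $x\triangleleft h=x+\gamma_h(1-g)$; every matched pair of $A$ and $H$ arises uniquely this way. The associated group/function pair is $L=\Gamma\bowtie G$ and $F(h,t)=f(t)-\gamma_h$; $g$ denotes $(1,g)\in L$, and $A\bowtie H\cong\mathfrak A^3_L(g,F)$.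 $\operatorname{Aut}_{g,f}(G)=\{\sigma\in\operatorname{Aut}(G)\mid\sigma(g)=g,\ f\circ\sigma=f\}$. The left action is trivial if $u\triangleright a=\varepsilon(u)a$ for all $u\in H,a\in A$; in that case the parameters $(\phi,\gamma)$ of the matched pair are the group homomorphism $\gamma:\Gamma\to k_g^+$ that is the third component of its matched-pair datum $(\triangleright,\triangleleft,\gamma)$ (so $x\triangleleft h=x+\gamma_h(1-g)$ for $h\in\Gamma$) and $\phi_h(t)=t\triangleleft h$ ($t\in G$, $h\in\Gamma$). A Hopf isomorphism $E_D\to E_{D'}$ is factor-preserving if it maps the factor $A$ onto $A$ and the factor $H$ onto $H$. *)

theory Defs
  imports
    "HOL-Computational_Algebra.Polynomial"
    "HOL-Library.Poly_Mapping"
    "HOL-Algebra.Module"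
    "HOL-Algebra.QuotRing"
begin

section \<open>Vector spaces, tensor products and algebras over a field\<close>

text \<open>
  The ground field is a type \<open>'k\<close>; algebras and vector spaces over it are
  \<^typ>\<open>('k, 'a) module\<close> records of \<open>HOL-Algebra\<close> (a ring record with scalar multiplication).
\<close>

definition ground :: "('k::field, 'k) module" where
  "ground = \<lparr>carrier = UNIV, mult = (*), one = 1, zero = 0, add = (+), smult = (*)\<rparr>"

text \<open>
  The free vector space on a set. As a mere vector space it carries the zero multiplication, and
  the field \<open>one\<close> has no meaning.
\<close>

definition free_vs :: "'x set \<Rightarrow> ('k::field, 'x \<Rightarrow>\<^sub>0 'k) module" where
  "free_vs S = \<lparr>carrier = {r. Poly_Mapping.keys r \<subseteq> S}, mult = (\<lambda>_ _. 0), one = 0, zero = 0,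
    add = (+), smult = (\<lambda>c. Poly_Mapping.map ((*) c))\<rparr>"

text \<open>The linear extension to the free vector space of a map into \<open>V\<close>.\<close>

definition lin_ext ::
    "('k::field, 'b, 'm) module_scheme \<Rightarrow> ('x \<Rightarrow> 'b) \<Rightarrow> ('x \<Rightarrow>\<^sub>0 'k) \<Rightarrow> 'b" where
  "lin_ext V \<beta> r = (\<Oplus>\<^bsub>V\<^esub>x\<in>Poly_Mapping.keys r. Poly_Mapping.lookup r x \<odot>\<^bsub>V\<^esub> \<beta> x)"

definition monoid_alg :: "('x, 'm) monoid_scheme \<Rightarrow> ('k::field, 'x \<Rightarrow>\<^sub>0 'k) module" where
  "monoid_alg M = (free_vs (carrier M))
    \<lparr>mult := (\<lambda>r s. \<Sum>a\<in>Poly_Mapping.keys r. \<Sum>b\<in>Poly_Mapping.keys s.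
        Poly_Mapping.single (a \<otimes>\<^bsub>M\<^esub> b) (Poly_Mapping.lookup r a * Poly_Mapping.lookup s b)),
     one := Poly_Mapping.single \<one>\<^bsub>M\<^esub> 1\<rparr>"

text \<open>The canonical basis element at \<open>x\<close>.\<close>

abbreviation \<delta> :: "'x \<Rightarrow> 'x \<Rightarrow>\<^sub>0 'k::field" where
  "\<delta> x \<equiv> Poly_Mapping.single x 1"

text \<open>The quotient of \<open>V\<close> by a subspace (or two-sided ideal) \<open>N\<close>; its elements are cosets.\<close>

definition quot ::
    "('k::field, 'a, 'm) module_scheme \<Rightarrow> 'a set \<Rightarrow> ('k, 'a set) module" where
  "quot V N = ring.extend (V Quot N)
    (module.fields (\<lambda>c X. \<Union>x\<in>X. N +>\<^bsub>V\<^esub> (c \<odot>\<^bsub>V\<^esub> x)))"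

definition tensor_rels ::
    "('k::field, 'a, 'm) module_scheme \<Rightarrow> ('k, 'b, 'n) module_scheme \<Rightarrow> ('a \<times> 'b \<Rightarrow>\<^sub>0 'k) set" where
  "tensor_rels V W =
     {\<delta> (v \<oplus>\<^bsub>V\<^esub> v', w) - \<delta> (v, w) - \<delta> (v', w) | v v' w.
        v \<in> carrier V \<and> v' \<in> carrier V \<and> w \<in> carrier W}
   \<union> {\<delta> (v, w \<oplus>\<^bsub>W\<^esub> w') - \<delta> (v, w) - \<delta> (v, w') | v w w'.
        v \<in> carrier V \<and> w \<in> carrier W \<and> w' \<in> carrier W}
   \<union> {\<delta> (c \<odot>\<^bsub>V\<^esub> v, w) - Poly_Mapping.single (v, w) c | c v w.
        v \<in> carrier V \<and> w \<in> carrier W}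
   \<union> {\<delta> (v, c \<odot>\<^bsub>W\<^esub> w) - Poly_Mapping.single (v, w) c | c v w.
        v \<in> carrier V \<and> w \<in> carrier W}"

definition tensor_null ::
    "('k::field, 'a, 'm) module_scheme \<Rightarrow> ('k, 'b, 'n) module_scheme \<Rightarrow> ('a \<times> 'b \<Rightarrow>\<^sub>0 'k) set" where
  "tensor_null V W =
    (\<lambda>N. submodule N ground (free_vs (carrier V \<times> carrier W))) hull tensor_rels V W"

definition tens ::
    "('k::field, 'a, 'm) module_scheme \<Rightarrow> ('k, 'b, 'n) module_scheme \<Rightarrow>
      'a \<Rightarrow> 'b \<Rightarrow> ('a \<times> 'b \<Rightarrow>\<^sub>0 'k) set" where
  "tens V W v w = tensor_null V W +>\<^bsub>free_vs (carrier V \<times> carrier W)\<^esub> \<delta> (v, w)"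

text \<open>
  The linear map on a tensor product induced by a bilinear map \<open>\<beta>\<close> into \<open>P\<close>. For bilinear \<open>\<beta>\<close>
  the value does not depend on the representative chosen.
\<close>

definition tensor_lift ::
    "('k::field, 'c, 'm) module_scheme \<Rightarrow> ('a \<Rightarrow> 'b \<Rightarrow> 'c) \<Rightarrow> ('a \<times> 'b \<Rightarrow>\<^sub>0 'k) set \<Rightarrow> 'c" where
  "tensor_lift P \<beta> X = lin_ext P (\<lambda>(v, w). \<beta> v w) (SOME r. r \<in> X)"

text \<open>
  The tensor product, with the multiplication \<open>(v \<otimes> w)(v' \<otimes> w') = vv' \<otimes> ww'\<close>, which is
  meaningful when both factors are algebras.
\<close>

definition tensor_vs ::
    "('k::field, 'a, 'm) module_scheme \<Rightarrow> ('k, 'b, 'n) module_scheme \<Rightarrow>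
      ('k, ('a \<times> 'b \<Rightarrow>\<^sub>0 'k) set) module" where
  "tensor_vs V W = quot (free_vs (carrier V \<times> carrier W)) (tensor_null V W)"

definition tensor ::
    "('k::field, 'a, 'm) module_scheme \<Rightarrow> ('k, 'b, 'n) module_scheme \<Rightarrow>
      ('k, ('a \<times> 'b \<Rightarrow>\<^sub>0 'k) set) module" where
  "tensor V W = (tensor_vs V W)
    \<lparr>mult := (\<lambda>X Y. tensor_lift (tensor_vs V W) (\<lambda>v w.
                  tensor_lift (tensor_vs V W) (\<lambda>v' w'.
                    tens V W (v \<otimes>\<^bsub>V\<^esub> v') (w \<otimes>\<^bsub>W\<^esub> w')) Y) X),
     one := tens V W \<one>\<^bsub>V\<^esub> \<one>\<^bsub>W\<^esub>\<rparr>"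


section \<open>Hopf algebras\<close>

record (overloaded) ('k, 'a) hopf = "('k, 'a) module" +
  comult :: "'a \<Rightarrow> ('a \<times> 'a \<Rightarrow>\<^sub>0 'k) set"
  counit :: "'a \<Rightarrow> 'k"
  antipode :: "'a \<Rightarrow> 'a"

text \<open>Sweedler notation: \<open>sweedler P H u \<beta>\<close> is \<open>\<beta>(u\<^sub>(\<^sub>1\<^sub>), u\<^sub>(\<^sub>2\<^sub>))\<close> for a bilinear map \<open>\<beta>\<close> into \<open>P\<close>.\<close>

definition sweedler ::
    "('k::field, 'c, 'm) module_scheme \<Rightarrow> ('k, 'a, 'n) hopf_scheme \<Rightarrow> 'a \<Rightarrow>
      ('a \<Rightarrow> 'a \<Rightarrow> 'c) \<Rightarrow> 'c" where
  "sweedler P H u \<beta> = tensor_lift P \<beta> (comult H u)"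

definition hopf_hom ::
    "('k::field, 'a, 'm) hopf_scheme \<Rightarrow> ('k, 'b, 'n) hopf_scheme \<Rightarrow> ('a \<Rightarrow> 'b) set" where
  "hopf_hom H K = {\<phi> \<in> ring_hom H K.
     (\<forall>c. \<forall>a\<in>carrier H. \<phi> (c \<odot>\<^bsub>H\<^esub> a) = c \<odot>\<^bsub>K\<^esub> \<phi> a) \<and>
     (\<forall>a\<in>carrier H.
        comult K (\<phi> a) = sweedler (tensor K K) H a (\<lambda>a1 a2. tens K K (\<phi> a1) (\<phi> a2)) \<and>
        counit K (\<phi> a) = counit H a \<and>
        antipode K (\<phi> a) = \<phi> (antipode H a))}"

definition hopf_iso ::
    "('k::field, 'a, 'm) hopf_scheme \<Rightarrow> ('k, 'b, 'n) hopf_scheme \<Rightarrow> ('a \<Rightarrow> 'b) set" where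
  "hopf_iso H K = {\<phi> \<in> hopf_hom H K. bij_betw \<phi> (carrier H) (carrier K)}"

definition hopf_isomorphic ::
    "('k::field, 'a, 'm) hopf_scheme \<Rightarrow> ('k, 'b, 'n) hopf_scheme \<Rightarrow> bool" where
  "hopf_isomorphic H K \<longleftrightarrow> hopf_iso H K \<noteq> {}"

definition group_hopf :: "('h, 'm) monoid_scheme \<Rightarrow> ('k::field, 'h \<Rightarrow>\<^sub>0 'k) hopf" where
  "group_hopf G = (let K = monoid_alg G in
    module.extend K (hopf.fields
      (lin_ext (tensor K K) (\<lambda>t. tens K K (\<delta> t) (\<delta> t)))
      (lin_ext ground (\<lambda>_. 1))
      (lin_ext K (\<lambda>t. \<delta> (inv\<^bsub>G\<^esub> t)))))"


section \<open>Third-type data and the Hopf algebra \<open>\<AA>\<^sup>3\<^sub>G(g,f)\<close>\<close>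

text \<open>The condition \<open>(a\<^sup>p - a)(1 - g\<^sup>p) = 0\<close> in \<open>k[G]\<close> that defines \<open>k\<^sub>g\<close>.\<close>

definition k_sub :: "('g, 'm) monoid_scheme \<Rightarrow> 'g \<Rightarrow> 'k::field set" where
  "k_sub G g = {a. (a ^ CHAR('k) - a) \<odot>\<^bsub>monoid_alg G\<^esub> (\<one>\<^bsub>monoid_alg G\<^esub> - \<delta> (g [^]\<^bsub>G\<^esub> CHAR('k)))
      = \<zero>\<^bsub>monoid_alg G\<^esub>}"

definition third_type_datum ::
    "('g, 'm) monoid_scheme \<Rightarrow> 'g \<Rightarrow> ('g \<Rightarrow> 'k::field) \<Rightarrow> bool" where
  "third_type_datum G g f \<longleftrightarrow>
     group G \<and> finite (carrier G) \<and>
     g \<in> carrier G \<and> (\<forall>t\<in>carrier G. g \<otimes>\<^bsub>G\<^esub> t = t \<otimes>\<^bsub>G\<^esub> g) \<and>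
     (\<forall>s\<in>carrier G. \<forall>t\<in>carrier G. f (s \<otimes>\<^bsub>G\<^esub> t) = f s + f t) \<and>
     f g = 1 \<and> (\<forall>t\<in>carrier G. f t \<in> k_sub G g)"

datatype 'g letter = Grp 'g | Xgen

text \<open>The free algebra on the letters \<open>t \<in> G\<close> and \<open>x\<close>, with basis the words in these letters.\<close>

definition A3_free :: "('g, 'm) monoid_scheme \<Rightarrow> ('k::field, 'g letter list \<Rightarrow>\<^sub>0 'k) module" where
  "A3_free G = monoid_alg
     \<lparr>carrier = lists (insert Xgen (Grp ` carrier G)), mult = (@), one = []\<rparr>"

definition A3_rels ::
    "('g, 'm) monoid_scheme \<Rightarrow> 'g \<Rightarrow> ('g \<Rightarrow> 'k::field) \<Rightarrow> ('g letter list \<Rightarrow>\<^sub>0 'k) set" where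
  "A3_rels G g f = (let F = A3_free G; \<tau> = (\<lambda>t. \<delta> [Grp t]); x = \<delta> [Xgen] in
     {\<tau> \<one>\<^bsub>G\<^esub> - \<one>\<^bsub>F\<^esub>}
   \<union> {\<tau> s \<otimes>\<^bsub>F\<^esub> \<tau> t - \<tau> (s \<otimes>\<^bsub>G\<^esub> t) | s t. s \<in> carrier G \<and> t \<in> carrier G}
   \<union> {(\<tau> t \<otimes>\<^bsub>F\<^esub> x - x \<otimes>\<^bsub>F\<^esub> \<tau> t) - f t \<odot>\<^bsub>F\<^esub> (\<tau> t \<otimes>\<^bsub>F\<^esub> (\<one>\<^bsub>F\<^esub> - \<tau> g)) | t. t \<in> carrier G}
   \<union> {x [^]\<^bsub>F\<^esub> CHAR('k) - x})"

definition A3_ideal ::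
    "('g, 'm) monoid_scheme \<Rightarrow> 'g \<Rightarrow> ('g \<Rightarrow> 'k::field) \<Rightarrow> ('g letter list \<Rightarrow>\<^sub>0 'k) set" where
  "A3_ideal G g f = Idl\<^bsub>A3_free G\<^esub> (A3_rels G g f)"

definition A3_alg ::
    "('g, 'm) monoid_scheme \<Rightarrow> 'g \<Rightarrow> ('g \<Rightarrow> 'k::field) \<Rightarrow>
      ('k, ('g letter list \<Rightarrow>\<^sub>0 'k) set) module" where
  "A3_alg G g f = quot (A3_free G) (A3_ideal G g f)"

definition A3_gen ::
    "('g, 'm) monoid_scheme \<Rightarrow> 'g \<Rightarrow> ('g \<Rightarrow> 'k::field) \<Rightarrow>
      'g letter \<Rightarrow> ('g letter list \<Rightarrow>\<^sub>0 'k) set" where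
  "A3_gen G g f l = A3_ideal G g f +>\<^bsub>A3_free G\<^esub> \<delta> [l]"

text \<open>
  The algebra homomorphism into \<open>B\<close> induced on a quotient of a free algebra by the values \<open>\<phi>\<close> of the
  generators. It does not depend on the representative chosen if \<open>\<phi>\<close> respects the relations.
\<close>

definition alg_ext ::
    "('k::field, 'b, 'm) module_scheme \<Rightarrow> ('l \<Rightarrow> 'b) \<Rightarrow> ('l list \<Rightarrow>\<^sub>0 'k) set \<Rightarrow> 'b" where
  "alg_ext B \<phi> C =
    lin_ext B (\<lambda>w. foldr (\<lambda>l b. \<phi> l \<otimes>\<^bsub>B\<^esub> b) w \<one>\<^bsub>B\<^esub>) (SOME a. a \<in> C)"

text \<open>The antipode is the algebra homomorphism into the opposite algebra.\<close>

definition A3 ::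
    "('g, 'm) monoid_scheme \<Rightarrow> 'g \<Rightarrow> ('g \<Rightarrow> 'k::field) \<Rightarrow>
      ('k, ('g letter list \<Rightarrow>\<^sub>0 'k) set) hopf" where
  "A3 G g f =
    (let B = A3_alg G g f; \<tau> = (\<lambda>t. A3_gen G g f (Grp t)); x = A3_gen G g f Xgen in
     module.extend B (hopf.fields
       (alg_ext (tensor B B) (\<lambda>l. case l of
            Grp t \<Rightarrow> tens B B (\<tau> t) (\<tau> t)
          | Xgen \<Rightarrow> tens B B x \<one>\<^bsub>B\<^esub> \<oplus>\<^bsub>tensor B B\<^esub> tens B B (\<tau> g) x))
       (alg_ext ground (\<lambda>l. case l of Grp t \<Rightarrow> 1 | Xgen \<Rightarrow> 0))
       (alg_ext (B\<lparr>mult := (\<lambda>a b. b \<otimes>\<^bsub>B\<^esub> a)\<rparr>) (\<lambda>l. case l of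
            Grp t \<Rightarrow> \<tau> (inv\<^bsub>G\<^esub> t)
          | Xgen \<Rightarrow> \<ominus>\<^bsub>B\<^esub> (\<tau> (inv\<^bsub>G\<^esub> g) \<otimes>\<^bsub>B\<^esub> x)))))"


section \<open>Matched pairs and bicrossed products of Hopf algebras\<close>

definition bilinear_into ::
    "('k::field, 'a, 'm) module_scheme \<Rightarrow> ('k, 'b, 'n) module_scheme \<Rightarrow>
      ('k, 'c, 'o) module_scheme \<Rightarrow> ('a \<Rightarrow> 'b \<Rightarrow> 'c) \<Rightarrow> bool" where
  "bilinear_into V W P \<beta> \<longleftrightarrow>
     (\<forall>v\<in>carrier V. \<forall>w\<in>carrier W. \<beta> v w \<in> carrier P) \<and>
     (\<forall>v\<in>carrier V. \<forall>v'\<in>carrier V. \<forall>w\<in>carrier W. \<beta> (v \<oplus>\<^bsub>V\<^esub> v') w = \<beta> v w \<oplus>\<^bsub>P\<^esub> \<beta> v' w) \<and>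
     (\<forall>v\<in>carrier V. \<forall>w\<in>carrier W. \<forall>w'\<in>carrier W. \<beta> v (w \<oplus>\<^bsub>W\<^esub> w') = \<beta> v w \<oplus>\<^bsub>P\<^esub> \<beta> v w') \<and>
     (\<forall>c. \<forall>v\<in>carrier V. \<forall>w\<in>carrier W.
        \<beta> (c \<odot>\<^bsub>V\<^esub> v) w = c \<odot>\<^bsub>P\<^esub> \<beta> v w \<and> \<beta> v (c \<odot>\<^bsub>W\<^esub> w) = c \<odot>\<^bsub>P\<^esub> \<beta> v w)"

text \<open>An action by \<open>\<beta> : U \<otimes> V \<rightarrow> P\<close>, where \<open>P\<close> is \<open>U\<close> or \<open>V\<close>, that is a map of coalgebras.\<close>

definition coalgebra_action ::
    "('k::field, 'a, 'm) hopf_scheme \<Rightarrow> ('k, 'b, 'n) hopf_scheme \<Rightarrow>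
      ('k, 'c, 'o) hopf_scheme \<Rightarrow> ('a \<Rightarrow> 'b \<Rightarrow> 'c) \<Rightarrow> bool" where
  "coalgebra_action U V P \<beta> \<longleftrightarrow>
     (\<forall>u\<in>carrier U. \<forall>v\<in>carrier V.
        comult P (\<beta> u v) = sweedler (tensor P P) U u (\<lambda>u1 u2.
          sweedler (tensor P P) V v (\<lambda>v1 v2. tens P P (\<beta> u1 v1) (\<beta> u2 v2))) \<and>
        counit P (\<beta> u v) = counit U u * counit V v)"

definition left_module_coalgebra ::
    "('k::field, 'u, 'n) hopf_scheme \<Rightarrow> ('k, 'a, 'm) hopf_scheme \<Rightarrow> ('u \<Rightarrow> 'a \<Rightarrow> 'a) \<Rightarrow> bool" where
  "left_module_coalgebra H A L \<longleftrightarrow> bilinear_into H A A L \<and>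
     (\<forall>a\<in>carrier A. L \<one>\<^bsub>H\<^esub> a = a) \<and>
     (\<forall>u\<in>carrier H. \<forall>v\<in>carrier H. \<forall>a\<in>carrier A. L (u \<otimes>\<^bsub>H\<^esub> v) a = L u (L v a)) \<and>
     coalgebra_action H A A L"

definition right_module_coalgebra ::
    "('k::field, 'u, 'n) hopf_scheme \<Rightarrow> ('k, 'a, 'm) hopf_scheme \<Rightarrow> ('u \<Rightarrow> 'a \<Rightarrow> 'u) \<Rightarrow> bool" where
  "right_module_coalgebra H A R \<longleftrightarrow> bilinear_into H A H R \<and>
     (\<forall>u\<in>carrier H. R u \<one>\<^bsub>A\<^esub> = u) \<and>
     (\<forall>u\<in>carrier H. \<forall>a\<in>carrier A. \<forall>b\<in>carrier A. R u (a \<otimes>\<^bsub>A\<^esub> b) = R (R u a) b) \<and>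
     coalgebra_action H A H R"

definition hopf_matched_pair ::
    "('k::field, 'a, 'm) hopf_scheme \<Rightarrow> ('k, 'u, 'n) hopf_scheme \<Rightarrow>
      ('u \<Rightarrow> 'a \<Rightarrow> 'a) \<Rightarrow> ('u \<Rightarrow> 'a \<Rightarrow> 'u) \<Rightarrow> bool" where
  "hopf_matched_pair A H L R \<longleftrightarrow>
     left_module_coalgebra H A L \<and> right_module_coalgebra H A R \<and>
     (\<forall>u\<in>carrier H. L u \<one>\<^bsub>A\<^esub> = counit H u \<odot>\<^bsub>A\<^esub> \<one>\<^bsub>A\<^esub>) \<and>
     (\<forall>a\<in>carrier A. R \<one>\<^bsub>H\<^esub> a = counit A a \<odot>\<^bsub>H\<^esub> \<one>\<^bsub>H\<^esub>) \<and>
     (\<forall>u\<in>carrier H. \<forall>a\<in>carrier A. \<forall>b\<in>carrier A.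
        L u (a \<otimes>\<^bsub>A\<^esub> b) = sweedler A H u (\<lambda>u1 u2. sweedler A A a (\<lambda>a1 a2.
          L u1 a1 \<otimes>\<^bsub>A\<^esub> L (R u2 a2) b))) \<and>
     (\<forall>u\<in>carrier H. \<forall>v\<in>carrier H. \<forall>a\<in>carrier A.
        R (u \<otimes>\<^bsub>H\<^esub> v) a = sweedler H H v (\<lambda>v1 v2. sweedler H A a (\<lambda>a1 a2.
          R u (L v1 a1) \<otimes>\<^bsub>H\<^esub> R v2 a2))) \<and>
     (\<forall>u\<in>carrier H. \<forall>a\<in>carrier A.
        sweedler (tensor H A) H u (\<lambda>u1 u2. sweedler (tensor H A) A a (\<lambda>a1 a2.
          tens H A (R u1 a1) (L u2 a2))) =
        sweedler (tensor H A) H u (\<lambda>u1 u2. sweedler (tensor H A) A a (\<lambda>a1 a2.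
          tens H A (R u2 a2) (L u1 a1))))"

definition bicrossed_alg ::
    "('k::field, 'a, 'm) hopf_scheme \<Rightarrow> ('k, 'u, 'n) hopf_scheme \<Rightarrow>
      ('u \<Rightarrow> 'a \<Rightarrow> 'a) \<Rightarrow> ('u \<Rightarrow> 'a \<Rightarrow> 'u) \<Rightarrow> ('k, ('a \<times> 'u \<Rightarrow>\<^sub>0 'k) set) module" where
  "bicrossed_alg A H L R = (let T = tensor_vs A H in
    T\<lparr>mult := (\<lambda>X Y. tensor_lift T (\<lambda>a u. tensor_lift T (\<lambda>b v.
                 sweedler T H u (\<lambda>u1 u2. sweedler T A b (\<lambda>b1 b2.
                   tens A H (a \<otimes>\<^bsub>A\<^esub> L u1 b1) (R u2 b2 \<otimes>\<^bsub>H\<^esub> v)))) Y) X),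
      one := tens A H \<one>\<^bsub>A\<^esub> \<one>\<^bsub>H\<^esub>\<rparr>)"

text \<open>
  The antipode is the one forced by the bialgebra structure:
  \<open>S(a \<bowtie> u) = (1 \<bowtie> S(u))(S(a) \<bowtie> 1)\<close>.
\<close>

definition bicrossed ::
    "('k::field, 'a, 'm) hopf_scheme \<Rightarrow> ('k, 'u, 'n) hopf_scheme \<Rightarrow>
      ('u \<Rightarrow> 'a \<Rightarrow> 'a) \<Rightarrow> ('u \<Rightarrow> 'a \<Rightarrow> 'u) \<Rightarrow> ('k, ('a \<times> 'u \<Rightarrow>\<^sub>0 'k) set) hopf" where
  "bicrossed A H L R = (let E = bicrossed_alg A H L R; EE = tensor E E in
    module.extend E (hopf.fields
      (tensor_lift EE (\<lambda>a u. sweedler EE A a (\<lambda>a1 a2. sweedler EE H u (\<lambda>u1 u2.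
         tens E E (tens A H a1 u1) (tens A H a2 u2)))))
      (tensor_lift ground (\<lambda>a u. counit A a * counit H u))
      (tensor_lift E (\<lambda>a u.
         tens A H \<one>\<^bsub>A\<^esub> (antipode H u) \<otimes>\<^bsub>E\<^esub> tens A H (antipode A a) \<one>\<^bsub>H\<^esub>))))"

definition left_trivial ::
    "('k::field, 'a, 'm) hopf_scheme \<Rightarrow> ('k, 'u, 'n) hopf_scheme \<Rightarrow> ('u \<Rightarrow> 'a \<Rightarrow> 'a) \<Rightarrow> bool" where
  "left_trivial A H L \<longleftrightarrow>
     (\<forall>u\<in>carrier H. \<forall>a\<in>carrier A. L u a = counit H u \<odot>\<^bsub>A\<^esub> a)"

text \<open>
  The factors of a bicrossed product of \<open>A\<close> and \<open>H\<close>. As subsets of \<open>A \<otimes> H\<close> they do not depend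
  on the matched pair.
\<close>

definition factor_left ::
    "('k::field, 'a, 'm) hopf_scheme \<Rightarrow> ('k, 'u, 'n) hopf_scheme \<Rightarrow> ('a \<times> 'u \<Rightarrow>\<^sub>0 'k) set set" where
  "factor_left A H = (\<lambda>a. tens A H a \<one>\<^bsub>H\<^esub>) ` carrier A"

definition factor_right ::
    "('k::field, 'a, 'm) hopf_scheme \<Rightarrow> ('k, 'u, 'n) hopf_scheme \<Rightarrow> ('a \<times> 'u \<Rightarrow>\<^sub>0 'k) set set" where
  "factor_right A H = (\<lambda>u. tens A H \<one>\<^bsub>A\<^esub> u) ` carrier H"

definition factor_preserving ::
    "('k::field, 'a, 'm) hopf_scheme \<Rightarrow> ('k, 'u, 'n) hopf_scheme \<Rightarrow>
      (('a \<times> 'u \<Rightarrow>\<^sub>0 'k) set \<Rightarrow> ('a \<times> 'u \<Rightarrow>\<^sub>0 'k) set) \<Rightarrow> bool" where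
  "factor_preserving A H \<phi> \<longleftrightarrow>
     \<phi> ` factor_left A H = factor_left A H \<and> \<phi> ` factor_right A H = factor_right A H"


section \<open>Matched pairs of groups and matched-pair data\<close>

text \<open>In the following \<open>l t h\<close> is \<open>t \<triangleright> h\<close> and \<open>r t h\<close> is \<open>t \<triangleleft> h\<close>.\<close>

definition group_matched_pair ::
    "('h, 'm) monoid_scheme \<Rightarrow> ('g, 'n) monoid_scheme \<Rightarrow>
      ('g \<Rightarrow> 'h \<Rightarrow> 'h) \<Rightarrow> ('g \<Rightarrow> 'h \<Rightarrow> 'g) \<Rightarrow> bool" where
  "group_matched_pair \<Gamma> G l r \<longleftrightarrow>
     (\<forall>t\<in>carrier G. \<forall>h\<in>carrier \<Gamma>. l t h \<in> carrier \<Gamma> \<and> r t h \<in> carrier G) \<and>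
     (\<forall>h\<in>carrier \<Gamma>. l \<one>\<^bsub>G\<^esub> h = h) \<and>
     (\<forall>s\<in>carrier G. \<forall>t\<in>carrier G. \<forall>h\<in>carrier \<Gamma>. l (s \<otimes>\<^bsub>G\<^esub> t) h = l s (l t h)) \<and>
     (\<forall>t\<in>carrier G. r t \<one>\<^bsub>\<Gamma>\<^esub> = t) \<and>
     (\<forall>t\<in>carrier G. \<forall>h\<in>carrier \<Gamma>. \<forall>k\<in>carrier \<Gamma>. r t (h \<otimes>\<^bsub>\<Gamma>\<^esub> k) = r (r t h) k) \<and>
     (\<forall>t\<in>carrier G. \<forall>h\<in>carrier \<Gamma>. \<forall>k\<in>carrier \<Gamma>.
        l t (h \<otimes>\<^bsub>\<Gamma>\<^esub> k) = l t h \<otimes>\<^bsub>\<Gamma>\<^esub> l (r t h) k) \<and>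
     (\<forall>t\<in>carrier G. \<forall>s\<in>carrier G. \<forall>h\<in>carrier \<Gamma>.
        r (t \<otimes>\<^bsub>G\<^esub> s) h = r t (l s h) \<otimes>\<^bsub>G\<^esub> r s h)"

definition group_bicrossed ::
    "('h, 'm) monoid_scheme \<Rightarrow> ('g, 'n) monoid_scheme \<Rightarrow>
      ('g \<Rightarrow> 'h \<Rightarrow> 'h) \<Rightarrow> ('g \<Rightarrow> 'h \<Rightarrow> 'g) \<Rightarrow> ('h \<times> 'g) monoid" where
  "group_bicrossed \<Gamma> G l r =
     \<lparr>carrier = carrier \<Gamma> \<times> carrier G,
      mult = (\<lambda>(h, t) (k, s). (h \<otimes>\<^bsub>\<Gamma>\<^esub> l t k, r t k \<otimes>\<^bsub>G\<^esub> s)),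
      one = (\<one>\<^bsub>\<Gamma>\<^esub>, \<one>\<^bsub>G\<^esub>)\<rparr>"

definition matched_pair_datum ::
    "('h, 'm) monoid_scheme \<Rightarrow> ('g, 'n) monoid_scheme \<Rightarrow> 'g \<Rightarrow> ('g \<Rightarrow> 'k::field) \<Rightarrow>
      ('g \<Rightarrow> 'h \<Rightarrow> 'h) \<Rightarrow> ('g \<Rightarrow> 'h \<Rightarrow> 'g) \<Rightarrow> ('h \<Rightarrow> 'k) \<Rightarrow> bool" where
  "matched_pair_datum \<Gamma> G g f l r \<gamma> \<longleftrightarrow>
     group_matched_pair \<Gamma> G l r \<and>
     (\<forall>h\<in>carrier \<Gamma>. l g h = h \<and> r g h = g) \<and>
     (\<forall>h\<in>carrier \<Gamma>. \<gamma> h \<in> k_sub G g) \<and>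
     (\<forall>h\<in>carrier \<Gamma>. \<forall>k\<in>carrier \<Gamma>. \<gamma> (h \<otimes>\<^bsub>\<Gamma>\<^esub> k) = \<gamma> h + \<gamma> k) \<and>
     (\<forall>t\<in>carrier G. \<forall>h\<in>carrier \<Gamma>. f (r t h) = f t + \<gamma> (l t h) - \<gamma> h)"

definition corresponding_matched_pair ::
    "('h, 'm) monoid_scheme \<Rightarrow> ('g, 'n) monoid_scheme \<Rightarrow> 'g \<Rightarrow> ('g \<Rightarrow> 'k::field) \<Rightarrow>
      ('g \<Rightarrow> 'h \<Rightarrow> 'h) \<Rightarrow> ('g \<Rightarrow> 'h \<Rightarrow> 'g) \<Rightarrow> ('h \<Rightarrow> 'k) \<Rightarrow>
      (('g letter list \<Rightarrow>\<^sub>0 'k) set \<Rightarrow> ('h \<Rightarrow>\<^sub>0 'k) \<Rightarrow> ('h \<Rightarrow>\<^sub>0 'k)) \<Rightarrow>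
      (('g letter list \<Rightarrow>\<^sub>0 'k) set \<Rightarrow> ('h \<Rightarrow>\<^sub>0 'k) \<Rightarrow> ('g letter list \<Rightarrow>\<^sub>0 'k) set) \<Rightarrow> bool" where
  "corresponding_matched_pair \<Gamma> G g f l r \<gamma> L R \<longleftrightarrow>
    (let A = group_hopf \<Gamma>; H = A3 G g f;
         \<tau> = (\<lambda>t. A3_gen G g f (Grp t)); x = A3_gen G g f Xgen in
     hopf_matched_pair A H L R \<and>
     (\<forall>t\<in>carrier G. \<forall>h\<in>carrier \<Gamma>. L (\<tau> t) (\<delta> h) = \<delta> (l t h) \<and> R (\<tau> t) (\<delta> h) = \<tau> (r t h)) \<and>
     (\<forall>h\<in>carrier \<Gamma>. L x (\<delta> h) = \<zero>\<^bsub>A\<^esub> \<and>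
        R x (\<delta> h) = x \<oplus>\<^bsub>H\<^esub> \<gamma> h \<odot>\<^bsub>H\<^esub> (\<one>\<^bsub>H\<^esub> \<ominus>\<^bsub>H\<^esub> \<tau> g)))"

definition assoc_fun :: "('g \<Rightarrow> 'k::field) \<Rightarrow> ('h \<Rightarrow> 'k) \<Rightarrow> 'h \<times> 'g \<Rightarrow> 'k" where
  "assoc_fun f \<gamma> = (\<lambda>(h, t). f t - \<gamma> h)"

definition Aut_gf :: "('g, 'm) monoid_scheme \<Rightarrow> 'g \<Rightarrow> ('g \<Rightarrow> 'k) \<Rightarrow> ('g \<Rightarrow> 'g) set" where
  "Aut_gf G g f = {\<sigma> \<in> iso G G. \<sigma> g = g \<and> (\<forall>t\<in>carrier G. f (\<sigma> t) = f t)}"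

end

theory Submission
  imports Defs
begin

text \<open>
  A Hopf algebra determines its grouplike and its skew-primitive elements. The Hopf algebra
  \<open>A3 G g f\<close> is spanned by the monomials \<open>t x^a\<close> with \<open>t \<in> G\<close> and \<open>a < p\<close>, and these are linearly
  independent, so its elements have coordinates. The coproduct becomes explicit when falling
  factorials \<open>x (x - 1) \<dots> (x - m + 1)\<close> replace the powers of \<open>x\<close>: then
  \<open>(x + g y) \<dots> (x + g y - m + 1)\<close> is the sum over \<open>j \<le> m\<close> of
  \<open>(m choose j) g^j \<cdot> (x - j) \<dots> (x - m + 1) \<cdot> y (y + 1) \<dots> (y + j - 1)\<close>, with \<open>x\<close>, \<open>g\<close>, \<open>y\<close>
  standing for \<open>x \<otimes> 1\<close>, \<open>g \<otimes> 1\<close>, \<open>1 \<otimes> x\<close>. For \<open>m = p\<close> the outer terms are \<open>x^p - x\<close> and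
  \<open>g^p (y^p - y)\<close> and the inner ones vanish, which is why \<open>\<Delta>\<close> respects the relation \<open>x^p = x\<close>. For
  \<open>m < p\<close> the formula gives the terms of highest degree of \<open>\<Delta>(u)\<close>. Comparing them shows that the
  grouplike elements are the elements of the group (lemma \<open>grouplike\<close>), and that every solution of
  \<open>\<Delta>(u) = u \<otimes> 1 + c \<otimes> u\<close> with \<open>c\<close> in the group has the form \<open>d x + b (1 - c)\<close>, where \<open>d \<noteq> 0\<close>
  forces \<open>c = g\<close> (lemma \<open>skew_primitive\<close>).

  Hence a Hopf isomorphism restricts to an isomorphism \<open>\<Theta>\<close> of the groups and sends \<open>x\<close> to
  \<open>d x + b (1 - \<Theta>(g))\<close>. Its effect on \<open>t x - x t = f(t) t (1 - g)\<close> gives first \<open>d \<noteq> 0\<close>, so that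
  \<open>\<Theta>\<close> preserves \<open>g\<close>, then \<open>f = d (f' \<circ> \<Theta>)\<close>, and at \<open>t = g\<close> the value \<open>d = 1\<close> (lemma
  \<open>hopf_iso_imp_group_iso\<close>). Conversely such a \<open>\<Theta>\<close> extends to the algebras by the universal
  property of generators and relations (lemma \<open>hopf_iso_amap\<close>).

  The bicrossed product of \<open>k[\<Gamma>]\<close> and \<open>A3 G g f\<close> is compared with the Hopf algebra of \<open>\<Lambda> = \<Gamma> \<bowtie> G\<close>
  by \<open>a \<bowtie> u \<mapsto> a u\<close>. This map is multiplicative because \<open>u k = \<Sum> (u\<^sub>1 \<triangleright> k) (u\<^sub>2 \<triangleleft> k)\<close> holds in the
  algebra of \<open>\<Lambda>\<close> for all \<open>k \<in> \<Gamma>\<close> (lemma \<open>exchange\<close>): for \<open>u \<in> G\<close> this is the product of \<open>\<Lambda>\<close>, and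
  the rule passes from \<open>v\<close> to \<open>v x\<close>. The map is bijective because it matches the monomials
  \<open>h \<bowtie> t x^a\<close> with \<open>(h, t) x^a\<close> (lemma \<open>hopf_iso_phi\<close>). Transported along it, an isomorphism that
  preserves both factors gives a \<open>\<Theta>\<close> that maps \<open>\<Gamma>\<close> to \<open>\<Gamma>\<close> and \<open>G\<close> to \<open>G\<close>, that is, a pair \<open>\<psi>\<close>,
  \<open>\<sigma>\<close>. With trivial left actions, multiplicativity of \<open>\<Theta>\<close> on the products \<open>t h\<close> is the relation
  between the right actions, and \<open>F' \<circ> \<Theta> = F\<close> splits into \<open>f \<circ> \<sigma> = f\<close> and \<open>\<gamma>' \<circ> \<psi> = \<gamma>\<close>.
\<close>

section \<open>Vector spaces and linear maps\<close>

lemma ground_simps [simp]: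
  "carrier ground = UNIV" "a \<otimes>\<^bsub>ground\<^esub> b = a * b" "\<one>\<^bsub>ground\<^esub> = 1" "\<zero>\<^bsub>ground\<^esub> = 0"
  "a \<oplus>\<^bsub>ground\<^esub> b = a + b" "a \<odot>\<^bsub>ground\<^esub> b = a * b"
  by (simp_all add: ground_def)

locale vs = abelian_group V for V :: "('k::field, 'v, 'm) module_scheme" (structure) +
  assumes smult_closed [simp, intro]: "v \<in> carrier V \<Longrightarrow> c \<odot> v \<in> carrier V"
    and smult_l_distr: "v \<in> carrier V \<Longrightarrow> (c + d) \<odot> v = c \<odot> v \<oplus> d \<odot> v"
    and smult_r_distr: "v \<in> carrier V \<Longrightarrow> w \<in> carrier V \<Longrightarrow> c \<odot> (v \<oplus> w) = c \<odot> v \<oplus> c \<odot> w"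
    and smult_smult: "v \<in> carrier V \<Longrightarrow> c \<odot> (d \<odot> v) = (c * d) \<odot> v"
    and smult_one [simp]: "v \<in> carrier V \<Longrightarrow> 1 \<odot> v = v"

lemma vs_ground: "vs (ground :: ('k::field, 'k) module)"
proof -
  have "abelian_group (ground :: ('k, 'k) module)"
    by (rule abelian_groupI) (auto simp: algebra_simps intro: exI[of _ "- x" for x])
  then show ?thesis
    by (rule vs.intro) (unfold_locales, auto simp: algebra_simps)
qed

context vs begin

lemma smult_zero_left [simp]: "v \<in> carrier V \<Longrightarrow> 0 \<odot> v = \<zero>"
  using smult_l_distr[of v 0 0] by simp

lemma smult_zero_right [simp]: "c \<odot> \<zero> = \<zero>"
  using smult_r_distr[of \<zero> \<zero> c] by simp

lemma smult_minus_left: "v \<in> carrier V \<Longrightarrow> (- c) \<odot> v = \<ominus> (c \<odot> v)"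
  using smult_l_distr[of v "- c" c] minus_equality[of "(- c) \<odot> v" "c \<odot> v"] by simp

lemma smult_minus_right: "v \<in> carrier V \<Longrightarrow> c \<odot> (\<ominus> v) = \<ominus> (c \<odot> v)"
  using smult_r_distr[of "\<ominus> v" v c] minus_equality[of "c \<odot> (\<ominus> v)" "c \<odot> v"] by (simp add: l_neg)

lemma smult_minus_one: "v \<in> carrier V \<Longrightarrow> (- 1) \<odot> v = \<ominus> v"
  by (simp add: smult_minus_left)

lemma finsum_smult:
  "finite T \<Longrightarrow> \<beta> \<in> T \<rightarrow> carrier V \<Longrightarrow> c \<odot> (\<Oplus>x\<in>T. \<beta> x) = (\<Oplus>x\<in>T. c \<odot> \<beta> x)"
  by (induction T rule: finite_induct) (simp_all add: smult_r_distr Pi_def finsum_closed)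

end

definition subsp :: "('k::field, 'v, 'm) module_scheme \<Rightarrow> 'v set \<Rightarrow> bool" where
  "subsp V N \<longleftrightarrow> N \<subseteq> carrier V \<and> \<zero>\<^bsub>V\<^esub> \<in> N \<and> (\<forall>v\<in>N. \<forall>w\<in>N. v \<oplus>\<^bsub>V\<^esub> w \<in> N) \<and>
     (\<forall>c. \<forall>v\<in>N. c \<odot>\<^bsub>V\<^esub> v \<in> N)"

text \<open>
  Spanning is phrased through subspaces instead of linear combinations. This is the form in which
  it is used: linear maps agree on a subspace, so it suffices to compare them on a spanning set.
\<close>

definition spans :: "('k::field, 'v, 'm) module_scheme \<Rightarrow> 'v set \<Rightarrow> bool" where
  "spans V S \<longleftrightarrow> S \<subseteq> carrier V \<and> (\<forall>N. subsp V N \<and> S \<subseteq> N \<longrightarrow> carrier V \<subseteq> N)"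

definition lin :: "('k::field, 'v, 'm) module_scheme \<Rightarrow> ('k, 'w, 'n) module_scheme \<Rightarrow>
    ('v \<Rightarrow> 'w) \<Rightarrow> bool" where
  "lin V W \<phi> \<longleftrightarrow> (\<forall>v\<in>carrier V. \<phi> v \<in> carrier W) \<and>
     (\<forall>v\<in>carrier V. \<forall>w\<in>carrier V. \<phi> (v \<oplus>\<^bsub>V\<^esub> w) = \<phi> v \<oplus>\<^bsub>W\<^esub> \<phi> w) \<and>
     (\<forall>c. \<forall>v\<in>carrier V. \<phi> (c \<odot>\<^bsub>V\<^esub> v) = c \<odot>\<^bsub>W\<^esub> \<phi> v)"

lemma linI:
  assumes "\<And>v. v \<in> carrier V \<Longrightarrow> \<phi> v \<in> carrier W"
    "\<And>v w. v \<in> carrier V \<Longrightarrow> w \<in> carrier V \<Longrightarrow> \<phi> (v \<oplus>\<^bsub>V\<^esub> w) = \<phi> v \<oplus>\<^bsub>W\<^esub> \<phi> w"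
    "\<And>c v. v \<in> carrier V \<Longrightarrow> \<phi> (c \<odot>\<^bsub>V\<^esub> v) = c \<odot>\<^bsub>W\<^esub> \<phi> v"
  shows "lin V W \<phi>"
  using assms by (auto simp: lin_def)

lemma lin_closed: "lin V W \<phi> \<Longrightarrow> v \<in> carrier V \<Longrightarrow> \<phi> v \<in> carrier W"
  and lin_add: "lin V W \<phi> \<Longrightarrow> v \<in> carrier V \<Longrightarrow> w \<in> carrier V \<Longrightarrow> \<phi> (v \<oplus>\<^bsub>V\<^esub> w) = \<phi> v \<oplus>\<^bsub>W\<^esub> \<phi> w"
  and lin_smult: "lin V W \<phi> \<Longrightarrow> v \<in> carrier V \<Longrightarrow> \<phi> (c \<odot>\<^bsub>V\<^esub> v) = c \<odot>\<^bsub>W\<^esub> \<phi> v"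
  by (auto simp: lin_def)

lemma (in vs) lin_zero:
  assumes "vs W" "lin V W \<phi>" shows "\<phi> \<zero> = \<zero>\<^bsub>W\<^esub>"
proof -
  interpret W: vs W by fact
  have "\<phi> (0 \<odot> \<zero>) = 0 \<odot>\<^bsub>W\<^esub> \<phi> \<zero>"
    by (rule lin_smult[OF assms(2)]) simp
  then show ?thesis using lin_closed[OF assms(2)] by simp
qed

lemma (in vs) lin_neg:
  assumes "vs W" "lin V W \<phi>" "v \<in> carrier V" shows "\<phi> (\<ominus> v) = \<ominus>\<^bsub>W\<^esub> \<phi> v"
proof -
  interpret W: vs W by fact
  have "\<phi> ((- 1) \<odot> v) = (- 1) \<odot>\<^bsub>W\<^esub> \<phi> v"
    by (rule lin_smult[OF assms(2,3)])
  then show ?thesis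
    using lin_closed[OF assms(2,3)] assms(3) by (simp add: smult_minus_one W.smult_minus_one)
qed

lemma (in vs) lin_minus:
  assumes "vs W" "lin V W \<phi>" "v \<in> carrier V" "w \<in> carrier V"
  shows "\<phi> (v \<ominus> w) = \<phi> v \<ominus>\<^bsub>W\<^esub> \<phi> w"
  using assms by (simp add: a_minus_def lin_add[OF assms(2)] lin_neg)

lemma lin_comp: "lin U V \<phi> \<Longrightarrow> lin V W \<psi> \<Longrightarrow> lin U W (\<lambda>u. \<psi> (\<phi> u))"
  by (auto simp: lin_def)

lemma lin_ident: "lin V V (\<lambda>v. v)"
  by (auto simp: lin_def)

lemma lin_cong: "vs V \<Longrightarrow> lin V W \<phi> \<Longrightarrow> (\<And>v. v \<in> carrier V \<Longrightarrow> \<psi> v = \<phi> v) \<Longrightarrow> lin V W \<psi>"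
  by (simp add: lin_def vs.smult_closed vs.axioms(1) abelian_group.axioms(1) abelian_monoid.a_closed)

lemma lin_finsum:
  assumes "vs V" "vs W" "lin V W \<phi>" "finite T" "\<beta> \<in> T \<rightarrow> carrier V"
  shows "\<phi> (\<Oplus>\<^bsub>V\<^esub>x\<in>T. \<beta> x) = (\<Oplus>\<^bsub>W\<^esub>x\<in>T. \<phi> (\<beta> x))"
proof -
  interpret V: vs V by fact
  interpret W: vs W by fact
  show ?thesis using assms(4,5)
  proof (induction T rule: finite_induct)
    case empty
    then show ?case by (simp add: V.lin_zero[OF assms(2,3)] V.finsum_empty W.finsum_empty)
  next
    case (insert x F)
    then show ?case
      by (simp add: V.finsum_insert W.finsum_insert Pi_def lin_add[OF assms(3)] lin_closed[OF assms(3)]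
          V.finsum_closed)
  qed
qed

lemma subsp_submodule:
  assumes "vs V" shows "submodule N ground V \<longleftrightarrow> subsp V N"
proof -
  interpret V: vs V by fact
  have "\<ominus>\<^bsub>V\<^esub> v \<in> N" if "subsp V N" "v \<in> N" for v
    using that V.smult_minus_one[of v] unfolding subsp_def by (metis subsetD)
  then show ?thesis
    unfolding submodule_def submodule_axioms_def subsp_def subgroup_def
    by (auto simp: subset_iff subsp_def simp flip: a_inv_def)
qed

lemma subsp_a_subgroup: "vs V \<Longrightarrow> subsp V N \<Longrightarrow> additive_subgroup N V"
  using subsp_submodule submodule.axioms(1) additive_subgroup.intro by blast

lemma subsp_eq_set:
  assumes "vs V" "vs W" "lin V W \<phi>" "lin V W \<psi>"
  shows "subsp V {v \<in> carrier V. \<phi> v = \<psi> v}"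
proof -
  interpret V: vs V by fact
  show ?thesis
    using assms by (auto simp: subsp_def V.lin_zero lin_add lin_smult)
qed

lemma subsp_vimage:
  assumes "vs V" "vs W" "lin V W \<phi>" "subsp W N"
  shows "subsp V {v \<in> carrier V. \<phi> v \<in> N}"
proof -
  interpret V: vs V by fact
  show ?thesis
    using assms by (auto simp: subsp_def V.lin_zero lin_add lin_smult)
qed

lemma spans_subset: "spans V S \<Longrightarrow> S \<subseteq> carrier V"
  by (simp add: spans_def)

lemma spans_induct:
  assumes "spans V S" "subsp V {v \<in> carrier V. P v}" "\<And>s. s \<in> S \<Longrightarrow> P s" "v \<in> carrier V"
  shows "P v"
  using assms unfolding spans_def by blast

lemma lin_eqI:
  assumes "vs V" "vs W" "spans V S" "lin V W \<phi>" "lin V W \<psi>" "\<And>s. s \<in> S \<Longrightarrow> \<phi> s = \<psi> s" "v \<in> carrier V"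
  shows "\<phi> v = \<psi> v"
  by (rule spans_induct[OF assms(3) _ assms(6,7)]) (rule subsp_eq_set[OF assms(1,2,4,5)])

lemma lin_image_subsp:
  assumes "vs V" "vs W" "spans V S" "lin V W \<phi>" "subsp W N" "\<And>s. s \<in> S \<Longrightarrow> \<phi> s \<in> N" "v \<in> carrier V"
  shows "\<phi> v \<in> N"
  by (rule spans_induct[OF assms(3) _ assms(6,7)]) (rule subsp_vimage[OF assms(1,2,4,5)])

lemma spans_trans:
  assumes "spans V S" "T \<subseteq> carrier V" "\<And>N. subsp V N \<Longrightarrow> T \<subseteq> N \<Longrightarrow> S \<subseteq> N"
  shows "spans V T"
  using assms unfolding spans_def by blast

section \<open>Free vector spaces\<close>

lemma lookup_scale [simp]: "Poly_Mapping.lookup (Poly_Mapping.map ((*) c) r) x = (c::'k::field) * Poly_Mapping.lookup r x"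
  by transfer (simp add: when_def)

lemma free_vs_simps [simp]:
  "carrier (free_vs S) = {r. Poly_Mapping.keys r \<subseteq> S}" "\<zero>\<^bsub>free_vs S\<^esub> = 0"
  "r \<oplus>\<^bsub>free_vs S\<^esub> s = r + s" "c \<odot>\<^bsub>free_vs S\<^esub> r = Poly_Mapping.map ((*) c) r"
  by (simp_all add: free_vs_def)

lemma keys_scale: "Poly_Mapping.keys (Poly_Mapping.map ((*) (c::'k::field)) r) \<subseteq> Poly_Mapping.keys r"
  by (auto simp: in_keys_iff)

lemma vs_free: "vs (free_vs S :: ('k::field, 'x \<Rightarrow>\<^sub>0 'k) module)"
proof -
  have "abelian_group (free_vs S :: ('k, 'x \<Rightarrow>\<^sub>0 'k) module)"
  proof (rule abelian_groupI)
    fix x :: "'x \<Rightarrow>\<^sub>0 'k" assume "x \<in> carrier (free_vs S)"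
    then show "\<exists>y\<in>carrier (free_vs S). y \<oplus>\<^bsub>free_vs S\<^esub> x = \<zero>\<^bsub>free_vs S\<^esub>"
      by (intro bexI[of _ "- x"]) simp_all
  next
    fix x y :: "'x \<Rightarrow>\<^sub>0 'k" assume "x \<in> carrier (free_vs S)" "y \<in> carrier (free_vs S)"
    then show "x \<oplus>\<^bsub>free_vs S\<^esub> y \<in> carrier (free_vs S)"
      using keys_add[of x y] by auto
  qed (auto simp: add.assoc add.commute)
  then show ?thesis
  proof (rule vs.intro, unfold_locales)
    fix v :: "'x \<Rightarrow>\<^sub>0 'k" and c assume "v \<in> carrier (free_vs S)"
    then show "c \<odot>\<^bsub>free_vs S\<^esub> v \<in> carrier (free_vs S)"
      using keys_scale by fastforce
  qed (auto intro!: poly_mapping_eqI simp: lookup_add algebra_simps)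
qed

lemma finsum_free:
  fixes \<beta> :: "'y \<Rightarrow> 'x \<Rightarrow>\<^sub>0 'k::field"
  shows "finite T \<Longrightarrow> (\<And>x. x \<in> T \<Longrightarrow> Poly_Mapping.keys (\<beta> x) \<subseteq> S) \<Longrightarrow>
   (\<Oplus>\<^bsub>free_vs S\<^esub>x\<in>T. \<beta> x) = (\<Sum>x\<in>T. \<beta> x)"
proof (induction T rule: finite_induct)
  case empty
  interpret vs "free_vs S :: ('k, 'x \<Rightarrow>\<^sub>0 'k) module" by (rule vs_free)
  show ?case using finsum_empty[of \<beta>] by simp
next
  case (insert x F)
  interpret vs "free_vs S :: ('k, 'x \<Rightarrow>\<^sub>0 'k) module" by (rule vs_free)
  show ?case using insert finsum_insert[of F x \<beta>] by auto
qed

lemma (in vs) lin_ext_superset: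
  assumes "\<And>x. x \<in> S \<Longrightarrow> \<beta> x \<in> carrier V" "finite T" "Poly_Mapping.keys r \<subseteq> T" "T \<subseteq> S"
  shows "lin_ext V \<beta> r = (\<Oplus>x\<in>T. Poly_Mapping.lookup r x \<odot> \<beta> x)"
  unfolding lin_ext_def
  by (rule add.finprod_mono_neutral_cong_left) (use assms in \<open>auto simp: in_keys_iff\<close>)

lemma lin_lin_ext:
  fixes V :: "('k::field, 'v, 'm) module_scheme" (structure) and \<beta> :: "'x \<Rightarrow> 'v"
  assumes "vs V" "\<And>x. x \<in> S \<Longrightarrow> \<beta> x \<in> carrier V"
  shows "lin (free_vs S) V (lin_ext V \<beta>)"
proof (rule linI)
  interpret vs V by fact
  fix r s :: "'x \<Rightarrow>\<^sub>0 'k" and c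
  assume r: "r \<in> carrier (free_vs S)" 
  have [simp]: "\<beta> x \<in> carrier V" if "x \<in> Poly_Mapping.keys r" for x
    using r assms that by auto
  show "lin_ext V \<beta> r \<in> carrier V"
    unfolding lin_ext_def by (rule finsum_closed) auto
  show "lin_ext V \<beta> (c \<odot>\<^bsub>free_vs S\<^esub> r) = c \<odot>\<^bsub>V\<^esub> lin_ext V \<beta> r"
  proof -
    have "lin_ext V \<beta> (c \<odot>\<^bsub>free_vs S\<^esub> r) =
        (\<Oplus>x\<in>Poly_Mapping.keys r. Poly_Mapping.lookup (c \<odot>\<^bsub>free_vs S\<^esub> r) x \<odot> \<beta> x)"
      by (rule lin_ext_superset[of S]) (use r assms keys_scale[of c r] in simp_all)
    also have "\<dots> = (\<Oplus>x\<in>Poly_Mapping.keys r. c \<odot> (Poly_Mapping.lookup r x \<odot> \<beta> x))"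
      by (rule finsum_cong') (auto simp: smult_smult)
    finally show ?thesis
      by (simp add: lin_ext_def finsum_smult)
  qed
  assume s: "s \<in> carrier (free_vs S)"
  let ?T = "Poly_Mapping.keys r \<union> Poly_Mapping.keys s"
  have *: "lin_ext V \<beta> q = (\<Oplus>x\<in>?T. Poly_Mapping.lookup q x \<odot> \<beta> x)" if "Poly_Mapping.keys q \<subseteq> ?T" for q
    by (rule lin_ext_superset[of S]) (use r s assms that in auto)
  have [simp]: "\<beta> x \<in> carrier V" if "x \<in> Poly_Mapping.keys s" for x
    using s assms that by auto
  have "lin_ext V \<beta> (r + s) = (\<Oplus>x\<in>?T. Poly_Mapping.lookup r x \<odot> \<beta> x \<oplus> Poly_Mapping.lookup s x \<odot> \<beta> x)"
    unfolding *[OF keys_add] by (rule finsum_cong') (auto simp: lookup_add smult_l_distr)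
  also have "\<dots> = lin_ext V \<beta> r \<oplus> lin_ext V \<beta> s"
    by (subst finsum_addf) (auto simp: *)
  finally show "lin_ext V \<beta> (r \<oplus>\<^bsub>free_vs S\<^esub> s) = lin_ext V \<beta> r \<oplus> lin_ext V \<beta> s" by simp
qed

lemma lin_ext_single:
  assumes "vs V" "\<beta> x \<in> carrier V"
  shows "lin_ext V \<beta> (Poly_Mapping.single x c) = c \<odot>\<^bsub>V\<^esub> \<beta> x"
proof -
  interpret vs V by fact
  show ?thesis
    using lin_ext_superset[of "{x}" \<beta> "{x}" "Poly_Mapping.single x c"] assms(2)
    by (simp add: finsum_insert finsum_empty)
qed

lemma lin_ext_delta [simp]: "vs V \<Longrightarrow> \<beta> x \<in> carrier V \<Longrightarrow> lin_ext V \<beta> (\<delta> x) = \<beta> x"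
  by (simp add: lin_ext_single vs.smult_one)

lemma spans_free: "spans (free_vs S) (\<delta> ` S)"
  unfolding spans_def
proof (intro conjI allI impI subsetI)
  fix N :: "('a \<Rightarrow>\<^sub>0 'b) set" and r :: "'a \<Rightarrow>\<^sub>0 'b"
  assume N: "subsp (free_vs S) N \<and> \<delta> ` S \<subseteq> N" and r: "r \<in> carrier (free_vs S)"
  have *: "(\<Sum>x\<in>T. Poly_Mapping.single x (Poly_Mapping.lookup r x)) \<in> N" if "finite T" "T \<subseteq> S" for T
    using that
  proof (induction T rule: finite_induct)
    case empty then show ?case using N by (simp add: subsp_def)
  next
    case (insert x F)
    have "\<delta> x \<in> N" using N insert.prems by auto
    then have "Poly_Mapping.map ((*) (Poly_Mapping.lookup r x)) (\<delta> x) \<in> N"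
      using N unfolding subsp_def free_vs_simps by blast
    moreover have "Poly_Mapping.map ((*) (Poly_Mapping.lookup r x)) (\<delta> x) =
        Poly_Mapping.single x (Poly_Mapping.lookup r x)"
      by (rule poly_mapping_eqI) (simp add: lookup_single when_def)
    ultimately have "Poly_Mapping.single x (Poly_Mapping.lookup r x) \<in> N" by simp
    then show ?case using N insert by (simp add: subsp_def)
  qed
  have "r = (\<Sum>x\<in>Poly_Mapping.keys r. Poly_Mapping.single x (Poly_Mapping.lookup r x))"
    by (rule poly_mapping_eqI) (simp add: lookup_sum lookup_single when_def in_keys_iff)
  then show "r \<in> N" using *[of "Poly_Mapping.keys r"] r by simp
qed auto

section \<open>Quotients and tensor products\<close>

lemma vs_cong:
  assumes "vs V" "carrier W = carrier V" "zero W = zero V" "add W = add V" "smult W = smult V"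
  shows "vs W"
proof -
  interpret vs V by fact
  have "abelian_group W"
    by (rule abelian_groupI) (use l_neg in \<open>auto simp: assms(2-5) a_ac\<close>)
  then show ?thesis
    by (rule vs.intro, unfold_locales)
      (auto simp: assms(2-5) smult_l_distr smult_r_distr smult_smult)
qed

lemma spans_image:
  assumes "vs V" "vs W" "lin V W \<phi>" "carrier W \<subseteq> \<phi> ` carrier V" "spans V S"
  shows "spans W (\<phi> ` S)"
  unfolding spans_def
proof (intro conjI allI impI subsetI)
  fix w assume "w \<in> \<phi> ` S"
  then show "w \<in> carrier W"
    using assms(3,5) by (auto simp: spans_def lin_def)
next
  fix N w assume "subsp W N \<and> \<phi> ` S \<subseteq> N" "w \<in> carrier W"
  then show "w \<in> N"
    using assms(4) lin_image_subsp[OF assms(1,2,5,3)] by blast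
qed

lemma quot_simps:
  "carrier (quot V N) = a_rcosets\<^bsub>V\<^esub> N" "X \<oplus>\<^bsub>quot V N\<^esub> Y = set_add V X Y" "\<zero>\<^bsub>quot V N\<^esub> = N"
  "\<one>\<^bsub>quot V N\<^esub> = N +>\<^bsub>V\<^esub> \<one>\<^bsub>V\<^esub>" "X \<otimes>\<^bsub>quot V N\<^esub> Y = rcoset_mult V N X Y"
  "c \<odot>\<^bsub>quot V N\<^esub> X = (\<Union>x\<in>X. N +>\<^bsub>V\<^esub> (c \<odot>\<^bsub>V\<^esub> x))"
  by (simp_all add: quot_def FactRing_def ring.extend_def module.fields_def)

locale vs_subsp = vs V for V :: "('k::field, 'v, 'm) module_scheme" (structure) +
  fixes N assumes subsp: "subsp V N"
begin

sublocale abelian_subgroup N V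
  by (rule abelian_subgroupI3) (use subsp_a_subgroup subsp vs_axioms abelian_group_axioms in auto)

lemma quot_carrier: "carrier (quot V N) = (\<lambda>v. N +> v) ` carrier V"
  by (auto simp: quot_simps A_RCOSETS_def' image_iff)

lemma cls_closed: "v \<in> carrier V \<Longrightarrow> N +> v \<in> carrier (quot V N)"
  by (simp add: quot_carrier)

lemma cls_self: "v \<in> carrier V \<Longrightarrow> v \<in> N +> v"
  by (rule a_rcos_self)

lemma cls_memD: "x \<in> N +> v \<Longrightarrow> \<exists>n\<in>N. x = n \<oplus> v"
  by (auto simp: a_r_coset_def')

lemma cls_eqI: "x \<in> N +> v \<Longrightarrow> v \<in> carrier V \<Longrightarrow> N +> x = N +> v"
  using a_repr_independence[OF _ _ a_subgroup] by metis

lemma cls_eq_iff: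
  assumes "v \<in> carrier V" "w \<in> carrier V"
  shows "N +> v = N +> w \<longleftrightarrow> v \<ominus> w \<in> N"
proof
  assume "N +> v = N +> w"
  then obtain n where "n \<in> N" "v = n \<oplus> w"
    using cls_self[OF assms(1)] cls_memD by blast
  moreover have "n \<in> carrier V" using \<open>n \<in> N\<close> a_subset by blast
  ultimately show "v \<ominus> w \<in> N"
    using assms by (simp add: a_minus_def a_assoc r_neg)
next
  assume "v \<ominus> w \<in> N"
  moreover have "v = (v \<ominus> w) \<oplus> w"
    using assms by (simp add: a_minus_def a_assoc l_neg)
  ultimately have "v \<in> N +> w"
    unfolding a_r_coset_def' by blast
  then show "N +> v = N +> w" using cls_eqI assms by blast
qed

lemma quot_add: "v \<in> carrier V \<Longrightarrow> w \<in> carrier V \<Longrightarrow> (N +> v) \<oplus>\<^bsub>quot V N\<^esub> (N +> w) = N +> (v \<oplus> w)"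
  by (simp add: quot_simps a_rcos_sum)

lemma quot_smult:
  assumes "v \<in> carrier V" shows "c \<odot>\<^bsub>quot V N\<^esub> (N +> v) = N +> (c \<odot> v)"
proof -
  have "N +> (c \<odot> x) = N +> (c \<odot> v)" if x: "x \<in> N +> v" for x
  proof -
    obtain n where n: "n \<in> N" "x = n \<oplus> v" using cls_memD[OF x] by blast
    then have nc: "n \<in> carrier V" using a_subset by blast
    have "c \<odot> x = c \<odot> n \<oplus> c \<odot> v" using n nc assms by (simp add: smult_r_distr)
    moreover have "c \<odot> n \<in> N" using n subsp by (simp add: subsp_def)
    ultimately have "c \<odot> x \<in> N +> (c \<odot> v)"
      unfolding a_r_coset_def' by blast
    then show ?thesis using cls_eqI assms by blast
  qed
  then show ?thesis
    using cls_self[OF assms] unfolding quot_simps by blast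
qed

lemma vs_quot: "vs (quot V N)"
proof -
  have z: "\<zero>\<^bsub>quot V N\<^esub> = N +> \<zero>"
    using a_subset by (simp add: quot_simps)
  have "\<exists>w\<in>carrier V. N +> v \<oplus> w = N +> \<zero>" if "v \<in> carrier V" for v
    using that by (intro bexI[of _ "\<ominus> v"]) (simp_all add: r_neg)
  then have "abelian_group (quot V N)"
    by (intro abelian_groupI)
      (auto simp: quot_carrier quot_add z a_ac)
  then show ?thesis
    by (rule vs.intro, unfold_locales)
      (auto simp: quot_carrier quot_add quot_smult smult_l_distr smult_r_distr smult_smult)
qed

lemma lin_cls: "lin V (quot V N) ((+>) N)"
  by (rule linI) (auto simp: quot_carrier quot_add quot_smult)

lemma spans_quot: "spans V S \<Longrightarrow> spans (quot V N) ((\<lambda>v. N +> v) ` S)"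
  by (rule spans_image[OF vs_axioms vs_quot lin_cls]) (auto simp: quot_carrier)

text \<open>
  The linear extension evaluated at an arbitrary representative is well defined because it
  vanishes on \<open>N\<close>, so two representatives have the same image.
\<close>

lemma lift_cls:
  assumes "vs W" "lin V W \<phi>" "\<And>n. n \<in> N \<Longrightarrow> \<phi> n = \<zero>\<^bsub>W\<^esub>" "v \<in> carrier V"
  shows "\<phi> (SOME r. r \<in> N +> v) = \<phi> v"
proof -
  interpret W: vs W by fact
  have "(SOME r. r \<in> N +> v) \<in> N +> v" by (rule someI) (rule cls_self[OF assms(4)])
  then obtain n where n: "n \<in> N" "(SOME r. r \<in> N +> v) = n \<oplus> v" using cls_memD by blast
  then have "n \<in> carrier V" using a_subset by blast
  then show ?thesis
    using n assms(3)[OF n(1)] assms(4) lin_closed[OF assms(2)] by (simp add: lin_add[OF assms(2)])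
qed

lemma lin_lift:
  assumes "vs W" "lin V W \<phi>" "\<And>n. n \<in> N \<Longrightarrow> \<phi> n = \<zero>\<^bsub>W\<^esub>"
  shows "lin (quot V N) W (\<lambda>X. \<phi> (SOME r. r \<in> X))"
  by (rule linI)
    (auto simp: quot_carrier quot_add quot_smult lift_cls[OF assms] lin_closed[OF assms(2)]
      lin_add[OF assms(2)] lin_smult[OF assms(2)])

end

lemma bilinear_iff:
  "bilinear_into V W P \<beta> \<longleftrightarrow>
    (\<forall>w\<in>carrier W. lin V P (\<lambda>v. \<beta> v w)) \<and> (\<forall>v\<in>carrier V. lin W P (\<beta> v))"
  unfolding bilinear_into_def lin_def by blast

lemma bilinearI:
  assumes "\<And>w. w \<in> carrier W \<Longrightarrow> lin V P (\<lambda>v. \<beta> v w)" "\<And>v. v \<in> carrier V \<Longrightarrow> lin W P (\<lambda>w. \<beta> v w)"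
  shows "bilinear_into V W P \<beta>"
  using assms by (simp add: bilinear_iff)

lemma bilinear_left: "bilinear_into V W P \<beta> \<Longrightarrow> w \<in> carrier W \<Longrightarrow> lin V P (\<lambda>v. \<beta> v w)"
  and bilinear_right: "bilinear_into V W P \<beta> \<Longrightarrow> v \<in> carrier V \<Longrightarrow> lin W P (\<beta> v)"
  by (simp_all add: bilinear_iff)

lemma free_minus [simp]: 
  fixes r :: "'x \<Rightarrow>\<^sub>0 'k::field"
  assumes "Poly_Mapping.keys r \<subseteq> S" "Poly_Mapping.keys s \<subseteq> S"
  shows "r \<ominus>\<^bsub>free_vs S\<^esub> s = r - s"
proof -
  interpret vs "free_vs S :: ('k, 'x \<Rightarrow>\<^sub>0 'k) module" by (rule vs_free)
  have "\<ominus>\<^bsub>free_vs S\<^esub> s = - s"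
    by (rule minus_equality) (use assms in auto)
  then show ?thesis by (simp add: a_minus_def)
qed

locale vs2 = V: vs V + W: vs W
  for V :: "('k::field, 'v, 'm) module_scheme" and W :: "('k, 'w, 'n) module_scheme"
begin

abbreviation "FV \<equiv> free_vs (carrier V \<times> carrier W) :: ('k, 'v \<times> 'w \<Rightarrow>\<^sub>0 'k) module"

lemma tensor_rels_carrier: "tensor_rels V W \<subseteq> carrier FV"
proof -
  have *: "Poly_Mapping.keys (a - b) \<subseteq> S" if "Poly_Mapping.keys a \<subseteq> S" "Poly_Mapping.keys b \<subseteq> S"
    for a b :: "'v \<times> 'w \<Rightarrow>\<^sub>0 'k" and S
    using that keys_diff[of a b] by blast
  have **: "Poly_Mapping.keys (Poly_Mapping.single x c) \<subseteq> S" if "x \<in> S" for x S and c :: 'k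
    using that by simp
  show ?thesis
    unfolding tensor_rels_def free_vs_simps
    by (intro subsetI, elim UnE CollectE exE conjE; simp only: mem_Collect_eq; intro * **; simp)
qed

lemma subsp_null: "subsp FV (tensor_null V W)"
proof -
  have "subsp FV (carrier FV)"
    using keys_add keys_scale by (fastforce simp: subsp_def)
  then have "carrier FV \<in> {t. subsp FV t \<and> tensor_rels V W \<subseteq> t}"
    using tensor_rels_carrier by blast
  then have "subsp FV (\<Inter>{t. subsp FV t \<and> tensor_rels V W \<subseteq> t})"
    unfolding subsp_def by blast
  then show ?thesis
    by (simp add: tensor_null_def hull_def subsp_submodule[OF vs_free])
qed

sublocale Q: vs_subsp FV "tensor_null V W"
  by (rule vs_subsp.intro[OF vs_free]) (unfold_locales, rule subsp_null)

lemma vs_tensor_vs: "vs (tensor_vs V W)"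
  unfolding tensor_vs_def by (rule Q.vs_quot)

lemma keys_add_closed [simp]:
  "Poly_Mapping.keys r \<subseteq> S \<Longrightarrow> Poly_Mapping.keys s \<subseteq> S \<Longrightarrow> Poly_Mapping.keys (r + s) \<subseteq> S"
  using keys_add[of r s] by blast

lemma delta_closed [simp]: "v \<in> carrier V \<Longrightarrow> w \<in> carrier W \<Longrightarrow> Poly_Mapping.single (v, w) c \<in> carrier FV"
  by simp

lemma null_rel:
  assumes "a - b \<in> tensor_rels V W" "a \<in> carrier FV" "b \<in> carrier FV"
  shows "tensor_null V W +>\<^bsub>FV\<^esub> a = tensor_null V W +>\<^bsub>FV\<^esub> b"
proof -
  have "a - b \<in> tensor_null V W"
    using assms(1) unfolding tensor_null_def by (rule hull_inc)
  then show ?thesis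
    using assms by (simp add: Q.cls_eq_iff)
qed

lemma tens_closed: "v \<in> carrier V \<Longrightarrow> w \<in> carrier W \<Longrightarrow> tens V W v w \<in> carrier (tensor_vs V W)"
  unfolding tens_def tensor_vs_def by (rule Q.cls_closed) simp

lemma tens_bilinear: "bilinear_into V W (tensor_vs V W) (tens V W)"
proof (rule bilinearI; rule linI)
  fix v v' w assume vw: "v \<in> carrier V" "v' \<in> carrier V" "w \<in> carrier W"
  have "\<delta> (v \<oplus>\<^bsub>V\<^esub> v', w) - (\<delta> (v, w) + \<delta> (v', w)) \<in> tensor_rels V W"
    unfolding tensor_rels_def using vw by (auto simp flip: diff_diff_eq)
  then show "tens V W (v \<oplus>\<^bsub>V\<^esub> v') w = tens V W v w \<oplus>\<^bsub>tensor_vs V W\<^esub> tens V W v' w"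
    using null_rel[of "\<delta> (v \<oplus>\<^bsub>V\<^esub> v', w)" "\<delta> (v, w) \<oplus>\<^bsub>FV\<^esub> \<delta> (v', w)"] vw Q.quot_add[of "\<delta> (v, w)" "\<delta> (v', w)"]
      Q.a_closed[of "\<delta> (v, w)" "\<delta> (v', w)"]
    by (simp add: tens_def tensor_vs_def)
next
  fix v w w' assume vw: "v \<in> carrier V" "w \<in> carrier W" "w' \<in> carrier W"
  have "\<delta> (v, w \<oplus>\<^bsub>W\<^esub> w') - (\<delta> (v, w) + \<delta> (v, w')) \<in> tensor_rels V W"
    unfolding tensor_rels_def using vw by (auto simp flip: diff_diff_eq)
  then show "tens V W v (w \<oplus>\<^bsub>W\<^esub> w') = tens V W v w \<oplus>\<^bsub>tensor_vs V W\<^esub> tens V W v w'"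
    using null_rel[of "\<delta> (v, w \<oplus>\<^bsub>W\<^esub> w')" "\<delta> (v, w) \<oplus>\<^bsub>FV\<^esub> \<delta> (v, w')"] vw Q.quot_add[of "\<delta> (v, w)" "\<delta> (v, w')"]
      Q.a_closed[of "\<delta> (v, w)" "\<delta> (v, w')"]
    by (simp add: tens_def tensor_vs_def)
next
  fix v w c assume vw: "v \<in> carrier V" "w \<in> carrier W"
  have *: "c \<odot>\<^bsub>tensor_vs V W\<^esub> tens V W v w = tensor_null V W +>\<^bsub>FV\<^esub> Poly_Mapping.single (v, w) c"
    using Q.quot_smult[of "\<delta> (v, w)" c] vw
    by (simp add: tens_def tensor_vs_def)
  have "\<delta> (c \<odot>\<^bsub>V\<^esub> v, w) - Poly_Mapping.single (v, w) c \<in> tensor_rels V W"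
    unfolding tensor_rels_def using vw by blast
  then show "tens V W (c \<odot>\<^bsub>V\<^esub> v) w = c \<odot>\<^bsub>tensor_vs V W\<^esub> tens V W v w"
    using null_rel vw unfolding * by (simp add: tens_def)
  have "\<delta> (v, c \<odot>\<^bsub>W\<^esub> w) - Poly_Mapping.single (v, w) c \<in> tensor_rels V W"
    unfolding tensor_rels_def using vw by blast
  then show "tens V W v (c \<odot>\<^bsub>W\<^esub> w) = c \<odot>\<^bsub>tensor_vs V W\<^esub> tens V W v w"
    using null_rel vw unfolding * by (simp add: tens_def)
qed (simp_all add: tens_closed)

text \<open>
  The kernel of the linear extension of a bilinear map is a subspace containing the four families
  of tensor relations, hence it contains their hull.
\<close>

lemma lift_null:
  assumes "vs P" "bilinear_into V W P \<beta>" "n \<in> tensor_null V W"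
  shows "lin_ext P (\<lambda>(v, w). \<beta> v w) n = \<zero>\<^bsub>P\<^esub>"
proof -
  interpret P: vs P by fact
  let ?L = "lin_ext P (\<lambda>(v, w). \<beta> v w)"
  have c: "\<beta> v w \<in> carrier P" if "v \<in> carrier V" "w \<in> carrier W" for v w
    using that assms(2) by (simp add: bilinear_into_def)
  have L: "lin FV P ?L"
    by (rule lin_lin_ext[OF assms(1)]) (auto simp: c)
  have "lin FV P (\<lambda>_. \<zero>\<^bsub>P\<^esub>)" by (rule linI) auto
  then have sub: "subsp FV {r \<in> carrier FV. ?L r = \<zero>\<^bsub>P\<^esub>}"
    using subsp_eq_set[OF vs_free assms(1) L] by simp
  have d: "?L (\<delta> (v, w)) = \<beta> v w" if "v \<in> carrier V" "w \<in> carrier W" for v w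
    using that by (subst lin_ext_delta[OF assms(1)]) (auto simp: c)
  have s: "?L (Poly_Mapping.single (v, w) e) = e \<odot>\<^bsub>P\<^esub> \<beta> v w" if "v \<in> carrier V" "w \<in> carrier W" for v w e
    using that by (subst lin_ext_single[OF assms(1)]) (auto simp: c)
  have m: "?L (a - b) = ?L a \<ominus>\<^bsub>P\<^esub> ?L b" if "a \<in> carrier FV" "b \<in> carrier FV" for a b
    using Q.lin_minus[OF assms(1) L that] that by simp
  have cl: "a - b \<in> carrier FV" if "a \<in> carrier FV" "b \<in> carrier FV" for a b
    using Q.minus_closed[OF that] that by simp
  have e: "x \<oplus>\<^bsub>P\<^esub> y \<ominus>\<^bsub>P\<^esub> x \<ominus>\<^bsub>P\<^esub> y = \<zero>\<^bsub>P\<^esub>" if "x \<in> carrier P" "y \<in> carrier P" for x y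
    using that P.minus_add[of x y] P.r_neg[of "x \<oplus>\<^bsub>P\<^esub> y"] by (simp add: a_minus_def P.a_assoc)
  have e2: "x \<ominus>\<^bsub>P\<^esub> x = \<zero>\<^bsub>P\<^esub>" if "x \<in> carrier P" for x
    using that by (simp add: a_minus_def P.r_neg)
  have "tensor_rels V W \<subseteq> {r \<in> carrier FV. ?L r = \<zero>\<^bsub>P\<^esub>}"
    unfolding tensor_rels_def using assms(2)
    by (auto simp del: free_vs_simps simp: m cl d s c e e2 bilinear_into_def)
  then have "tensor_null V W \<subseteq> {r \<in> carrier FV. ?L r = \<zero>\<^bsub>P\<^esub>}"
    unfolding tensor_null_def using sub by (intro hull_minimal) (simp_all add: subsp_submodule[OF vs_free])
  then show ?thesis using assms(3) by blast
qed

lemma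
  assumes "vs P" "bilinear_into V W P \<beta>"
  shows lin_tensor_lift: "lin (tensor_vs V W) P (tensor_lift P \<beta>)"
    and tensor_lift_tens: "v \<in> carrier V \<Longrightarrow> w \<in> carrier W \<Longrightarrow> tensor_lift P \<beta> (tens V W v w) = \<beta> v w"
proof -
  have c: "\<beta> v w \<in> carrier P" if "v \<in> carrier V" "w \<in> carrier W" for v w
    using that assms(2) by (simp add: bilinear_into_def)
  have L: "lin FV P (lin_ext P (\<lambda>(v, w). \<beta> v w))"
    by (rule lin_lin_ext[OF assms(1)]) (auto simp: c)
  show "lin (tensor_vs V W) P (tensor_lift P \<beta>)"
    unfolding tensor_vs_def tensor_lift_def
    by (rule Q.lin_lift[OF assms(1) L]) (rule lift_null[OF assms])
  assume vw: "v \<in> carrier V" "w \<in> carrier W"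
  show "tensor_lift P \<beta> (tens V W v w) = \<beta> v w"
    unfolding tens_def tensor_lift_def
    by (subst Q.lift_cls[OF assms(1) L lift_null[OF assms]]) (use vw c in \<open>simp_all add: lin_ext_delta[OF assms(1)]\<close>)
qed

lemma spans_tensor_vs:
  assumes "spans V S" "spans W T"
  shows "spans (tensor_vs V W) {tens V W s t | s t. s \<in> S \<and> t \<in> T}"
proof -
  have "spans (tensor_vs V W) ((\<lambda>v. tensor_null V W +>\<^bsub>FV\<^esub> v) ` (\<delta> ` (carrier V \<times> carrier W)))"
    unfolding tensor_vs_def by (rule Q.spans_quot[OF spans_free])
  then show ?thesis
  proof (rule spans_trans)
    show "{tens V W s t | s t. s \<in> S \<and> t \<in> T} \<subseteq> carrier (tensor_vs V W)"
      using assms by (auto simp: spans_def intro!: tens_closed)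
    fix N assume N: "subsp (tensor_vs V W) N" "{tens V W s t | s t. s \<in> S \<and> t \<in> T} \<subseteq> N"
    have "tens V W s w \<in> N" if "s \<in> S" "w \<in> carrier W" for s w
      using lin_image_subsp[OF W.vs_axioms vs_tensor_vs assms(2) bilinear_right[OF tens_bilinear] N(1)]
        that N(2) spans_subset[OF assms(1)] by blast
    then have "tens V W v w \<in> N" if "v \<in> carrier V" "w \<in> carrier W" for v w
      using lin_image_subsp[OF V.vs_axioms vs_tensor_vs assms(1) bilinear_left[OF tens_bilinear] N(1)]
        that by blast
    then show "(\<lambda>v. tensor_null V W +>\<^bsub>FV\<^esub> v) ` (\<delta> ` (carrier V \<times> carrier W)) \<subseteq> N"
      by (auto simp: tens_def)
  qed
qed

lemma lin_tensor_eqI: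
  assumes "vs P" "lin (tensor_vs V W) P \<phi>" "lin (tensor_vs V W) P \<psi>"
    "\<And>v w. v \<in> carrier V \<Longrightarrow> w \<in> carrier W \<Longrightarrow> \<phi> (tens V W v w) = \<psi> (tens V W v w)"
    "X \<in> carrier (tensor_vs V W)"
  shows "\<phi> X = \<psi> X"
proof (rule lin_eqI[OF vs_tensor_vs assms(1) _ assms(2,3) _ assms(5)])
  show "spans (tensor_vs V W) {tens V W s t | s t. s \<in> carrier V \<and> t \<in> carrier W}"
    by (rule spans_tensor_vs) (auto simp: spans_def)
qed (use assms(4) in auto)

text \<open>
  Nested Sweedler sums integrate a bilinear map that depends on the variables of an outer sum. For
  the outer sum to make sense, the inner one has to be linear in these variables.
\<close>

lemma lin_lift_param:
  assumes "vs U" "vs P" "\<And>u. u \<in> carrier U \<Longrightarrow> bilinear_into V W P (\<beta> u)"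
    "\<And>v w. v \<in> carrier V \<Longrightarrow> w \<in> carrier W \<Longrightarrow> lin U P (\<lambda>u. \<beta> u v w)"
    "X \<in> carrier (tensor_vs V W)"
  shows "lin U P (\<lambda>u. tensor_lift P (\<beta> u) X)"
proof -
  interpret U: vs U by fact
  interpret P: vs P by fact
  note L = lin_tensor_lift[OF assms(2) assms(3)]
  show ?thesis
  proof (rule linI)
    fix u u' c assume u: "u \<in> carrier U"
    show "tensor_lift P (\<beta> u) X \<in> carrier P" using lin_closed[OF L[OF u] assms(5)] .
    show "tensor_lift P (\<beta> (c \<odot>\<^bsub>U\<^esub> u)) X = c \<odot>\<^bsub>P\<^esub> tensor_lift P (\<beta> u) X"
    proof (rule lin_tensor_eqI[OF assms(2) L _ _ assms(5)])
      show "lin (tensor_vs V W) P (\<lambda>X. c \<odot>\<^bsub>P\<^esub> tensor_lift P (\<beta> u) X)"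
        using L[OF u] by (auto simp: lin_def P.smult_r_distr P.smult_smult mult.commute)
    qed (use u lin_smult[OF assms(4)] in \<open>simp_all add: tensor_lift_tens[OF assms(2) assms(3)]\<close>)
    assume u': "u' \<in> carrier U"
    show "tensor_lift P (\<beta> (u \<oplus>\<^bsub>U\<^esub> u')) X = tensor_lift P (\<beta> u) X \<oplus>\<^bsub>P\<^esub> tensor_lift P (\<beta> u') X"
    proof (rule lin_tensor_eqI[OF assms(2) L _ _ assms(5)])
      show "lin (tensor_vs V W) P (\<lambda>X. tensor_lift P (\<beta> u) X \<oplus>\<^bsub>P\<^esub> tensor_lift P (\<beta> u') X)"
        using L[OF u] L[OF u'] by (auto simp: lin_def P.smult_r_distr P.a_ac)
    qed (use u u' lin_add[OF assms(4)] in \<open>simp_all add: tensor_lift_tens[OF assms(2) assms(3)]\<close>)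
  qed
qed

end

section \<open>Algebras\<close>

locale kalg = ring B + vs B for B :: "('k::field, 'v, 'm) module_scheme" (structure) +
  assumes smult_mult_left: "a \<in> carrier B \<Longrightarrow> b \<in> carrier B \<Longrightarrow> (c \<odot> a) \<otimes> b = c \<odot> (a \<otimes> b)"
    and smult_mult_right: "a \<in> carrier B \<Longrightarrow> b \<in> carrier B \<Longrightarrow> a \<otimes> (c \<odot> b) = c \<odot> (a \<otimes> b)"
begin

lemma lin_mult_left: "a \<in> carrier B \<Longrightarrow> lin B B (\<lambda>b. a \<otimes> b)"
  by (rule linI) (auto simp: r_distr smult_mult_right)

lemma lin_mult_right: "b \<in> carrier B \<Longrightarrow> lin B B (\<lambda>a. a \<otimes> b)"
  by (rule linI) (auto simp: l_distr smult_mult_left)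

end

lemma kalg_vs: "kalg B \<Longrightarrow> vs B" by (simp add: kalg_def)

lemma kalgI:
  assumes "vs B" "bilinear_into B B B (mult B)"
    "\<And>x y z. x \<in> carrier B \<Longrightarrow> y \<in> carrier B \<Longrightarrow> z \<in> carrier B \<Longrightarrow>
       (x \<otimes>\<^bsub>B\<^esub> y) \<otimes>\<^bsub>B\<^esub> z = x \<otimes>\<^bsub>B\<^esub> (y \<otimes>\<^bsub>B\<^esub> z)"
    "\<one>\<^bsub>B\<^esub> \<in> carrier B" "\<And>x. x \<in> carrier B \<Longrightarrow> \<one>\<^bsub>B\<^esub> \<otimes>\<^bsub>B\<^esub> x = x"
    "\<And>x. x \<in> carrier B \<Longrightarrow> x \<otimes>\<^bsub>B\<^esub> \<one>\<^bsub>B\<^esub> = x"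
  shows "kalg B"
proof -
  interpret vs B by fact
  have "ring B"
    by (rule ringI) (use assms in \<open>auto simp: bilinear_into_def intro!: monoidI abelian_group_axioms\<close>)
  then show ?thesis
    by (rule kalg.intro[OF _ vs_axioms]) (unfold_locales, use assms in \<open>auto simp: bilinear_into_def\<close>)
qed

lemma kalg_cong:
  assumes "kalg B" "carrier C = carrier B" "zero C = zero B" "add C = add B" "smult C = smult B"
    "mult C = mult B" "one C = one B"
  shows "kalg C"
proof -
  interpret kalg B by fact
  show ?thesis
    by (rule kalgI[OF vs_cong[OF vs_axioms]])
      (auto simp: assms(2-7) bilinear_into_def m_assoc l_distr r_distr smult_mult_left smult_mult_right)
qed

lemma kalg_ground: "kalg (ground :: ('k::field, 'k) module)"
  by (rule kalgI[OF vs_ground]) (auto simp: bilinear_into_def algebra_simps)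

definition alg_hom :: "('k::field, 'v, 'm) module_scheme \<Rightarrow> ('k, 'w, 'n) module_scheme \<Rightarrow>
    ('v \<Rightarrow> 'w) \<Rightarrow> bool" where
  "alg_hom B C \<phi> \<longleftrightarrow> lin B C \<phi> \<and> \<phi> \<one>\<^bsub>B\<^esub> = \<one>\<^bsub>C\<^esub> \<and>
     (\<forall>a\<in>carrier B. \<forall>b\<in>carrier B. \<phi> (a \<otimes>\<^bsub>B\<^esub> b) = \<phi> a \<otimes>\<^bsub>C\<^esub> \<phi> b)"

lemma alg_hom_iff: "alg_hom B C \<phi> \<longleftrightarrow> \<phi> \<in> ring_hom B C \<and> (\<forall>c. \<forall>a\<in>carrier B. \<phi> (c \<odot>\<^bsub>B\<^esub> a) = c \<odot>\<^bsub>C\<^esub> \<phi> a)"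
  by (auto simp: alg_hom_def lin_def ring_hom_def)

lemma alg_hom_lin: "alg_hom B C \<phi> \<Longrightarrow> lin B C \<phi>"
  and alg_hom_one: "alg_hom B C \<phi> \<Longrightarrow> \<phi> \<one>\<^bsub>B\<^esub> = \<one>\<^bsub>C\<^esub>"
  and alg_hom_mult: "alg_hom B C \<phi> \<Longrightarrow> a \<in> carrier B \<Longrightarrow> b \<in> carrier B \<Longrightarrow> \<phi> (a \<otimes>\<^bsub>B\<^esub> b) = \<phi> a \<otimes>\<^bsub>C\<^esub> \<phi> b"
  by (auto simp: alg_hom_def)

lemma alg_hom_closed: "alg_hom B C \<phi> \<Longrightarrow> v \<in> carrier B \<Longrightarrow> \<phi> v \<in> carrier C"
  by (rule lin_closed[OF alg_hom_lin])

lemma alg_hom_comp: "alg_hom B C \<phi> \<Longrightarrow> alg_hom C D \<psi> \<Longrightarrow> alg_hom B D (\<lambda>u. \<psi> (\<phi> u))"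
  by (auto simp: alg_hom_def lin_def)

text \<open>A two-sided ideal absorbs scalars because \<open>c v = (c 1) v\<close>.\<close>

lemma ideal_subsp: "kalg B \<Longrightarrow> ideal I B \<Longrightarrow> subsp B I"
proof -
  assume "kalg B" "ideal I B"
  interpret kalg B by fact
  interpret ideal I B by fact
  have "c \<odot>\<^bsub>B\<^esub> v \<in> I" if "v \<in> I" for c v
    using I_l_closed[OF that, of "c \<odot>\<^bsub>B\<^esub> \<one>\<^bsub>B\<^esub>"] that a_subset by (auto simp: smult_mult_left subset_iff)
  then show ?thesis using a_subset by (auto simp: subsp_def)
qed

lemma kalg_quot:
  assumes "kalg B" "ideal I B"
  shows "kalg (quot B I)" "alg_hom B (quot B I) ((+>\<^bsub>B\<^esub>) I)"
proof -
  interpret kalg B by fact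
  interpret ideal I B by fact
  interpret Q: vs_subsp B I
    by (rule vs_subsp.intro[OF vs_axioms]) (unfold_locales, rule ideal_subsp[OF assms])
  have m: "(I +>\<^bsub>B\<^esub> a) \<otimes>\<^bsub>quot B I\<^esub> (I +>\<^bsub>B\<^esub> b) = I +>\<^bsub>B\<^esub> (a \<otimes>\<^bsub>B\<^esub> b)" if "a \<in> carrier B" "b \<in> carrier B" for a b
    using that by (simp add: quot_simps rcoset_mult_add)
  have o: "\<one>\<^bsub>quot B I\<^esub> = I +>\<^bsub>B\<^esub> \<one>\<^bsub>B\<^esub>" by (simp add: quot_simps)
  show "kalg (quot B I)"
    by (rule kalgI[OF Q.vs_quot])
     (auto simp: Q.quot_carrier m o m_assoc bilinear_into_def Q.quot_add Q.quot_smult l_distr r_distr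
        smult_mult_left smult_mult_right)
  show "alg_hom B (quot B I) ((+>\<^bsub>B\<^esub>) I)"
    by (auto simp: alg_hom_def m o Q.lin_cls)
qed

lemma tensor_simps:
  "carrier (tensor V W) = carrier (tensor_vs V W)" "zero (tensor V W) = zero (tensor_vs V W)"
  "add (tensor V W) = add (tensor_vs V W)" "smult (tensor V W) = smult (tensor_vs V W)"
  "\<one>\<^bsub>tensor V W\<^esub> = tens V W \<one>\<^bsub>V\<^esub> \<one>\<^bsub>W\<^esub>"
  by (simp_all add: tensor_def)

lemma lin_tensor_from: "lin (tensor V W) = lin (tensor_vs V W)"
  by (intro ext) (simp add: lin_def tensor_simps)

lemma lin_tensor_to: "lin P (tensor V W) = lin P (tensor_vs V W)"
  by (intro ext) (simp add: lin_def tensor_simps)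

lemma bilinear_tensor_to: "bilinear_into U P (tensor V W) = bilinear_into U P (tensor_vs V W)"
  by (intro ext) (simp add: bilinear_into_def tensor_simps)

locale kalg2 = V: kalg V + W: kalg W
  for V :: "('k::field, 'v, 'm) module_scheme" and W :: "('k, 'w, 'n) module_scheme"
begin

sublocale vs2 V W ..

abbreviation "TV \<equiv> tensor_vs V W"

lemma tens_mult_bilinear:
  assumes "v \<in> carrier V" "w \<in> carrier W"
  shows "bilinear_into V W TV (\<lambda>v' w'. tens V W (v \<otimes>\<^bsub>V\<^esub> v') (w \<otimes>\<^bsub>W\<^esub> w'))"
proof (rule bilinearI)
  fix w' assume w': "w' \<in> carrier W"
  show "lin V TV (\<lambda>v'. tens V W (v \<otimes>\<^bsub>V\<^esub> v') (w \<otimes>\<^bsub>W\<^esub> w'))"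
    by (rule lin_comp[OF V.lin_mult_left bilinear_left[OF tens_bilinear]]) (use assms w' in auto)
next
  fix v' assume v': "v' \<in> carrier V"
  show "lin W TV (\<lambda>w'. tens V W (v \<otimes>\<^bsub>V\<^esub> v') (w \<otimes>\<^bsub>W\<^esub> w'))"
    by (rule lin_comp[OF W.lin_mult_left bilinear_right[OF tens_bilinear]]) (use assms v' in auto)
qed

lemma tens_mult_bilinear':
  assumes "v' \<in> carrier V" "w' \<in> carrier W"
  shows "bilinear_into V W TV (\<lambda>v w. tens V W (v \<otimes>\<^bsub>V\<^esub> v') (w \<otimes>\<^bsub>W\<^esub> w'))"
proof (rule bilinearI)
  fix w assume w: "w \<in> carrier W"
  show "lin V TV (\<lambda>v. tens V W (v \<otimes>\<^bsub>V\<^esub> v') (w \<otimes>\<^bsub>W\<^esub> w'))"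
    by (rule lin_comp[OF V.lin_mult_right bilinear_left[OF tens_bilinear]]) (use assms w in auto)
next
  fix v assume v: "v \<in> carrier V"
  show "lin W TV (\<lambda>w. tens V W (v \<otimes>\<^bsub>V\<^esub> v') (w \<otimes>\<^bsub>W\<^esub> w'))"
    by (rule lin_comp[OF W.lin_mult_right bilinear_right[OF tens_bilinear]]) (use assms v in auto)
qed

lemma tensor_mult_eq:
  "X \<otimes>\<^bsub>tensor V W\<^esub> Y = tensor_lift TV (\<lambda>v w. tensor_lift TV (\<lambda>v' w'.
     tens V W (v \<otimes>\<^bsub>V\<^esub> v') (w \<otimes>\<^bsub>W\<^esub> w')) Y) X"
  by (simp add: tensor_def)

lemma inner_bilinear:
  assumes "Y \<in> carrier TV"
  shows "bilinear_into V W TV (\<lambda>v w. tensor_lift TV (\<lambda>v' w'. tens V W (v \<otimes>\<^bsub>V\<^esub> v') (w \<otimes>\<^bsub>W\<^esub> w')) Y)"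
proof (rule bilinearI)
  fix w assume "w \<in> carrier W"
  then show "lin V TV (\<lambda>v. tensor_lift TV (\<lambda>v' w'. tens V W (v \<otimes>\<^bsub>V\<^esub> v') (w \<otimes>\<^bsub>W\<^esub> w')) Y)"
    by (intro lin_lift_param[OF V.vs_axioms vs_tensor_vs _ _ assms] tens_mult_bilinear
        bilinear_left[OF tens_mult_bilinear'])
next
  fix v assume "v \<in> carrier V"
  then show "lin W TV (\<lambda>w. tensor_lift TV (\<lambda>v' w'. tens V W (v \<otimes>\<^bsub>V\<^esub> v') (w \<otimes>\<^bsub>W\<^esub> w')) Y)"
    by (intro lin_lift_param[OF W.vs_axioms vs_tensor_vs _ _ assms] tens_mult_bilinear
        bilinear_right[OF tens_mult_bilinear'])
qed

lemma tensor_mult_bilinear: "bilinear_into TV TV TV (mult (tensor V W))"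
proof (rule bilinearI)
  fix Y assume Y: "Y \<in> carrier TV"
  show "lin TV TV (\<lambda>X. X \<otimes>\<^bsub>tensor V W\<^esub> Y)"
    unfolding tensor_mult_eq by (rule lin_tensor_lift[OF vs_tensor_vs inner_bilinear[OF Y]])
next
  fix X assume X: "X \<in> carrier TV"
  show "lin TV TV (\<lambda>Y. X \<otimes>\<^bsub>tensor V W\<^esub> Y)"
    unfolding tensor_mult_eq
    by (rule lin_lift_param[OF vs_tensor_vs vs_tensor_vs inner_bilinear lin_tensor_lift[OF vs_tensor_vs tens_mult_bilinear] X])
qed

lemma tensor_mult_tens:
  assumes "v \<in> carrier V" "w \<in> carrier W" "v' \<in> carrier V" "w' \<in> carrier W"
  shows "tens V W v w \<otimes>\<^bsub>tensor V W\<^esub> tens V W v' w' = tens V W (v \<otimes>\<^bsub>V\<^esub> v') (w \<otimes>\<^bsub>W\<^esub> w')"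
  unfolding tensor_mult_eq using assms
  by (simp add: tensor_lift_tens[OF vs_tensor_vs inner_bilinear] tens_closed
    tensor_lift_tens[OF vs_tensor_vs tens_mult_bilinear])

lemma kalg_tensor: "kalg (tensor V W)"
proof (rule kalgI)
  show "vs (tensor V W)" by (rule vs_cong[OF vs_tensor_vs]) (simp_all add: tensor_simps)
  show "bilinear_into (tensor V W) (tensor V W) (tensor V W) (mult (tensor V W))"
    using tensor_mult_bilinear by (simp add: bilinear_iff tensor_simps lin_tensor_from lin_tensor_to)
  let ?m = "mult (tensor V W)"
  have L: "lin TV TV (\<lambda>X. ?m X Y)" if "Y \<in> carrier TV" for Y
    using bilinear_left[OF tensor_mult_bilinear that] .
  have R: "lin TV TV (\<lambda>Y. ?m X Y)" if "X \<in> carrier TV" for X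
    using bilinear_right[OF tensor_mult_bilinear that] .
  have c: "?m X Y \<in> carrier TV" if "X \<in> carrier TV" "Y \<in> carrier TV" for X Y
    using lin_closed[OF L] that by blast
  show "\<one>\<^bsub>tensor V W\<^esub> \<in> carrier (tensor V W)" by (simp add: tensor_simps tens_closed)
  show "\<one>\<^bsub>tensor V W\<^esub> \<otimes>\<^bsub>tensor V W\<^esub> X = X" if "X \<in> carrier (tensor V W)" for X
    unfolding tensor_simps
    by (rule lin_tensor_eqI[OF vs_tensor_vs R lin_ident]) (use that in \<open>simp_all add: tensor_mult_tens tens_closed tensor_simps\<close>)
  show "X \<otimes>\<^bsub>tensor V W\<^esub> \<one>\<^bsub>tensor V W\<^esub> = X" if "X \<in> carrier (tensor V W)" for X
    unfolding tensor_simps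
    by (rule lin_tensor_eqI[OF vs_tensor_vs L lin_ident]) (use that in \<open>simp_all add: tensor_mult_tens tens_closed tensor_simps\<close>)
  have 1: "?m (?m (tens V W a b) (tens V W a' b')) Z = ?m (tens V W a b) (?m (tens V W a' b') Z)"
    if "Z \<in> carrier TV" "a \<in> carrier V" "a' \<in> carrier V" "b \<in> carrier W" "b' \<in> carrier W" for Z a b a' b'
    by (rule lin_tensor_eqI[OF vs_tensor_vs R lin_comp[OF R R] _ that(1)])
      (use that in \<open>simp_all add: tensor_mult_tens tens_closed V.m_assoc W.m_assoc\<close>)
  have 2: "?m (?m (tens V W a b) Y) Z = ?m (tens V W a b) (?m Y Z)"
    if "Z \<in> carrier TV" "Y \<in> carrier TV" "a \<in> carrier V" "b \<in> carrier W" for Z Y a b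
    by (rule lin_tensor_eqI[OF vs_tensor_vs lin_comp[OF R L] lin_comp[OF L R] _ that(2)])
      (use that in \<open>simp_all add: tens_closed 1\<close>)
  have 3: "?m (?m X Y) Z = ?m X (?m Y Z)"
    if "Z \<in> carrier TV" "Y \<in> carrier TV" "X \<in> carrier TV" for X Y Z
    by (rule lin_tensor_eqI[OF vs_tensor_vs lin_comp[OF L L] L _ that(3)])
      (use that in \<open>simp_all add: tens_closed 2 c\<close>)
  show "(X \<otimes>\<^bsub>tensor V W\<^esub> Y) \<otimes>\<^bsub>tensor V W\<^esub> Z = X \<otimes>\<^bsub>tensor V W\<^esub> (Y \<otimes>\<^bsub>tensor V W\<^esub> Z)"
    if "X \<in> carrier (tensor V W)" "Y \<in> carrier (tensor V W)" "Z \<in> carrier (tensor V W)" for X Y Z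
    using 3 that by (simp add: tensor_simps)
qed

end

section \<open>Polynomials in an element of an algebra\<close>

definition pev :: "('k::field, 'v, 'm) module_scheme \<Rightarrow> 'v \<Rightarrow> 'k poly \<Rightarrow> 'v" where
  "pev B x q = fold_coeffs (\<lambda>a b. a \<odot>\<^bsub>B\<^esub> \<one>\<^bsub>B\<^esub> \<oplus>\<^bsub>B\<^esub> x \<otimes>\<^bsub>B\<^esub> b) q \<zero>\<^bsub>B\<^esub>"

context kalg begin

lemma pev_0 [simp]: "pev B x 0 = \<zero>"
  by (simp add: pev_def)

lemma pev_pCons:
  assumes "x \<in> carrier B" shows "pev B x (pCons a q) = a \<odot> \<one> \<oplus> x \<otimes> pev B x q"
  by (cases "a = 0 \<and> q = 0") (use assms in \<open>auto simp: pev_def\<close>)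

lemma pev_closed [simp]: "x \<in> carrier B \<Longrightarrow> pev B x q \<in> carrier B"
  by (induction q) (simp_all add: pev_pCons)

lemma pev_add: "x \<in> carrier B \<Longrightarrow> pev B x (q + r) = pev B x q \<oplus> pev B x r"
  by (induction q r rule: poly_induct2) (simp_all add: pev_pCons smult_l_distr r_distr a_ac)

lemma pev_smult: "x \<in> carrier B \<Longrightarrow> pev B x (Polynomial.smult c q) = c \<odot> pev B x q"
  by (induction q) (simp_all add: pev_pCons smult_r_distr smult_smult smult_mult_right)

lemma pev_uminus: "x \<in> carrier B \<Longrightarrow> pev B x (- q) = \<ominus> pev B x q"
  using pev_smult[of x "-1" q] by (simp add: smult_minus_one)

lemma pev_1 [simp]: "x \<in> carrier B \<Longrightarrow> pev B x 1 = \<one>"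
  using pev_pCons[of x 1 0] by (simp add: one_pCons)

lemma pev_X [simp]: "x \<in> carrier B \<Longrightarrow> pev B x [:0, 1:] = x"
  by (simp add: pev_pCons)

lemma pev_linear: "x \<in> carrier B \<Longrightarrow> pev B x [:c, 1:] = c \<odot> \<one> \<oplus> x"
  by (simp add: pev_pCons)

lemma pev_mult: "x \<in> carrier B \<Longrightarrow> pev B x (q * r) = pev B x q \<otimes> pev B x r"
  by (induction q) (simp_all add: pev_add pev_smult pev_pCons l_distr m_assoc smult_mult_left)

lemma pev_power: "x \<in> carrier B \<Longrightarrow> pev B x (q ^ n) = pev B x q [^] n"
  by (induction n) (simp_all add: pev_mult power_Suc2 del: power_Suc)

lemma pev_monom: "x \<in> carrier B \<Longrightarrow> pev B x (monom 1 n) = x [^] n"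
  using pev_power[of x "[:0, 1:]" n] by (simp add: monom_altdef)

lemma pev_pcompose: "x \<in> carrier B \<Longrightarrow> pev B x (pcompose q r) = pev B (pev B x r) q"
  by (induction q) (simp_all add: pcompose_pCons pev_add pev_mult pev_pCons)

lemma pev_commute:
  assumes "x \<in> carrier B" "y \<in> carrier B" "y \<otimes> x = x \<otimes> y"
  shows "y \<otimes> pev B x q = pev B x q \<otimes> y"
proof (induction q)
  case (pCons a q)
  have "y \<otimes> (x \<otimes> pev B x q) = x \<otimes> pev B x q \<otimes> y"
    using assms pCons m_assoc[of y x "pev B x q"] m_assoc[of x y "pev B x q"] m_assoc[of x "pev B x q" y]
    by simp
  then show ?case
    using assms by (simp add: pev_pCons l_distr r_distr smult_mult_left smult_mult_right)
qed (use assms in simp)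

end

lemma alg_hom_pev:
  assumes "kalg B" "kalg C" "alg_hom B C \<phi>" "x \<in> carrier B"
  shows "\<phi> (pev B x q) = pev C (\<phi> x) q"
proof -
  interpret B: kalg B by fact
  interpret C: kalg C by fact
  note L = alg_hom_lin[OF assms(3)]
  show ?thesis
    by (induction q)
      (simp_all add: B.pev_pCons C.pev_pCons assms lin_add[OF L] lin_smult[OF L] lin_closed[OF L]
        alg_hom_mult[OF assms(3)] alg_hom_one[OF assms(3)] B.lin_zero[OF C.vs_axioms L])
qed

section \<open>Factorial polynomials in characteristic p\<close>

text \<open>
  The polynomial \<open>(x - j) (x - j - 1) \<dots> (x - m + 1)\<close>; for \<open>j = 0\<close> it is the falling factorial.
\<close>

definition ffac :: "nat \<Rightarrow> nat \<Rightarrow> 'k::field poly" where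
  "ffac m j = (\<Prod>i = j..<m. [:- of_nat i, 1:])"

text \<open>The rising factorial \<open>x (x + 1) \<dots> (x + m - 1)\<close>.\<close>

definition rfac :: "nat \<Rightarrow> 'k::field poly" where
  "rfac m = (\<Prod>i<m. [:of_nat i, 1:])"

text \<open>
  The Artin--Schreier polynomial \<open>x^p - x\<close>, whose roots are the elements of the prime field.
\<close>

definition artin :: "'k::field poly" where
  "artin = monom 1 CHAR('k) - [:0, 1:]"

lemma ffac_Suc: "j \<le> m \<Longrightarrow> ffac (Suc m) j = [:- of_nat m, 1:] * ffac m j"
  by (simp add: ffac_def prod.atLeastLessThan_Suc mult.commute)

lemma ffac_less: "j < m \<Longrightarrow> ffac m j = [:- of_nat j, 1:] * ffac m (Suc j)"
  by (simp add: ffac_def prod.atLeast_Suc_lessThan)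

lemma ffac_self [simp]: "ffac m m = 1"
  by (simp add: ffac_def)

lemma rfac_0 [simp]: "rfac 0 = 1" and rfac_Suc: "rfac (Suc m) = [:of_nat m, 1:] * rfac m"
  by (simp_all add: rfac_def mult.commute)

lemma degree_ffac: "degree (ffac m j) = m - j"
  by (simp add: ffac_def degree_prod_sum_eq)

lemma lead_coeff_ffac: "coeff (ffac m j) (m - j) = 1"
proof -
  have "lead_coeff (ffac m j) = 1" by (simp add: ffac_def lead_coeff_prod)
  then show ?thesis by (simp add: degree_ffac)
qed

lemma degree_rfac: "degree (rfac m) = m"
  by (simp add: rfac_def degree_prod_sum_eq)

lemma lead_coeff_rfac: "coeff (rfac m) m = 1"
proof -
  have "lead_coeff (rfac m) = 1" by (simp add: rfac_def lead_coeff_prod)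
  then show ?thesis by (simp add: degree_rfac)
qed

locale prime_char =
  fixes ty :: "'k::field itself"
  assumes prime_p: "prime CHAR('k)"
begin

lemma p_gt_1: "CHAR('k) > 1" using prime_p prime_gt_1_nat by blast

lemma of_nat_eq_iff: "m < CHAR('k) \<Longrightarrow> n < CHAR('k) \<Longrightarrow> (of_nat m :: 'k) = of_nat n \<longleftrightarrow> m = n"
proof (induction m n rule: linorder_wlog)
  case (le m n)
  have "(of_nat (n - m) :: 'k) = 0 \<longleftrightarrow> CHAR('k) dvd n - m" by (rule of_nat_eq_0_iff_char_dvd)
  moreover have "CHAR('k) dvd n - m \<longleftrightarrow> n - m = 0" using le by (auto dest: dvd_imp_le)
  ultimately show ?case using le by (auto simp: of_nat_diff)
qed auto

lemma of_nat_power_p: "(of_nat n :: 'k) ^ CHAR('k) = of_nat n"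
proof (induction n)
  case (Suc n)
  then show ?case by (simp add: freshmans_dream[OF prime_p refl])
qed (use p_gt_1 in auto)

lemma minus_power_p: "(- a :: 'k) ^ CHAR('k) = - (a ^ CHAR('k))"
  by (rule minus_power_prime_CHAR[OF refl prime_p])

lemma poly_artin: "poly artin (a :: 'k) = a ^ CHAR('k) - a"
  by (simp add: artin_def poly_monom)

lemma degree_artin: "degree (artin :: 'k poly) = CHAR('k)" "coeff (artin :: 'k poly) CHAR('k) = 1"
proof -
  have "degree (- [:0, 1 :: 'k:]) < degree (monom 1 CHAR('k) :: 'k poly)"
    using p_gt_1 by (simp add: degree_monom_eq)
  then show "degree (artin :: 'k poly) = CHAR('k)"
    unfolding artin_def diff_conv_add_uminus using degree_add_eq_left[of "- [:0, 1 :: 'k:]" "monom 1 CHAR('k)"]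
    by (simp add: degree_monom_eq del: minus_pCons)
  show "coeff (artin :: 'k poly) CHAR('k) = 1"
    using p_gt_1 by (simp add: artin_def coeff_pCons split: nat.split)
qed

text \<open>
  A nonzero polynomial of degree below \<open>p\<close> cannot have all \<open>p\<close> elements of the prime field as
  roots.
\<close>

lemma poly_eq_on_prime_field:
  fixes q r :: "'k poly"
  assumes "degree (q - r) < CHAR('k)" "\<And>n. n < CHAR('k) \<Longrightarrow> poly q (of_nat n) = poly r (of_nat n)"
  shows "q = r"
proof (rule ccontr)
  assume "q \<noteq> r"
  then have ne: "q - r \<noteq> 0" by simp
  have "card (of_nat ` {..<CHAR('k)} :: 'k set) \<le> card {x. poly (q - r) x = 0}"
    using assms(2) by (intro card_mono poly_roots_finite[OF ne]) auto
  also have "\<dots> \<le> degree (q - r)" by (rule card_poly_roots_bound[OF ne])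
  also have "card (of_nat ` {..<CHAR('k)} :: 'k set) = CHAR('k)"
    by (subst card_image) (auto simp: inj_on_def of_nat_eq_iff)
  finally show False using assms(1) by simp
qed

lemma degree_diff_monic_less:
  fixes q r :: "'k poly"
  assumes "degree q = n" "degree r = n" "coeff q n = 1" "coeff r n = 1" "n > 0"
  shows "degree (q - r) < n"
proof -
  have "degree (q - r) \<le> n" using assms degree_diff_le_max[of q r] by simp
  moreover have "degree (q - r) \<noteq> n"
  proof
    assume "degree (q - r) = n"
    then have "q - r = 0" using assms by (metis coeff_diff diff_self leading_coeff_0_iff)
    then show False using \<open>degree (q - r) = n\<close> assms(5) by simp
  qed
  ultimately show ?thesis by simp
qed

text \<open>
  Falling and rising factorial of length \<open>p\<close> both run over the whole prime field, so they agree
  with \<open>x^p - x\<close>: the difference of two monic polynomials of degree \<open>p\<close> has degree below \<open>p\<close>, and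
  it vanishes on the prime field.
\<close>

lemma ffac_p: "ffac CHAR('k) 0 = (artin :: 'k poly)"
proof (rule poly_eq_on_prime_field)
  show "degree (ffac CHAR('k) 0 - artin :: 'k poly) < CHAR('k)"
    by (rule degree_diff_monic_less) (use degree_artin degree_ffac[of "CHAR('k)" 0] lead_coeff_ffac[of "CHAR('k)" 0] p_gt_1 in auto)
  fix n assume "n < CHAR('k)"
  then show "poly (ffac CHAR('k) 0) (of_nat n) = poly artin (of_nat n :: 'k)"
    by (auto simp: poly_artin of_nat_power_p ffac_def poly_prod intro!: prod_zero bexI[of _ n])
qed

lemma pcompose_power: "pcompose (q ^ n) r = pcompose q r ^ n" for q r :: "'k poly"
  by (induction n) (simp_all add: pcompose_mult pcompose_1)

text \<open>
  Additivity of \<open>x^p - x\<close> in characteristic \<open>p\<close>; for \<open>c\<close> in the prime field the shift does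
  nothing.
\<close>

lemma pcompose_artin_shift: "pcompose artin [:c, 1 :: 'k:] = artin + [:c ^ CHAR('k) - c:]"
proof -
  have "prime CHAR('k poly)" using prime_p by simp
  then have "([:c:] + [:0, 1:] :: 'k poly) ^ CHAR('k) = [:c:] ^ CHAR('k) + [:0, 1:] ^ CHAR('k)"
    by (rule freshmans_dream) simp
  then have "([:c, 1:] :: 'k poly) ^ CHAR('k) = [:c ^ CHAR('k):] + [:0, 1:] ^ CHAR('k)"
    by (simp only: add_pCons poly_const_pow add_0_left add_0_right)
  moreover have "pcompose artin [:c, 1 :: 'k:] = [:c, 1:] ^ CHAR('k) - [:c, 1:]"
    by (simp add: artin_def monom_altdef pcompose_diff pcompose_power pcompose_pCons)
  ultimately have "pcompose artin [:c, 1 :: 'k:] = ([:c ^ CHAR('k):] + [:0, 1:] ^ CHAR('k)) - ([:c:] + [:0, 1:])"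
    by simp
  also have "\<dots> = ([:0, 1:] ^ CHAR('k) - [:0, 1:]) + ([:c ^ CHAR('k):] - [:c:])"
    by (metis add.commute add_diff_add)
  finally show ?thesis
    by (simp add: artin_def monom_altdef)
qed

lemma pcompose_artin_neg: "pcompose artin [:0, - 1 :: 'k:] = - artin"
proof -
  have "(- [:0, 1:] :: 'k poly) ^ CHAR('k) = - ([:0, 1:] ^ CHAR('k))"
    by (rule minus_power_prime_CHAR) (use prime_p in simp_all)
  then show ?thesis
    by (simp add: artin_def monom_altdef pcompose_diff pcompose_power pcompose_pCons)
qed

lemma one_minus_X_power: "([:1, - 1:] :: 'k poly) ^ CHAR('k) = 1 - monom 1 CHAR('k)"
proof -
  have "prime CHAR('k poly)" using prime_p by simp
  then have "(1 + (- [:0, 1:]) :: 'k poly) ^ CHAR('k) = 1 ^ CHAR('k) + (- [:0, 1:]) ^ CHAR('k)"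
    by (rule freshmans_dream) simp
  also have "(- [:0, 1:] :: 'k poly) ^ CHAR('k) = - ([:0, 1:] ^ CHAR('k))"
    by (rule minus_power_prime_CHAR) (use prime_p in simp_all)
  finally show ?thesis by (simp add: monom_altdef one_pCons[symmetric] del: minus_pCons) (simp add: one_pCons)
qed

lemma rfac_p: "rfac CHAR('k) = (artin :: 'k poly)"
proof (rule poly_eq_on_prime_field)
  show "degree (rfac CHAR('k) - artin :: 'k poly) < CHAR('k)"
    by (rule degree_diff_monic_less) (use degree_artin degree_rfac[of "CHAR('k)"] lead_coeff_rfac[of "CHAR('k)"] p_gt_1 in auto)
  fix n assume n: "n < CHAR('k)"
  have "poly (rfac CHAR('k)) (of_nat n :: 'k) = 0"
  proof (cases n)
    case 0
    then show ?thesis using p_gt_1 by (auto simp: rfac_def poly_prod intro!: prod_zero bexI[of _ 0])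
  next
    case (Suc k)
    have "(of_nat (CHAR('k) - n) + of_nat n :: 'k) = of_nat CHAR('k)" using n by (simp flip: of_nat_add)
    then show ?thesis using n Suc by (auto simp: rfac_def poly_prod intro!: prod_zero bexI[of _ "CHAR('k) - n"])
  qed
  then show "poly (rfac CHAR('k)) (of_nat n) = poly artin (of_nat n :: 'k)"
    by (simp add: poly_artin of_nat_power_p)
qed

lemma binomial_p: "0 < j \<Longrightarrow> j < CHAR('k) \<Longrightarrow> (of_nat (CHAR('k) choose j) :: 'k) = 0"
  using dvd_choose_prime[of j "CHAR('k)"] prime_p by (simp add: of_nat_eq_0_iff_char_dvd)

end

lemma (in kalg) pev_artin:
  assumes "x \<in> carrier B"
  shows "pev B x artin = \<zero> \<longleftrightarrow> x [^] CHAR('k) = x"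
proof -
  have "pev B x artin = x [^] CHAR('k) \<ominus> x"
    using assms pev_add[of x "monom 1 CHAR('k)" "- [:0, 1:]"] pev_uminus[of x "[:0, 1:]"]
    by (simp add: artin_def pev_monom a_minus_def del: minus_pCons)
  moreover have "a \<ominus> b = \<zero> \<longleftrightarrow> a = b" if "a \<in> carrier B" "b \<in> carrier B" for a b
    using that minus_equality[of a "\<ominus> b"] by (auto simp: a_minus_def r_neg)
  ultimately show ?thesis using assms by simp
qed

section \<open>Commutation formulas\<close>

context kalg begin

text \<open>
  The hypothesis says \<open>[x, g] = g (g - 1)\<close>. As \<open>[x, _]\<close> is a derivation,
  \<open>[x, g^j] = j g^j (g - 1)\<close>. The equations are kept free of subtraction so that both sides can be
  normalised as commutative sums.
\<close>

lemma commute_power: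
  assumes [simp]: "x \<in> carrier B" "g \<in> carrier B" and rel: "x \<otimes> g \<oplus> g = g \<otimes> x \<oplus> g \<otimes> g"
  shows "x \<otimes> g [^] (j::nat) \<oplus> of_nat j \<odot> g [^] j = g [^] j \<otimes> x \<oplus> of_nat j \<odot> g [^] Suc j"
proof (induction j)
  case (Suc j)
  have "x \<otimes> g [^] Suc j \<oplus> of_nat (Suc j) \<odot> g [^] Suc j =
      (x \<otimes> g [^] j \<oplus> of_nat j \<odot> g [^] j) \<otimes> g \<oplus> g [^] Suc j"
    by (simp add: l_distr smult_l_distr smult_mult_left m_assoc a_ac)
  also have "\<dots> = g [^] j \<otimes> (x \<otimes> g \<oplus> g) \<oplus> of_nat j \<odot> g [^] Suc (Suc j)"
    unfolding Suc.IH by (simp add: l_distr r_distr smult_mult_left m_assoc a_ac)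
  also have "\<dots> = g [^] Suc j \<otimes> x \<oplus> of_nat (Suc j) \<odot> g [^] Suc (Suc j)"
    unfolding rel by (simp add: r_distr smult_l_distr m_assoc a_ac)
  finally show ?case .
qed simp

text \<open>
  Here \<open>[x, u] = u - 1\<close>. This is the relation satisfied by \<open>u = g^(-1)\<close> in the antipode, and by
  \<open>u = 1 - \<rho>\<close> with \<open>\<rho>\<close> the right translation by \<open>g\<close> in the representation that proves linear
  independence.
\<close>

lemma commute_power':
  assumes [simp]: "x \<in> carrier B" "u \<in> carrier B" and rel: "x \<otimes> u \<oplus> \<one> = u \<otimes> x \<oplus> u"
  shows "u \<otimes> x \<otimes> u [^] (j::nat) \<oplus> of_nat j \<odot> u [^] j = u [^] Suc j \<otimes> x \<oplus> of_nat j \<odot> u [^] Suc j"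
proof (induction j)
  case (Suc j)
  have "u \<otimes> x \<otimes> u [^] Suc j \<oplus> of_nat (Suc j) \<odot> u [^] Suc j =
      (u \<otimes> x \<otimes> u [^] j \<oplus> of_nat j \<odot> u [^] j) \<otimes> u \<oplus> u [^] Suc j"
    by (simp add: l_distr smult_l_distr smult_mult_left m_assoc a_ac)
  also have "\<dots> = u [^] Suc j \<otimes> (x \<otimes> u \<oplus> \<one>) \<oplus> of_nat j \<odot> u [^] Suc (Suc j)"
    unfolding Suc.IH by (simp add: l_distr r_distr smult_mult_left m_assoc a_ac)
  also have "\<dots> = u [^] Suc (Suc j) \<otimes> x \<oplus> of_nat (Suc j) \<odot> u [^] Suc (Suc j)"
    unfolding rel by (simp add: r_distr smult_l_distr m_assoc a_ac)
  finally show ?case .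
qed simp

text \<open>
  Pushing all factors \<open>u\<close> of \<open>(u x) (u x + 1) \<dots> (u x + m - 1)\<close> to the left turns each remaining
  factor \<open>u x + i\<close> into \<open>x + i\<close>. At \<open>m = p\<close> this reads \<open>(u x)^p - u x = u^p (x^p - x)\<close>.
\<close>

lemma pev_rfac_twisted:
  assumes [simp]: "x \<in> carrier B" "u \<in> carrier B" and rel: "x \<otimes> u \<oplus> \<one> = u \<otimes> x \<oplus> u"
  shows "pev B (u \<otimes> x) (rfac m) = u [^] m \<otimes> pev B x (rfac m)"
proof (induction m)
  case (Suc m)
  let ?q = "pev B x (rfac m)"
  have "pev B (u \<otimes> x) (rfac (Suc m)) = (of_nat m \<odot> \<one> \<oplus> u \<otimes> x) \<otimes> (u [^] m \<otimes> ?q)"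
    by (simp add: rfac_Suc pev_mult pev_linear Suc.IH del: mult_pCons_left)
  also have "\<dots> = (u \<otimes> x \<otimes> u [^] m \<oplus> of_nat m \<odot> u [^] m) \<otimes> ?q"
    by (simp add: l_distr smult_mult_left m_assoc a_ac)
  also have "\<dots> = u [^] Suc m \<otimes> ((of_nat m \<odot> \<one> \<oplus> x) \<otimes> ?q)"
    unfolding commute_power'[OF assms]
    by (simp add: l_distr r_distr smult_mult_left smult_mult_right m_assoc a_ac)
  finally show ?case by (simp add: rfac_Suc pev_mult pev_linear del: mult_pCons_left)
qed simp

end

text \<open>
  The situation of \<open>x \<otimes> 1\<close>, \<open>g \<otimes> 1\<close>, \<open>1 \<otimes> x\<close> in \<open>\<AA> \<otimes> \<AA>\<close>, where \<open>x + g y\<close> is the coproduct of \<open>x\<close>.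
\<close>

locale skew_sum = kalg B for B :: "('k::field, 'v, 'm) module_scheme" (structure) +
  fixes x g y
  assumes xc [simp]: "x \<in> carrier B" and gc [simp]: "g \<in> carrier B" and yc [simp]: "y \<in> carrier B"
    and xg: "x \<otimes> g \<oplus> g = g \<otimes> x \<oplus> g \<otimes> g" and xy: "x \<otimes> y = y \<otimes> x" and gy: "g \<otimes> y = y \<otimes> g"
begin

text \<open>
  The summands of the formula for \<open>x + g y\<close>, with an arbitrary polynomial \<open>q\<close> in \<open>x\<close>, since the
  induction on the number of factors changes the polynomial of each summand.
\<close>

definition T :: "nat \<Rightarrow> 'k poly \<Rightarrow> 'v" where
  "T j q = g [^] j \<otimes> pev B x q \<otimes> pev B y (rfac j)"

primrec Tsum :: "(nat \<Rightarrow> 'k poly) \<Rightarrow> nat \<Rightarrow> 'v" where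
  "Tsum q 0 = T 0 (q 0)"
| "Tsum q (Suc n) = Tsum q n \<oplus> T (Suc n) (q (Suc n))"

lemma T_closed [simp]: "T j q \<in> carrier B" by (simp add: T_def)

lemma Tsum_closed [simp]: "Tsum q n \<in> carrier B" by (induction n) auto

lemma T_add: "T j (q + r) = T j q \<oplus> T j r"
  by (simp add: T_def pev_add l_distr r_distr)

lemma T_smult: "T j (Polynomial.smult c q) = c \<odot> T j q"
  by (simp add: T_def pev_smult smult_mult_left smult_mult_right)

lemma T_zero [simp]: "T j 0 = \<zero>"
  using T_smult[of j 0 0] by simp

lemma Tsum_add: "Tsum (\<lambda>j. q j + r j) n = Tsum q n \<oplus> Tsum r n"
  by (induction n) (simp_all add: T_add a_ac)

lemma Tsum_smult: "Tsum (\<lambda>j. Polynomial.smult c (q j)) n = c \<odot> Tsum q n"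
  by (induction n) (simp_all add: T_smult smult_r_distr)

lemma Tsum_cong: "(\<And>j. j \<le> n \<Longrightarrow> q j = r j) \<Longrightarrow> Tsum q n = Tsum r n"
  by (induction n) auto

lemma y_T: "y \<otimes> T j q = g [^] j \<otimes> pev B x q \<otimes> (y \<otimes> pev B y (rfac j))"
proof -
  have 1: "y \<otimes> g [^] j = g [^] j \<otimes> y"
    using pev_commute[of g y "monom 1 j"] gy by (simp add: pev_monom)
  have 2: "y \<otimes> pev B x q = pev B x q \<otimes> y"
    using pev_commute[of x y q] xy by simp
  have "y \<otimes> T j q = (y \<otimes> g [^] j) \<otimes> pev B x q \<otimes> pev B y (rfac j)"
    by (simp add: T_def m_assoc)
  also have "\<dots> = g [^] j \<otimes> (y \<otimes> pev B x q) \<otimes> pev B y (rfac j)"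
    unfolding 1 by (simp add: m_assoc)
  also have "\<dots> = g [^] j \<otimes> pev B x q \<otimes> (y \<otimes> pev B y (rfac j))"
    unfolding 2 by (simp add: m_assoc)
  finally show ?thesis .
qed

text \<open>
  Multiplication by \<open>x + g y\<close> on the left. Moving \<open>x\<close> past \<open>g^j\<close> costs \<open>j g^j (g - 1)\<close>: the part
  \<open>- j g^j\<close> shifts the factor \<open>x\<close> to \<open>x - j\<close>, and the part \<open>j g^(j+1)\<close> shifts the factor \<open>y\<close>
  coming from \<open>g y\<close> to \<open>y + j\<close>, which is the next factor of the rising factorial.
\<close>

lemma X_T: "(x \<oplus> g \<otimes> y) \<otimes> T j q = T j ([:- of_nat j, 1:] * q) \<oplus> T (Suc j) q"
proof -
  let ?P = "pev B x q" and ?Q = "pev B y (rfac j)"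
  have "x \<otimes> T j q \<oplus> of_nat j \<odot> T j q = (x \<otimes> g [^] j \<oplus> of_nat j \<odot> g [^] j) \<otimes> ?P \<otimes> ?Q"
    by (simp add: T_def l_distr smult_mult_left m_assoc)
  also have "\<dots> = g [^] j \<otimes> (x \<otimes> ?P) \<otimes> ?Q \<oplus> of_nat j \<odot> (g [^] Suc j \<otimes> ?P \<otimes> ?Q)"
    unfolding commute_power[OF xc gc xg] by (simp add: l_distr smult_mult_left m_assoc)
  finally have 1: "x \<otimes> T j q \<oplus> of_nat j \<odot> T j q =
      T j ([:0, 1:] * q) \<oplus> of_nat j \<odot> (g [^] Suc j \<otimes> ?P \<otimes> ?Q)"
    by (simp add: T_def pev_mult del: mult_pCons_left)
  have gT: "g \<otimes> g [^] j = g [^] Suc j"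
    by (rule nat_pow_Suc2[symmetric]) simp
  have 2: "g \<otimes> y \<otimes> T j q \<oplus> of_nat j \<odot> (g [^] Suc j \<otimes> ?P \<otimes> ?Q) = T (Suc j) q"
  proof -
    have "g \<otimes> y \<otimes> T j q = (g \<otimes> g [^] j) \<otimes> ?P \<otimes> (y \<otimes> ?Q)"
      by (simp add: m_assoc y_T)
    then show ?thesis
      unfolding gT by (simp add: T_def rfac_Suc pev_mult pev_linear l_distr r_distr smult_mult_left
          smult_mult_right a_ac del: nat_pow_Suc mult_pCons_left)
  qed
  have 3: "T j ([:- of_nat j, 1:] * q) \<oplus> of_nat j \<odot> T j q = T j ([:0, 1:] * q)"
    by (simp flip: T_smult T_add)
  let ?r = "of_nat j \<odot> T j q \<oplus> of_nat j \<odot> (g [^] Suc j \<otimes> ?P \<otimes> ?Q)"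
  have "(x \<oplus> g \<otimes> y) \<otimes> T j q \<oplus> ?r = (x \<otimes> T j q \<oplus> of_nat j \<odot> T j q) \<oplus>
      (g \<otimes> y \<otimes> T j q \<oplus> of_nat j \<odot> (g [^] Suc j \<otimes> ?P \<otimes> ?Q))"
    by (simp add: l_distr a_ac)
  also have "\<dots> = (T j ([:- of_nat j, 1:] * q) \<oplus> T (Suc j) q) \<oplus> ?r"
    unfolding 1 2 3[symmetric] by (simp add: a_ac)
  finally show ?thesis by (subst (asm) add.right_cancel) simp_all
qed

lemma X_Tsum: "(x \<oplus> g \<otimes> y) \<otimes> Tsum q n =
   Tsum (\<lambda>j. [:- of_nat j, 1:] * q j + (case j of 0 \<Rightarrow> 0 | Suc i \<Rightarrow> q i)) n \<oplus> T (Suc n) (q n)"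
proof (induction n)
  case (Suc n)
  show ?case
    by (simp add: r_distr Suc.IH X_T T_add a_ac del: mult_pCons_left)
qed (simp add: X_T)

text \<open>
  The comparison of coefficients in the induction step of the formula for \<open>x + g y\<close>. Besides
  Pascal's rule it uses \<open>(i + 1) (m choose (i + 1)) = (m - i) (m choose i)\<close>, since the two
  contributions carry different linear factors.
\<close>

lemma choose_ffac_step:
  assumes "j \<le> m"
  shows "[:- of_nat j, 1:] * Polynomial.smult (of_nat (m choose j)) (ffac m j) +
       (case j of 0 \<Rightarrow> 0 | Suc i \<Rightarrow> Polynomial.smult (of_nat (m choose i)) (ffac m i)) +
       Polynomial.smult (- of_nat m) (Polynomial.smult (of_nat (m choose j)) (ffac m j)) =
     (Polynomial.smult (of_nat (Suc m choose j)) (ffac (Suc m) j) :: 'k poly)"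
proof (cases j)
  case 0
  then show ?thesis by (simp add: ffac_Suc)
next
  case (Suc i)
  define c d :: 'k where "c = of_nat (m choose j)" and "d = of_nat (m choose i)"
  define M I :: 'k where "M = of_nat m" and "I = of_nat i"
  have "Suc i * (m choose Suc i) = (m - i) * (m choose i)"
    by (metis binomial_absorb_comp binomial_absorption)
  then have "of_nat (Suc i) * c = (of_nat m - of_nat i) * d"
    unfolding c_def d_def Suc using assms Suc by (metis of_nat_mult of_nat_diff Suc_leD)
  then have eq: "(1 + I) * c = (M - I) * d" by (simp add: M_def I_def)
  have ff: "ffac m i = [:- I, 1:] * (ffac m j :: 'k poly)"
    using ffac_less[of i m] assms Suc by (simp add: I_def)
  have sm: "Polynomial.smult a F = [:a:] * F" for a :: 'k and F by simp
  have "[:- (1 + I), 1:] * Polynomial.smult c (ffac m j) + Polynomial.smult d ([:- I, 1:] * ffac m j) +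
      Polynomial.smult (- M) (Polynomial.smult c (ffac m j)) =
      ([:c:] * [:- (1 + I), 1:] + [:d:] * [:- I, 1:] + [:- M:] * [:c:]) * ffac m j"
    unfolding sm by (simp only: ring_distribs mult_ac)
  also have "[:c:] * [:- (1 + I), 1:] + [:d:] * [:- I, 1:] + [:- M:] * [:c:] = [:c + d:] * [:- M, 1:]"
    using eq by (simp add: algebra_simps)
  also have "\<dots> * ffac m j = Polynomial.smult (c + d) (ffac (Suc m) j)"
    unfolding ffac_Suc[OF assms] M_def sm by (simp only: mult_ac)
  finally show ?thesis
    using ff by (simp add: Suc c_def d_def M_def I_def add.commute del: mult_pCons_left)
qed

text \<open>
  The coproduct formula for falling factorials, by induction on \<open>m\<close>: multiply by \<open>x + g y - m\<close>.
\<close>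

lemma pev_ffac: "pev B (x \<oplus> g \<otimes> y) (ffac m 0) = Tsum (\<lambda>j. Polynomial.smult (of_nat (m choose j)) (ffac m j)) m"
proof (induction m)
  case 0
  then show ?case by (simp add: T_def flip: one_pCons)
next
  case (Suc m)
  let ?q = "\<lambda>m j. Polynomial.smult (of_nat (m choose j)) (ffac m j) :: 'k poly"
  have "pev B (x \<oplus> g \<otimes> y) (ffac (Suc m) 0) =
      (x \<oplus> g \<otimes> y) \<otimes> Tsum (?q m) m \<oplus> (- of_nat m) \<odot> Tsum (?q m) m"
    by (simp add: ffac_Suc pev_mult pev_linear Suc.IH l_distr smult_mult_left a_ac del: mult_pCons_left)
  also have "\<dots> = Tsum (\<lambda>j. [:- of_nat j, 1:] * ?q m j + (case j of 0 \<Rightarrow> 0 | Suc i \<Rightarrow> ?q m i) +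
      Polynomial.smult (- of_nat m) (?q m j)) m \<oplus> T (Suc m) (?q m m)"
    unfolding X_Tsum Tsum_add Tsum_smult by (simp add: a_ac)
  also have "\<dots> = Tsum (?q (Suc m)) m \<oplus> T (Suc m) (?q m m)"
    by (subst Tsum_cong[OF choose_ffac_step]) auto
  finally show ?case by simp
qed

lemma Tsum_single: "(\<And>j. 0 < j \<Longrightarrow> j \<le> n \<Longrightarrow> q j = 0) \<Longrightarrow> Tsum q n = T 0 (q 0)"
  by (induction n) auto

text \<open>
  At \<open>m = p\<close> the inner binomial coefficients vanish; the two outer terms are \<open>x^p - x\<close> and
  \<open>g^p (y^p - y)\<close>.
\<close>

lemma artin_skew_sum:
  assumes "prime CHAR('k)" "x [^] CHAR('k) = x" "y [^] CHAR('k) = y"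
  shows "(x \<oplus> g \<otimes> y) [^] CHAR('k) = x \<oplus> g \<otimes> y"
proof -
  interpret prime_char "TYPE('k)" by unfold_locales fact
  \<comment> \<open>the last summand, \<open>j = p\<close>, is split off\<close>
  obtain m where m: "CHAR('k) = Suc m" using p_gt_1 by (cases "CHAR('k)") auto
  have "pev B (x \<oplus> g \<otimes> y) artin = Tsum (\<lambda>j. Polynomial.smult (of_nat (CHAR('k) choose j)) (ffac CHAR('k) j)) CHAR('k)"
    unfolding ffac_p[symmetric] by (rule pev_ffac)
  also have "\<dots> = T 0 artin \<oplus> T CHAR('k) 1"
  proof -
    let ?q = "\<lambda>j. Polynomial.smult (of_nat (CHAR('k) choose j)) (ffac CHAR('k) j) :: 'k poly"
    have "Tsum ?q CHAR('k) = Tsum ?q m \<oplus> T CHAR('k) (?q CHAR('k))"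
      using Tsum.simps(2)[of ?q m] unfolding m[symmetric] .
    moreover have "Tsum ?q m = T 0 (?q 0)"
      by (rule Tsum_single) (use m binomial_p in auto)
    ultimately show ?thesis by (simp add: ffac_p one_pCons)
  qed
  also have "\<dots> = \<zero>"
    using assms pev_artin[of x] pev_artin[of y] by (simp add: T_def rfac_p)
  finally show ?thesis by (simp add: pev_artin)
qed

end

section \<open>Monoid algebras\<close>

lemma monoid_alg_simps [simp]:
  "carrier (monoid_alg M) = {r. Poly_Mapping.keys r \<subseteq> carrier M}" "\<zero>\<^bsub>monoid_alg M\<^esub> = 0"
  "r \<oplus>\<^bsub>monoid_alg M\<^esub> s = r + s" "c \<odot>\<^bsub>monoid_alg M\<^esub> r = Poly_Mapping.map ((*) c) r"
  "\<one>\<^bsub>monoid_alg M\<^esub> = \<delta> \<one>\<^bsub>M\<^esub>"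
  by (simp_all add: monoid_alg_def free_vs_def)

lemma scale_single: "Poly_Mapping.map ((*) (c::'k::field)) (Poly_Mapping.single x d) = Poly_Mapping.single x (c * d)"
  by (rule poly_mapping_eqI) (simp add: lookup_single when_def)

lemma scale_sum: "Poly_Mapping.map ((*) (c::'k::field)) (\<Sum>x\<in>T. f x) = (\<Sum>x\<in>T. Poly_Mapping.map ((*) c) (f x))"
  by (rule poly_mapping_eqI) (simp add: lookup_sum sum_distrib_left)

lemma lin_ext_free:
  assumes "Poly_Mapping.keys r \<subseteq> S" "\<And>x. x \<in> S \<Longrightarrow> Poly_Mapping.keys (\<beta> x) \<subseteq> S'"
  shows "lin_ext (free_vs S') \<beta> r =
    (\<Sum>x\<in>Poly_Mapping.keys r. Poly_Mapping.map ((*) (Poly_Mapping.lookup r x :: 'k::field)) (\<beta> x))"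
proof -
  have "Poly_Mapping.keys (Poly_Mapping.lookup r x \<odot>\<^bsub>free_vs S'\<^esub> \<beta> x) \<subseteq> S'" if "x \<in> Poly_Mapping.keys r" for x
    using order_trans[OF keys_scale assms(2)] assms(1) that by auto
  then show ?thesis
    unfolding lin_ext_def by (subst finsum_free) simp_all
qed

lemma monoid_alg_delta_mult: "\<delta> a \<otimes>\<^bsub>monoid_alg M\<^esub> \<delta> b = (\<delta> (a \<otimes>\<^bsub>M\<^esub> b) :: 'x \<Rightarrow>\<^sub>0 'k::field)"
  by (simp add: monoid_alg_def)

text \<open>
  The product is bilinear because it is an iterated linear extension, in either order; the algebra
  laws then need to be checked on basis elements only, where they are the monoid laws.
\<close>

lemma kalg_monoid_alg:
  assumes "monoid M"
  shows "kalg (monoid_alg M :: ('k::field, 'x \<Rightarrow>\<^sub>0 'k) module)"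
proof -
  interpret M: monoid M by fact
  let ?A = "monoid_alg M :: ('k, 'x \<Rightarrow>\<^sub>0 'k) module" and ?F = "free_vs (carrier M) :: ('k, 'x \<Rightarrow>\<^sub>0 'k) module"
  let ?m = "mult ?A"
  have vF: "vs ?F" by (rule vs_free)
  have m: "?m r s = (\<Sum>a\<in>Poly_Mapping.keys r. \<Sum>b\<in>Poly_Mapping.keys s.
      Poly_Mapping.single (a \<otimes>\<^bsub>M\<^esub> b) (Poly_Mapping.lookup r a * Poly_Mapping.lookup s b))" for r s
    by (simp add: monoid_alg_def)
  have d: "lin_ext ?F (\<lambda>b. \<delta> (a \<otimes>\<^bsub>M\<^esub> b)) s =
      (\<Sum>b\<in>Poly_Mapping.keys s. Poly_Mapping.single (a \<otimes>\<^bsub>M\<^esub> b) (Poly_Mapping.lookup s b))"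
    if "a \<in> carrier M" "s \<in> carrier ?F" for a s
    by (subst lin_ext_free[of _ "carrier M"]) (use that in \<open>auto simp: scale_single\<close>)
  have d': "lin_ext ?F (\<lambda>a. \<delta> (a \<otimes>\<^bsub>M\<^esub> b)) s =
      (\<Sum>a\<in>Poly_Mapping.keys s. Poly_Mapping.single (a \<otimes>\<^bsub>M\<^esub> b) (Poly_Mapping.lookup s a))"
    if "b \<in> carrier M" "s \<in> carrier ?F" for b s
    by (subst lin_ext_free[of _ "carrier M"]) (use that in \<open>auto simp: scale_single\<close>)
  have l: "lin ?F ?F (lin_ext ?F (\<lambda>b. \<delta> (a \<otimes>\<^bsub>M\<^esub> b)))" if "a \<in> carrier M" for a
    by (rule lin_lin_ext[OF vF]) (use that in auto)
  have l': "lin ?F ?F (lin_ext ?F (\<lambda>a. \<delta> (a \<otimes>\<^bsub>M\<^esub> b)))" if "b \<in> carrier M" for b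
    by (rule lin_lin_ext[OF vF]) (use that in auto)
  have m1: "?m r s = lin_ext ?F (\<lambda>a. lin_ext ?F (\<lambda>b. \<delta> (a \<otimes>\<^bsub>M\<^esub> b)) s) r"
    if "r \<in> carrier ?F" "s \<in> carrier ?F" for r s
    using that lin_closed[OF l that(2)]
    by (subst lin_ext_free[of _ "carrier M"]) (auto simp: m d scale_sum scale_single intro!: sum.cong)
  have m2: "?m r s = lin_ext ?F (\<lambda>b. lin_ext ?F (\<lambda>a. \<delta> (a \<otimes>\<^bsub>M\<^esub> b)) r) s"
    if "r \<in> carrier ?F" "s \<in> carrier ?F" for r s
    using that lin_closed[OF l' that(1)] unfolding m
    by (subst sum.swap, subst lin_ext_free[of _ "carrier M"])
      (auto simp: d' scale_sum scale_single mult.commute intro!: sum.cong)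
  have L: "lin ?F ?F (\<lambda>r. ?m r s)" if "s \<in> carrier ?F" for s
    by (rule lin_cong[OF vF lin_lin_ext[OF vF]]) (use that m1 lin_closed[OF l that] in auto)
  have R: "lin ?F ?F (\<lambda>s. ?m r s)" if "r \<in> carrier ?F" for r
    by (rule lin_cong[OF vF lin_lin_ext[OF vF]]) (use that m2 lin_closed[OF l' that] in auto)
  have c: "?m r s \<in> carrier ?F" if "r \<in> carrier ?F" "s \<in> carrier ?F" for r s
    using lin_closed[OF L] that by blast
  have sF: "spans ?F (\<delta> ` carrier M)" by (rule spans_free)
  have D: "?m (\<delta> a) (\<delta> b) = \<delta> (a \<otimes>\<^bsub>M\<^esub> b)" for a b by (rule monoid_alg_delta_mult)
  have dc: "\<delta> a \<in> carrier ?F" if "a \<in> carrier M" for a using that by simp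
  show ?thesis
  proof (rule kalgI)
    show "vs ?A" by (rule vs_cong[OF vF]) (auto simp: fun_eq_iff)
    have "lin ?A ?A = lin ?F ?F" by (simp add: lin_def fun_eq_iff)
    then show "bilinear_into ?A ?A ?A ?m" using L R by (simp add: bilinear_iff)
    show "\<one>\<^bsub>?A\<^esub> \<in> carrier ?A" by simp
    show "\<one>\<^bsub>?A\<^esub> \<otimes>\<^bsub>?A\<^esub> r = r" if "r \<in> carrier ?A" for r
      by (rule lin_eqI[OF vF vF sF R lin_ident]) (use that in \<open>auto simp: D\<close>)
    show "r \<otimes>\<^bsub>?A\<^esub> \<one>\<^bsub>?A\<^esub> = r" if "r \<in> carrier ?A" for r
      by (rule lin_eqI[OF vF vF sF L lin_ident]) (use that in \<open>auto simp: D\<close>)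
    have 1: "?m (?m (\<delta> a) (\<delta> b)) z = ?m (\<delta> a) (?m (\<delta> b) z)"
      if "a \<in> carrier M" "b \<in> carrier M" "z \<in> carrier ?F" for a b z
      by (rule lin_eqI[OF vF vF sF R lin_comp[OF R R] _ that(3)])
        (use that in \<open>auto simp: D M.m_assoc\<close>)
    have 2: "?m (?m (\<delta> a) y) z = ?m (\<delta> a) (?m y z)"
      if "a \<in> carrier M" "y \<in> carrier ?F" "z \<in> carrier ?F" for a y z
      by (rule lin_eqI[OF vF vF sF lin_comp[OF R L] lin_comp[OF L R] _ that(2)])
        (use that 1 in auto)
    have 3: "?m (?m x y) z = ?m x (?m y z)"
      if "x \<in> carrier ?F" "y \<in> carrier ?F" "z \<in> carrier ?F" for x y z
      by (rule lin_eqI[OF vF vF sF lin_comp[OF L L] L _ that(1)])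
        (use that 2 c in auto)
    show "(x \<otimes>\<^bsub>?A\<^esub> y) \<otimes>\<^bsub>?A\<^esub> z = x \<otimes>\<^bsub>?A\<^esub> (y \<otimes>\<^bsub>?A\<^esub> z)"
      if "x \<in> carrier ?A" "y \<in> carrier ?A" "z \<in> carrier ?A" for x y z
      using 3 that by simp
  qed
qed

lemma lin_monoid_alg: "lin (monoid_alg M) W = lin (free_vs (carrier M)) W"
  by (simp add: lin_def fun_eq_iff)

lemma spans_monoid_alg: "spans (monoid_alg M) (\<delta> ` carrier M)"
  using spans_free[of "carrier M"] by (simp add: spans_def subsp_def)

section \<open>The algebra given by generators and relations\<close>

definition word_monoid :: "('g, 'm) monoid_scheme \<Rightarrow> 'g letter list monoid" where
  "word_monoid G = \<lparr>carrier = lists (insert Xgen (Grp ` carrier G)), mult = (@), one = []\<rparr>"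

lemma A3_free_eq: "A3_free G = monoid_alg (word_monoid G)"
  by (simp add: A3_free_def word_monoid_def)

lemma word_monoid: "monoid (word_monoid G)"
  by (rule monoidI) (auto simp: word_monoid_def)

locale third_type = G: group G for G :: "('g, 'm) monoid_scheme" +
  fixes g :: 'g and f :: "'g \<Rightarrow> 'k::field"
  assumes datum: "third_type_datum G g f" and prime_char: "prime CHAR('k)"
begin

sublocale prime_char "TYPE('k)" by unfold_locales (rule prime_char)

lemma g_closed [simp]: "g \<in> carrier G"
  and g_central: "t \<in> carrier G \<Longrightarrow> g \<otimes>\<^bsub>G\<^esub> t = t \<otimes>\<^bsub>G\<^esub> g"
  and f_mult: "s \<in> carrier G \<Longrightarrow> t \<in> carrier G \<Longrightarrow> f (s \<otimes>\<^bsub>G\<^esub> t) = f s + f t"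
  and f_g [simp]: "f g = 1"
  and f_k_sub: "t \<in> carrier G \<Longrightarrow> f t \<in> k_sub G g"
  and finite_G: "finite (carrier G)"
  using datum by (auto simp: third_type_datum_def)

lemma f_one [simp]: "f \<one>\<^bsub>G\<^esub> = 0"
  using f_mult[of "\<one>\<^bsub>G\<^esub>" "\<one>\<^bsub>G\<^esub>"] by (metis G.one_closed G.r_one add_cancel_right_right)

lemma f_inv: "t \<in> carrier G \<Longrightarrow> f (inv\<^bsub>G\<^esub> t) = - f t"
  using f_mult[of "inv\<^bsub>G\<^esub> t" t] by (simp add: eq_neg_iff_add_eq_0)

lemma g_ne_one: "g \<noteq> \<one>\<^bsub>G\<^esub>"
  using f_one f_g by force

abbreviation "Fr \<equiv> A3_free G :: ('k, 'g letter list \<Rightarrow>\<^sub>0 'k) module"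
abbreviation "words \<equiv> lists (insert Xgen (Grp ` carrier G))"
abbreviation "B \<equiv> A3_alg G g f"
abbreviation "\<tau> t \<equiv> A3_gen G g f (Grp t)"
abbreviation "X \<equiv> A3_gen G g f Xgen"

sublocale Fr: kalg Fr
  unfolding A3_free_eq by (rule kalg_monoid_alg[OF word_monoid])

lemma Fr_simps:
  "carrier Fr = {r. Poly_Mapping.keys r \<subseteq> words}" "\<zero>\<^bsub>Fr\<^esub> = 0" "r \<oplus>\<^bsub>Fr\<^esub> s = r + s"
  "\<one>\<^bsub>Fr\<^esub> = \<delta> []" "\<delta> u \<otimes>\<^bsub>Fr\<^esub> \<delta> v = \<delta> (u @ v)"
  unfolding A3_free_eq by (simp_all add: monoid_alg_delta_mult) (simp_all add: word_monoid_def)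

lemma delta_word: "w \<in> words \<Longrightarrow> \<delta> w \<in> carrier Fr"
  by (simp add: Fr_simps)

lemma Fr_minus: "r \<in> carrier Fr \<Longrightarrow> s \<in> carrier Fr \<Longrightarrow> r - s = r \<ominus>\<^bsub>Fr\<^esub> s"
proof -
  assume rs: "r \<in> carrier Fr" "s \<in> carrier Fr"
  have "- s \<in> carrier Fr" using rs by (simp add: Fr_simps)
  moreover have "- s \<oplus>\<^bsub>Fr\<^esub> s = \<zero>\<^bsub>Fr\<^esub>" by (simp add: Fr_simps)
  ultimately have "\<ominus>\<^bsub>Fr\<^esub> s = - s" using Fr.minus_equality rs by blast
  then show ?thesis by (simp add: a_minus_def Fr_simps)
qed

lemma spans_Fr: "spans Fr (\<delta> ` words)"
  using spans_monoid_alg[of "word_monoid G"] by (simp add: A3_free_eq word_monoid_def)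

abbreviation "gens t \<equiv> \<delta> [Grp t] :: 'g letter list \<Rightarrow>\<^sub>0 'k"
abbreviation "genx \<equiv> \<delta> [Xgen] :: 'g letter list \<Rightarrow>\<^sub>0 'k"

lemma gens_closed [simp]: "t \<in> carrier G \<Longrightarrow> gens t \<in> carrier Fr" "genx \<in> carrier Fr"
  by (simp_all add: Fr_simps)

lemma A3_rels_eq: "A3_rels G g f =
     {gens \<one>\<^bsub>G\<^esub> \<ominus>\<^bsub>Fr\<^esub> \<one>\<^bsub>Fr\<^esub>}
   \<union> {gens s \<otimes>\<^bsub>Fr\<^esub> gens t \<ominus>\<^bsub>Fr\<^esub> gens (s \<otimes>\<^bsub>G\<^esub> t) | s t. s \<in> carrier G \<and> t \<in> carrier G}
   \<union> {(gens t \<otimes>\<^bsub>Fr\<^esub> genx \<ominus>\<^bsub>Fr\<^esub> genx \<otimes>\<^bsub>Fr\<^esub> gens t) \<ominus>\<^bsub>Fr\<^esub> f t \<odot>\<^bsub>Fr\<^esub> (gens t \<otimes>\<^bsub>Fr\<^esub> (\<one>\<^bsub>Fr\<^esub> \<ominus>\<^bsub>Fr\<^esub> gens g)) | t. t \<in> carrier G}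
   \<union> {genx [^]\<^bsub>Fr\<^esub> CHAR('k) \<ominus>\<^bsub>Fr\<^esub> genx}"
proof -
  have "A3_rels G g f =
     {gens \<one>\<^bsub>G\<^esub> - \<one>\<^bsub>Fr\<^esub>}
   \<union> {gens s \<otimes>\<^bsub>Fr\<^esub> gens t - gens (s \<otimes>\<^bsub>G\<^esub> t) | s t. s \<in> carrier G \<and> t \<in> carrier G}
   \<union> {(gens t \<otimes>\<^bsub>Fr\<^esub> genx - genx \<otimes>\<^bsub>Fr\<^esub> gens t) - f t \<odot>\<^bsub>Fr\<^esub> (gens t \<otimes>\<^bsub>Fr\<^esub> (\<one>\<^bsub>Fr\<^esub> - gens g)) | t. t \<in> carrier G}
   \<union> {genx [^]\<^bsub>Fr\<^esub> CHAR('k) - genx}"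
    by (simp only: A3_rels_def Let_def)
  also have "{gens s \<otimes>\<^bsub>Fr\<^esub> gens t - gens (s \<otimes>\<^bsub>G\<^esub> t) | s t. s \<in> carrier G \<and> t \<in> carrier G} =
     {gens s \<otimes>\<^bsub>Fr\<^esub> gens t \<ominus>\<^bsub>Fr\<^esub> gens (s \<otimes>\<^bsub>G\<^esub> t) | s t. s \<in> carrier G \<and> t \<in> carrier G}"
    by (intro Collect_cong ex_cong1) (auto simp: Fr_minus)
  also have "{(gens t \<otimes>\<^bsub>Fr\<^esub> genx - genx \<otimes>\<^bsub>Fr\<^esub> gens t) - f t \<odot>\<^bsub>Fr\<^esub> (gens t \<otimes>\<^bsub>Fr\<^esub> (\<one>\<^bsub>Fr\<^esub> - gens g)) | t. t \<in> carrier G} =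
     {(gens t \<otimes>\<^bsub>Fr\<^esub> genx \<ominus>\<^bsub>Fr\<^esub> genx \<otimes>\<^bsub>Fr\<^esub> gens t) \<ominus>\<^bsub>Fr\<^esub> f t \<odot>\<^bsub>Fr\<^esub> (gens t \<otimes>\<^bsub>Fr\<^esub> (\<one>\<^bsub>Fr\<^esub> \<ominus>\<^bsub>Fr\<^esub> gens g)) | t. t \<in> carrier G}"
    by (intro Collect_cong ex_cong1) (auto simp: Fr_minus simp del: Fr.nat_pow_Suc)
  finally show ?thesis
    by (simp only: Fr_minus Fr.one_closed gens_closed Fr.nat_pow_closed G.one_closed)
qed

lemma A3_rels_closed: "A3_rels G g f \<subseteq> carrier Fr"
  unfolding A3_rels_eq by (auto intro!: Fr.minus_closed)

lemma ideal_A3: "ideal (A3_ideal G g f) Fr"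
  unfolding A3_ideal_def by (rule Fr.genideal_ideal[OF A3_rels_closed])

lemma kalg_B: "kalg B"
  unfolding A3_alg_def by (rule kalg_quot(1)[OF Fr.kalg_axioms ideal_A3])

sublocale B: kalg B by (rule kalg_B)

abbreviation "cls r \<equiv> A3_ideal G g f +>\<^bsub>Fr\<^esub> r"

sublocale I: vs_subsp Fr "A3_ideal G g f"
  by (rule vs_subsp.intro[OF Fr.vs_axioms], unfold_locales, rule ideal_subsp[OF Fr.kalg_axioms ideal_A3])

lemma alg_hom_cls: "alg_hom Fr B cls"
  unfolding A3_alg_def by (rule kalg_quot(2)[OF Fr.kalg_axioms ideal_A3])

lemma gen_closed [simp]: "t \<in> carrier G \<Longrightarrow> \<tau> t \<in> carrier B" "X \<in> carrier B"
  by (simp_all add: A3_gen_def alg_hom_closed[OF alg_hom_cls])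

lemma cls_rel: "r \<ominus>\<^bsub>Fr\<^esub> s \<in> A3_rels G g f \<Longrightarrow> r \<in> carrier Fr \<Longrightarrow> s \<in> carrier Fr \<Longrightarrow> cls r = cls s"
  using Fr.genideal_self[OF A3_rels_closed] by (subst I.cls_eq_iff) (auto simp: A3_ideal_def)

definition word :: "'g letter list \<Rightarrow> ('g letter list \<Rightarrow>\<^sub>0 'k) set" where
  "word w = foldr (\<lambda>l b. A3_gen G g f l \<otimes>\<^bsub>B\<^esub> b) w \<one>\<^bsub>B\<^esub>"

lemma cls_delta: "w \<in> words \<Longrightarrow> cls (\<delta> w) = word w"
proof (induction w)
  case Nil
  then show ?case using alg_hom_one[OF alg_hom_cls] by (simp add: word_def Fr_simps)
next
  case (Cons l w)
  have "\<delta> (l # w) = \<delta> [l] \<otimes>\<^bsub>Fr\<^esub> (\<delta> w :: _ \<Rightarrow>\<^sub>0 'k)" by (simp add: Fr_simps)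
  then show ?case
    using Cons alg_hom_mult[OF alg_hom_cls, of "\<delta> [l]" "\<delta> w"]
    by (simp add: word_def A3_gen_def Fr_simps)
qed

lemma spans_words: "spans B (word ` words)"
proof -
  have "spans B (cls ` (\<delta> ` words))"
    unfolding A3_alg_def by (rule I.spans_quot[OF spans_Fr])
  then show ?thesis by (simp add: image_image cls_delta cong: image_cong)
qed

text \<open>
  Words are built from the left, so a subspace that contains the unit and is stable under left
  multiplication by the generators is everything.
\<close>

lemma B_induct:
  assumes "subsp B N" "\<one>\<^bsub>B\<^esub> \<in> N" "\<And>t v. t \<in> carrier G \<Longrightarrow> v \<in> N \<Longrightarrow> \<tau> t \<otimes>\<^bsub>B\<^esub> v \<in> N"
    "\<And>v. v \<in> N \<Longrightarrow> X \<otimes>\<^bsub>B\<^esub> v \<in> N" "v \<in> carrier B"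
  shows "v \<in> N"
proof -
  have "word w \<in> N" if "w \<in> words" for w
    using that by (induction w) (auto simp: word_def assms)
  then show ?thesis using spans_words assms(1,5) unfolding spans_def by blast
qed

lemma alg_hom_eqI:
  assumes "kalg C" "alg_hom B C \<phi>" "alg_hom B C \<psi>" "\<And>t. t \<in> carrier G \<Longrightarrow> \<phi> (\<tau> t) = \<psi> (\<tau> t)"
    "\<phi> X = \<psi> X" "v \<in> carrier B"
  shows "\<phi> v = \<psi> v"
proof -
  interpret C: kalg C by fact
  have "v \<in> {v \<in> carrier B. \<phi> v = \<psi> v}"
    by (rule B_induct[OF subsp_eq_set[OF B.vs_axioms C.vs_axioms alg_hom_lin[OF assms(2)] alg_hom_lin[OF assms(3)]]])
      (use assms in \<open>auto simp: alg_hom_one[OF assms(2)] alg_hom_one[OF assms(3)]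
        alg_hom_mult[OF assms(2)] alg_hom_mult[OF assms(3)]\<close>)
  then show ?thesis by blast
qed

lemma tau_one: "\<tau> \<one>\<^bsub>G\<^esub> = \<one>\<^bsub>B\<^esub>"
proof -
  have "cls (gens \<one>\<^bsub>G\<^esub>) = cls \<one>\<^bsub>Fr\<^esub>" by (rule cls_rel) (auto simp: A3_rels_eq)
  then show ?thesis using alg_hom_one[OF alg_hom_cls] by (simp add: A3_gen_def)
qed

lemma tau_mult: "s \<in> carrier G \<Longrightarrow> t \<in> carrier G \<Longrightarrow> \<tau> s \<otimes>\<^bsub>B\<^esub> \<tau> t = \<tau> (s \<otimes>\<^bsub>G\<^esub> t)"
proof -
  assume st: "s \<in> carrier G" "t \<in> carrier G"
  have "cls (gens s \<otimes>\<^bsub>Fr\<^esub> gens t) = cls (gens (s \<otimes>\<^bsub>G\<^esub> t))"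
    by (rule cls_rel) (use st in \<open>auto simp: A3_rels_eq\<close>)
  then show ?thesis using alg_hom_mult[OF alg_hom_cls] st by (simp add: A3_gen_def)
qed

lemma cls_minus: "r \<in> carrier Fr \<Longrightarrow> s \<in> carrier Fr \<Longrightarrow> cls (r \<ominus>\<^bsub>Fr\<^esub> s) = cls r \<ominus>\<^bsub>B\<^esub> cls s"
  by (rule Fr.lin_minus[OF B.vs_axioms alg_hom_lin[OF alg_hom_cls]])

lemma tau_X_minus:
  assumes t: "t \<in> carrier G"
  shows "\<tau> t \<otimes>\<^bsub>B\<^esub> X \<ominus>\<^bsub>B\<^esub> X \<otimes>\<^bsub>B\<^esub> \<tau> t = f t \<odot>\<^bsub>B\<^esub> (\<tau> t \<otimes>\<^bsub>B\<^esub> (\<one>\<^bsub>B\<^esub> \<ominus>\<^bsub>B\<^esub> \<tau> g))"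
proof -
  have "cls (gens t \<otimes>\<^bsub>Fr\<^esub> genx \<ominus>\<^bsub>Fr\<^esub> genx \<otimes>\<^bsub>Fr\<^esub> gens t) = cls (f t \<odot>\<^bsub>Fr\<^esub> (gens t \<otimes>\<^bsub>Fr\<^esub> (\<one>\<^bsub>Fr\<^esub> \<ominus>\<^bsub>Fr\<^esub> gens g)))"
    by (rule cls_rel) (use t in \<open>auto simp: A3_rels_eq intro!: Fr.minus_closed\<close>)
  then show ?thesis
    using t by (simp add: cls_minus alg_hom_mult[OF alg_hom_cls] lin_smult[OF alg_hom_lin[OF alg_hom_cls]]
        alg_hom_one[OF alg_hom_cls] A3_gen_def Fr.minus_closed)
qed

lemma cls_pow: "r \<in> carrier Fr \<Longrightarrow> cls (r [^]\<^bsub>Fr\<^esub> (n::nat)) = cls r [^]\<^bsub>B\<^esub> n"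
  by (induction n) (simp_all add: alg_hom_mult[OF alg_hom_cls] alg_hom_one[OF alg_hom_cls])

lemma X_pow: "X [^]\<^bsub>B\<^esub> CHAR('k) = X"
proof -
  have "cls (genx [^]\<^bsub>Fr\<^esub> CHAR('k)) = cls genx" by (rule cls_rel) (auto simp: A3_rels_eq)
  then show ?thesis by (simp add: A3_gen_def cls_pow)
qed

end

text \<open>
  Elements \<open>\<phi> l\<close> of an algebra \<open>C\<close> that satisfy the defining relations. By the universal property
  they are the images of the generators under an algebra homomorphism.
\<close>

definition A3_rep :: "('g, 'm) monoid_scheme \<Rightarrow> 'g \<Rightarrow> ('g \<Rightarrow> 'k::field) \<Rightarrow>
    ('k, 'v, 'n) module_scheme \<Rightarrow> ('g letter \<Rightarrow> 'v) \<Rightarrow> bool" where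
  "A3_rep G g f C \<phi> \<longleftrightarrow>
     (\<forall>t\<in>carrier G. \<phi> (Grp t) \<in> carrier C) \<and> \<phi> Xgen \<in> carrier C \<and> \<phi> (Grp \<one>\<^bsub>G\<^esub>) = \<one>\<^bsub>C\<^esub> \<and>
     (\<forall>s\<in>carrier G. \<forall>t\<in>carrier G. \<phi> (Grp s) \<otimes>\<^bsub>C\<^esub> \<phi> (Grp t) = \<phi> (Grp (s \<otimes>\<^bsub>G\<^esub> t))) \<and>
     (\<forall>t\<in>carrier G. \<phi> (Grp t) \<otimes>\<^bsub>C\<^esub> \<phi> Xgen \<ominus>\<^bsub>C\<^esub> \<phi> Xgen \<otimes>\<^bsub>C\<^esub> \<phi> (Grp t) =
        f t \<odot>\<^bsub>C\<^esub> (\<phi> (Grp t) \<otimes>\<^bsub>C\<^esub> (\<one>\<^bsub>C\<^esub> \<ominus>\<^bsub>C\<^esub> \<phi> (Grp g)))) \<and>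
     \<phi> Xgen [^]\<^bsub>C\<^esub> CHAR('k) = \<phi> Xgen"

context third_type begin

context
  fixes C :: "('k, 'v, 'n) module_scheme" and \<phi>
  assumes kC: "kalg C" and rep: "A3_rep G g f C \<phi>"
begin

interpretation C: kalg C by (rule kC)

lemma rep_closed: "l \<in> insert Xgen (Grp ` carrier G) \<Longrightarrow> \<phi> l \<in> carrier C"
  using rep by (auto simp: A3_rep_def)

abbreviation "wv w \<equiv> foldr (\<lambda>l b. \<phi> l \<otimes>\<^bsub>C\<^esub> b) w \<one>\<^bsub>C\<^esub>"

lemma wv_closed: "w \<in> words \<Longrightarrow> wv w \<in> carrier C"
  by (induction w) (auto intro!: C.m_closed rep_closed)

lemma wv_append: "u \<in> words \<Longrightarrow> v \<in> words \<Longrightarrow> wv (u @ v) = wv u \<otimes>\<^bsub>C\<^esub> wv v"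
proof (induction u)
  case (Cons l u)
  then show ?case using rep_closed[of l] by (simp add: wv_closed C.m_assoc)
qed (simp add: wv_closed)

abbreviation "ev \<equiv> lin_ext C wv"

lemma lin_ev: "lin Fr C ev"
  unfolding A3_free_eq lin_monoid_alg
  by (rule lin_lin_ext[OF C.vs_axioms]) (rule wv_closed, simp add: word_monoid_def)

lemma ev_delta: "w \<in> words \<Longrightarrow> ev (\<delta> w) = wv w"
  using wv_closed by (simp only: lin_ext_delta[OF C.vs_axioms])

lemma alg_hom_ev: "alg_hom Fr C ev"
  unfolding alg_hom_def
proof (intro conjI ballI)
  show "ev \<one>\<^bsub>Fr\<^esub> = \<one>\<^bsub>C\<^esub>" by (simp add: Fr_simps ev_delta)
  have vC: "vs C" and vF: "vs Fr" by (rule C.vs_axioms, rule Fr.vs_axioms)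
  have 1: "ev (\<delta> u \<otimes>\<^bsub>Fr\<^esub> b) = wv u \<otimes>\<^bsub>C\<^esub> ev b" if u: "u \<in> words" and b: "b \<in> carrier Fr" for u b
  proof (rule lin_eqI[OF vF vC spans_Fr lin_comp[OF Fr.lin_mult_left lin_ev] lin_comp[OF lin_ev C.lin_mult_left] _ b])
    fix s :: "'g letter list \<Rightarrow>\<^sub>0 'k" assume "s \<in> \<delta> ` words"
    then obtain v where v: "s = \<delta> v" "v \<in> words" by blast
    have uv: "u @ v \<in> words" using u v by simp
    show "ev (\<delta> u \<otimes>\<^bsub>Fr\<^esub> s) = wv u \<otimes>\<^bsub>C\<^esub> ev s"
      unfolding v(1) Fr_simps(5) ev_delta[OF uv] ev_delta[OF v(2)] wv_append[OF u v(2)] ..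
  qed (use delta_word[OF u] wv_closed[OF u] in auto)
  show "ev (a \<otimes>\<^bsub>Fr\<^esub> b) = ev a \<otimes>\<^bsub>C\<^esub> ev b" if a: "a \<in> carrier Fr" and b: "b \<in> carrier Fr" for a b
  proof (rule lin_eqI[OF vF vC spans_Fr lin_comp[OF Fr.lin_mult_right lin_ev] lin_comp[OF lin_ev C.lin_mult_right] _ a])
    fix s :: "'g letter list \<Rightarrow>\<^sub>0 'k" assume "s \<in> \<delta> ` words"
    then obtain v where v: "s = \<delta> v" "v \<in> words" by blast
    show "ev (s \<otimes>\<^bsub>Fr\<^esub> b) = ev s \<otimes>\<^bsub>C\<^esub> ev b"
      unfolding v(1) ev_delta[OF v(2)] by (rule 1[OF v(2) b])
  qed (use b in \<open>auto simp: lin_closed[OF lin_ev]\<close>)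
qed (rule lin_ev)

lemma ev_pow: "r \<in> carrier Fr \<Longrightarrow> ev (r [^]\<^bsub>Fr\<^esub> (n::nat)) = ev r [^]\<^bsub>C\<^esub> n"
  by (induction n) (simp_all add: alg_hom_mult[OF alg_hom_ev] alg_hom_one[OF alg_hom_ev])

text \<open>
  The kernel of the evaluation of words is an ideal and contains the defining relations, hence the
  ideal they generate.
\<close>

lemma ev_ideal: "r \<in> A3_ideal G g f \<Longrightarrow> ev r = \<zero>\<^bsub>C\<^esub>"
proof -
  assume r: "r \<in> A3_ideal G g f"
  have rh: "ring_hom_ring Fr C ev"
    by (rule ring_hom_ringI2[OF Fr.ring_axioms C.ring_axioms]) (use alg_hom_ev alg_hom_iff in blast)
  have gs: "ev (gens t) = \<phi> (Grp t)" if "t \<in> carrier G" for t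
    using that rep by (subst ev_delta) (auto simp: A3_rep_def)
  have gx: "ev genx = \<phi> Xgen"
    using rep by (subst ev_delta) (auto simp: A3_rep_def)
  have mi: "ev (a \<ominus>\<^bsub>Fr\<^esub> b) = ev a \<ominus>\<^bsub>C\<^esub> ev b" if "a \<in> carrier Fr" "b \<in> carrier Fr" for a b
    by (rule Fr.lin_minus[OF C.vs_axioms lin_ev that])
  have z: "a \<ominus>\<^bsub>C\<^esub> a = \<zero>\<^bsub>C\<^esub>" if "a \<in> carrier C" for a
    using that by (simp add: a_minus_def C.r_neg)
  have rl: "\<phi> (Grp t) \<in> carrier C" "\<phi> (Grp s) \<otimes>\<^bsub>C\<^esub> \<phi> (Grp t) = \<phi> (Grp (s \<otimes>\<^bsub>G\<^esub> t))"
     "\<phi> (Grp t) \<otimes>\<^bsub>C\<^esub> \<phi> Xgen \<ominus>\<^bsub>C\<^esub> \<phi> Xgen \<otimes>\<^bsub>C\<^esub> \<phi> (Grp t) =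
        f t \<odot>\<^bsub>C\<^esub> (\<phi> (Grp t) \<otimes>\<^bsub>C\<^esub> (\<one>\<^bsub>C\<^esub> \<ominus>\<^bsub>C\<^esub> \<phi> (Grp g)))"
     if "t \<in> carrier G" "s \<in> carrier G" for s t
    using rep that by (auto simp: A3_rep_def)
  have rl': "\<phi> Xgen \<in> carrier C" "\<phi> (Grp \<one>\<^bsub>G\<^esub>) = \<one>\<^bsub>C\<^esub>" "\<phi> Xgen [^]\<^bsub>C\<^esub> CHAR('k) = \<phi> Xgen"
    using rep by (auto simp: A3_rep_def)
  have "A3_rels G g f \<subseteq> a_kernel Fr C ev"
  proof
    fix q assume q: "q \<in> A3_rels G g f"
    then have qc: "q \<in> carrier Fr" using A3_rels_closed by blast
    have "ev q = \<zero>\<^bsub>C\<^esub>"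
      using q unfolding A3_rels_eq
      by (auto simp: mi gs gx alg_hom_mult[OF alg_hom_ev] alg_hom_one[OF alg_hom_ev] ev_pow
          lin_smult[OF lin_ev] rl rl' Fr.minus_closed C.minus_closed intro!: z)
    then show "q \<in> a_kernel Fr C ev" using qc by (simp add: a_kernel_def')
  qed
  then have "A3_ideal G g f \<subseteq> a_kernel Fr C ev"
    unfolding A3_ideal_def by (rule Fr.genideal_minimal[OF ring_hom_ring.kernel_is_ideal[OF rh]])
  then show ?thesis using r by (auto simp: a_kernel_def')
qed

lemma alg_ext_cls: "r \<in> carrier Fr \<Longrightarrow> alg_ext C \<phi> (cls r) = ev r"
  unfolding alg_ext_def by (rule I.lift_cls[OF C.vs_axioms lin_ev ev_ideal])

lemma alg_hom_alg_ext: "alg_hom B C (alg_ext C \<phi>)"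
proof -
  have "lin B C (alg_ext C \<phi>)"
    using I.lin_lift[OF C.vs_axioms lin_ev ev_ideal] unfolding A3_alg_def alg_ext_def by simp
  moreover have "alg_ext C \<phi> \<one>\<^bsub>B\<^esub> = \<one>\<^bsub>C\<^esub>"
    using alg_ext_cls[of "\<one>\<^bsub>Fr\<^esub>"] alg_hom_one[OF alg_hom_cls] alg_hom_one[OF alg_hom_ev] by simp
  moreover have "alg_ext C \<phi> (a \<otimes>\<^bsub>B\<^esub> b) = alg_ext C \<phi> a \<otimes>\<^bsub>C\<^esub> alg_ext C \<phi> b"
    if "a \<in> carrier B" "b \<in> carrier B" for a b
  proof -
    have im: "carrier B = cls ` carrier Fr"
      unfolding A3_alg_def by (rule I.quot_carrier)
    have "\<exists>r. r \<in> carrier Fr \<and> a = cls r"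
      using that(1) unfolding im image_def mem_Collect_eq Bex_def .
    then obtain r where r: "r \<in> carrier Fr" "a = cls r" by (elim exE conjE)
    have "\<exists>s. s \<in> carrier Fr \<and> b = cls s"
      using that(2) unfolding im image_def mem_Collect_eq Bex_def .
    then obtain s where s: "s \<in> carrier Fr" "b = cls s" by (elim exE conjE)
    have "a \<otimes>\<^bsub>B\<^esub> b = cls (r \<otimes>\<^bsub>Fr\<^esub> s)"
      unfolding r(2) s(2) by (rule alg_hom_mult[OF alg_hom_cls r(1) s(1), symmetric])
    then have "alg_ext C \<phi> (a \<otimes>\<^bsub>B\<^esub> b) = ev (r \<otimes>\<^bsub>Fr\<^esub> s)"
      using alg_ext_cls[OF Fr.m_closed[OF r(1) s(1)]] by (simp only:)
    also have "\<dots> = ev r \<otimes>\<^bsub>C\<^esub> ev s" by (rule alg_hom_mult[OF alg_hom_ev r(1) s(1)])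
    finally show ?thesis
      unfolding r(2) s(2) alg_ext_cls[OF r(1)] alg_ext_cls[OF s(1)] .
  qed
  ultimately show ?thesis by (simp add: alg_hom_def)
qed

lemma alg_ext_gen: "t \<in> carrier G \<Longrightarrow> alg_ext C \<phi> (\<tau> t) = \<phi> (Grp t)" "alg_ext C \<phi> X = \<phi> Xgen"
  using rep_closed by (simp_all add: A3_gen_def alg_ext_cls ev_delta)

end

end

section \<open>Linear independence of the standard monomials\<close>

lemma subsp_Inter: "(\<And>N. N \<in> S \<Longrightarrow> subsp V N) \<Longrightarrow> S \<noteq> {} \<Longrightarrow> subsp V (\<Inter>S)"
  unfolding subsp_def by blast

text \<open>
  The endomorphism algebra of the space of functions on the type of group elements. The operators
  below act on these functions as on \<open>k[G]\<close>, where \<open>m\<close> stands for \<open>\<Sum> m(s) s\<close>.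
\<close>

definition endo :: "('k::field, ('g \<Rightarrow> 'k) \<Rightarrow> 'g \<Rightarrow> 'k) module" where
  "endo = \<lparr>carrier = {\<phi>. (\<forall>m n. \<phi> (\<lambda>s. m s + n s) = (\<lambda>s. \<phi> m s + \<phi> n s)) \<and>
        (\<forall>c m. \<phi> (\<lambda>s. c * m s) = (\<lambda>s. c * \<phi> m s))},
     mult = (\<lambda>a b m. a (b m)), one = (\<lambda>m. m), zero = (\<lambda>m s. 0), add = (\<lambda>a b m s. a m s + b m s),
     smult = (\<lambda>c a m s. c * a m s)\<rparr>"

lemma endo_simps:
  "carrier endo = {\<phi>. (\<forall>m n. \<phi> (\<lambda>s. m s + n s) = (\<lambda>s. \<phi> m s + \<phi> n s)) \<and>
        (\<forall>c m. \<phi> (\<lambda>s. c * m s) = (\<lambda>s. c * \<phi> m s))}"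
  "(a \<otimes>\<^bsub>endo\<^esub> b) m = a (b m)" "\<one>\<^bsub>endo\<^esub> m = m" "\<zero>\<^bsub>endo\<^esub> m s = 0" "(a \<oplus>\<^bsub>endo\<^esub> b) m s = a m s + b m s"
  "(c \<odot>\<^bsub>endo\<^esub> a) m s = c * a m s"
  by (simp_all add: endo_def)

lemma kalg_endo: "kalg (endo :: ('k::field, ('g \<Rightarrow> 'k) \<Rightarrow> 'g \<Rightarrow> 'k) module)"
proof -
  let ?E = "endo :: ('k, ('g \<Rightarrow> 'k) \<Rightarrow> 'g \<Rightarrow> 'k) module"
  have "abelian_group ?E"
  proof (rule abelian_groupI)
    fix a assume "a \<in> carrier ?E"
    then show "\<exists>b\<in>carrier ?E. b \<oplus>\<^bsub>?E\<^esub> a = \<zero>\<^bsub>?E\<^esub>"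
      by (intro bexI[of _ "\<lambda>m s. - a m s"]) (auto simp: endo_simps fun_eq_iff)
  qed (auto simp: endo_simps fun_eq_iff algebra_simps)
  then have "vs ?E"
    by (rule vs.intro, unfold_locales) (auto simp: endo_simps fun_eq_iff algebra_simps)
  then show ?thesis
    by (rule kalgI) (auto simp: endo_def bilinear_into_def)
qed

lemma endo_minus: 
  assumes "a \<in> carrier endo" "b \<in> carrier endo" shows "(a \<ominus>\<^bsub>endo\<^esub> b) m s = a m s - b m s"
proof -
  interpret kalg endo by (rule kalg_endo)
  have "a \<ominus>\<^bsub>endo\<^esub> b = a \<oplus>\<^bsub>endo\<^esub> (-1) \<odot>\<^bsub>endo\<^esub> b"
    using assms by (simp add: a_minus_def smult_minus_one)
  then show ?thesis by (simp add: endo_simps)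
qed

text \<open>
  If \<open>g^p \<noteq> 1\<close> then \<open>1\<close> and \<open>g^p\<close> are different basis elements of \<open>k[G]\<close>.
\<close>

lemma k_sub_iff:
  fixes g (structure)
  assumes "group G" "g \<in> carrier G"
  shows "(a :: 'k::field) \<in> k_sub G g \<longleftrightarrow> a ^ CHAR('k) = a \<or> g [^]\<^bsub>G\<^esub> CHAR('k) = \<one>\<^bsub>G\<^esub>"
proof -
  have "a \<in> k_sub G g \<longleftrightarrow> Poly_Mapping.map ((*) (a ^ CHAR('k) - a)) (\<delta> \<one>\<^bsub>G\<^esub> - \<delta> (g [^]\<^bsub>G\<^esub> CHAR('k))) = 0"
    by (simp add: k_sub_def)
  also have "\<dots> \<longleftrightarrow> a ^ CHAR('k) = a \<or> g [^]\<^bsub>G\<^esub> CHAR('k) = \<one>\<^bsub>G\<^esub>"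
    (is "?z = 0 \<longleftrightarrow> _")
  proof
    assume "?z = 0"
    then have "Poly_Mapping.lookup ?z \<one>\<^bsub>G\<^esub> = 0" by simp
    then show "a ^ CHAR('k) = a \<or> g [^]\<^bsub>G\<^esub> CHAR('k) = \<one>\<^bsub>G\<^esub>"
      by (simp add: lookup_minus lookup_single when_def split: if_splits)
  qed (auto intro!: poly_mapping_eqI simp: lookup_minus lookup_single)
  finally show ?thesis .
qed

context third_type begin

abbreviation "EE \<equiv> endo :: ('k, ('g \<Rightarrow> 'k) \<Rightarrow> 'g \<Rightarrow> 'k) module"

sublocale EE: kalg EE by (rule kalg_endo)

text \<open>
  Left multiplication by \<open>t\<close>. It is the identity on the values outside \<open>G\<close>, so that \<open>op_t 1\<close> is
  the identity operator.
\<close>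

definition op_t :: "'g \<Rightarrow> ('g \<Rightarrow> 'k) \<Rightarrow> 'g \<Rightarrow> 'k" where
  "op_t t m s = (if s \<in> carrier G then m (inv\<^bsub>G\<^esub> t \<otimes>\<^bsub>G\<^esub> s) else m s)"

text \<open>
  Right multiplication by \<open>g\<close>. Outside \<open>G\<close> the value is \<open>0\<close> and not \<open>m s\<close>: then \<open>u = 1 - op_r\<close> is
  the identity there, and the relation \<open>[op_f, u] = u - 1\<close> needed below also holds at such points,
  where \<open>op_f\<close> vanishes.
\<close>

definition op_r :: "('g \<Rightarrow> 'k) \<Rightarrow> 'g \<Rightarrow> 'k" where
  "op_r m s = (if s \<in> carrier G then m (s \<otimes>\<^bsub>G\<^esub> inv\<^bsub>G\<^esub> g) else 0)"

definition op_f :: "('g \<Rightarrow> 'k) \<Rightarrow> 'g \<Rightarrow> 'k" where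
  "op_f m s = (if s \<in> carrier G then f s * m s else 0)"

text \<open>
  The derivation \<open>s \<mapsto> f(s) s (g - 1)\<close> of \<open>k[G]\<close>. It satisfies \<open>t D - D t = f(t) t (1 - g)\<close>.
\<close>

definition op_d :: "('g \<Rightarrow> 'k) \<Rightarrow> 'g \<Rightarrow> 'k" where
  "op_d m s = (if s \<in> carrier G then f (s \<otimes>\<^bsub>G\<^esub> inv\<^bsub>G\<^esub> g) * m (s \<otimes>\<^bsub>G\<^esub> inv\<^bsub>G\<^esub> g) - f s * m s else 0)"

definition op_x :: "'k \<Rightarrow> ('g \<Rightarrow> 'k) \<Rightarrow> 'g \<Rightarrow> 'k" where
  "op_x c m s = c * m s + op_d m s"

lemma op_closed [simp]:
  "op_t t \<in> carrier EE" "op_r \<in> carrier EE" "op_f \<in> carrier EE" "op_d \<in> carrier EE" "op_x c \<in> carrier EE"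
  by (auto simp: endo_simps op_t_def op_r_def op_f_def op_d_def op_x_def fun_eq_iff algebra_simps)

lemma f_div_g: "s \<in> carrier G \<Longrightarrow> f (s \<otimes>\<^bsub>G\<^esub> inv\<^bsub>G\<^esub> g) = f s - 1"
  by (simp add: f_mult f_inv)

lemma op_r_pow: "(op_r [^]\<^bsub>EE\<^esub> (n::nat)) m s =
    (if s \<in> carrier G then m (s \<otimes>\<^bsub>G\<^esub> inv\<^bsub>G\<^esub> (g [^]\<^bsub>G\<^esub> n)) else if n = 0 then m s else 0)"
proof (induction n arbitrary: m s)
  case (Suc n)
  have *: "s \<otimes>\<^bsub>G\<^esub> inv\<^bsub>G\<^esub> (g [^]\<^bsub>G\<^esub> n) \<otimes>\<^bsub>G\<^esub> inv\<^bsub>G\<^esub> g = s \<otimes>\<^bsub>G\<^esub> inv\<^bsub>G\<^esub> (g [^]\<^bsub>G\<^esub> Suc n)"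
    if "s \<in> carrier G"
    using that by (simp only: G.nat_pow_Suc2[OF g_closed]) (simp add: G.inv_mult_group G.m_assoc)
  have A: "(op_r [^]\<^bsub>EE\<^esub> Suc n) m s = (op_r [^]\<^bsub>EE\<^esub> n) (op_r m) s"
    by (simp add: endo_simps(2))
  show ?case unfolding A Suc.IH using * by (auto simp: op_r_def simp del: G.nat_pow_Suc)
qed (simp add: endo_simps)

lemma op_f_pow: "(op_f [^]\<^bsub>EE\<^esub> (n::nat)) m s = (if s \<in> carrier G then f s ^ n * m s else if n = 0 then m s else 0)"
proof (induction n arbitrary: m s)
  case (Suc n)
  have A: "(op_f [^]\<^bsub>EE\<^esub> Suc n) m s = (op_f [^]\<^bsub>EE\<^esub> n) (op_f m) s"
    by (simp add: endo_simps(2))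
  show ?case unfolding A Suc.IH by (auto simp: op_f_def)
qed (simp add: endo_simps)

text \<open>
  With \<open>u = 1 - op_r\<close> one has \<open>D = - u op_f\<close>, so \<open>D^p - D\<close> equals \<open>- u^p (op_f^p - op_f)\<close>. Here
  \<open>u^p = 1 - op_r^p\<close> is \<open>1\<close> minus right multiplication by \<open>g^p\<close>, and \<open>op_f^p - op_f\<close> multiplies by
  \<open>f^p - f\<close>; by the condition \<open>(f(t)^p - f(t)) (1 - g^p) = 0\<close> one of the two operators is zero on
  \<open>k[G]\<close>.
\<close>

lemma op_d_artin: "pev EE op_d artin = \<zero>\<^bsub>EE\<^esub>"
proof -
  define u where "u = pev EE op_r [:1, - 1:]"
  have uc [simp]: "u \<in> carrier EE" by (simp add: u_def)
  have u: "u m s = m s - op_r m s" for m s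
  proof -
    have "u = \<one>\<^bsub>EE\<^esub> \<oplus>\<^bsub>EE\<^esub> (-1) \<odot>\<^bsub>EE\<^esub> op_r"
      by (simp add: u_def EE.pev_pCons EE.smult_mult_right)
    then show ?thesis by (simp add: endo_simps)
  qed
  have rel: "op_f \<otimes>\<^bsub>EE\<^esub> u \<oplus>\<^bsub>EE\<^esub> \<one>\<^bsub>EE\<^esub> = u \<otimes>\<^bsub>EE\<^esub> op_f \<oplus>\<^bsub>EE\<^esub> u"
    by (intro ext) (auto simp: endo_simps(2-) u op_f_def op_r_def f_div_g algebra_simps)
  have d: "op_d = pev EE (u \<otimes>\<^bsub>EE\<^esub> op_f) [:0, -1:]"
  proof -
    have "pev EE (u \<otimes>\<^bsub>EE\<^esub> op_f) [:0, -1:] = (-1) \<odot>\<^bsub>EE\<^esub> (u \<otimes>\<^bsub>EE\<^esub> op_f)"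
      by (simp add: EE.pev_pCons EE.smult_mult_right)
    moreover have "op_d = \<dots>"
      by (intro ext) (auto simp: endo_simps(2-) u op_d_def op_f_def op_r_def)
    ultimately show ?thesis by simp
  qed
  have "pev EE op_d artin = pev EE (u \<otimes>\<^bsub>EE\<^esub> op_f) (pcompose artin [:0, -1:])"
    unfolding d by (rule EE.pev_pcompose[symmetric]) simp
  also have "\<dots> = \<ominus>\<^bsub>EE\<^esub> pev EE (u \<otimes>\<^bsub>EE\<^esub> op_f) (rfac CHAR('k))"
    unfolding pcompose_artin_neg rfac_p by (rule EE.pev_uminus) simp
  also have "\<dots> = \<ominus>\<^bsub>EE\<^esub> (u [^]\<^bsub>EE\<^esub> CHAR('k) \<otimes>\<^bsub>EE\<^esub> pev EE op_f artin)"
    by (subst EE.pev_rfac_twisted[OF _ _ rel]) (simp_all add: rfac_p)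
  also have "u [^]\<^bsub>EE\<^esub> CHAR('k) \<otimes>\<^bsub>EE\<^esub> pev EE op_f artin = \<zero>\<^bsub>EE\<^esub>"
  proof (intro ext)
    fix m s
    have 1: "u [^]\<^bsub>EE\<^esub> CHAR('k) = pev EE op_r (1 - monom 1 CHAR('k))"
      unfolding u_def by (simp add: EE.pev_power flip: one_minus_X_power)
    have "\<dots> = \<one>\<^bsub>EE\<^esub> \<oplus>\<^bsub>EE\<^esub> (-1) \<odot>\<^bsub>EE\<^esub> (op_r [^]\<^bsub>EE\<^esub> CHAR('k))"
      using EE.pev_add[of op_r 1 "- monom 1 CHAR('k)"] EE.pev_uminus[of op_r "monom 1 CHAR('k)"]
      by (simp add: EE.pev_monom EE.smult_minus_one)
    then have up: "(u [^]\<^bsub>EE\<^esub> CHAR('k)) m s = m s - (op_r [^]\<^bsub>EE\<^esub> CHAR('k)) m s" for m s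
      unfolding 1 by (simp add: endo_simps)
    have "pev EE op_f artin = (op_f [^]\<^bsub>EE\<^esub> CHAR('k)) \<oplus>\<^bsub>EE\<^esub> (-1) \<odot>\<^bsub>EE\<^esub> op_f"
      using EE.pev_add[of op_f "monom 1 CHAR('k)" "- [:0, 1:]"] EE.pev_uminus[of op_f "[:0, 1:]"]
      by (simp add: artin_def EE.pev_monom EE.smult_minus_one del: minus_pCons)
    then have fp: "pev EE op_f artin m s = (op_f [^]\<^bsub>EE\<^esub> CHAR('k)) m s - op_f m s" for m s
      by (simp add: endo_simps)
    have p0: "CHAR('k) \<noteq> 0" using p_gt_1 by simp
    have k: "f t ^ CHAR('k) = f t \<or> g [^]\<^bsub>G\<^esub> CHAR('k) = \<one>\<^bsub>G\<^esub>" if "t \<in> carrier G" for t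
      using f_k_sub[OF that] k_sub_iff[OF G.group_axioms g_closed] by blast
    show "(u [^]\<^bsub>EE\<^esub> CHAR('k) \<otimes>\<^bsub>EE\<^esub> pev EE op_f artin) m s = \<zero>\<^bsub>EE\<^esub> m s"
    proof (cases "g [^]\<^bsub>G\<^esub> CHAR('k) = \<one>\<^bsub>G\<^esub>")
      case True
      then show ?thesis
        using p0 by (auto simp: endo_simps(2,4) up fp op_r_pow op_f_pow op_f_def)
    next
      case False
      then have "pev EE op_f artin m = (\<lambda>s. 0)"
        using k p0 by (auto simp: fp op_f_pow op_f_def fun_eq_iff)
      then show ?thesis
        using p0 by (simp add: endo_simps(2,4) up op_r_pow)
    qed
  qed
  finally show ?thesis by simp
qed

lemma op_x_pow:
  assumes "c ^ CHAR('k) = c" shows "op_x c [^]\<^bsub>EE\<^esub> CHAR('k) = op_x c"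
proof -
  have e: "op_x c = pev EE op_d [:c, 1:]"
    by (intro ext) (simp add: EE.pev_linear op_x_def endo_simps(2-))
  have "pev EE (op_x c) artin = pev EE op_d (artin + [:c ^ CHAR('k) - c:])"
    unfolding e pcompose_artin_shift[symmetric] by (rule EE.pev_pcompose[symmetric]) simp
  also have "\<dots> = \<zero>\<^bsub>EE\<^esub>" using assms by (simp add: op_d_artin)
  finally show ?thesis using EE.pev_artin[of "op_x c"] by simp
qed

text \<open>
  \<open>x\<close> acts by \<open>D + n\<close>. The relations tolerate the shift by a scalar, and \<open>x^p = x\<close> survives it
  since \<open>n^p = n\<close> in the field.
\<close>

definition op :: "nat \<Rightarrow> 'g letter \<Rightarrow> ('g \<Rightarrow> 'k) \<Rightarrow> 'g \<Rightarrow> 'k" where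
  "op n l = (case l of Grp t \<Rightarrow> op_t t | Xgen \<Rightarrow> op_x (of_nat n))"

lemma A3_rep_op: "A3_rep G g f EE (op n)"
  unfolding A3_rep_def
proof (intro conjI ballI)
  have cancel: "inv\<^bsub>G\<^esub> t \<otimes>\<^bsub>G\<^esub> (inv\<^bsub>G\<^esub> s \<otimes>\<^bsub>G\<^esub> r) = inv\<^bsub>G\<^esub> (s \<otimes>\<^bsub>G\<^esub> t) \<otimes>\<^bsub>G\<^esub> r"
    if "s \<in> carrier G" "t \<in> carrier G" "r \<in> carrier G" for s t r
    using that by (simp add: G.inv_mult_group G.m_assoc)
  show "op n (Grp \<one>\<^bsub>G\<^esub>) = \<one>\<^bsub>EE\<^esub>"
    by (intro ext) (simp add: op_def op_t_def endo_simps)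
  fix t assume t: "t \<in> carrier G"
  show "op n (Grp s) \<otimes>\<^bsub>EE\<^esub> op n (Grp t) = op n (Grp (s \<otimes>\<^bsub>G\<^esub> t))" if "s \<in> carrier G" for s
    using that t by (intro ext) (auto simp: op_def op_t_def endo_simps cancel)
  have gi: "inv\<^bsub>G\<^esub> g \<otimes>\<^bsub>G\<^esub> r = r \<otimes>\<^bsub>G\<^esub> inv\<^bsub>G\<^esub> g" if "r \<in> carrier G" for r
    using that g_central[of "inv\<^bsub>G\<^esub> r"] G.inv_mult_group[of g "inv\<^bsub>G\<^esub> r"] G.inv_mult_group[of "inv\<^bsub>G\<^esub> r" g]
    by simp
  show "op n (Grp t) \<otimes>\<^bsub>EE\<^esub> op n Xgen \<ominus>\<^bsub>EE\<^esub> op n Xgen \<otimes>\<^bsub>EE\<^esub> op n (Grp t) =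
     f t \<odot>\<^bsub>EE\<^esub> (op n (Grp t) \<otimes>\<^bsub>EE\<^esub> (\<one>\<^bsub>EE\<^esub> \<ominus>\<^bsub>EE\<^esub> op n (Grp g)))"
  proof (intro ext)
    fix m s
    have l: "(op n (Grp t) \<otimes>\<^bsub>EE\<^esub> op n Xgen \<ominus>\<^bsub>EE\<^esub> op n Xgen \<otimes>\<^bsub>EE\<^esub> op n (Grp t)) m s =
      op_t t (op_x (of_nat n) m) s - op_x (of_nat n) (op_t t m) s"
      by (subst endo_minus) (auto simp: op_def endo_simps(2))
    have g1: "\<one>\<^bsub>EE\<^esub> \<ominus>\<^bsub>EE\<^esub> op n (Grp g) = (\<lambda>m s. m s - op_t g m s)"
      by (intro ext, subst endo_minus) (auto simp: op_def endo_simps(3))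
    have r: "(f t \<odot>\<^bsub>EE\<^esub> (op n (Grp t) \<otimes>\<^bsub>EE\<^esub> (\<one>\<^bsub>EE\<^esub> \<ominus>\<^bsub>EE\<^esub> op n (Grp g)))) m s =
       f t * op_t t (\<lambda>s. m s - op_t g m s) s"
      unfolding g1 by (simp add: op_def endo_simps(2,6))
    show "(op n (Grp t) \<otimes>\<^bsub>EE\<^esub> op n Xgen \<ominus>\<^bsub>EE\<^esub> op n Xgen \<otimes>\<^bsub>EE\<^esub> op n (Grp t)) m s =
      (f t \<odot>\<^bsub>EE\<^esub> (op n (Grp t) \<otimes>\<^bsub>EE\<^esub> (\<one>\<^bsub>EE\<^esub> \<ominus>\<^bsub>EE\<^esub> op n (Grp g)))) m s"
      unfolding l r using t
      by (auto simp: op_t_def op_x_def op_d_def f_mult f_inv gi G.m_assoc algebra_simps)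
  qed
qed (use op_x_pow of_nat_power_p in \<open>auto simp: op_def\<close>)

text \<open>
  \<open>D\<close> kills the unit of \<open>k[G]\<close>, so \<open>x\<close> acts on it by the scalar \<open>n\<close>, and an element \<open>\<Sum> t q_t(x)\<close>
  sends it to \<open>\<Sum> q_t(n) t\<close>. The functional thus reads off the value at \<open>n\<close> of the polynomial \<open>q_t\<close>
  next to \<open>t\<close>.
\<close>

definition pval :: "'g \<Rightarrow> nat \<Rightarrow> ('g letter list \<Rightarrow>\<^sub>0 'k) set \<Rightarrow> 'k" where
  "pval t n u = alg_ext EE (op n) u (\<lambda>s. if s = \<one>\<^bsub>G\<^esub> then 1 else 0) t"

lemma lin_pval: "lin B ground (pval t n)"
  using alg_hom_lin[OF alg_hom_alg_ext[OF kalg_endo A3_rep_op[of n]]]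
  by (simp add: lin_def pval_def endo_simps(5,6))

lemma pev_op_x: "pev EE (op_x c) q (\<lambda>s. if s = \<one>\<^bsub>G\<^esub> then 1 else 0) = (\<lambda>s. poly q c * (if s = \<one>\<^bsub>G\<^esub> then 1 else 0))"
proof (induction q)
  case (pCons a q)
  let ?e = "\<lambda>s. if s = \<one>\<^bsub>G\<^esub> then 1 else 0 :: 'k"
  have "s \<otimes>\<^bsub>G\<^esub> inv\<^bsub>G\<^esub> g = \<one>\<^bsub>G\<^esub> \<longleftrightarrow> s = g" if "s \<in> carrier G" for s
    using that G.inv_equality[of s "inv\<^bsub>G\<^esub> g"] by auto
  then have "op_x c ?e = (\<lambda>s. c * ?e s)"
    by (auto simp: op_x_def op_d_def fun_eq_iff)
  moreover have "op_x c (\<lambda>s. poly q c * ?e s) = (\<lambda>s. poly q c * op_x c ?e s)"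
    using op_closed(5)[of c] by (simp add: endo_simps)
  ultimately show ?case
    by (simp add: EE.pev_pCons endo_simps(2-) pCons fun_eq_iff algebra_simps)
qed (simp add: endo_simps fun_eq_iff)

lemma pval_basis:
  assumes "s \<in> carrier G" "t \<in> carrier G"
  shows "pval t n (\<tau> s \<otimes>\<^bsub>B\<^esub> pev B X q) = (if t = s then poly q (of_nat n) else 0)"
proof -
  note h = alg_hom_alg_ext[OF kalg_endo A3_rep_op[of n]]
  have "alg_ext EE (op n) (\<tau> s \<otimes>\<^bsub>B\<^esub> pev B X q) = op_t s \<otimes>\<^bsub>EE\<^esub> pev EE (op_x (of_nat n)) q"
    using assms by (simp add: alg_hom_mult[OF h] alg_hom_pev[OF kalg_B kalg_endo h]
      alg_ext_gen[OF kalg_endo A3_rep_op] op_def)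
  moreover have "inv\<^bsub>G\<^esub> s \<otimes>\<^bsub>G\<^esub> t = \<one>\<^bsub>G\<^esub> \<longleftrightarrow> t = s"
    using assms G.inv_equality[of "inv\<^bsub>G\<^esub> s" t] by auto
  ultimately show ?thesis
    using assms by (simp add: pval_def endo_simps(2) pev_op_x op_t_def)
qed

definition lagrange_basis :: "nat \<Rightarrow> 'k poly" where
  "lagrange_basis n = (let q = \<Prod>m\<in>{..<CHAR('k)} - {n}. [:- of_nat m, 1:] in Polynomial.smult (inverse (poly q (of_nat n))) q)"

lemma poly_lagrange_basis:
  assumes "n < CHAR('k)" "m < CHAR('k)" shows "poly (lagrange_basis n) (of_nat m) = (if m = n then 1 else 0)"
proof -
  have "poly (\<Prod>m\<in>{..<CHAR('k)} - {n}. [:- of_nat m, 1 :: 'k:]) (of_nat n) \<noteq> 0"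
    using assms(1) by (auto simp: poly_prod of_nat_eq_iff)
  then show ?thesis
    using assms by (auto simp: lagrange_basis_def Let_def poly_prod of_nat_eq_iff)
qed

lemma degree_lagrange_basis: "n < CHAR('k) \<Longrightarrow> degree (lagrange_basis n) < CHAR('k)"
proof -
  assume n: "n < CHAR('k)"
  have "degree (\<Prod>m\<in>{..<CHAR('k)} - {n}. [:- of_nat m, 1 :: 'k:]) = CHAR('k) - 1"
    using n by (simp add: degree_prod_sum_eq)
  then show ?thesis
    using degree_smult_le[of _ "\<Prod>m\<in>{..<CHAR('k)} - {n}. [:- of_nat m, 1 :: 'k:]"] n p_gt_1
    by (simp add: lagrange_basis_def Let_def)
qed

lemma lagrange_interpolation:
  assumes "degree q < CHAR('k)"
  shows "(\<Sum>n<CHAR('k). Polynomial.smult (poly q (of_nat n)) (lagrange_basis n)) = (q :: 'k poly)"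
proof (rule poly_eq_on_prime_field)
  have "degree (\<Sum>n<CHAR('k). Polynomial.smult (poly q (of_nat n)) (lagrange_basis n)) < CHAR('k)"
    using degree_lagrange_basis p_gt_1 by (intro degree_sum_less) (auto intro: le_less_trans[OF degree_smult_le])
  then show "degree ((\<Sum>n<CHAR('k). Polynomial.smult (poly q (of_nat n)) (lagrange_basis n)) - q) < CHAR('k)"
    using assms by (rule degree_diff_less)
  show "poly (\<Sum>n<CHAR('k). Polynomial.smult (poly q (of_nat n)) (lagrange_basis n)) (of_nat m) = poly q (of_nat m)"
    if "m < CHAR('k)" for m
    using that by (simp add: poly_sum poly_lagrange_basis if_distrib[of "(*) _"] cong: if_cong)
qed

text \<open>
  The polynomial next to \<open>t\<close> in the expansion \<open>u = \<Sum> t q_t(x)\<close>: as its degree is below \<open>p\<close>, it is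
  the Lagrange interpolation of its values at \<open>0, \<dots>, p - 1\<close>.
\<close>

definition pcoord :: "'g \<Rightarrow> ('g letter list \<Rightarrow>\<^sub>0 'k) set \<Rightarrow> 'k poly" where
  "pcoord t u = (\<Sum>n<CHAR('k). Polynomial.smult (pval t n u) (lagrange_basis n))"

lemma degree_pcoord: "degree (pcoord t u) < CHAR('k)"
  unfolding pcoord_def
  using degree_lagrange_basis p_gt_1 by (intro degree_sum_less) (auto intro: le_less_trans[OF degree_smult_le])

lemma pcoord_add: "u \<in> carrier B \<Longrightarrow> v \<in> carrier B \<Longrightarrow> pcoord t (u \<oplus>\<^bsub>B\<^esub> v) = pcoord t u + pcoord t v"
  by (simp add: pcoord_def lin_add[OF lin_pval] smult_add_left sum.distrib)

lemma smult_sum': "Polynomial.smult c (\<Sum>n\<in>S. q n) = (\<Sum>n\<in>S. Polynomial.smult c (q n :: 'k poly))"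
  by (induction S rule: infinite_finite_induct) (simp_all add: smult_add_right)

lemma pcoord_smult: "u \<in> carrier B \<Longrightarrow> pcoord t (c \<odot>\<^bsub>B\<^esub> u) = Polynomial.smult c (pcoord t u)"
  by (simp add: pcoord_def lin_smult[OF lin_pval] smult_sum')

lemma pcoord_basis:
  assumes "s \<in> carrier G" "t \<in> carrier G" "degree q < CHAR('k)"
  shows "pcoord t (\<tau> s \<otimes>\<^bsub>B\<^esub> pev B X q) = (if t = s then q else 0)"
  using assms by (simp add: pcoord_def pval_basis lagrange_interpolation)

text \<open>The coefficient of \<open>t x^a\<close>.\<close>

definition coord :: "'g \<Rightarrow> nat \<Rightarrow> ('g letter list \<Rightarrow>\<^sub>0 'k) set \<Rightarrow> 'k" where
  "coord t a u = coeff (pcoord t u) a"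

lemma lin_coord: "lin B ground (coord t a)"
  by (rule linI) (simp_all add: coord_def pcoord_add pcoord_smult)

section \<open>The standard monomials span\<close>

text \<open>
  The defining relation \<open>t x - x t = f(t) t (1 - g)\<close>, solved for \<open>x t\<close> and free of subtraction.
\<close>

lemma X_tau:
  assumes t: "t \<in> carrier G"
  shows "X \<otimes>\<^bsub>B\<^esub> \<tau> t \<oplus>\<^bsub>B\<^esub> f t \<odot>\<^bsub>B\<^esub> \<tau> t = \<tau> t \<otimes>\<^bsub>B\<^esub> X \<oplus>\<^bsub>B\<^esub> f t \<odot>\<^bsub>B\<^esub> \<tau> (t \<otimes>\<^bsub>G\<^esub> g)"
proof -
  have e: "a = b \<ominus>\<^bsub>B\<^esub> c \<oplus>\<^bsub>B\<^esub> c \<oplus>\<^bsub>B\<^esub> (a \<ominus>\<^bsub>B\<^esub> b)" if "a \<in> carrier B" "b \<in> carrier B" "c \<in> carrier B" for a b c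
  proof -
    have "b \<ominus>\<^bsub>B\<^esub> c \<oplus>\<^bsub>B\<^esub> c = b" using that by (simp add: a_minus_def B.a_assoc B.l_neg)
    moreover have "b \<oplus>\<^bsub>B\<^esub> (a \<ominus>\<^bsub>B\<^esub> b) = a" using that by (simp add: a_minus_def B.a_lcomm[of b a] B.r_neg)
    ultimately show ?thesis by simp
  qed
  let ?a = "\<tau> t \<otimes>\<^bsub>B\<^esub> X" and ?b = "X \<otimes>\<^bsub>B\<^esub> \<tau> t"
  have 1: "f t \<odot>\<^bsub>B\<^esub> (\<tau> t \<otimes>\<^bsub>B\<^esub> (\<one>\<^bsub>B\<^esub> \<ominus>\<^bsub>B\<^esub> \<tau> g)) \<oplus>\<^bsub>B\<^esub> f t \<odot>\<^bsub>B\<^esub> \<tau> (t \<otimes>\<^bsub>G\<^esub> g) = f t \<odot>\<^bsub>B\<^esub> \<tau> t"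
    using t by (simp add: a_minus_def B.r_distr B.r_minus tau_mult B.smult_r_distr B.smult_minus_right B.a_assoc B.l_neg)
  have "?a = ?b \<oplus>\<^bsub>B\<^esub> (?a \<ominus>\<^bsub>B\<^esub> ?b)"
    using t e[of ?a ?b "\<zero>\<^bsub>B\<^esub>"] by (simp add: a_minus_def B.a_lcomm[of ?b ?a] B.r_neg)
  then have "?a \<oplus>\<^bsub>B\<^esub> f t \<odot>\<^bsub>B\<^esub> \<tau> (t \<otimes>\<^bsub>G\<^esub> g) = ?b \<oplus>\<^bsub>B\<^esub> (?a \<ominus>\<^bsub>B\<^esub> ?b) \<oplus>\<^bsub>B\<^esub> f t \<odot>\<^bsub>B\<^esub> \<tau> (t \<otimes>\<^bsub>G\<^esub> g)"
    by simp
  also have "\<dots> = ?b \<oplus>\<^bsub>B\<^esub> f t \<odot>\<^bsub>B\<^esub> \<tau> t"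
    unfolding tau_X_minus[OF t] 1[symmetric] using t by (simp add: B.a_assoc B.minus_closed)
  finally show ?thesis by simp
qed

text \<open>
  The relation moves \<open>x\<close> to the right of group elements, so the span of these elements is stable
  under left multiplication by the generators.
\<close>

lemma spans_all: "spans B {\<tau> t \<otimes>\<^bsub>B\<^esub> pev B X q | t q. t \<in> carrier G}" (is "spans B ?S")
  unfolding spans_def
proof (intro conjI allI impI)
  show "?S \<subseteq> carrier B" by auto
  fix N assume N: "subsp B N \<and> ?S \<subseteq> N"
  \<comment> \<open>the span itself; unlike an arbitrary \<open>N\<close> containing the monomials it is mapped into itself
    by multiplications\<close>
  define N1 where "N1 = \<Inter>{N. subsp B N \<and> ?S \<subseteq> N}"
  have low: "N1 \<subseteq> M" if "subsp B M" "?S \<subseteq> M" for M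
    unfolding N1_def by (rule Inter_lower) (use that in simp)
  have N1N: "N1 \<subseteq> N" using N low by simp
  have sN1: "subsp B N1" unfolding N1_def by (rule subsp_Inter) (use N in auto)
  have "?S \<subseteq> N1" unfolding N1_def by (rule Inter_greatest) simp
  then have SN1: "s \<in> N1" if "s \<in> ?S" for s
    using that by (rule subsetD)
  have ind: "\<phi> v \<in> N1" if "v \<in> N1" "lin B B \<phi>" "\<And>s. s \<in> ?S \<Longrightarrow> \<phi> s \<in> N1" for \<phi> v
  proof -
    have "N1 \<subseteq> {v \<in> carrier B. \<phi> v \<in> N1}"
    proof (rule low)
      show "subsp B {v \<in> carrier B. \<phi> v \<in> N1}"
        by (rule subsp_vimage[OF B.vs_axioms B.vs_axioms that(2) sN1])
      show "?S \<subseteq> {v \<in> carrier B. \<phi> v \<in> N1}"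
        using that(3) subsetD[OF \<open>?S \<subseteq> carrier B\<close>] by (intro subsetI CollectI conjI)
    qed
    then show ?thesis using that(1) by (simp add: subset_iff)
  qed
  have S: "\<tau> t \<otimes>\<^bsub>B\<^esub> pev B X q \<in> N1" if "t \<in> carrier G" for t q
    by (rule SN1) (use that in blast)
  have add: "a \<oplus>\<^bsub>B\<^esub> b \<in> N1" if "a \<in> N1" "b \<in> N1" for a b
    using sN1 that by (simp add: subsp_def)
  have sm: "c \<odot>\<^bsub>B\<^esub> a \<in> N1" if "a \<in> N1" for a c
    using sN1 that by (simp add: subsp_def)
  show "carrier B \<subseteq> N"
  proof
    fix v assume "v \<in> carrier B"
    then have "v \<in> N1"
    proof (rule B_induct[OF sN1, rotated -1])
      show "\<one>\<^bsub>B\<^esub> \<in> N1" using S[of "\<one>\<^bsub>G\<^esub>" 1] by (simp add: tau_one)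
      show "\<tau> t \<otimes>\<^bsub>B\<^esub> v \<in> N1" if t: "t \<in> carrier G" and v: "v \<in> N1" for t v
      proof (rule ind[OF v B.lin_mult_left])
        fix s assume "s \<in> ?S"
        then obtain r q where r: "s = \<tau> r \<otimes>\<^bsub>B\<^esub> pev B X q" "r \<in> carrier G" by blast
        then have "\<tau> t \<otimes>\<^bsub>B\<^esub> s = \<tau> (t \<otimes>\<^bsub>G\<^esub> r) \<otimes>\<^bsub>B\<^esub> pev B X q"
          using t by (simp add: tau_mult[symmetric] B.m_assoc)
        then show "\<tau> t \<otimes>\<^bsub>B\<^esub> s \<in> N1" using S[of "t \<otimes>\<^bsub>G\<^esub> r" q] t r by simp
      qed (use t in simp)
      show "X \<otimes>\<^bsub>B\<^esub> v \<in> N1" if v: "v \<in> N1" for v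
      proof (rule ind[OF v B.lin_mult_left])
        fix s assume "s \<in> ?S"
        then obtain r q where r: "s = \<tau> r \<otimes>\<^bsub>B\<^esub> pev B X q" "r \<in> carrier G" by blast
        let ?p = "pev B X q"
        have "X \<otimes>\<^bsub>B\<^esub> s \<oplus>\<^bsub>B\<^esub> f r \<odot>\<^bsub>B\<^esub> (\<tau> r \<otimes>\<^bsub>B\<^esub> ?p) = (X \<otimes>\<^bsub>B\<^esub> \<tau> r \<oplus>\<^bsub>B\<^esub> f r \<odot>\<^bsub>B\<^esub> \<tau> r) \<otimes>\<^bsub>B\<^esub> ?p"
          using r by (simp add: B.l_distr B.m_assoc B.smult_mult_left)
        also have "\<dots> = \<tau> r \<otimes>\<^bsub>B\<^esub> pev B X ([:0, 1:] * q) \<oplus>\<^bsub>B\<^esub> f r \<odot>\<^bsub>B\<^esub> (\<tau> (r \<otimes>\<^bsub>G\<^esub> g) \<otimes>\<^bsub>B\<^esub> ?p)"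
          unfolding X_tau[OF r(2)] using r
          by (simp add: B.l_distr B.m_assoc B.smult_mult_left B.pev_mult del: mult_pCons_left)
        finally have e: "X \<otimes>\<^bsub>B\<^esub> s \<oplus>\<^bsub>B\<^esub> f r \<odot>\<^bsub>B\<^esub> (\<tau> r \<otimes>\<^bsub>B\<^esub> ?p) =
          \<tau> r \<otimes>\<^bsub>B\<^esub> pev B X ([:0, 1:] * q) \<oplus>\<^bsub>B\<^esub> f r \<odot>\<^bsub>B\<^esub> (\<tau> (r \<otimes>\<^bsub>G\<^esub> g) \<otimes>\<^bsub>B\<^esub> ?p)" .
        have "X \<otimes>\<^bsub>B\<^esub> s = (X \<otimes>\<^bsub>B\<^esub> s \<oplus>\<^bsub>B\<^esub> f r \<odot>\<^bsub>B\<^esub> (\<tau> r \<otimes>\<^bsub>B\<^esub> ?p)) \<oplus>\<^bsub>B\<^esub> (- f r) \<odot>\<^bsub>B\<^esub> (\<tau> r \<otimes>\<^bsub>B\<^esub> ?p)"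
          using r by (simp add: B.smult_minus_left B.a_assoc B.r_neg)
        moreover have "(X \<otimes>\<^bsub>B\<^esub> s \<oplus>\<^bsub>B\<^esub> f r \<odot>\<^bsub>B\<^esub> (\<tau> r \<otimes>\<^bsub>B\<^esub> ?p)) \<oplus>\<^bsub>B\<^esub> (- f r) \<odot>\<^bsub>B\<^esub> (\<tau> r \<otimes>\<^bsub>B\<^esub> ?p) \<in> N1"
          unfolding e using r by (intro add sm S) auto
        ultimately show "X \<otimes>\<^bsub>B\<^esub> s \<in> N1" by simp
      qed simp
    qed
    then show "v \<in> N" using N1N by blast
  qed
qed

lemma pev_X_mod: "pev B X (q mod artin) = pev B X q"
proof -
  have "pev B X q = pev B X (q div artin * artin + q mod artin)" by simp
  also have "\<dots> = pev B X (q mod artin)"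
    unfolding B.pev_add[OF gen_closed(2)] B.pev_mult[OF gen_closed(2)]
    using B.pev_artin[of X] X_pow by simp
  finally show ?thesis by simp
qed

lemma spans_red: "spans B {\<tau> t \<otimes>\<^bsub>B\<^esub> pev B X q | t q. t \<in> carrier G \<and> degree q < CHAR('k)}"
proof (rule spans_trans[OF spans_all])
  fix N assume N: "{\<tau> t \<otimes>\<^bsub>B\<^esub> pev B X q | t q. t \<in> carrier G \<and> degree q < CHAR('k)} \<subseteq> N"
  have "artin \<noteq> (0 :: 'k poly)" using degree_artin(2) by auto
  then have "degree (q mod artin :: 'k poly) < CHAR('k)" for q
    using degree_mod_less[of artin q] degree_artin(1) p_gt_1 by auto
  then have d: "degree (q mod artin :: 'k poly) < CHAR('k)" for q .
  show "{\<tau> t \<otimes>\<^bsub>B\<^esub> pev B X q | t q. t \<in> carrier G} \<subseteq> N"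
  proof
    fix s assume "s \<in> {\<tau> t \<otimes>\<^bsub>B\<^esub> pev B X q | t q. t \<in> carrier G}"
    then obtain t q where s: "s = \<tau> t \<otimes>\<^bsub>B\<^esub> pev B X q" "t \<in> carrier G" by blast
    have "s \<in> {\<tau> t \<otimes>\<^bsub>B\<^esub> pev B X q | t q. t \<in> carrier G \<and> degree q < CHAR('k)}"
      unfolding s(1) by (intro CollectI exI[of _ t] exI[of _ "q mod artin"]) (use s d[of q] pev_X_mod[of q] in simp)
    then show "s \<in> N" using N by (rule rev_subsetD)
  qed
qed auto

lemma expansion:
  assumes "u \<in> carrier B"
  shows "u = (\<Oplus>\<^bsub>B\<^esub>t\<in>carrier G. \<tau> t \<otimes>\<^bsub>B\<^esub> pev B X (pcoord t u))"
proof (rule lin_eqI[OF B.vs_axioms B.vs_axioms spans_red lin_ident _ _ assms])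
  show "lin B B (\<lambda>u. \<Oplus>\<^bsub>B\<^esub>t\<in>carrier G. \<tau> t \<otimes>\<^bsub>B\<^esub> pev B X (pcoord t u))"
  proof (rule linI)
    fix v w c assume v: "v \<in> carrier B"
    show "(\<Oplus>\<^bsub>B\<^esub>t\<in>carrier G. \<tau> t \<otimes>\<^bsub>B\<^esub> pev B X (pcoord t v)) \<in> carrier B"
      by (rule B.finsum_closed) auto
    have "(\<Oplus>\<^bsub>B\<^esub>t\<in>carrier G. \<tau> t \<otimes>\<^bsub>B\<^esub> pev B X (pcoord t (c \<odot>\<^bsub>B\<^esub> v))) =
        (\<Oplus>\<^bsub>B\<^esub>t\<in>carrier G. c \<odot>\<^bsub>B\<^esub> (\<tau> t \<otimes>\<^bsub>B\<^esub> pev B X (pcoord t v)))"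
      by (rule B.finsum_cong') (use v in \<open>auto simp: pcoord_smult B.pev_smult B.smult_mult_right\<close>)
    then show "(\<Oplus>\<^bsub>B\<^esub>t\<in>carrier G. \<tau> t \<otimes>\<^bsub>B\<^esub> pev B X (pcoord t (c \<odot>\<^bsub>B\<^esub> v))) =
        c \<odot>\<^bsub>B\<^esub> (\<Oplus>\<^bsub>B\<^esub>t\<in>carrier G. \<tau> t \<otimes>\<^bsub>B\<^esub> pev B X (pcoord t v))"
      by (subst B.finsum_smult) (auto simp: finite_G)
    assume w: "w \<in> carrier B"
    have "(\<Oplus>\<^bsub>B\<^esub>t\<in>carrier G. \<tau> t \<otimes>\<^bsub>B\<^esub> pev B X (pcoord t (v \<oplus>\<^bsub>B\<^esub> w))) =
        (\<Oplus>\<^bsub>B\<^esub>t\<in>carrier G. \<tau> t \<otimes>\<^bsub>B\<^esub> pev B X (pcoord t v) \<oplus>\<^bsub>B\<^esub> \<tau> t \<otimes>\<^bsub>B\<^esub> pev B X (pcoord t w))"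
      by (rule B.finsum_cong') (use v w in \<open>auto simp: pcoord_add B.pev_add B.r_distr\<close>)
    then show "(\<Oplus>\<^bsub>B\<^esub>t\<in>carrier G. \<tau> t \<otimes>\<^bsub>B\<^esub> pev B X (pcoord t (v \<oplus>\<^bsub>B\<^esub> w))) =
        (\<Oplus>\<^bsub>B\<^esub>t\<in>carrier G. \<tau> t \<otimes>\<^bsub>B\<^esub> pev B X (pcoord t v)) \<oplus>\<^bsub>B\<^esub>
        (\<Oplus>\<^bsub>B\<^esub>t\<in>carrier G. \<tau> t \<otimes>\<^bsub>B\<^esub> pev B X (pcoord t w))"
      by (subst (asm) B.finsum_addf) auto
  qed
  fix s assume "s \<in> {\<tau> t \<otimes>\<^bsub>B\<^esub> pev B X q | t q. t \<in> carrier G \<and> degree q < CHAR('k)}"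
  then obtain t q where s: "s = \<tau> t \<otimes>\<^bsub>B\<^esub> pev B X q" "t \<in> carrier G" "degree q < CHAR('k)" by blast
  have "(\<Oplus>\<^bsub>B\<^esub>r\<in>carrier G. \<tau> r \<otimes>\<^bsub>B\<^esub> pev B X (pcoord r s)) =
     (\<Oplus>\<^bsub>B\<^esub>r\<in>carrier G. if t = r then \<tau> t \<otimes>\<^bsub>B\<^esub> pev B X q else \<zero>\<^bsub>B\<^esub>)"
    by (rule B.finsum_cong') (use s in \<open>auto simp: pcoord_basis\<close>)
  also have "\<dots> = \<tau> t \<otimes>\<^bsub>B\<^esub> pev B X q"
    by (rule B.finsum_singleton) (use s finite_G in auto)
  finally show "s = (\<Oplus>\<^bsub>B\<^esub>r\<in>carrier G. \<tau> r \<otimes>\<^bsub>B\<^esub> pev B X (pcoord r s))" using s by simp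
qed

lemma pcoord_eqI:
  assumes "u \<in> carrier B" "v \<in> carrier B" "\<And>t. t \<in> carrier G \<Longrightarrow> pcoord t u = pcoord t v"
  shows "u = v"
proof -
  have "(\<Oplus>\<^bsub>B\<^esub>t\<in>carrier G. \<tau> t \<otimes>\<^bsub>B\<^esub> pev B X (pcoord t u)) = (\<Oplus>\<^bsub>B\<^esub>t\<in>carrier G. \<tau> t \<otimes>\<^bsub>B\<^esub> pev B X (pcoord t v))"
    by (rule B.finsum_cong') (use assms in auto)
  then show ?thesis
    unfolding expansion[OF assms(1), symmetric] expansion[OF assms(2), symmetric] .
qed

end

section \<open>Functoriality of tensor products\<close>

text \<open>
  A Hopf algebra and its underlying algebra are different records with the same algebra
  operations; their tensor products are literally equal.
\<close>

lemma tensor_cong: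
  assumes "carrier V' = carrier V" "add V' = add V" "smult V' = smult V" "mult V' = mult V" "one V' = one V"
    "carrier W' = carrier W" "add W' = add W" "smult W' = smult W" "mult W' = mult W" "one W' = one W"
  shows "tensor_vs V' W' = tensor_vs V W" "tens V' W' = tens V W" "tensor V' W' = tensor V W"
proof -
  have r: "tensor_rels V' W' = tensor_rels V W" by (simp only: tensor_rels_def assms)
  have n: "tensor_null V' W' = tensor_null V W" by (simp only: tensor_null_def r assms)
  show v: "tensor_vs V' W' = tensor_vs V W" by (simp only: tensor_vs_def n assms)
  show t: "tens V' W' = tens V W" by (intro ext) (simp only: tens_def n assms)
  show "tensor V' W' = tensor V W" by (simp only: tensor_def v t assms)
qed

lemma vs_tensor: "vs V \<Longrightarrow> vs W \<Longrightarrow> vs (tensor V W)"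
  by (rule vs_cong[OF vs2.vs_tensor_vs[OF vs2.intro]]) (simp_all add: tensor_simps)

context vs2 begin

lemma tensor_closed [simp]: "v \<in> carrier V \<Longrightarrow> w \<in> carrier W \<Longrightarrow> tens V W v w \<in> carrier (tensor V W)"
  by (simp add: tensor_simps tens_closed)

lemma tensor_bilinear: "bilinear_into V W (tensor V W) (tens V W)"
  using tens_bilinear by (simp add: bilinear_tensor_to)

lemma lin_tensor_lift': "vs P \<Longrightarrow> bilinear_into V W P \<beta> \<Longrightarrow> lin (tensor V W) P (tensor_lift P \<beta>)"
  using lin_tensor_lift by (simp add: lin_tensor_from)

lemma lin_tensor_eqI':
  assumes "vs P" "lin (tensor V W) P \<phi>" "lin (tensor V W) P \<psi>"
    "\<And>v w. v \<in> carrier V \<Longrightarrow> w \<in> carrier W \<Longrightarrow> \<phi> (tens V W v w) = \<psi> (tens V W v w)"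
    "X \<in> carrier (tensor V W)"
  shows "\<phi> X = \<psi> X"
  by (rule lin_tensor_eqI[OF assms(1)]) (use assms(2-5) in \<open>simp_all add: lin_tensor_from tensor_simps\<close>)

end

lemma lin_pair_bilinear:
  assumes "vs2 V W" "vs2 V' W'" "lin V V' \<phi>" "lin W W' \<psi>"
  shows "bilinear_into V W (tensor V' W') (\<lambda>a b. tens V' W' (\<phi> a) (\<psi> b))"
proof -
  interpret S: vs2 V W by fact
  interpret T: vs2 V' W' by fact
  show ?thesis
    by (rule bilinearI)
     (use lin_comp[OF assms(3) bilinear_left[OF T.tensor_bilinear]] lin_comp[OF assms(4) bilinear_right[OF T.tensor_bilinear]]
        lin_closed[OF assms(3)] lin_closed[OF assms(4)] in auto)
qed

text \<open>The tensor product \<open>\<phi> \<otimes> \<psi>\<close> of two linear maps.\<close>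

definition tmap :: "('k::field, 'v, 'm) module_scheme \<Rightarrow> ('k, 'w, 'n) module_scheme \<Rightarrow>
    ('a \<Rightarrow> 'v) \<Rightarrow> ('b \<Rightarrow> 'w) \<Rightarrow> ('a \<times> 'b \<Rightarrow>\<^sub>0 'k) set \<Rightarrow> ('v \<times> 'w \<Rightarrow>\<^sub>0 'k) set" where
  "tmap V W \<phi> \<psi> = tensor_lift (tensor V W) (\<lambda>a b. tens V W (\<phi> a) (\<psi> b))"

lemma
  assumes "vs2 V W" "vs2 V' W'" "lin V V' \<phi>" "lin W W' \<psi>"
  shows lin_tmap: "lin (tensor V W) (tensor V' W') (tmap V' W' \<phi> \<psi>)"
    and tmap_tens: "v \<in> carrier V \<Longrightarrow> w \<in> carrier W \<Longrightarrow> tmap V' W' \<phi> \<psi> (tens V W v w) = tens V' W' (\<phi> v) (\<psi> w)"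
proof -
  interpret S: vs2 V W by fact
  interpret T: vs2 V' W' by fact
  have v: "vs (tensor V' W')" by (rule vs_tensor) (rule T.V.vs_axioms T.W.vs_axioms)+
  show "lin (tensor V W) (tensor V' W') (tmap V' W' \<phi> \<psi>)"
    unfolding tmap_def by (rule S.lin_tensor_lift'[OF v lin_pair_bilinear[OF assms]])
  show "tmap V' W' \<phi> \<psi> (tens V W v w) = tens V' W' (\<phi> v) (\<psi> w)" if "v \<in> carrier V" "w \<in> carrier W"
    unfolding tmap_def by (rule S.tensor_lift_tens[OF v lin_pair_bilinear[OF assms] that])
qed

context kalg2 begin

lemma alg_hom_left: "alg_hom V (tensor V W) (\<lambda>v. tens V W v \<one>\<^bsub>W\<^esub>)"
  using bilinear_left[OF tensor_bilinear W.one_closed]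
  by (simp add: alg_hom_def tensor_simps tensor_mult_tens)

lemma alg_hom_right: "alg_hom W (tensor V W) (\<lambda>w. tens V W \<one>\<^bsub>V\<^esub> w)"
  using bilinear_right[OF tensor_bilinear V.one_closed]
  by (simp add: alg_hom_def tensor_simps tensor_mult_tens)

end

lemma alg_hom_tmap:
  assumes "kalg2 V W" "kalg2 V' W'" "alg_hom V V' \<phi>" "alg_hom W W' \<psi>"
  shows "alg_hom (tensor V W) (tensor V' W') (tmap V' W' \<phi> \<psi>)"
proof -
  interpret S: kalg2 V W by fact
  interpret T: kalg2 V' W' by fact
  note l = alg_hom_lin[OF assms(3)] alg_hom_lin[OF assms(4)]
  note tm = tmap_tens[OF S.vs2_axioms T.vs2_axioms l]
  note L = lin_tmap[OF S.vs2_axioms T.vs2_axioms l]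
  let ?m = "tmap V' W' \<phi> \<psi>"
  interpret TS: kalg "tensor V W" by (rule S.kalg_tensor)
  interpret TT: kalg "tensor V' W'" by (rule T.kalg_tensor)
  note cl = alg_hom_closed[OF assms(3)] alg_hom_closed[OF assms(4)]
  have 1: "?m (tens V W a b \<otimes>\<^bsub>tensor V W\<^esub> Y) = ?m (tens V W a b) \<otimes>\<^bsub>tensor V' W'\<^esub> ?m Y"
    if "a \<in> carrier V" "b \<in> carrier W" "Y \<in> carrier (tensor V W)" for a b Y
    by (rule S.lin_tensor_eqI'[OF TT.vs_axioms lin_comp[OF TS.lin_mult_left L] lin_comp[OF L TT.lin_mult_left] _ that(3)])
      (use that in \<open>simp_all add: S.tensor_mult_tens T.tensor_mult_tens tm cl alg_hom_mult[OF assms(3)] alg_hom_mult[OF assms(4)]\<close>)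
  have 2: "?m (X \<otimes>\<^bsub>tensor V W\<^esub> Y) = ?m X \<otimes>\<^bsub>tensor V' W'\<^esub> ?m Y"
    if "X \<in> carrier (tensor V W)" "Y \<in> carrier (tensor V W)" for X Y
    by (rule S.lin_tensor_eqI'[OF TT.vs_axioms lin_comp[OF TS.lin_mult_right L] lin_comp[OF L TT.lin_mult_right] _ that(1)])
      (use that 1 lin_closed[OF L] in simp_all)
  show ?thesis
    unfolding alg_hom_def using L 2
    by (simp add: tensor_simps(5) tm alg_hom_one[OF assms(3)] alg_hom_one[OF assms(4)])
qed

section \<open>Homomorphisms of Hopf algebras\<close>

text \<open>
  What is needed of the source and target in order to compose and invert Hopf homomorphisms: the
  operations stay inside the carriers.
\<close>

definition hopf_closed :: "('k::field, 'a, 'm) hopf_scheme \<Rightarrow> bool" where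
  "hopf_closed H \<longleftrightarrow> vs H \<and> (\<forall>a\<in>carrier H. comult H a \<in> carrier (tensor H H)) \<and>
     (\<forall>a\<in>carrier H. antipode H a \<in> carrier H) \<and> \<one>\<^bsub>H\<^esub> \<in> carrier H \<and>
     (\<forall>a\<in>carrier H. \<forall>b\<in>carrier H. a \<otimes>\<^bsub>H\<^esub> b \<in> carrier H)"

lemma hopf_hom_iff:
  "\<phi> \<in> hopf_hom H K \<longleftrightarrow> alg_hom H K \<phi> \<and>
     (\<forall>a\<in>carrier H. comult K (\<phi> a) = tmap K K \<phi> \<phi> (comult H a) \<and> counit K (\<phi> a) = counit H a \<and>
        antipode K (\<phi> a) = \<phi> (antipode H a))"
  by (simp add: hopf_hom_def alg_hom_iff sweedler_def tmap_def)

lemma tmap_comp: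
  assumes "vs H" "vs K" "vs M" "lin H K \<phi>" "lin K M \<psi>" "X \<in> carrier (tensor H H)"
  shows "tmap M M \<psi> \<psi> (tmap K K \<phi> \<phi> X) = tmap M M (\<lambda>u. \<psi> (\<phi> u)) (\<lambda>u. \<psi> (\<phi> u)) X"
proof -
  interpret H: vs2 H H by (rule vs2.intro) fact+
  interpret K: vs2 K K by (rule vs2.intro) fact+
  interpret M: vs2 M M by (rule vs2.intro) fact+
  note l1 = lin_tmap[OF H.vs2_axioms K.vs2_axioms assms(4,4)]
  note l2 = lin_tmap[OF K.vs2_axioms M.vs2_axioms assms(5,5)]
  note l3 = lin_tmap[OF H.vs2_axioms M.vs2_axioms lin_comp[OF assms(4,5)] lin_comp[OF assms(4,5)]]
  note t1 = tmap_tens[OF H.vs2_axioms K.vs2_axioms assms(4,4)]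
  note t2 = tmap_tens[OF K.vs2_axioms M.vs2_axioms assms(5,5)]
  note t3 = tmap_tens[OF H.vs2_axioms M.vs2_axioms lin_comp[OF assms(4,5)] lin_comp[OF assms(4,5)]]
  show ?thesis
    by (rule H.lin_tensor_eqI'[OF vs_tensor[OF assms(3,3)] lin_comp[OF l1 l2] l3 _ assms(6)])
      (simp add: t1 t2 t3 lin_closed[OF assms(4)])
qed

lemma tmap_ident:
  assumes "vs H" "\<And>a. a \<in> carrier H \<Longrightarrow> \<phi> a = a" "X \<in> carrier (tensor H H)"
  shows "tmap H H \<phi> \<phi> X = X"
proof -
  interpret H: vs2 H H by (rule vs2.intro) fact+
  have l: "lin H H \<phi>" by (rule lin_cong[OF assms(1) lin_ident assms(2)])
  show ?thesis
    by (rule H.lin_tensor_eqI'[OF vs_tensor[OF assms(1,1)] lin_tmap[OF H.vs2_axioms H.vs2_axioms l l] lin_ident _ assms(3)])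
      (simp add: tmap_tens[OF H.vs2_axioms H.vs2_axioms l l] assms(2))
qed

lemma hopf_hom_comp:
  assumes "hopf_closed H" "hopf_closed K" "hopf_closed M" "\<phi> \<in> hopf_hom H K" "\<psi> \<in> hopf_hom K M"
  shows "(\<lambda>u. \<psi> (\<phi> u)) \<in> hopf_hom H M"
proof -
  have vs: "vs H" "vs K" "vs M" using assms(1-3) by (simp_all add: hopf_closed_def)
  have h: "alg_hom H K \<phi>" "alg_hom K M \<psi>" using assms(4,5) by (simp_all add: hopf_hom_iff)
  have c: "comult H a \<in> carrier (tensor H H)" if "a \<in> carrier H" for a
    using assms(1) that by (simp add: hopf_closed_def)
  show ?thesis
    unfolding hopf_hom_iff
    using alg_hom_comp[OF h] assms(4,5) alg_hom_closed[OF h(1)]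
    by (simp add: hopf_hom_iff tmap_comp[OF vs alg_hom_lin[OF h(1)] alg_hom_lin[OF h(2)] c])
qed

lemma hopf_iso_comp:
  assumes "hopf_closed H" "hopf_closed K" "hopf_closed M" "\<phi> \<in> hopf_iso H K" "\<psi> \<in> hopf_iso K M"
  shows "(\<lambda>u. \<psi> (\<phi> u)) \<in> hopf_iso H M"
  using assms hopf_hom_comp[OF assms(1-3)] bij_betw_trans[of \<phi> "carrier H" "carrier K" \<psi> "carrier M"]
  by (simp add: hopf_iso_def comp_def)

lemma hopf_iso_inv:
  assumes "hopf_closed H" "hopf_closed K" "\<phi> \<in> hopf_iso H K"
  shows "inv_into (carrier H) \<phi> \<in> hopf_iso K H"
proof -
  let ?i = "inv_into (carrier H) \<phi>"
  have vs: "vs H" "vs K" using assms(1,2) by (simp_all add: hopf_closed_def)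
  interpret H: vs H by fact
  have b: "bij_betw \<phi> (carrier H) (carrier K)" and hom: "\<phi> \<in> hopf_hom H K"
    using assms(3) by (simp_all add: hopf_iso_def)
  have h: "alg_hom H K \<phi>" using hom by (simp add: hopf_hom_iff)
  note l = alg_hom_lin[OF h]
  have bi: "bij_betw ?i (carrier K) (carrier H)" by (rule bij_betw_inv_into[OF b])
  have ic: "?i a \<in> carrier H" if "a \<in> carrier K" for a
    using bi that by (auto simp: bij_betw_def)
  have fi: "\<phi> (?i a) = a" if "a \<in> carrier K" for a
    using b that by (simp add: bij_betw_inv_into_right)
  have if': "?i (\<phi> a) = a" if "a \<in> carrier H" for a
    using b that by (simp add: bij_betw_inv_into_left)
  have cl: "\<one>\<^bsub>H\<^esub> \<in> carrier H" "\<And>a b. a \<in> carrier H \<Longrightarrow> b \<in> carrier H \<Longrightarrow> a \<otimes>\<^bsub>H\<^esub> b \<in> carrier H"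
    "\<And>a. a \<in> carrier H \<Longrightarrow> comult H a \<in> carrier (tensor H H)" "\<And>a. a \<in> carrier H \<Longrightarrow> antipode H a \<in> carrier H"
    using assms(1) by (simp_all add: hopf_closed_def)
  have ai: "alg_hom K H ?i"
    unfolding alg_hom_def
  proof (intro conjI ballI linI)
    fix a b c assume a: "a \<in> carrier K"
    show "?i (c \<odot>\<^bsub>K\<^esub> a) = c \<odot>\<^bsub>H\<^esub> ?i a"
      using if'[of "c \<odot>\<^bsub>H\<^esub> ?i a"] ic[OF a] by (simp add: lin_smult[OF l] fi a)
    assume b: "b \<in> carrier K"
    show "?i (a \<oplus>\<^bsub>K\<^esub> b) = ?i a \<oplus>\<^bsub>H\<^esub> ?i b"
      using if'[of "?i a \<oplus>\<^bsub>H\<^esub> ?i b"] ic[OF a] ic[OF b] by (simp add: lin_add[OF l] fi a b)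
    show "?i (a \<otimes>\<^bsub>K\<^esub> b) = ?i a \<otimes>\<^bsub>H\<^esub> ?i b"
      using if'[of "?i a \<otimes>\<^bsub>H\<^esub> ?i b"] ic[OF a] ic[OF b] cl(2) by (simp add: alg_hom_mult[OF h] fi a b)
  next
    show "?i \<one>\<^bsub>K\<^esub> = \<one>\<^bsub>H\<^esub>" using if'[of "\<one>\<^bsub>H\<^esub>"] cl(1) by (simp add: alg_hom_one[OF h])
  qed (rule ic)
  have "comult H (?i a) = tmap H H ?i ?i (comult K a)" if a: "a \<in> carrier K" for a
  proof -
    have "comult K a = tmap K K \<phi> \<phi> (comult H (?i a))"
      using hom ic[OF a] fi[OF a] by (auto simp: hopf_hom_iff)
    then show ?thesis
      using tmap_comp[OF vs vs(1) l alg_hom_lin[OF ai] cl(3)[OF ic[OF a]]]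
        tmap_ident[OF vs(1) if' cl(3)[OF ic[OF a]]] by simp
  qed
  moreover have "counit H (?i a) = counit K a" if a: "a \<in> carrier K" for a
    using hom ic[OF a] fi[OF a] by (auto simp: hopf_hom_iff)
  moreover have "antipode H (?i a) = ?i (antipode K a)" if a: "a \<in> carrier K" for a
  proof -
    have "antipode K a = \<phi> (antipode H (?i a))"
      using hom ic[OF a] fi[OF a] by (auto simp: hopf_hom_iff)
    then show ?thesis using if'[OF cl(4)[OF ic[OF a]]] by simp
  qed
  ultimately show ?thesis using ai bi by (simp add: hopf_iso_def hopf_hom_iff)
qed

section \<open>The opposite algebra\<close>

abbreviation opp :: "('k::field, 'v) module \<Rightarrow> ('k, 'v) module" where
  "opp C \<equiv> C\<lparr>mult := (\<lambda>a b. b \<otimes>\<^bsub>C\<^esub> a)\<rparr>"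

lemma opp_simps:
  "carrier (opp C) = carrier C" "zero (opp C) = zero C" "add (opp C) = add C" "module.smult (opp C) = module.smult C"
  "one (opp C) = one C" "a \<otimes>\<^bsub>opp C\<^esub> b = b \<otimes>\<^bsub>C\<^esub> a"
  by simp_all

lemma kalg_opp: assumes "kalg C" shows "kalg (opp C)"
proof -
  interpret kalg C by fact
  show ?thesis
    by (rule kalgI[OF vs_cong[OF vs_axioms]])
      (auto simp: bilinear_into_def m_assoc l_distr r_distr smult_mult_left smult_mult_right)
qed

lemma opp_pow:
  assumes "kalg C" "a \<in> carrier C" shows "a [^]\<^bsub>opp C\<^esub> (n::nat) = a [^]\<^bsub>C\<^esub> n"
proof -
  interpret kalg C by fact
  interpret O: kalg "opp C" by (rule kalg_opp[OF assms(1)])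
  show ?thesis
  proof (induction n)
    case (Suc n)
    then show ?case
      using O.nat_pow_Suc[of a n] nat_pow_Suc2[OF assms(2), of n] by (simp only: opp_simps)
  qed simp
qed

lemma lin_opp: "lin V (opp C) = lin V C"
  by (intro ext) (simp add: lin_def)

lemma (in kalg) A3_rep_relation:
  assumes "a \<in> carrier B" "b \<in> carrier B" "t \<in> carrier B" "s \<in> carrier B"
    "b \<oplus> c \<odot> t = a \<oplus> c \<odot> (t \<otimes> s)"
  shows "a \<ominus> b = c \<odot> (t \<otimes> (\<one> \<ominus> s))"
proof -
  have "c \<odot> (t \<otimes> (\<one> \<ominus> s)) = c \<odot> t \<oplus> \<ominus> (c \<odot> (t \<otimes> s))"
    using assms by (simp add: a_minus_def r_distr r_minus smult_r_distr smult_minus_right)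
  also have "c \<odot> t = \<ominus> b \<oplus> (b \<oplus> c \<odot> t)"
    using assms(1-4) by (simp add: r_neg1)
  also have "\<ominus> b \<oplus> (b \<oplus> c \<odot> t) \<oplus> \<ominus> (c \<odot> (t \<otimes> s)) = a \<ominus> b"
    unfolding assms(5) using assms(1-4) by (simp add: a_minus_def a_assoc r_neg) (simp add: a_comm)
  finally show ?thesis by simp
qed

lemma A3_repI:
  assumes "kalg C" "\<And>t. t \<in> carrier G \<Longrightarrow> \<phi> (Grp t) \<in> carrier C" "\<phi> Xgen \<in> carrier C"
    "\<phi> (Grp \<one>\<^bsub>G\<^esub>) = \<one>\<^bsub>C\<^esub>" "g \<in> carrier G"
    "\<And>s t. s \<in> carrier G \<Longrightarrow> t \<in> carrier G \<Longrightarrow> \<phi> (Grp s) \<otimes>\<^bsub>C\<^esub> \<phi> (Grp t) = \<phi> (Grp (s \<otimes>\<^bsub>G\<^esub> t))"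
    "\<And>t. t \<in> carrier G \<Longrightarrow> \<phi> Xgen \<otimes>\<^bsub>C\<^esub> \<phi> (Grp t) \<oplus>\<^bsub>C\<^esub> f t \<odot>\<^bsub>C\<^esub> \<phi> (Grp t) =
        \<phi> (Grp t) \<otimes>\<^bsub>C\<^esub> \<phi> Xgen \<oplus>\<^bsub>C\<^esub> f t \<odot>\<^bsub>C\<^esub> \<phi> (Grp (t \<otimes>\<^bsub>G\<^esub> g))"
    "\<phi> Xgen [^]\<^bsub>C\<^esub> CHAR('k) = \<phi> Xgen"
  shows "A3_rep G g (f :: 'g \<Rightarrow> 'k::field) C \<phi>"
proof -
  interpret C: kalg C by fact
  show ?thesis
    unfolding A3_rep_def
    by (intro conjI ballI C.A3_rep_relation) (use assms in auto)
qed

section \<open>The Hopf algebra structure\<close>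

context third_type begin

abbreviation "H \<equiv> A3 G g f"
abbreviation "TT \<equiv> tensor B B"

lemma H_simps:
  "carrier H = carrier B" "mult H = mult B" "one H = one B" "zero H = zero B" "add H = add B"
  "module.smult H = module.smult B"
  by (simp_all add: A3_def Let_def module.extend_def)

lemma kalg_H: "kalg H"
  by (rule kalg_cong[OF kalg_B]) (rule H_simps)+

lemma tensor_H: "tensor H H = TT" "tens H H = tens B B" "tensor_vs H H = tensor_vs B B"
  by (rule tensor_cong; simp only: H_simps)+

sublocale BB: kalg2 B B by (rule kalg2.intro) (rule kalg_B)+
sublocale TT: kalg TT by (rule BB.kalg_tensor)

text \<open>The coproduct of \<open>x\<close>.\<close>

definition cX :: "(('g letter list \<Rightarrow>\<^sub>0 'k) set \<times> ('g letter list \<Rightarrow>\<^sub>0 'k) set \<Rightarrow>\<^sub>0 'k) set" where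
  "cX = tens B B X \<one>\<^bsub>B\<^esub> \<oplus>\<^bsub>TT\<^esub> tens B B (\<tau> g) X"

lemma cX_closed [simp]: "cX \<in> carrier TT" by (simp add: cX_def)

lemma tens_add_left: "a \<in> carrier B \<Longrightarrow> a' \<in> carrier B \<Longrightarrow> b \<in> carrier B \<Longrightarrow>
    tens B B (a \<oplus>\<^bsub>B\<^esub> a') b = tens B B a b \<oplus>\<^bsub>TT\<^esub> tens B B a' b"
  and tens_add_right: "a \<in> carrier B \<Longrightarrow> b \<in> carrier B \<Longrightarrow> b' \<in> carrier B \<Longrightarrow>
    tens B B a (b \<oplus>\<^bsub>B\<^esub> b') = tens B B a b \<oplus>\<^bsub>TT\<^esub> tens B B a b'"
  and tens_smult_left: "a \<in> carrier B \<Longrightarrow> b \<in> carrier B \<Longrightarrow> tens B B (c \<odot>\<^bsub>B\<^esub> a) b = c \<odot>\<^bsub>TT\<^esub> tens B B a b"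
  and tens_smult_right: "a \<in> carrier B \<Longrightarrow> b \<in> carrier B \<Longrightarrow> tens B B a (c \<odot>\<^bsub>B\<^esub> b) = c \<odot>\<^bsub>TT\<^esub> tens B B a b"
  using BB.tensor_bilinear by (simp_all add: bilinear_into_def)

lemma X_g: "X \<otimes>\<^bsub>B\<^esub> \<tau> g \<oplus>\<^bsub>B\<^esub> \<tau> g = \<tau> g \<otimes>\<^bsub>B\<^esub> X \<oplus>\<^bsub>B\<^esub> \<tau> g \<otimes>\<^bsub>B\<^esub> \<tau> g"
  using X_tau[OF g_closed] by (simp add: tau_mult)

sublocale S: skew_sum TT "tens B B X \<one>\<^bsub>B\<^esub>" "tens B B (\<tau> g) \<one>\<^bsub>B\<^esub>" "tens B B \<one>\<^bsub>B\<^esub> X"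
proof
  show "tens B B X \<one>\<^bsub>B\<^esub> \<otimes>\<^bsub>TT\<^esub> tens B B (\<tau> g) \<one>\<^bsub>B\<^esub> \<oplus>\<^bsub>TT\<^esub> tens B B (\<tau> g) \<one>\<^bsub>B\<^esub> =
      tens B B (\<tau> g) \<one>\<^bsub>B\<^esub> \<otimes>\<^bsub>TT\<^esub> tens B B X \<one>\<^bsub>B\<^esub> \<oplus>\<^bsub>TT\<^esub> tens B B (\<tau> g) \<one>\<^bsub>B\<^esub> \<otimes>\<^bsub>TT\<^esub> tens B B (\<tau> g) \<one>\<^bsub>B\<^esub>"
    by (simp add: BB.tensor_mult_tens X_g flip: tens_add_left)
qed (simp_all add: BB.tensor_mult_tens)

lemma cX_eq: "cX = tens B B X \<one>\<^bsub>B\<^esub> \<oplus>\<^bsub>TT\<^esub> tens B B (\<tau> g) \<one>\<^bsub>B\<^esub> \<otimes>\<^bsub>TT\<^esub> tens B B \<one>\<^bsub>B\<^esub> X"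
  by (simp add: cX_def BB.tensor_mult_tens)

lemma alg_hom_pow:
  assumes "kalg C" "kalg D" "alg_hom C D \<phi>" "a \<in> carrier C"
  shows "\<phi> (a [^]\<^bsub>C\<^esub> (n::nat)) = \<phi> a [^]\<^bsub>D\<^esub> n"
proof -
  interpret C: kalg C by fact
  interpret D: kalg D by fact
  show ?thesis
    by (induction n) (simp_all add: alg_hom_one[OF assms(3)] alg_hom_mult[OF assms(3)] assms(4))
qed

lemma cX_pow: "cX [^]\<^bsub>TT\<^esub> CHAR('k) = cX"
  unfolding cX_eq
proof (rule S.artin_skew_sum[OF prime_char])
  show "tens B B X \<one>\<^bsub>B\<^esub> [^]\<^bsub>TT\<^esub> CHAR('k) = tens B B X \<one>\<^bsub>B\<^esub>"
    using alg_hom_pow[OF kalg_B TT.kalg_axioms BB.alg_hom_left gen_closed(2), of "CHAR('k)"] X_pow by simp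
  show "tens B B \<one>\<^bsub>B\<^esub> X [^]\<^bsub>TT\<^esub> CHAR('k) = tens B B \<one>\<^bsub>B\<^esub> X"
    using alg_hom_pow[OF kalg_B TT.kalg_axioms BB.alg_hom_right gen_closed(2), of "CHAR('k)"] X_pow by simp
qed

definition comult_gen :: "'g letter \<Rightarrow> _" where
  "comult_gen = (\<lambda>l. case l of Grp t \<Rightarrow> tens B B (\<tau> t) (\<tau> t) | Xgen \<Rightarrow> cX)"

text \<open>
  The coproducts of the generators satisfy the relations: in \<open>\<Delta>(x) \<Delta>(t)\<close> the summand \<open>x t \<otimes> t\<close>
  contributes the correction in the first factor and \<open>g t \<otimes> x t\<close> the one in the second factor; the
  mixed terms \<open>t g \<otimes> t\<close> cancel.
\<close>

lemma A3_rep_comult: "A3_rep G g f TT comult_gen"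
proof (rule A3_repI[OF TT.kalg_axioms])
  show "comult_gen (Grp \<one>\<^bsub>G\<^esub>) = \<one>\<^bsub>TT\<^esub>" by (simp add: comult_gen_def tau_one tensor_simps)
  fix t assume t: "t \<in> carrier G"
  have tg: "g \<otimes>\<^bsub>G\<^esub> t = t \<otimes>\<^bsub>G\<^esub> g" using t by (rule g_central)
  have "cX \<otimes>\<^bsub>TT\<^esub> tens B B (\<tau> t) (\<tau> t) \<oplus>\<^bsub>TT\<^esub> f t \<odot>\<^bsub>TT\<^esub> tens B B (\<tau> t) (\<tau> t) =
     tens B B (X \<otimes>\<^bsub>B\<^esub> \<tau> t \<oplus>\<^bsub>B\<^esub> f t \<odot>\<^bsub>B\<^esub> \<tau> t) (\<tau> t) \<oplus>\<^bsub>TT\<^esub> tens B B (\<tau> (t \<otimes>\<^bsub>G\<^esub> g)) (X \<otimes>\<^bsub>B\<^esub> \<tau> t)"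
    using t by (simp add: cX_def TT.l_distr BB.tensor_mult_tens tau_mult tg tens_add_left tens_smult_left TT.a_ac)
  also have "\<dots> = tens B B (\<tau> t \<otimes>\<^bsub>B\<^esub> X) (\<tau> t) \<oplus>\<^bsub>TT\<^esub>
      tens B B (\<tau> (t \<otimes>\<^bsub>G\<^esub> g)) (X \<otimes>\<^bsub>B\<^esub> \<tau> t \<oplus>\<^bsub>B\<^esub> f t \<odot>\<^bsub>B\<^esub> \<tau> t)"
    by (subst (1) X_tau[OF t])
      (use t in \<open>simp add: tens_add_left tens_smult_left tens_add_right tens_smult_right TT.a_ac\<close>)
  also have "\<dots> = tens B B (\<tau> t) (\<tau> t) \<otimes>\<^bsub>TT\<^esub> cX \<oplus>\<^bsub>TT\<^esub> f t \<odot>\<^bsub>TT\<^esub> tens B B (\<tau> (t \<otimes>\<^bsub>G\<^esub> g)) (\<tau> (t \<otimes>\<^bsub>G\<^esub> g))"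
    unfolding X_tau[OF t] using t
    by (simp add: cX_def TT.r_distr BB.tensor_mult_tens tau_mult tens_add_right tens_smult_right TT.a_ac)
  finally show "comult_gen Xgen \<otimes>\<^bsub>TT\<^esub> comult_gen (Grp t) \<oplus>\<^bsub>TT\<^esub> f t \<odot>\<^bsub>TT\<^esub> comult_gen (Grp t) =
      comult_gen (Grp t) \<otimes>\<^bsub>TT\<^esub> comult_gen Xgen \<oplus>\<^bsub>TT\<^esub> f t \<odot>\<^bsub>TT\<^esub> comult_gen (Grp (t \<otimes>\<^bsub>G\<^esub> g))"
    by (simp add: comult_gen_def)
qed (auto simp: comult_gen_def BB.tensor_mult_tens tau_mult cX_pow)

lemma comult_eq: "comult H = alg_ext TT comult_gen"
  unfolding comult_gen_def cX_def by (simp add: A3_def Let_def module.extend_def hopf.fields_def)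

lemma alg_hom_comult: "alg_hom B TT (comult H)"
  unfolding comult_eq by (rule alg_hom_alg_ext[OF TT.kalg_axioms A3_rep_comult])

lemma comult_tau: "t \<in> carrier G \<Longrightarrow> comult H (\<tau> t) = tens B B (\<tau> t) (\<tau> t)"
  and comult_X: "comult H X = cX"
  unfolding comult_eq using alg_ext_gen[OF TT.kalg_axioms A3_rep_comult] by (simp_all add: comult_gen_def)

definition counit_gen :: "'g letter \<Rightarrow> 'k" where
  "counit_gen = (\<lambda>l. case l of Grp t \<Rightarrow> 1 | Xgen \<Rightarrow> 0)"

lemma A3_rep_counit: "A3_rep G g f ground counit_gen"
proof (rule A3_repI[OF kalg_ground])
  interpret gr: kalg "ground :: ('k, 'k) module" by (rule kalg_ground)
  obtain n where "CHAR('k) = Suc n" using p_gt_1 by (cases "CHAR('k)") auto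
  then show "counit_gen Xgen [^]\<^bsub>ground\<^esub> CHAR('k) = counit_gen Xgen"
    by (simp add: counit_gen_def)
qed (auto simp: counit_gen_def)

lemma counit_eq: "counit H = alg_ext ground counit_gen"
  by (simp add: A3_def Let_def module.extend_def hopf.fields_def counit_gen_def)

lemma alg_hom_counit: "alg_hom B ground (counit H)"
  unfolding counit_eq by (rule alg_hom_alg_ext[OF kalg_ground A3_rep_counit])

lemma counit_tau: "t \<in> carrier G \<Longrightarrow> counit H (\<tau> t) = 1"
  and counit_X: "counit H X = 0"
  unfolding counit_eq using alg_ext_gen[OF kalg_ground A3_rep_counit] by (simp_all add: counit_gen_def)

definition antipode_gen :: "'g letter \<Rightarrow> _" where
  "antipode_gen = (\<lambda>l. case l of Grp t \<Rightarrow> \<tau> (inv\<^bsub>G\<^esub> t) | Xgen \<Rightarrow> \<ominus>\<^bsub>B\<^esub> (\<tau> (inv\<^bsub>G\<^esub> g) \<otimes>\<^bsub>B\<^esub> X))"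

text \<open>
  \<open>x^p - x\<close> is odd, and \<open>u = g^(-1)\<close> satisfies \<open>[x, u] = u - 1\<close>, so the twisted factorial formula
  gives \<open>(u x)^p - u x = u^p (x^p - x) = 0\<close>.
\<close>

lemma antipode_X_pow: "(\<ominus>\<^bsub>B\<^esub> (\<tau> (inv\<^bsub>G\<^esub> g) \<otimes>\<^bsub>B\<^esub> X)) [^]\<^bsub>B\<^esub> CHAR('k) = \<ominus>\<^bsub>B\<^esub> (\<tau> (inv\<^bsub>G\<^esub> g) \<otimes>\<^bsub>B\<^esub> X)"
proof -
  let ?u = "\<tau> (inv\<^bsub>G\<^esub> g)"
  have "X \<otimes>\<^bsub>B\<^esub> ?u \<oplus>\<^bsub>B\<^esub> (-1) \<odot>\<^bsub>B\<^esub> ?u = ?u \<otimes>\<^bsub>B\<^esub> X \<oplus>\<^bsub>B\<^esub> (-1) \<odot>\<^bsub>B\<^esub> \<one>\<^bsub>B\<^esub>"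
    using X_tau[of "inv\<^bsub>G\<^esub> g"] by (simp add: f_inv tau_one)
  then have e: "X \<otimes>\<^bsub>B\<^esub> ?u \<oplus>\<^bsub>B\<^esub> \<ominus>\<^bsub>B\<^esub> ?u = ?u \<otimes>\<^bsub>B\<^esub> X \<oplus>\<^bsub>B\<^esub> \<ominus>\<^bsub>B\<^esub> \<one>\<^bsub>B\<^esub>"
    by (simp add: B.smult_minus_one)
  have "X \<otimes>\<^bsub>B\<^esub> ?u \<oplus>\<^bsub>B\<^esub> \<one>\<^bsub>B\<^esub> = (X \<otimes>\<^bsub>B\<^esub> ?u \<oplus>\<^bsub>B\<^esub> \<ominus>\<^bsub>B\<^esub> ?u) \<oplus>\<^bsub>B\<^esub> (?u \<oplus>\<^bsub>B\<^esub> \<one>\<^bsub>B\<^esub>)"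
    by (simp add: B.a_assoc B.r_neg1)
  also have "\<dots> = ?u \<otimes>\<^bsub>B\<^esub> X \<oplus>\<^bsub>B\<^esub> ?u"
    unfolding e by (simp add: B.a_assoc B.a_comm[of ?u "\<one>\<^bsub>B\<^esub>"] B.r_neg1)
  finally have rel: "X \<otimes>\<^bsub>B\<^esub> ?u \<oplus>\<^bsub>B\<^esub> \<one>\<^bsub>B\<^esub> = ?u \<otimes>\<^bsub>B\<^esub> X \<oplus>\<^bsub>B\<^esub> ?u" .
  have n: "\<ominus>\<^bsub>B\<^esub> (?u \<otimes>\<^bsub>B\<^esub> X) = pev B (?u \<otimes>\<^bsub>B\<^esub> X) [:0, -1:]"
    by (simp add: B.pev_pCons B.smult_mult_right B.smult_minus_one B.r_minus)
  have "pev B (\<ominus>\<^bsub>B\<^esub> (?u \<otimes>\<^bsub>B\<^esub> X)) artin = \<ominus>\<^bsub>B\<^esub> pev B (?u \<otimes>\<^bsub>B\<^esub> X) artin"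
    unfolding n by (subst B.pev_pcompose[symmetric]) (simp_all add: pcompose_artin_neg B.pev_uminus)
  also have "pev B (?u \<otimes>\<^bsub>B\<^esub> X) artin = ?u [^]\<^bsub>B\<^esub> CHAR('k) \<otimes>\<^bsub>B\<^esub> pev B X artin"
    using B.pev_rfac_twisted[OF _ _ rel, of "CHAR('k)"] by (simp add: rfac_p)
  also have "pev B X artin = \<zero>\<^bsub>B\<^esub>" using B.pev_artin[of X] X_pow by simp
  finally show ?thesis by (subst B.pev_artin[symmetric]) simp_all
qed

lemma A3_rep_antipode: "A3_rep G g f (opp B) antipode_gen"
proof (rule A3_repI[OF kalg_opp[OF kalg_B]])
  show "antipode_gen Xgen [^]\<^bsub>opp B\<^esub> CHAR('k) = antipode_gen Xgen"
    by (subst opp_pow[OF kalg_B]) (simp_all add: antipode_gen_def antipode_X_pow)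
  fix t assume t: "t \<in> carrier G"
  let ?s = "inv\<^bsub>G\<^esub> t" and ?u = "inv\<^bsub>G\<^esub> g"
  have us: "?u \<otimes>\<^bsub>G\<^esub> ?s = ?s \<otimes>\<^bsub>G\<^esub> ?u"
    using t g_central[of t] by (simp flip: G.inv_mult_group)
  have usg: "?u \<otimes>\<^bsub>G\<^esub> (?s \<otimes>\<^bsub>G\<^esub> g) = ?s"
    using t by (simp add: g_central[of ?s, symmetric] flip: G.m_assoc)
  have x: "X \<otimes>\<^bsub>B\<^esub> \<tau> ?s \<oplus>\<^bsub>B\<^esub> (- f t) \<odot>\<^bsub>B\<^esub> \<tau> ?s = \<tau> ?s \<otimes>\<^bsub>B\<^esub> X \<oplus>\<^bsub>B\<^esub> (- f t) \<odot>\<^bsub>B\<^esub> \<tau> (?s \<otimes>\<^bsub>G\<^esub> g)"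
    using X_tau[of ?s] t by (simp add: f_inv)
  let ?S = "(-1) \<odot>\<^bsub>B\<^esub> (\<tau> ?u \<otimes>\<^bsub>B\<^esub> X)"
  have "?S \<otimes>\<^bsub>B\<^esub> \<tau> ?s \<oplus>\<^bsub>B\<^esub> f t \<odot>\<^bsub>B\<^esub> \<tau> (?u \<otimes>\<^bsub>G\<^esub> ?s) =
      (-1) \<odot>\<^bsub>B\<^esub> (\<tau> ?u \<otimes>\<^bsub>B\<^esub> (X \<otimes>\<^bsub>B\<^esub> \<tau> ?s \<oplus>\<^bsub>B\<^esub> (- f t) \<odot>\<^bsub>B\<^esub> \<tau> ?s))"
    using t by (simp add: B.smult_mult_left B.smult_mult_right B.m_assoc B.r_distr B.smult_r_distr B.smult_smult tau_mult)
  also have "\<dots> = \<tau> ?s \<otimes>\<^bsub>B\<^esub> ?S \<oplus>\<^bsub>B\<^esub> f t \<odot>\<^bsub>B\<^esub> \<tau> ?s"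
    unfolding x using t
    by (simp add: B.smult_mult_left B.smult_mult_right B.r_distr B.smult_r_distr B.smult_smult tau_mult usg us
        flip: B.m_assoc)
  finally show "antipode_gen Xgen \<otimes>\<^bsub>opp B\<^esub> antipode_gen (Grp t) \<oplus>\<^bsub>opp B\<^esub> f t \<odot>\<^bsub>opp B\<^esub> antipode_gen (Grp t) =
     antipode_gen (Grp t) \<otimes>\<^bsub>opp B\<^esub> antipode_gen Xgen \<oplus>\<^bsub>opp B\<^esub> f t \<odot>\<^bsub>opp B\<^esub> antipode_gen (Grp (t \<otimes>\<^bsub>G\<^esub> g))"
    using t by (simp add: antipode_gen_def B.smult_minus_one G.inv_mult_group)
qed (auto simp: antipode_gen_def tau_mult tau_one G.inv_mult_group)

lemma antipode_eq: "antipode H = alg_ext (opp B) antipode_gen"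
  by (simp add: A3_def Let_def module.extend_def hopf.fields_def antipode_gen_def)

lemma alg_hom_antipode: "alg_hom B (opp B) (antipode H)"
  unfolding antipode_eq by (rule alg_hom_alg_ext[OF kalg_opp[OF kalg_B] A3_rep_antipode])

lemma antipode_tau: "t \<in> carrier G \<Longrightarrow> antipode H (\<tau> t) = \<tau> (inv\<^bsub>G\<^esub> t)"
  and antipode_X: "antipode H X = \<ominus>\<^bsub>B\<^esub> (\<tau> (inv\<^bsub>G\<^esub> g) \<otimes>\<^bsub>B\<^esub> X)"
  unfolding antipode_eq using alg_ext_gen[OF kalg_opp[OF kalg_B] A3_rep_antipode]
  by (simp_all add: antipode_gen_def)

lemma hopf_closed_H: "hopf_closed H"
  using alg_hom_closed[OF alg_hom_comult] alg_hom_closed[OF alg_hom_antipode] kalg_vs[OF kalg_H]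
  by (simp add: hopf_closed_def H_simps tensor_H)

end

section \<open>Hopf homomorphisms induced by group homomorphisms\<close>

text \<open>
  A homomorphism of groups that is compatible with the data induces a Hopf homomorphism fixing
  \<open>x\<close>.
\<close>

locale third_type_map = S: third_type G g f + T: third_type G' g' f'
  for G :: "('g, 'm) monoid_scheme" and g and f :: "'g \<Rightarrow> 'k::field"
    and G' :: "('h, 'n) monoid_scheme" and g' and f' :: "'h \<Rightarrow> 'k" +
  fixes \<theta> :: "'g \<Rightarrow> 'h"
  assumes hom: "\<theta> \<in> hom G G'" and theta_g: "\<theta> g = g'" and theta_f: "t \<in> carrier G \<Longrightarrow> f' (\<theta> t) = f t"
begin

lemma theta_closed [simp]: "t \<in> carrier G \<Longrightarrow> \<theta> t \<in> carrier G'"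
  and theta_mult: "s \<in> carrier G \<Longrightarrow> t \<in> carrier G \<Longrightarrow> \<theta> (s \<otimes>\<^bsub>G\<^esub> t) = \<theta> s \<otimes>\<^bsub>G'\<^esub> \<theta> t"
  using hom by (auto simp: hom_def)

sublocale gh: group_hom G G' \<theta> by unfold_locales (rule hom)

definition amap_gen :: "'g letter \<Rightarrow> ('h letter list \<Rightarrow>\<^sub>0 'k) set" where
  "amap_gen l = (case l of Grp t \<Rightarrow> T.\<tau> (\<theta> t) | Xgen \<Rightarrow> T.X)"

definition amap :: "('g letter list \<Rightarrow>\<^sub>0 'k) set \<Rightarrow> ('h letter list \<Rightarrow>\<^sub>0 'k) set" where
  "amap = alg_ext T.B amap_gen"

lemma A3_rep_amap: "A3_rep G g f T.B amap_gen"
proof (rule A3_repI[OF T.kalg_B])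
  fix t assume t: "t \<in> carrier G"
  then show "amap_gen Xgen \<otimes>\<^bsub>T.B\<^esub> amap_gen (Grp t) \<oplus>\<^bsub>T.B\<^esub> f t \<odot>\<^bsub>T.B\<^esub> amap_gen (Grp t) =
      amap_gen (Grp t) \<otimes>\<^bsub>T.B\<^esub> amap_gen Xgen \<oplus>\<^bsub>T.B\<^esub> f t \<odot>\<^bsub>T.B\<^esub> amap_gen (Grp (t \<otimes>\<^bsub>G\<^esub> g))"
    using T.X_tau[of "\<theta> t"] by (simp add: amap_gen_def theta_mult theta_g theta_f)
qed (auto simp: amap_gen_def T.tau_one T.tau_mult theta_mult T.X_pow)

lemma alg_hom_amap: "alg_hom S.B T.B amap"
  unfolding amap_def by (rule S.alg_hom_alg_ext[OF T.kalg_B A3_rep_amap])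

lemma amap_tau: "t \<in> carrier G \<Longrightarrow> amap (S.\<tau> t) = T.\<tau> (\<theta> t)" and amap_X: "amap S.X = T.X"
  unfolding amap_def using S.alg_ext_gen[OF T.kalg_B A3_rep_amap] by (simp_all add: amap_gen_def)

lemma amap_closed: "u \<in> carrier S.B \<Longrightarrow> amap u \<in> carrier T.B"
  by (rule alg_hom_closed[OF alg_hom_amap])

lemma hopf_hom_amap: "amap \<in> hopf_hom S.H T.H"
  unfolding hopf_hom_iff
proof (intro conjI ballI)
  note l = alg_hom_lin[OF alg_hom_amap]
  show "alg_hom S.H T.H amap"
    using alg_hom_amap by (simp add: alg_hom_def lin_def S.H_simps T.H_simps)
  fix u assume "u \<in> carrier S.H"
  then have u: "u \<in> carrier S.B" by (simp add: S.H_simps)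
  have tm: "alg_hom S.TT T.TT (tmap T.B T.B amap amap)"
    by (rule alg_hom_tmap[OF S.BB.kalg2_axioms T.BB.kalg2_axioms alg_hom_amap alg_hom_amap])
  note tt = tmap_tens[OF S.BB.vs2_axioms T.BB.vs2_axioms l l]
  have "comult T.H (amap u) = tmap T.B T.B amap amap (comult S.H u)"
  proof (rule S.alg_hom_eqI[OF T.TT.kalg_axioms alg_hom_comp[OF alg_hom_amap T.alg_hom_comult]
        alg_hom_comp[OF S.alg_hom_comult tm] _ _ u])
    fix t assume t: "t \<in> carrier G"
    then show "comult T.H (amap (S.\<tau> t)) = tmap T.B T.B amap amap (comult S.H (S.\<tau> t))"
      by (simp add: amap_tau T.comult_tau S.comult_tau tt)
  next
    show "comult T.H (amap S.X) = tmap T.B T.B amap amap (comult S.H S.X)"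
      by (simp add: amap_X T.comult_X S.comult_X tt S.cX_def T.cX_def lin_add[OF alg_hom_lin[OF tm]]
          amap_tau theta_g alg_hom_one[OF alg_hom_amap])
  qed
  then show "comult T.H (amap u) = tmap T.H T.H amap amap (comult S.H u)"
    by (simp add: tmap_def T.tensor_H)
  show "counit T.H (amap u) = counit S.H u"
    by (rule S.alg_hom_eqI[OF kalg_ground alg_hom_comp[OF alg_hom_amap T.alg_hom_counit] S.alg_hom_counit _ _ u])
      (simp_all add: amap_X amap_tau T.counit_tau S.counit_tau T.counit_X S.counit_X)
  have ao: "alg_hom (opp S.B) (opp T.B) amap"
    using alg_hom_amap by (simp add: alg_hom_def lin_def)
  show "antipode T.H (amap u) = amap (antipode S.H u)"
    by (rule S.alg_hom_eqI[OF kalg_opp[OF T.kalg_B] alg_hom_comp[OF alg_hom_amap T.alg_hom_antipode]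
        alg_hom_comp[OF S.alg_hom_antipode ao] _ _ u])
     (simp_all add: amap_X amap_tau T.antipode_tau S.antipode_tau T.antipode_X S.antipode_X
       S.B.lin_neg[OF T.B.vs_axioms l] alg_hom_mult[OF alg_hom_amap] theta_g gh.hom_inv)
qed

end

section \<open>Grouplike and skew-primitive elements\<close>

lemma finsum_ground: "finite T \<Longrightarrow> (\<Oplus>\<^bsub>ground\<^esub>x\<in>T. h x) = (\<Sum>x\<in>T. h x :: 'k::field)"
proof (induction T rule: finite_induct)
  case empty
  interpret vs "ground :: ('k, 'k) module" by (rule vs_ground)
  show ?case using finsum_empty[of h] by simp
next
  case (insert x F)
  interpret vs "ground :: ('k, 'k) module" by (rule vs_ground)
  show ?case using insert finsum_insert[of F x h] by simp
qed

lemma (in skew_sum) lin_Tsum: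
  assumes "lin B ground \<phi>" shows "\<phi> (Tsum q n) = (\<Sum>j\<le>n. \<phi> (T j (q j)))"
  by (induction n) (simp_all add: lin_add[OF assms])

context third_type begin

lemma tau_pow: "t \<in> carrier G \<Longrightarrow> \<tau> t [^]\<^bsub>B\<^esub> (n::nat) = \<tau> (t [^]\<^bsub>G\<^esub> n)"
  by (induction n) (simp_all add: tau_one tau_mult)

lemma pcoord_tau: "s \<in> carrier G \<Longrightarrow> t \<in> carrier G \<Longrightarrow> pcoord t (\<tau> s) = (if t = s then 1 else 0)"
  using pcoord_basis[of s t 1] p_gt_1 by simp

lemma pcoord_one: "t \<in> carrier G \<Longrightarrow> pcoord t \<one>\<^bsub>B\<^esub> = (if t = \<one>\<^bsub>G\<^esub> then 1 else 0)"
  using pcoord_tau[of "\<one>\<^bsub>G\<^esub>" t] by (simp add: tau_one)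

lemma pcoord_X: "t \<in> carrier G \<Longrightarrow> pcoord t X = (if t = \<one>\<^bsub>G\<^esub> then [:0, 1:] else 0)"
  using pcoord_basis[of "\<one>\<^bsub>G\<^esub>" t "[:0, 1:]"] p_gt_1 by (simp add: tau_one)

lemma pcoord_zero: "pcoord t \<zero>\<^bsub>B\<^esub> = 0"
  using pcoord_smult[of "\<zero>\<^bsub>B\<^esub>" t 0] by simp

lemma pcoord_minus: "u \<in> carrier B \<Longrightarrow> v \<in> carrier B \<Longrightarrow> pcoord t (u \<ominus>\<^bsub>B\<^esub> v) = pcoord t u - pcoord t v"
  using pcoord_add[of u "(-1) \<odot>\<^bsub>B\<^esub> v" t] pcoord_smult[of v t "-1"]
  by (simp add: a_minus_def B.smult_minus_one)

lemma tau_inj: "s \<in> carrier G \<Longrightarrow> t \<in> carrier G \<Longrightarrow> \<tau> s = \<tau> t \<longleftrightarrow> s = t"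
  using pcoord_tau[of s s] pcoord_tau[of t s] by (auto split: if_splits)

text \<open>The coefficient of \<open>t x^a \<otimes> s x^b\<close>.\<close>

definition coord2 :: "'g \<Rightarrow> nat \<Rightarrow> 'g \<Rightarrow> nat \<Rightarrow> (('g letter list \<Rightarrow>\<^sub>0 'k) set \<times> ('g letter list \<Rightarrow>\<^sub>0 'k) set \<Rightarrow>\<^sub>0 'k) set \<Rightarrow> 'k" where
  "coord2 t a s b = tensor_lift ground (\<lambda>u v. coord t a u * coord s b v)"

lemma coord2_bilinear: "bilinear_into B B ground (\<lambda>u v. coord t a u * coord s b v)"
  using lin_coord[of t a] lin_coord[of s b] by (simp add: bilinear_into_def lin_def algebra_simps)

lemma lin_coord2: "lin TT ground (coord2 t a s b)"
  unfolding coord2_def by (rule BB.lin_tensor_lift'[OF vs_ground coord2_bilinear])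

lemma coord2_tens: "u \<in> carrier B \<Longrightarrow> v \<in> carrier B \<Longrightarrow> coord2 t a s b (tens B B u v) = coord t a u * coord s b v"
  unfolding coord2_def by (rule BB.tensor_lift_tens[OF vs_ground coord2_bilinear])

lemma coord2_add: "Y \<in> carrier TT \<Longrightarrow> Z \<in> carrier TT \<Longrightarrow> coord2 t a s b (Y \<oplus>\<^bsub>TT\<^esub> Z) = coord2 t a s b Y + coord2 t a s b Z"
  using lin_add[OF lin_coord2] by simp

lemma S_T: "S.T j q = tens B B (\<tau> (g [^]\<^bsub>G\<^esub> j) \<otimes>\<^bsub>B\<^esub> pev B X q) (pev B X (rfac j))"
proof -
  have 1: "tens B B (\<tau> g) \<one>\<^bsub>B\<^esub> [^]\<^bsub>TT\<^esub> j = tens B B (\<tau> (g [^]\<^bsub>G\<^esub> j)) \<one>\<^bsub>B\<^esub>"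
    using alg_hom_pow[OF kalg_B TT.kalg_axioms BB.alg_hom_left, of "\<tau> g" j] by (simp add: tau_pow)
  have 2: "pev TT (tens B B X \<one>\<^bsub>B\<^esub>) q = tens B B (pev B X q) \<one>\<^bsub>B\<^esub>"
    by (rule alg_hom_pev[OF kalg_B TT.kalg_axioms BB.alg_hom_left, symmetric]) simp
  have 3: "pev TT (tens B B \<one>\<^bsub>B\<^esub> X) q = tens B B \<one>\<^bsub>B\<^esub> (pev B X q)" for q
    by (rule alg_hom_pev[OF kalg_B TT.kalg_axioms BB.alg_hom_right, symmetric]) simp
  show ?thesis unfolding S.T_def 1 2 3 by (simp add: BB.tensor_mult_tens)
qed

lemma coord_basis:
  assumes "r \<in> carrier G" "t \<in> carrier G" "degree q < CHAR('k)"
  shows "coord t a (\<tau> r \<otimes>\<^bsub>B\<^esub> pev B X q) = (if t = r then coeff q a else 0)"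
  using pcoord_basis[OF assms] by (simp add: coord_def)

text \<open>
  In the coproduct formula the \<open>j\<close>-th term has degree \<open>m - j\<close> on the left and \<open>j\<close> on the right, so
  in total degree at least \<open>m\<close> it contributes only \<open>(m choose j) r g^j x^(m-j) \<otimes> r x^j\<close>.
\<close>

lemma coord2_comult_ffac:
  assumes r: "r \<in> carrier G" and t: "t \<in> carrier G" and s: "s \<in> carrier G" and m: "m < CHAR('k)" "m \<le> a + b"
  shows "coord2 t a s b (comult H (\<tau> r \<otimes>\<^bsub>B\<^esub> pev B X (ffac m 0))) =
    (if a + b = m \<and> r = s \<and> t = r \<otimes>\<^bsub>G\<^esub> g [^]\<^bsub>G\<^esub> b then of_nat (m choose b) else 0)"
proof -
  let ?R = "tens B B (\<tau> r) (\<tau> r)"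
  let ?q = "\<lambda>j. Polynomial.smult (of_nat (m choose j)) (ffac m j) :: 'k poly"
  have "comult H (\<tau> r \<otimes>\<^bsub>B\<^esub> pev B X (ffac m 0)) = ?R \<otimes>\<^bsub>TT\<^esub> pev TT cX (ffac m 0)"
    using r by (simp add: alg_hom_mult[OF alg_hom_comult] comult_tau comult_X
      alg_hom_pev[OF kalg_B TT.kalg_axioms alg_hom_comult])
  also have "pev TT cX (ffac m 0) = S.Tsum ?q m"
    unfolding cX_eq by (rule S.pev_ffac)
  finally have e: "comult H (\<tau> r \<otimes>\<^bsub>B\<^esub> pev B X (ffac m 0)) = ?R \<otimes>\<^bsub>TT\<^esub> S.Tsum ?q m" .
  have l: "lin TT ground (\<lambda>Y. coord2 t a s b (?R \<otimes>\<^bsub>TT\<^esub> Y))"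
    by (rule lin_comp[OF TT.lin_mult_left lin_coord2]) (use r in simp)
  have "coord2 t a s b (?R \<otimes>\<^bsub>TT\<^esub> S.Tsum ?q m) = (\<Sum>j\<le>m. coord2 t a s b (?R \<otimes>\<^bsub>TT\<^esub> S.T j (?q j)))"
    by (rule S.lin_Tsum[OF l])
  also have "\<dots> = (\<Sum>j\<le>m. if j = b then (if a + b = m \<and> r = s \<and> t = r \<otimes>\<^bsub>G\<^esub> g [^]\<^bsub>G\<^esub> b then of_nat (m choose b) else 0) else 0)"
  proof (rule sum.cong[OF refl])
    fix j assume j: "j \<in> {..m}"
    have dq: "degree (?q j) < CHAR('k)"
      using j m(1) degree_smult_le[of "of_nat (m choose j)" "ffac m j :: 'k poly"] by (simp add: degree_ffac)
    have "?R \<otimes>\<^bsub>TT\<^esub> S.T j (?q j) =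
        tens B B (\<tau> (r \<otimes>\<^bsub>G\<^esub> g [^]\<^bsub>G\<^esub> j) \<otimes>\<^bsub>B\<^esub> pev B X (?q j)) (\<tau> r \<otimes>\<^bsub>B\<^esub> pev B X (rfac j))"
      unfolding S_T using r by (simp add: BB.tensor_mult_tens tau_mult flip: B.m_assoc)
    then have "coord2 t a s b (?R \<otimes>\<^bsub>TT\<^esub> S.T j (?q j)) =
        (if t = r \<otimes>\<^bsub>G\<^esub> g [^]\<^bsub>G\<^esub> j then coeff (?q j) a else 0) * (if s = r then coeff (rfac j) b else 0)"
      using r t s dq j m(1) by (simp add: coord2_tens coord_basis degree_rfac)
    also have "\<dots> = (if j = b then (if a + b = m \<and> r = s \<and> t = r \<otimes>\<^bsub>G\<^esub> g [^]\<^bsub>G\<^esub> b then of_nat (m choose b) else 0) else 0)"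
    proof -
      consider "j < b" | "b < j" | "j = b" by linarith
      then show ?thesis
      proof cases
        case 1
        then have "coeff (rfac j :: 'k poly) b = 0" by (intro coeff_eq_0) (simp add: degree_rfac)
        then show ?thesis using 1 by simp
      next
        case 2
        then have "coeff (ffac m j :: 'k poly) a = 0" using m(2) j by (intro coeff_eq_0) (simp add: degree_ffac)
        then show ?thesis using 2 by simp
      next
        case 3
        show ?thesis
        proof (cases "a + b = m")
          case True
          then have a: "a = m - j" using 3 by simp
          have "coeff (ffac m j :: 'k poly) a = 1" unfolding a by (rule lead_coeff_ffac)
          then show ?thesis using 3 True by (simp add: lead_coeff_rfac)
        next
          case False
          then have "coeff (ffac m j :: 'k poly) a = 0" using m(2) j 3 by (intro coeff_eq_0) (simp add: degree_ffac)
          then show ?thesis using 3 False by simp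
        qed
      qed
    qed
    finally show "coord2 t a s b (?R \<otimes>\<^bsub>TT\<^esub> S.T j (?q j)) = \<dots>" .
  qed
  also have "\<dots> = (if a + b = m \<and> r = s \<and> t = r \<otimes>\<^bsub>G\<^esub> g [^]\<^bsub>G\<^esub> b then of_nat (m choose b) else 0)"
    by simp
  finally show ?thesis unfolding e .
qed

text \<open>
  Subtracting the leading coefficient times the falling factorial lowers the degree, so only the
  leading coefficient matters in total degree \<open>m\<close>.
\<close>

lemma coord2_comult_basis:
  assumes r: "r \<in> carrier G" and t: "t \<in> carrier G" and s: "s \<in> carrier G"
  shows "degree q \<le> m \<Longrightarrow> m < CHAR('k) \<Longrightarrow> m \<le> a + b \<Longrightarrow>
    coord2 t a s b (comult H (\<tau> r \<otimes>\<^bsub>B\<^esub> pev B X q)) =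
    (if a + b = m \<and> r = s \<and> t = r \<otimes>\<^bsub>G\<^esub> g [^]\<^bsub>G\<^esub> b then of_nat (m choose b) * coeff q m else 0)"
proof (induction m arbitrary: q)
  have L: "lin B ground (\<lambda>u. coord2 t a s b (comult H u))"
    by (rule lin_comp[OF alg_hom_lin[OF alg_hom_comult] lin_coord2])
  have sm: "coord2 t a s b (comult H (\<tau> r \<otimes>\<^bsub>B\<^esub> pev B X (Polynomial.smult c q))) =
      c * coord2 t a s b (comult H (\<tau> r \<otimes>\<^bsub>B\<^esub> pev B X q))" for c q
    using lin_smult[OF L, of "\<tau> r \<otimes>\<^bsub>B\<^esub> pev B X q" c] r by (simp add: B.pev_smult B.smult_mult_right)
  have ad: "coord2 t a s b (comult H (\<tau> r \<otimes>\<^bsub>B\<^esub> pev B X (q + q'))) =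
      coord2 t a s b (comult H (\<tau> r \<otimes>\<^bsub>B\<^esub> pev B X q)) + coord2 t a s b (comult H (\<tau> r \<otimes>\<^bsub>B\<^esub> pev B X q'))" for q q'
    using lin_add[OF L, of "\<tau> r \<otimes>\<^bsub>B\<^esub> pev B X q" "\<tau> r \<otimes>\<^bsub>B\<^esub> pev B X q'"] r by (simp add: B.pev_add B.r_distr)
  {
    case 0
    then have "q = Polynomial.smult (coeff q 0) (ffac 0 0)"
      by (simp add: degree_eq_zeroE) (metis degree_eq_zeroE coeff_pCons_0)
    then show ?case using 0 coord2_comult_ffac[OF r t s, of 0 a b] sm[of "coeff q 0" "ffac 0 0"]
      by (metis (no_types, lifting) mult.commute mult_zero_right)
  next
    case (Suc m)
    define q' where "q' = q - Polynomial.smult (coeff q (Suc m)) (ffac (Suc m) 0)"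
    have dq': "degree q' \<le> m"
    proof (rule degree_le, intro allI impI)
      fix i assume i: "m < i"
      show "coeff q' i = 0"
      proof (cases "i = Suc m")
        case True
        have "coeff (ffac (Suc m) 0 :: 'k poly) (Suc m - 0) = 1" by (rule lead_coeff_ffac)
        then show ?thesis using True by (simp add: q'_def)
      next
        case False
        then show ?thesis using i Suc.prems(1) by (simp add: q'_def coeff_eq_0 degree_ffac)
      qed
    qed
    have q: "q = q' + Polynomial.smult (coeff q (Suc m)) (ffac (Suc m) 0)"
      by (simp add: q'_def)
    have "coord2 t a s b (comult H (\<tau> r \<otimes>\<^bsub>B\<^esub> pev B X q')) = 0"
      using Suc.IH[OF dq'] Suc.prems by simp
    then have "coord2 t a s b (comult H (\<tau> r \<otimes>\<^bsub>B\<^esub> pev B X q)) =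
        coeff q (Suc m) * coord2 t a s b (comult H (\<tau> r \<otimes>\<^bsub>B\<^esub> pev B X (ffac (Suc m) 0)))"
      by (subst q) (simp add: ad sm)
    then show ?case
      using coord2_comult_ffac[OF r t s Suc.prems(2,3)] by simp
  }
qed

text \<open>
  If \<open>u\<close> has degree at most \<open>n\<close> in \<open>x\<close>, its coproduct has total degree at most \<open>n\<close>, and the terms
  of total degree \<open>n\<close> are \<open>(n choose b) c s g^b x^(n-b) \<otimes> s x^b\<close> with \<open>c\<close> the coefficient of
  \<open>s x^n\<close> in \<open>u\<close>.
\<close>

lemma coord2_comult:
  assumes u: "u \<in> carrier B" and t: "t \<in> carrier G" and s: "s \<in> carrier G"
    and n: "\<And>r. r \<in> carrier G \<Longrightarrow> degree (pcoord r u) \<le> n" "n < CHAR('k)" "n \<le> a + b"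
  shows "coord2 t a s b (comult H u) =
    (if a + b = n \<and> t = s \<otimes>\<^bsub>G\<^esub> g [^]\<^bsub>G\<^esub> b then of_nat (n choose b) * coord s n u else 0)"
proof -
  have L: "lin B ground (\<lambda>u. coord2 t a s b (comult H u))"
    by (rule lin_comp[OF alg_hom_lin[OF alg_hom_comult] lin_coord2])
  have "coord2 t a s b (comult H u) = coord2 t a s b (comult H (\<Oplus>\<^bsub>B\<^esub>r\<in>carrier G. \<tau> r \<otimes>\<^bsub>B\<^esub> pev B X (pcoord r u)))"
    using expansion[OF u] by simp
  also have "\<dots> = (\<Sum>r\<in>carrier G. coord2 t a s b (comult H (\<tau> r \<otimes>\<^bsub>B\<^esub> pev B X (pcoord r u))))"
    by (subst lin_finsum[OF B.vs_axioms vs_ground L finite_G]) (auto simp: finsum_ground[OF finite_G])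
  also have "\<dots> = (\<Sum>r\<in>carrier G. if r = s then (if a + b = n \<and> t = s \<otimes>\<^bsub>G\<^esub> g [^]\<^bsub>G\<^esub> b then of_nat (n choose b) * coord s n u else 0) else 0)"
    by (rule sum.cong) (use coord2_comult_basis[OF _ t s n(1) n(2,3)] in \<open>auto simp: coord_def\<close>)
  finally show ?thesis using s finite_G by simp
qed

lemma degree_bound:
  "\<exists>n<CHAR('k). (\<forall>r\<in>carrier G. degree (pcoord r u) \<le> n) \<and> (\<exists>r\<in>carrier G. degree (pcoord r u) = n)"
proof -
  let ?D = "(\<lambda>r. degree (pcoord r u)) ` carrier G"
  have D: "finite ?D" "?D \<noteq> {}" using finite_G G.one_closed by auto
  have "Max ?D \<in> ?D" by (rule Max_in[OF D])
  then obtain r where r: "r \<in> carrier G" "Max ?D = degree (pcoord r u)" by blast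
  show ?thesis
  proof (intro exI[of _ "Max ?D"] conjI ballI)
    show "Max ?D < CHAR('k)" using r degree_pcoord by simp
    show "\<exists>r\<in>carrier G. degree (pcoord r u) = Max ?D" using r by auto
    show "degree (pcoord s u) \<le> Max ?D" if "s \<in> carrier G" for s
      by (rule Max_ge[OF D(1)]) (use that in blast)
  qed
qed

lemma pcoord_degree_0: "degree (pcoord t u) = 0 \<Longrightarrow> pcoord t u = [:coord t 0 u:]"
  by (metis degree_eq_zeroE coeff_pCons_0 coord_def)

text \<open>
  If \<open>u\<close> has degree \<open>n > 0\<close> then \<open>u \<otimes> u\<close> has terms of total degree \<open>2 n\<close> while \<open>\<Delta>(u)\<close> has none. So
  \<open>u = \<Sum> c_t t\<close>, and \<open>\<Delta>(u) = u \<otimes> u\<close> says that the \<open>c_t\<close> are orthogonal idempotents of the field: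
  exactly one of them is \<open>1\<close>.
\<close>

theorem grouplike:
  assumes u: "u \<in> carrier B" "u \<noteq> \<zero>\<^bsub>B\<^esub>" "comult H u = tens B B u u"
  shows "\<exists>t\<in>carrier G. u = \<tau> t"
proof -
  obtain n where n: "n < CHAR('k)" "\<And>r. r \<in> carrier G \<Longrightarrow> degree (pcoord r u) \<le> n"
    "\<exists>r\<in>carrier G. degree (pcoord r u) = n" using degree_bound[of u] by blast
  have e: "coord t a u * coord s b u =
      (if a + b = n \<and> t = s \<otimes>\<^bsub>G\<^esub> g [^]\<^bsub>G\<^esub> b then of_nat (n choose b) * coord s n u else 0)"
    if "t \<in> carrier G" "s \<in> carrier G" "n \<le> a + b" for t s a b
    using coord2_comult[OF u(1) that(1,2) n(2,1) that(3)] u by (simp add: coord2_tens)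
  have n0: "n = 0"
  proof (rule ccontr)
    assume "n \<noteq> 0"
    obtain r where r: "r \<in> carrier G" "degree (pcoord r u) = n" using n(3) by blast
    have "coord r n u * coord r n u = 0" using e[OF r(1,1), of n n] \<open>n \<noteq> 0\<close> by simp
    then have "lead_coeff (pcoord r u) = 0" by (simp add: coord_def r(2))
    then have "pcoord r u = 0" by (simp only: leading_coeff_0_iff)
    then show False using r(2) \<open>n \<noteq> 0\<close> by simp
  qed
  have d: "pcoord r u = [:coord r 0 u:]" if "r \<in> carrier G" for r
    using n(2)[OF that] n0 by (intro pcoord_degree_0) simp
  have e0: "coord t 0 u * coord s 0 u = (if t = s then coord s 0 u else 0)" if "t \<in> carrier G" "s \<in> carrier G" for t s
    using e[OF that, of 0 0] that n0 by simp
  have "\<exists>s\<in>carrier G. coord s 0 u \<noteq> 0"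
  proof (rule ccontr)
    assume "\<not> (\<exists>s\<in>carrier G. coord s 0 u \<noteq> 0)"
    then have "u = \<zero>\<^bsub>B\<^esub>" by (intro pcoord_eqI u(1)) (auto simp: d pcoord_zero)
    then show False using u(2) by simp
  qed
  then obtain s where s: "s \<in> carrier G" "coord s 0 u \<noteq> 0" by blast
  have 1: "coord s 0 u = 1" using e0[OF s(1,1)] s(2) by simp
  have "u = \<tau> s"
  proof (rule pcoord_eqI[OF u(1)])
    fix t assume t: "t \<in> carrier G"
    show "pcoord t u = pcoord t (\<tau> s)"
      using e0[OF t s(1)] 1 by (auto simp: d t pcoord_tau s one_pCons)
  qed (use s in simp)
  then show ?thesis using s(1) by blast
qed

text \<open>
  Degree \<open>n \<ge> 2\<close> is impossible: the term of \<open>\<Delta>(u)\<close> at \<open>s g x^(n-1) \<otimes> s x\<close> is \<open>n\<close> times the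
  coefficient of \<open>s x^n\<close>, which is nonzero for a leading term as \<open>n < p\<close>, and \<open>u \<otimes> 1 + c \<otimes> u\<close> has
  no such term. In degree \<open>1\<close> the coefficients of \<open>s x\<close> with \<open>s \<noteq> 1\<close> vanish, and the term at
  \<open>g \<otimes> x\<close> shows \<open>c = g\<close> when \<open>x\<close> occurs. After subtracting \<open>d x\<close> the element is a combination of
  group elements, where the equation leaves only the multiples of \<open>1 - c\<close>.
\<close>

theorem skew_primitive:
  assumes u: "u \<in> carrier B" and c: "c \<in> carrier G"
    and cu: "comult H u = tens B B u \<one>\<^bsub>B\<^esub> \<oplus>\<^bsub>TT\<^esub> tens B B (\<tau> c) u"
  shows "\<exists>d b. u = d \<odot>\<^bsub>B\<^esub> X \<oplus>\<^bsub>B\<^esub> b \<odot>\<^bsub>B\<^esub> (\<one>\<^bsub>B\<^esub> \<ominus>\<^bsub>B\<^esub> \<tau> c) \<and> (d \<noteq> 0 \<longrightarrow> c = g)"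
proof -
  have x1: "coord s b \<one>\<^bsub>B\<^esub> = (if s = \<one>\<^bsub>G\<^esub> \<and> b = 0 then 1 else 0)" if "s \<in> carrier G" for s b
    using that by (simp add: coord_def pcoord_one)
  have xc: "coord s b (\<tau> c) = (if s = c \<and> b = 0 then 1 else 0)" if "s \<in> carrier G" for s b
    using that c by (simp add: coord_def pcoord_tau)
  have E: "coord t a v * (if s = \<one>\<^bsub>G\<^esub> \<and> b = 0 then 1 else 0) + (if t = c \<and> a = 0 then 1 else 0) * coord s b v =
      (if a + b = n \<and> t = s \<otimes>\<^bsub>G\<^esub> g [^]\<^bsub>G\<^esub> b then of_nat (n choose b) * coord s n v else 0)"
    if "v \<in> carrier B" "comult H v = tens B B v \<one>\<^bsub>B\<^esub> \<oplus>\<^bsub>TT\<^esub> tens B B (\<tau> c) v"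
      "\<And>r. r \<in> carrier G \<Longrightarrow> degree (pcoord r v) \<le> n" "n < CHAR('k)" "t \<in> carrier G" "s \<in> carrier G" "n \<le> a + b" for v n t s a b
    using coord2_comult[OF that(1,5,6,3,4,7)] that c by (simp add: coord2_add coord2_tens x1 xc)
  obtain n where n: "n < CHAR('k)" "\<And>r. r \<in> carrier G \<Longrightarrow> degree (pcoord r u) \<le> n"
    "\<exists>r\<in>carrier G. degree (pcoord r u) = n" using degree_bound[of u] by blast
  have n1: "n \<le> 1"
  proof (rule ccontr)
    assume n2: "\<not> n \<le> 1"
    obtain s where s: "s \<in> carrier G" "degree (pcoord s u) = n" using n(3) by blast
    have "(of_nat n :: 'k) * coord s n u = 0"
      using E[OF u cu n(2,1), of "s \<otimes>\<^bsub>G\<^esub> g" s "n - 1" 1] n2 s by simp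
    moreover have "(of_nat n :: 'k) \<noteq> 0" using of_nat_eq_iff[of n 0] n(1) n2 by simp
    ultimately have "lead_coeff (pcoord s u) = 0" by (simp add: coord_def s(2))
    then have "pcoord s u = 0" by (simp only: leading_coeff_0_iff)
    then show False using s(2) n2 by simp
  qed
  have d1: "degree (pcoord r u) \<le> 1" if "r \<in> carrier G" for r using n(2)[OF that] n1 by simp
  have p1: "1 < CHAR('k)" by (rule p_gt_1)
  define d where "d = coord \<one>\<^bsub>G\<^esub> 1 u"
  have h1: "coord s 1 u = 0" if "s \<in> carrier G" "s \<noteq> \<one>\<^bsub>G\<^esub>" for s
    using E[OF u cu d1 p1, of s s 1 0] that by simp
  have dg: "d \<noteq> 0 \<Longrightarrow> c = g"
    using E[OF u cu d1 p1, of g "\<one>\<^bsub>G\<^esub>" 0 1] by (auto simp: d_def split: if_splits)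
  define v where "v = u \<oplus>\<^bsub>B\<^esub> (- d) \<odot>\<^bsub>B\<^esub> X"
  have vB: "v \<in> carrier B" using u by (simp add: v_def)
  have kv: "pcoord r v = pcoord r u + Polynomial.smult (- d) (if r = \<one>\<^bsub>G\<^esub> then [:0, 1:] else 0)" if "r \<in> carrier G" for r
    using u that by (simp add: v_def pcoord_add pcoord_smult pcoord_X)
  have dv: "degree (pcoord r v) \<le> 0" if r: "r \<in> carrier G" for r
  proof (rule degree_le, intro allI impI)
    fix i :: nat assume "0 < i"
    show "coeff (pcoord r v) i = 0"
    proof (cases "i = 1")
      case True
      then show ?thesis using h1[OF r] by (auto simp: kv r coord_def d_def)
    next
      case False
      then obtain j where "i = Suc (Suc j)" using \<open>0 < i\<close> by (metis One_nat_def not0_implies_Suc not_gr_zero)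
      then show ?thesis using d1[OF r] by (simp add: kv r coeff_eq_0)
    qed
  qed
  have cv: "comult H v = tens B B v \<one>\<^bsub>B\<^esub> \<oplus>\<^bsub>TT\<^esub> tens B B (\<tau> c) v"
  proof (cases "d = 0")
    case True
    then have "v = u" using u by (simp add: v_def)
    then show ?thesis using cu by simp
  next
    case False
    then have "c = g" by (rule dg)
    have "comult H v = comult H u \<oplus>\<^bsub>TT\<^esub> (- d) \<odot>\<^bsub>TT\<^esub> cX"
      unfolding v_def using u lin_add[OF alg_hom_lin[OF alg_hom_comult]] lin_smult[OF alg_hom_lin[OF alg_hom_comult]]
      by (simp add: comult_X)
    also have "\<dots> = tens B B v \<one>\<^bsub>B\<^esub> \<oplus>\<^bsub>TT\<^esub> tens B B (\<tau> c) v"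
      unfolding cu v_def cX_def \<open>c = g\<close> using u
      by (simp add: tens_add_left tens_add_right tens_smult_left tens_smult_right TT.smult_r_distr TT.a_ac)
    finally show ?thesis .
  qed
  have E0: "coord t 0 v * (if s = \<one>\<^bsub>G\<^esub> then 1 else 0) + (if t = c then 1 else 0) * coord s 0 v = (if t = s then coord s 0 v else 0)"
    if "t \<in> carrier G" "s \<in> carrier G" for t s
    using E[OF vB cv dv _ that, of 0 0] that p1 by simp
  \<comment> \<open>for \<open>c = 1\<close> the element \<open>1 - c\<close> is zero and the equation gives \<open>v = 0\<close>, so any \<open>b\<close> will do\<close>
  define b where "b = (if c = \<one>\<^bsub>G\<^esub> then 0 else coord \<one>\<^bsub>G\<^esub> 0 v)"
  have "v = b \<odot>\<^bsub>B\<^esub> (\<one>\<^bsub>B\<^esub> \<ominus>\<^bsub>B\<^esub> \<tau> c)"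
  proof (rule pcoord_eqI[OF vB])
    fix t assume t: "t \<in> carrier G"
    have "pcoord t v = [:coord t 0 v:]" by (rule pcoord_degree_0) (use dv[OF t] in simp)
    moreover have "pcoord t (b \<odot>\<^bsub>B\<^esub> (\<one>\<^bsub>B\<^esub> \<ominus>\<^bsub>B\<^esub> \<tau> c)) =
        [:b * ((if t = \<one>\<^bsub>G\<^esub> then 1 else 0) - (if t = c then 1 else 0)):]"
      using t c by (auto simp: pcoord_smult pcoord_minus pcoord_one pcoord_tau one_pCons)
    moreover have "coord t 0 v = b * ((if t = \<one>\<^bsub>G\<^esub> then 1 else 0) - (if t = c then 1 else 0))"
    proof (cases "c = \<one>\<^bsub>G\<^esub>")
      case True
      have "(2 :: 'k) \<noteq> 1" by (metis add_cancel_right_right one_add_one zero_neq_one)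
      then show ?thesis using True E0[OF t t] E0[OF t G.one_closed] by (auto simp: b_def split: if_splits)
    next
      case False
      then show ?thesis using E0[OF t t] E0[OF t G.one_closed] t
        by (auto simp: b_def eq_neg_iff_add_eq_0 split: if_splits)
    qed
    ultimately show "pcoord t v = pcoord t (b \<odot>\<^bsub>B\<^esub> (\<one>\<^bsub>B\<^esub> \<ominus>\<^bsub>B\<^esub> \<tau> c))" by simp
  qed (use c in simp)
  moreover have "u = d \<odot>\<^bsub>B\<^esub> X \<oplus>\<^bsub>B\<^esub> v"
    using u by (simp add: v_def B.smult_minus_left B.a_lcomm[of "d \<odot>\<^bsub>B\<^esub> X" u] B.r_neg)
  ultimately show ?thesis using dg by blast
qed

end

section \<open>Isomorphisms and the groups of grouplike elements\<close>

locale third_type_pair = S: third_type G g f + T: third_type G' g' f'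
  for G :: "('g, 'm) monoid_scheme" and g and f :: "'g \<Rightarrow> 'k::field"
    and G' :: "('h, 'n) monoid_scheme" and g' and f' :: "'h \<Rightarrow> 'k"

text \<open>The image is grouplike, and nonzero by injectivity.\<close>

lemma (in third_type_pair) hopf_hom_grouplike:
  assumes hom: "\<phi> \<in> hopf_hom S.H T.H" and inj: "inj_on \<phi> (carrier S.H)" and t: "t \<in> carrier G"
  shows "\<exists>s\<in>carrier G'. \<phi> (S.\<tau> t) = T.\<tau> s"
proof -
  have h: "alg_hom S.B T.B \<phi>"
    using hom by (simp add: hopf_hom_iff alg_hom_def lin_def S.H_simps T.H_simps)
  note l = alg_hom_lin[OF h]
  have c: "\<phi> (S.\<tau> t) \<in> carrier T.B" using alg_hom_closed[OF h] t by simp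
  have "comult T.H (\<phi> (S.\<tau> t)) = tmap T.B T.B \<phi> \<phi> (tens S.B S.B (S.\<tau> t) (S.\<tau> t))"
    using hom t by (simp add: hopf_hom_iff S.H_simps S.comult_tau tmap_def T.tensor_H)
  then have "comult T.H (\<phi> (S.\<tau> t)) = tens T.B T.B (\<phi> (S.\<tau> t)) (\<phi> (S.\<tau> t))"
    using t by (simp add: tmap_tens[OF S.BB.vs2_axioms T.BB.vs2_axioms l l])
  moreover have "\<phi> (S.\<tau> t) \<noteq> \<zero>\<^bsub>T.B\<^esub>"
  proof
    assume "\<phi> (S.\<tau> t) = \<zero>\<^bsub>T.B\<^esub>"
    then have "\<phi> (S.\<tau> t) = \<phi> \<zero>\<^bsub>S.B\<^esub>" by (simp add: S.B.lin_zero[OF T.B.vs_axioms l])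
    then have "S.\<tau> t = \<zero>\<^bsub>S.B\<^esub>" using inj t by (simp add: inj_on_eq_iff S.H_simps)
    then show False using S.pcoord_tau[OF t t] S.pcoord_zero[of t] by simp
  qed
  ultimately show ?thesis using T.grouplike[OF c] by blast
qed

text \<open>
  The image \<open>w\<close> of \<open>x\<close> is skew-primitive with respect to \<open>c = \<Theta>(g)\<close>, so \<open>w = d x + b (1 - c)\<close>. If
  \<open>d\<close> were \<open>0\<close>, then \<open>w\<close> would commute with \<open>c\<close>, whereas the relation at \<open>t = g\<close> demands that the
  commutator be \<open>c (1 - c) \<noteq> 0\<close>. So \<open>c = g'\<close>; now \<open>1 - g'\<close> is central, and comparing coefficients
  in the relation at \<open>t\<close> gives \<open>f(t) = d f'(\<Theta>(t))\<close>. At \<open>t = g\<close> this is \<open>1 = d\<close>.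
\<close>

theorem (in third_type_pair) hopf_iso_imp_group_iso:
  assumes iso: "\<phi> \<in> hopf_iso S.H T.H"
  shows "\<exists>\<Theta>\<in>iso G G'. \<Theta> g = g' \<and> (\<forall>t\<in>carrier G. f' (\<Theta> t) = f t) \<and> (\<forall>t\<in>carrier G. \<phi> (S.\<tau> t) = T.\<tau> (\<Theta> t))"
proof -
  interpret R: third_type_pair G' g' f' G g f ..
  have hom: "\<phi> \<in> hopf_hom S.H T.H" and bij: "bij_betw \<phi> (carrier S.H) (carrier T.H)"
    using iso by (auto simp: hopf_iso_def)
  have inj: "inj_on \<phi> (carrier S.H)" using bij by (simp add: bij_betw_def)
  have h: "alg_hom S.B T.B \<phi>"
    using hom by (simp add: hopf_hom_iff alg_hom_def lin_def S.H_simps T.H_simps)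
  note l = alg_hom_lin[OF h]
  have inj': "\<phi> a = \<phi> b \<longleftrightarrow> a = b" if "a \<in> carrier S.B" "b \<in> carrier S.B" for a b
    using inj that by (simp add: inj_on_eq_iff S.H_simps)
  have "\<forall>t\<in>carrier G. \<exists>s. s \<in> carrier G' \<and> \<phi> (S.\<tau> t) = T.\<tau> s"
    using hopf_hom_grouplike[OF hom inj] by blast
  then obtain \<Theta> where \<Theta>: "\<And>t. t \<in> carrier G \<Longrightarrow> \<Theta> t \<in> carrier G'" "\<And>t. t \<in> carrier G \<Longrightarrow> \<phi> (S.\<tau> t) = T.\<tau> (\<Theta> t)"
    by metis
  have mult: "\<Theta> (s \<otimes>\<^bsub>G\<^esub> t) = \<Theta> s \<otimes>\<^bsub>G'\<^esub> \<Theta> t" if "s \<in> carrier G" "t \<in> carrier G" for s t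
  proof -
    have "T.\<tau> (\<Theta> (s \<otimes>\<^bsub>G\<^esub> t)) = \<phi> (S.\<tau> s \<otimes>\<^bsub>S.B\<^esub> S.\<tau> t)" using that by (simp add: S.tau_mult \<Theta>)
    also have "\<dots> = T.\<tau> (\<Theta> s \<otimes>\<^bsub>G'\<^esub> \<Theta> t)" using that by (simp add: alg_hom_mult[OF h] \<Theta> T.tau_mult)
    finally show ?thesis using that \<Theta> by (simp add: T.tau_inj)
  qed
  have injT: "inj_on \<Theta> (carrier G)"
  proof (rule inj_onI)
    fix s t assume st: "s \<in> carrier G" "t \<in> carrier G" "\<Theta> s = \<Theta> t"
    then have "\<phi> (S.\<tau> s) = \<phi> (S.\<tau> t)" by (simp add: \<Theta>)
    then show "s = t" using st by (simp add: inj' S.tau_inj)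
  qed
  have surjT: "\<Theta> ` carrier G = carrier G'"
  proof (intro equalityI subsetI)
    fix s assume s: "s \<in> carrier G'"
    let ?i = "inv_into (carrier S.H) \<phi>"
    have i: "?i \<in> hopf_iso T.H S.H"
      by (rule hopf_iso_inv[OF S.hopf_closed_H T.hopf_closed_H iso])
    then have "\<exists>t\<in>carrier G. ?i (T.\<tau> s) = S.\<tau> t"
      by (intro R.hopf_hom_grouplike s) (auto simp: hopf_iso_def bij_betw_def)
    then obtain t where t: "t \<in> carrier G" "?i (T.\<tau> s) = S.\<tau> t" by blast
    have "\<phi> (?i (T.\<tau> s)) = T.\<tau> s"
      using bij s by (simp add: bij_betw_inv_into_right T.H_simps)
    then have "T.\<tau> (\<Theta> t) = T.\<tau> s" using t by (simp add: \<Theta>)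
    then have "s = \<Theta> t" using s t \<Theta> by (simp add: T.tau_inj)
    then show "s \<in> \<Theta> ` carrier G" using t by blast
  qed (use \<Theta> in auto)
  have iso\<Theta>: "\<Theta> \<in> iso G G'"
    using \<Theta>(1) mult injT surjT by (auto simp: iso_def hom_def bij_betw_def)
  let ?c = "\<Theta> g"
  have c: "?c \<in> carrier G'" by (simp add: \<Theta>)
  have c1: "?c \<noteq> \<one>\<^bsub>G'\<^esub>"
  proof
    assume "?c = \<one>\<^bsub>G'\<^esub>"
    then have "\<phi> (S.\<tau> g) = \<phi> (S.\<tau> \<one>\<^bsub>G\<^esub>)" by (simp add: \<Theta> T.tau_one S.tau_one alg_hom_one[OF h])
    then show False using S.g_ne_one by (simp add: inj' S.tau_inj)
  qed
  let ?w = "\<phi> S.X"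
  have w: "?w \<in> carrier T.B" using alg_hom_closed[OF h] by simp
  have tt: "tmap T.B T.B \<phi> \<phi> (tens S.B S.B a b) = tens T.B T.B (\<phi> a) (\<phi> b)" if "a \<in> carrier S.B" "b \<in> carrier S.B" for a b
    by (rule tmap_tens[OF S.BB.vs2_axioms T.BB.vs2_axioms l l that])
  have "comult T.H ?w = tmap T.B T.B \<phi> \<phi> S.cX"
    using hom by (simp add: hopf_hom_iff S.H_simps S.comult_X tmap_def T.tensor_H)
  also have "\<dots> = tens T.B T.B ?w \<one>\<^bsub>T.B\<^esub> \<oplus>\<^bsub>T.TT\<^esub> tens T.B T.B (T.\<tau> ?c) ?w"
    by (simp add: S.cX_def lin_add[OF lin_tmap[OF S.BB.vs2_axioms T.BB.vs2_axioms l l]] tt alg_hom_one[OF h] \<Theta>)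
  finally obtain d b where db: "?w = d \<odot>\<^bsub>T.B\<^esub> T.X \<oplus>\<^bsub>T.B\<^esub> b \<odot>\<^bsub>T.B\<^esub> (\<one>\<^bsub>T.B\<^esub> \<ominus>\<^bsub>T.B\<^esub> T.\<tau> ?c)" "d \<noteq> 0 \<longrightarrow> ?c = g'"
    using T.skew_primitive[OF w c] by blast
  have rel: "?w \<otimes>\<^bsub>T.B\<^esub> T.\<tau> (\<Theta> t) \<oplus>\<^bsub>T.B\<^esub> f t \<odot>\<^bsub>T.B\<^esub> T.\<tau> (\<Theta> t) =
      T.\<tau> (\<Theta> t) \<otimes>\<^bsub>T.B\<^esub> ?w \<oplus>\<^bsub>T.B\<^esub> f t \<odot>\<^bsub>T.B\<^esub> T.\<tau> (\<Theta> t \<otimes>\<^bsub>G'\<^esub> ?c)" if t: "t \<in> carrier G" for t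
  proof -
    have "\<phi> (S.X \<otimes>\<^bsub>S.B\<^esub> S.\<tau> t \<oplus>\<^bsub>S.B\<^esub> f t \<odot>\<^bsub>S.B\<^esub> S.\<tau> t) = \<phi> (S.\<tau> t \<otimes>\<^bsub>S.B\<^esub> S.X \<oplus>\<^bsub>S.B\<^esub> f t \<odot>\<^bsub>S.B\<^esub> S.\<tau> (t \<otimes>\<^bsub>G\<^esub> g))"
      using S.X_tau[OF t] by simp
    then show ?thesis
      using t by (simp add: lin_add[OF l] lin_smult[OF l] alg_hom_mult[OF h] \<Theta> mult)
  qed
  have kw: "T.pcoord s (?w \<otimes>\<^bsub>T.B\<^esub> T.\<tau> r) + T.pcoord s (f t \<odot>\<^bsub>T.B\<^esub> T.\<tau> r) =
      T.pcoord s (T.\<tau> r \<otimes>\<^bsub>T.B\<^esub> ?w) + T.pcoord s (f t \<odot>\<^bsub>T.B\<^esub> T.\<tau> (r \<otimes>\<^bsub>G'\<^esub> ?c))" if "r = \<Theta> t" "t \<in> carrier G" for s r t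
    using arg_cong[OF rel[OF that(2)], of "T.pcoord s"] that w c \<Theta> by (simp add: T.pcoord_add)
  have comm: "?w \<otimes>\<^bsub>T.B\<^esub> T.\<tau> r \<oplus>\<^bsub>T.B\<^esub> d \<odot>\<^bsub>T.B\<^esub> (T.\<tau> r \<otimes>\<^bsub>T.B\<^esub> T.X) = T.\<tau> r \<otimes>\<^bsub>T.B\<^esub> ?w \<oplus>\<^bsub>T.B\<^esub> d \<odot>\<^bsub>T.B\<^esub> (T.X \<otimes>\<^bsub>T.B\<^esub> T.\<tau> r)"
    if r: "r \<in> carrier G'" and rc: "r \<otimes>\<^bsub>G'\<^esub> ?c = ?c \<otimes>\<^bsub>G'\<^esub> r" for r
  proof -
    have z: "(\<one>\<^bsub>T.B\<^esub> \<ominus>\<^bsub>T.B\<^esub> T.\<tau> ?c) \<otimes>\<^bsub>T.B\<^esub> T.\<tau> r = T.\<tau> r \<otimes>\<^bsub>T.B\<^esub> (\<one>\<^bsub>T.B\<^esub> \<ominus>\<^bsub>T.B\<^esub> T.\<tau> ?c)"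
      using r c by (simp add: a_minus_def T.B.l_distr T.B.r_distr T.B.l_minus T.B.r_minus T.tau_mult rc)
    show ?thesis
      unfolding db(1) using r c z
      by (simp add: T.B.l_distr T.B.r_distr T.B.smult_mult_left T.B.smult_mult_right T.B.a_ac)
  qed
  have d0: "d \<noteq> 0"
  proof
    assume d: "d = 0"
    have "?w \<otimes>\<^bsub>T.B\<^esub> T.\<tau> ?c = T.\<tau> ?c \<otimes>\<^bsub>T.B\<^esub> ?w" using comm[OF c refl] d w c by simp
    then have "T.pcoord ?c (T.\<tau> ?c) = T.pcoord ?c (T.\<tau> (?c \<otimes>\<^bsub>G'\<^esub> ?c))"
      using kw[of ?c g ?c] c by (simp add: T.pcoord_smult)
    then show False using c c1 by (simp add: T.pcoord_tau split: if_splits)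
  qed
  then have cg: "?c = g'" using db(2) by blast
  have df: "f t = d * f' (\<Theta> t)" if t: "t \<in> carrier G" for t
  proof -
    let ?r = "\<Theta> t"
    have r: "?r \<in> carrier G'" using t \<Theta> by simp
    have rg: "?r \<otimes>\<^bsub>G'\<^esub> g' \<noteq> ?r" using r T.g_ne_one by simp
    have k0: "T.pcoord ?r (T.\<tau> ?r) = 1" "T.pcoord ?r (T.\<tau> (?r \<otimes>\<^bsub>G'\<^esub> g')) = 0" using r rg by (simp_all add: T.pcoord_tau)
    have "T.pcoord ?r (?w \<otimes>\<^bsub>T.B\<^esub> T.\<tau> ?r) + [:f t:] = T.pcoord ?r (T.\<tau> ?r \<otimes>\<^bsub>T.B\<^esub> ?w)"
      using kw[OF refl t, of ?r] r k0 by (simp add: T.pcoord_smult cg)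
    moreover have "T.pcoord ?r (?w \<otimes>\<^bsub>T.B\<^esub> T.\<tau> ?r) + Polynomial.smult d (T.pcoord ?r (T.\<tau> ?r \<otimes>\<^bsub>T.B\<^esub> T.X)) =
        T.pcoord ?r (T.\<tau> ?r \<otimes>\<^bsub>T.B\<^esub> ?w) + Polynomial.smult d (T.pcoord ?r (T.X \<otimes>\<^bsub>T.B\<^esub> T.\<tau> ?r))"
      using arg_cong[OF comm[OF r], of "T.pcoord ?r"] r w T.g_central[OF r] by (simp add: T.pcoord_add T.pcoord_smult cg)
    moreover have "T.pcoord ?r (T.X \<otimes>\<^bsub>T.B\<^esub> T.\<tau> ?r) + [:f' ?r:] = T.pcoord ?r (T.\<tau> ?r \<otimes>\<^bsub>T.B\<^esub> T.X)"
      using arg_cong[OF T.X_tau[OF r], of "T.pcoord ?r"] r k0 by (simp add: T.pcoord_add T.pcoord_smult)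
    moreover have "[:x:] = Polynomial.smult d [:y:]"
      if "P + [:x:] = Q" "P + Polynomial.smult d M = Q + Polynomial.smult d N" "N + [:y:] = M"
      for x y and P Q M N :: "'k poly"
    proof -
      have "P + (Polynomial.smult d N + Polynomial.smult d [:y:]) = P + (Polynomial.smult d N + [:x:])"
        using that(2) unfolding that(1)[symmetric] that(3)[symmetric] smult_add_right by (simp only: ac_simps)
      then show ?thesis by (simp only: add_left_cancel)
    qed
    ultimately have "[:f t:] = Polynomial.smult d [:f' ?r:]" by blast
    then show ?thesis by simp
  qed
  have "d = 1" using df[OF S.g_closed] cg by simp
  then have "\<forall>t\<in>carrier G. f' (\<Theta> t) = f t" using df by simp
  then show ?thesis using iso\<Theta> cg \<Theta>(2) by blast
qed

lemma alg_hom_ident: "alg_hom B B (\<lambda>u. u)"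
  by (simp add: alg_hom_def lin_def)

lemma (in third_type_map) hopf_iso_amap:
  assumes iso: "\<theta> \<in> iso G G'"
  shows "amap \<in> hopf_iso S.H T.H"
proof -
  let ?i = "inv_into (carrier G) \<theta>"
  have bij: "bij_betw \<theta> (carrier G) (carrier G')" using iso by (simp add: iso_def)
  have i: "?i \<in> hom G' G" using S.G.iso_set_sym[OF iso] by (simp add: iso_def)
  have fi: "\<theta> (?i t) = t" if "t \<in> carrier G'" for t using bij that by (rule bij_betw_inv_into_right)
  have if': "?i (\<theta> t) = t" if "t \<in> carrier G" for t using bij that by (rule bij_betw_inv_into_left)
  have ic: "?i t \<in> carrier G" if "t \<in> carrier G'" for t using i that by (auto simp: hom_def)
  interpret R: third_type_map G' g' f' G g f ?i
  proof unfold_locales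
    show "?i g' = g" using if'[OF S.g_closed] theta_g by simp
    show "f (?i t) = f' t" if "t \<in> carrier G'" for t using theta_f[OF ic[OF that]] fi[OF that] by simp
  qed (rule i)
  have 1: "R.amap (amap u) = u" if "u \<in> carrier S.B" for u
    by (rule S.alg_hom_eqI[OF S.kalg_B alg_hom_comp[OF alg_hom_amap R.alg_hom_amap] alg_hom_ident _ _ that])
      (simp_all add: amap_tau amap_X R.amap_tau R.amap_X if')
  have 2: "amap (R.amap u) = u" if "u \<in> carrier T.B" for u
    by (rule T.alg_hom_eqI[OF T.kalg_B alg_hom_comp[OF R.alg_hom_amap alg_hom_amap] alg_hom_ident _ _ that])
      (simp_all add: amap_tau amap_X R.amap_tau R.amap_X fi ic)
  have "bij_betw amap (carrier S.H) (carrier T.H)"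
    by (rule bij_betw_byWitness[where f' = R.amap])
      (use 1 2 amap_closed R.amap_closed in \<open>auto simp: S.H_simps T.H_simps\<close>)
  then show ?thesis using hopf_hom_amap by (simp add: hopf_iso_def)
qed

theorem (in third_type_pair) hopf_isomorphic_iff:
  "hopf_isomorphic S.H T.H \<longleftrightarrow> (\<exists>\<Theta>\<in>iso G G'. \<Theta> g = g' \<and> (\<forall>t\<in>carrier G. f' (\<Theta> t) = f t))"
proof
  assume "hopf_isomorphic S.H T.H"
  then obtain \<phi> where "\<phi> \<in> hopf_iso S.H T.H" by (auto simp: hopf_isomorphic_def)
  from hopf_iso_imp_group_iso[OF this]
  show "\<exists>\<Theta>\<in>iso G G'. \<Theta> g = g' \<and> (\<forall>t\<in>carrier G. f' (\<Theta> t) = f t)" by blast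
next
  assume "\<exists>\<Theta>\<in>iso G G'. \<Theta> g = g' \<and> (\<forall>t\<in>carrier G. f' (\<Theta> t) = f t)"
  then obtain \<Theta> where \<Theta>: "\<Theta> \<in> iso G G'" "\<Theta> g = g'" "\<forall>t\<in>carrier G. f' (\<Theta> t) = f t" by blast
  interpret M: third_type_map G g f G' g' f' \<Theta>
    by unfold_locales (use \<Theta> in \<open>auto simp: iso_def\<close>)
  show "hopf_isomorphic S.H T.H"
    using M.hopf_iso_amap[OF \<Theta>(1)] by (auto simp: hopf_isomorphic_def)
qed

section \<open>The bicrossed product of groups\<close>

locale matched_datum = Gam: group \<Gamma> + third_type G g f
  for \<Gamma> :: "'h monoid" and G :: "'g monoid" and g and f :: "'g \<Rightarrow> 'k::field" +
  fixes l :: "'g \<Rightarrow> 'h \<Rightarrow> 'h" and r :: "'g \<Rightarrow> 'h \<Rightarrow> 'g" and \<gamma> :: "'h \<Rightarrow> 'k"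
  assumes fin_Gam: "finite (carrier \<Gamma>)" and mdatum: "matched_pair_datum \<Gamma> G g f l r \<gamma>"
begin

lemma gmp: "group_matched_pair \<Gamma> G l r"
  using mdatum by (simp add: matched_pair_datum_def)

lemma
  shows l_closed [simp]: "t \<in> carrier G \<Longrightarrow> h \<in> carrier \<Gamma> \<Longrightarrow> l t h \<in> carrier \<Gamma>"
    and r_closed [simp]: "t \<in> carrier G \<Longrightarrow> h \<in> carrier \<Gamma> \<Longrightarrow> r t h \<in> carrier G"
    and l_one [simp]: "h \<in> carrier \<Gamma> \<Longrightarrow> l \<one>\<^bsub>G\<^esub> h = h"
    and l_mult: "s \<in> carrier G \<Longrightarrow> t \<in> carrier G \<Longrightarrow> h \<in> carrier \<Gamma> \<Longrightarrow> l (s \<otimes>\<^bsub>G\<^esub> t) h = l s (l t h)"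
    and r_one [simp]: "t \<in> carrier G \<Longrightarrow> r t \<one>\<^bsub>\<Gamma>\<^esub> = t"
    and r_mult: "t \<in> carrier G \<Longrightarrow> h \<in> carrier \<Gamma> \<Longrightarrow> k \<in> carrier \<Gamma> \<Longrightarrow> r t (h \<otimes>\<^bsub>\<Gamma>\<^esub> k) = r (r t h) k"
    and l_prod: "t \<in> carrier G \<Longrightarrow> h \<in> carrier \<Gamma> \<Longrightarrow> k \<in> carrier \<Gamma> \<Longrightarrow> l t (h \<otimes>\<^bsub>\<Gamma>\<^esub> k) = l t h \<otimes>\<^bsub>\<Gamma>\<^esub> l (r t h) k"
    and r_prod: "t \<in> carrier G \<Longrightarrow> s \<in> carrier G \<Longrightarrow> h \<in> carrier \<Gamma> \<Longrightarrow> r (t \<otimes>\<^bsub>G\<^esub> s) h = r t (l s h) \<otimes>\<^bsub>G\<^esub> r s h"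
  using gmp by (simp_all add: group_matched_pair_def)

lemma
  shows l_g [simp]: "h \<in> carrier \<Gamma> \<Longrightarrow> l g h = h" and r_g [simp]: "h \<in> carrier \<Gamma> \<Longrightarrow> r g h = g"
    and gam_k_sub: "h \<in> carrier \<Gamma> \<Longrightarrow> \<gamma> h \<in> k_sub G g"
    and gam_mult: "h \<in> carrier \<Gamma> \<Longrightarrow> k \<in> carrier \<Gamma> \<Longrightarrow> \<gamma> (h \<otimes>\<^bsub>\<Gamma>\<^esub> k) = \<gamma> h + \<gamma> k"
    and f_r: "t \<in> carrier G \<Longrightarrow> h \<in> carrier \<Gamma> \<Longrightarrow> f (r t h) = f t + \<gamma> (l t h) - \<gamma> h"
  using mdatum by (simp_all add: matched_pair_datum_def)

lemma gam_one [simp]: "\<gamma> \<one>\<^bsub>\<Gamma>\<^esub> = 0"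
  using gam_mult[of "\<one>\<^bsub>\<Gamma>\<^esub>" "\<one>\<^bsub>\<Gamma>\<^esub>"] by (metis Gam.one_closed Gam.r_one add_cancel_right_right)

lemma l_at_one [simp]: "t \<in> carrier G \<Longrightarrow> l t \<one>\<^bsub>\<Gamma>\<^esub> = \<one>\<^bsub>\<Gamma>\<^esub>"
  using l_prod[of t "\<one>\<^bsub>\<Gamma>\<^esub>" "\<one>\<^bsub>\<Gamma>\<^esub>"] Gam.r_cancel_one'[of "l t \<one>\<^bsub>\<Gamma>\<^esub>" "l t \<one>\<^bsub>\<Gamma>\<^esub>"] by simp

lemma r_at_one [simp]: "h \<in> carrier \<Gamma> \<Longrightarrow> r \<one>\<^bsub>G\<^esub> h = \<one>\<^bsub>G\<^esub>"
  using r_prod[of "\<one>\<^bsub>G\<^esub>" "\<one>\<^bsub>G\<^esub>" h] G.r_cancel_one'[of "r \<one>\<^bsub>G\<^esub> h" "r \<one>\<^bsub>G\<^esub> h"] by simp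

abbreviation "\<Lambda> \<equiv> group_bicrossed \<Gamma> G l r"
abbreviation "F \<equiv> assoc_fun f \<gamma>"

lemma Lam_simps [simp]:
  "carrier \<Lambda> = carrier \<Gamma> \<times> carrier G" "(h, t) \<otimes>\<^bsub>\<Lambda>\<^esub> (k, s) = (h \<otimes>\<^bsub>\<Gamma>\<^esub> l t k, r t k \<otimes>\<^bsub>G\<^esub> s)"
  "\<one>\<^bsub>\<Lambda>\<^esub> = (\<one>\<^bsub>\<Gamma>\<^esub>, \<one>\<^bsub>G\<^esub>)"
  by (simp_all add: group_bicrossed_def)

lemma group_Lam: "group \<Lambda>"
proof (rule groupI)
  fix x y z assume "x \<in> carrier \<Lambda>" "y \<in> carrier \<Lambda>" "z \<in> carrier \<Lambda>"
  then show "x \<otimes>\<^bsub>\<Lambda>\<^esub> y \<otimes>\<^bsub>\<Lambda>\<^esub> z = x \<otimes>\<^bsub>\<Lambda>\<^esub> (y \<otimes>\<^bsub>\<Lambda>\<^esub> z)"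
    by (cases x; cases y; cases z) (simp add: Gam.m_assoc G.m_assoc l_prod r_prod l_mult r_mult)
next
  fix x assume "x \<in> carrier \<Lambda>"
  then obtain h t where x: "x = (h, t)" "h \<in> carrier \<Gamma>" "t \<in> carrier G" by auto
  let ?a = "l (inv\<^bsub>G\<^esub> t) (inv\<^bsub>\<Gamma>\<^esub> h)" and ?b = "r (inv\<^bsub>G\<^esub> t) (inv\<^bsub>\<Gamma>\<^esub> h)"
  have "?a \<otimes>\<^bsub>\<Gamma>\<^esub> l ?b h = \<one>\<^bsub>\<Gamma>\<^esub>"
    using x l_prod[of "inv\<^bsub>G\<^esub> t" "inv\<^bsub>\<Gamma>\<^esub> h" h] by simp
  moreover have "r ?b h \<otimes>\<^bsub>G\<^esub> t = \<one>\<^bsub>G\<^esub>"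
    using x r_mult[of "inv\<^bsub>G\<^esub> t" "inv\<^bsub>\<Gamma>\<^esub> h" h] by simp
  ultimately show "\<exists>y\<in>carrier \<Lambda>. y \<otimes>\<^bsub>\<Lambda>\<^esub> x = \<one>\<^bsub>\<Lambda>\<^esub>"
    using x by (intro bexI[of _ "(?a, ?b)"]) simp_all
next
  fix x y assume "x \<in> carrier \<Lambda>" "y \<in> carrier \<Lambda>"
  then show "x \<otimes>\<^bsub>\<Lambda>\<^esub> y \<in> carrier \<Lambda>" by auto
qed auto

lemma k_sub_diff:
  assumes "a \<in> k_sub G g" "b \<in> k_sub G g" shows "(a - b :: 'k) \<in> k_sub G g"
proof -
  have "(a + (- b)) ^ CHAR('k) = a ^ CHAR('k) + (- b) ^ CHAR('k)"
    by (rule freshmans_dream[OF prime_char refl])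
  then show ?thesis using assms
    by (auto simp: k_sub_iff[OF G.group_axioms g_closed] minus_power_p)
qed

lemma Lam_pow: "(\<one>\<^bsub>\<Gamma>\<^esub>, t) [^]\<^bsub>\<Lambda>\<^esub> (n::nat) = (\<one>\<^bsub>\<Gamma>\<^esub>, t [^]\<^bsub>G\<^esub> n)" if "t \<in> carrier G"
proof -
  interpret Lm: group \<Lambda> by (rule group_Lam)
  show ?thesis
  proof (induction n)
    case (Suc n)
    then show ?case using that Lm.nat_pow_Suc[of "(\<one>\<^bsub>\<Gamma>\<^esub>, t)" n] by simp
  qed simp
qed

text \<open>
  Centrality of \<open>g\<close> in \<open>\<Lambda>\<close> uses that \<open>g\<close> acts trivially and is fixed by the right action;
  additivity of \<open>F(h,t) = f(t) - \<gamma>(h)\<close> is the compatibility \<open>f(t \<triangleleft> h) = f(t) + \<gamma>(t \<triangleright> h) - \<gamma>(h)\<close>.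
\<close>

lemma third_type_Lam: "third_type \<Lambda> (\<one>\<^bsub>\<Gamma>\<^esub>, g) F"
proof (rule third_type.intro[OF group_Lam], unfold_locales)
  have k: "F y \<in> k_sub \<Lambda> (\<one>\<^bsub>\<Gamma>\<^esub>, g)" if "y \<in> carrier \<Lambda>" for y
  proof -
    have "F y \<in> k_sub G g"
      using that k_sub_diff f_k_sub gam_k_sub by (auto simp: assoc_fun_def)
    then show ?thesis
      using k_sub_iff[OF group_Lam, of "(\<one>\<^bsub>\<Gamma>\<^esub>, g)" "F y"] by (simp add: k_sub_iff[OF G.group_axioms g_closed] Lam_pow)
  qed
  show "third_type_datum \<Lambda> (\<one>\<^bsub>\<Gamma>\<^esub>, g) F"
    unfolding third_type_datum_def
    using group_Lam k fin_Gam finite_G g_central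
    by (auto simp: assoc_fun_def f_mult gam_mult f_r)
qed (rule prime_char)

sublocale D: third_type \<Lambda> "(\<one>\<^bsub>\<Gamma>\<^esub>, g)" F by (rule third_type_Lam)

text \<open>
  A constant rather than an abstraction, so that the laws of homomorphisms apply as rewrite rules
  only to terms that mention it.
\<close>

definition emb :: "'g \<Rightarrow> 'h \<times> 'g" where
  "emb t = (\<one>\<^bsub>\<Gamma>\<^esub>, t)"

sublocale J: third_type_map G g f \<Lambda> "(\<one>\<^bsub>\<Gamma>\<^esub>, g)" F emb
  by unfold_locales (auto simp: emb_def hom_def assoc_fun_def)

lemma j_tau: "t \<in> carrier G \<Longrightarrow> J.amap (\<tau> t) = D.\<tau> (\<one>\<^bsub>\<Gamma>\<^esub>, t)"
  using J.amap_tau by (simp add: emb_def)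

end

section \<open>The group algebra as a Hopf algebra\<close>

locale group_alg = group \<Gamma> for \<Gamma> :: "('h, 'm) monoid_scheme" +
  fixes ty :: "'k::field itself"
begin

abbreviation "K \<equiv> monoid_alg \<Gamma> :: ('k, 'h \<Rightarrow>\<^sub>0 'k) module"
abbreviation "A \<equiv> group_hopf \<Gamma> :: ('k, 'h \<Rightarrow>\<^sub>0 'k) hopf"

sublocale K: kalg K by (rule kalg_monoid_alg) (rule monoid_axioms)
sublocale KK: kalg2 K K ..

lemma A_simps:
  "carrier A = carrier K" "mult A = mult K" "one A = one K" "zero A = zero K" "add A = add K"
  "module.smult A = module.smult K"
  by (simp_all add: group_hopf_def Let_def module.extend_def)

lemma spans_K: "spans K (\<delta> ` carrier \<Gamma>)"
  by (rule spans_monoid_alg)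

lemma comult_A: "lin K (tensor K K) (comult A)" "h \<in> carrier \<Gamma> \<Longrightarrow> comult A (\<delta> h) = tens K K (\<delta> h) (\<delta> h)"
proof -
  have e: "comult A = lin_ext (tensor K K) (\<lambda>t. tens K K (\<delta> t) (\<delta> t))"
    by (simp add: group_hopf_def Let_def module.extend_def hopf.fields_def)
  have v: "vs (tensor K K)" by (rule vs_tensor[OF K.vs_axioms K.vs_axioms])
  have c: "tens K K (\<delta> h) (\<delta> h) \<in> carrier (tensor K K)" if "h \<in> carrier \<Gamma>" for h
    using that by (intro KK.tensor_closed) simp_all
  show "lin K (tensor K K) (comult A)"
    unfolding e lin_monoid_alg by (rule lin_lin_ext[OF v c])
  show "comult A (\<delta> h) = tens K K (\<delta> h) (\<delta> h)" if "h \<in> carrier \<Gamma>"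
    unfolding e using c[OF that] v by simp
qed

lemma counit_A: "lin K ground (counit A)" "h \<in> carrier \<Gamma> \<Longrightarrow> counit A (\<delta> h) = 1"
proof -
  have e: "counit A = lin_ext ground (\<lambda>_. 1)"
    by (simp add: group_hopf_def Let_def module.extend_def hopf.fields_def)
  show "lin K ground (counit A)"
    unfolding e lin_monoid_alg by (rule lin_lin_ext[OF vs_ground]) simp
  show "counit A (\<delta> h) = 1" if "h \<in> carrier \<Gamma>"
    unfolding e by (simp add: vs_ground)
qed

lemma antipode_A: "lin K K (antipode A)" "h \<in> carrier \<Gamma> \<Longrightarrow> antipode A (\<delta> h) = \<delta> (inv\<^bsub>\<Gamma>\<^esub> h)"
proof -
  have e: "antipode A = lin_ext K (\<lambda>t. \<delta> (inv\<^bsub>\<Gamma>\<^esub> t))"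
    by (simp add: group_hopf_def Let_def module.extend_def hopf.fields_def)
  have "lin (free_vs (carrier \<Gamma>)) K (lin_ext K (\<lambda>t. \<delta> (inv\<^bsub>\<Gamma>\<^esub> t)))"
    by (rule lin_lin_ext[OF K.vs_axioms]) simp
  then show "lin K K (antipode A)"
    unfolding e by (simp only: lin_monoid_alg)
  show "antipode A (\<delta> h) = \<delta> (inv\<^bsub>\<Gamma>\<^esub> h)" if "h \<in> carrier \<Gamma>"
    unfolding e using that by (intro lin_ext_delta[OF K.vs_axioms]) simp
qed

end

section \<open>Bicrossed products of Hopf algebras\<close>

lemma bilinear_comp: "bilinear_into V W P \<beta> \<Longrightarrow> lin P Q h \<Longrightarrow> bilinear_into V W Q (\<lambda>a b. h (\<beta> a b))"
  unfolding bilinear_iff by (auto intro: lin_comp)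

lemma (in vs2) tensor_lift_comp:
  assumes "vs P" "vs Q" "bilinear_into V W P \<beta>" "lin P Q h" "Y \<in> carrier (tensor V W)"
  shows "h (tensor_lift P \<beta> Y) = tensor_lift Q (\<lambda>a b. h (\<beta> a b)) Y"
  by (rule lin_tensor_eqI'[OF assms(2) lin_comp[OF lin_tensor_lift'[OF assms(1,3)] assms(4)]
        lin_tensor_lift'[OF assms(2) bilinear_comp[OF assms(3,4)]] _ assms(5)])
    (simp add: tensor_lift_tens[OF assms(1,3)] tensor_lift_tens[OF assms(2) bilinear_comp[OF assms(3,4)]])

lemma (in vs2) lin_lift_param':
  assumes "vs U" "vs P" "\<And>u. u \<in> carrier U \<Longrightarrow> bilinear_into V W P (\<beta> u)"
    "\<And>v w. v \<in> carrier V \<Longrightarrow> w \<in> carrier W \<Longrightarrow> lin U P (\<lambda>u. \<beta> u v w)"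
    "Y \<in> carrier (tensor V W)"
  shows "lin U P (\<lambda>u. tensor_lift P (\<beta> u) Y)"
  by (rule lin_lift_param[OF assms(1-4)]) (use assms(5) in \<open>auto simp: tensor_simps\<close>)

lemma lin_finsum_fun:
  assumes "vs V" "vs W" "finite S" "\<And>y. y \<in> S \<Longrightarrow> lin V W (h y)"
  shows "lin V W (\<lambda>u. \<Oplus>\<^bsub>W\<^esub>y\<in>S. h y u)"
proof -
  interpret W: vs W by fact
  show ?thesis using assms(3,4)
  proof (induction S rule: finite_induct)
    case empty
    then show ?case by (intro linI) (simp_all add: W.finsum_empty)
  next
    case (insert y S)
    have l: "lin V W (h y)" "lin V W (\<lambda>u. \<Oplus>\<^bsub>W\<^esub>y\<in>S. h y u)" using insert by auto
    have e: "(\<Oplus>\<^bsub>W\<^esub>y\<in>insert y S. h y u) = h y u \<oplus>\<^bsub>W\<^esub> (\<Oplus>\<^bsub>W\<^esub>y\<in>S. h y u)" if "u \<in> carrier V" for u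
    proof (rule W.finsum_insert[OF insert.hyps])
      show "(\<lambda>y. h y u) \<in> S \<rightarrow> carrier W"
        by (intro funcsetI lin_closed[OF insert.prems that]) simp
      show "h y u \<in> carrier W" by (rule lin_closed[OF l(1) that])
    qed
    have "lin V W (\<lambda>u. h y u \<oplus>\<^bsub>W\<^esub> (\<Oplus>\<^bsub>W\<^esub>y\<in>S. h y u))"
      by (rule linI) (simp_all add: lin_closed[OF l(1)] lin_closed[OF l(2)] lin_add[OF l(1)] lin_add[OF l(2)]
          lin_smult[OF l(1)] lin_smult[OF l(2)] W.a_ac W.smult_r_distr)
    then show ?case by (rule lin_cong[OF assms(1)]) (rule e)
  qed
qed

locale bicross = matched_datum \<Gamma> G g f l r \<gamma>
  for \<Gamma> :: "'h monoid" and G :: "'g monoid" and g and f :: "'g \<Rightarrow> 'k::field" and l r \<gamma> +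
  fixes L R
  assumes corr: "corresponding_matched_pair \<Gamma> G g f l r \<gamma> L R"
begin

sublocale GA: group_alg \<Gamma> "TYPE('k)" by unfold_locales

abbreviation "K \<equiv> GA.K"
abbreviation "A \<equiv> GA.A"

sublocale KB: kalg2 K B by (rule kalg2.intro) (rule GA.K.kalg_axioms, rule kalg_B)

abbreviation "T \<equiv> tensor_vs K B"
abbreviation "tn \<equiv> tens K B"

lemma tensor_AH: "tensor_vs A H = T" "tens A H = tn"
  by (rule tensor_cong; simp only: H_simps GA.A_simps)+

lemma vsT: "vs T" by (rule KB.vs_tensor_vs)

lemma mp: "hopf_matched_pair A H L R"
  and L_tau: "t \<in> carrier G \<Longrightarrow> h \<in> carrier \<Gamma> \<Longrightarrow> L (\<tau> t) (\<delta> h) = \<delta> (l t h)"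
  and R_tau: "t \<in> carrier G \<Longrightarrow> h \<in> carrier \<Gamma> \<Longrightarrow> R (\<tau> t) (\<delta> h) = \<tau> (r t h)"
  and L_X: "h \<in> carrier \<Gamma> \<Longrightarrow> L X (\<delta> h) = 0"
  using corr by (simp_all add: corresponding_matched_pair_def Let_def GA.A_simps)

lemma R_X: "h \<in> carrier \<Gamma> \<Longrightarrow> R X (\<delta> h) = X \<oplus>\<^bsub>B\<^esub> \<gamma> h \<odot>\<^bsub>B\<^esub> (\<one>\<^bsub>B\<^esub> \<oplus>\<^bsub>B\<^esub> (-1) \<odot>\<^bsub>B\<^esub> \<tau> g)"
proof -
  assume h: "h \<in> carrier \<Gamma>"
  interpret Hk: kalg H by (rule kalg_H)
  have "\<one>\<^bsub>H\<^esub> \<ominus>\<^bsub>H\<^esub> \<tau> g = \<one>\<^bsub>H\<^esub> \<oplus>\<^bsub>H\<^esub> (-1) \<odot>\<^bsub>H\<^esub> \<tau> g"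
    by (simp add: a_minus_def Hk.smult_minus_one H_simps(1))
  then show ?thesis
    using corr h by (simp add: corresponding_matched_pair_def Let_def H_simps)
qed

lemma L_bilinear: "bilinear_into B K K L" and R_bilinear: "bilinear_into B K B R"
  using mp by (simp_all add: hopf_matched_pair_def left_module_coalgebra_def right_module_coalgebra_def
    bilinear_into_def H_simps GA.A_simps del: monoid_alg_simps)

lemma L_mult: "u \<in> carrier B \<Longrightarrow> v \<in> carrier B \<Longrightarrow> a \<in> carrier K \<Longrightarrow> L (u \<otimes>\<^bsub>B\<^esub> v) a = L u (L v a)"
  using mp by (simp_all add: hopf_matched_pair_def left_module_coalgebra_def H_simps GA.A_simps del: monoid_alg_simps)

lemma R_mult: "u \<in> carrier B \<Longrightarrow> v \<in> carrier B \<Longrightarrow> a \<in> carrier K \<Longrightarrow>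
    R (u \<otimes>\<^bsub>B\<^esub> v) a = sweedler H H v (\<lambda>v1 v2. sweedler H A a (\<lambda>a1 a2. R u (L v1 a1) \<otimes>\<^bsub>B\<^esub> R v2 a2))"
  using mp by (simp add: hopf_matched_pair_def H_simps GA.A_simps del: monoid_alg_simps)

lemma L_closed: "u \<in> carrier B \<Longrightarrow> a \<in> carrier K \<Longrightarrow> L u a \<in> carrier K"
  and R_closed: "u \<in> carrier B \<Longrightarrow> a \<in> carrier K \<Longrightarrow> R u a \<in> carrier B"
  using L_bilinear R_bilinear by (simp_all add: bilinear_into_def del: monoid_alg_simps)

lemma vs_H: "vs H" by (rule kalg_vs[OF kalg_H])

lemma bilinear_H: "bilinear_into V W H = bilinear_into V W B" for V W
  by (intro ext) (simp add: bilinear_into_def H_simps)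

lemma dK: "h \<in> carrier \<Gamma> \<Longrightarrow> \<delta> h \<in> carrier K" by simp

lemma sw_A_delta: "vs P \<Longrightarrow> bilinear_into K K P \<beta> \<Longrightarrow> h \<in> carrier \<Gamma> \<Longrightarrow> sweedler P A (\<delta> h) \<beta> = \<beta> (\<delta> h) (\<delta> h)"
  by (simp add: sweedler_def GA.comult_A(2) GA.KK.tensor_lift_tens[OF _ _ dK dK] del: monoid_alg_simps)

lemma lin_sw_A: "vs P \<Longrightarrow> bilinear_into K K P \<beta> \<Longrightarrow> lin K P (\<lambda>a. sweedler P A a \<beta>)"
  unfolding sweedler_def by (rule lin_comp[OF GA.comult_A(1) GA.KK.lin_tensor_lift'])

lemma lin_sw_B: "vs P \<Longrightarrow> bilinear_into B B P \<beta> \<Longrightarrow> lin B P (\<lambda>u. sweedler P H u \<beta>)"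
  unfolding sweedler_def by (rule lin_comp[OF alg_hom_lin[OF alg_hom_comult] BB.lin_tensor_lift'])

lemma lin_sw_A_param:
  assumes "vs U" "vs P" "\<And>u. u \<in> carrier U \<Longrightarrow> bilinear_into K K P (\<beta> u)"
    "\<And>v w. v \<in> carrier K \<Longrightarrow> w \<in> carrier K \<Longrightarrow> lin U P (\<lambda>u. \<beta> u v w)" "a \<in> carrier K"
  shows "lin U P (\<lambda>u. sweedler P A a (\<beta> u))"
  unfolding sweedler_def
  by (rule GA.KK.lin_lift_param'[OF assms(1-4)]) (use lin_closed[OF GA.comult_A(1) assms(5)] in auto)

lemma lin_sw_B_param:
  assumes "vs U" "vs P" "\<And>u. u \<in> carrier U \<Longrightarrow> bilinear_into B B P (\<beta> u)"
    "\<And>v w. v \<in> carrier B \<Longrightarrow> w \<in> carrier B \<Longrightarrow> lin U P (\<lambda>u. \<beta> u v w)" "a \<in> carrier B"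
  shows "lin U P (\<lambda>u. sweedler P H a (\<beta> u))"
  unfolding sweedler_def
  by (rule BB.lin_lift_param'[OF assms(1-4)]) (use lin_closed[OF alg_hom_lin[OF alg_hom_comult] assms(5)] in auto)

subsection \<open>The multiplication of the bicrossed product\<close>

text \<open>
  The product \<open>(a \<bowtie> u) (b \<bowtie> v)\<close> is \<open>mm a u b v\<close>, a double Sweedler sum. Its summand \<open>gm\<close> and its
  inner sum \<open>ka\<close> are separate constants so that linearity in each argument can be established
  level by level.
\<close>

definition gm where "gm a u1 u2 v b1 b2 = tn (a \<otimes>\<^bsub>K\<^esub> L u1 b1) (R u2 b2 \<otimes>\<^bsub>B\<^esub> v)"
definition ka where "ka a u1 u2 b v = sweedler T A b (gm a u1 u2 v)"
definition mm where "mm a u b v = sweedler T H u (\<lambda>u1 u2. ka a u1 u2 b v)"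

lemmas tnL = bilinear_left[OF KB.tens_bilinear]
lemmas tnR = bilinear_right[OF KB.tens_bilinear]

context
  fixes a u1 u2 v b1 b2
  assumes c: "a \<in> carrier K" "u1 \<in> carrier B" "u2 \<in> carrier B" "v \<in> carrier B" "b1 \<in> carrier K" "b2 \<in> carrier K"
begin

lemma gm_a: "lin K T (\<lambda>a. gm a u1 u2 v b1 b2)"
  unfolding gm_def
  by (rule lin_comp[OF GA.K.lin_mult_right tnL]) (use c L_closed R_closed in \<open>auto simp del: monoid_alg_simps\<close>)

lemma gm_u1: "lin B T (\<lambda>u1. gm a u1 u2 v b1 b2)"
  unfolding gm_def
  by (rule lin_comp[OF bilinear_left[OF L_bilinear] lin_comp[OF GA.K.lin_mult_left tnL]])
    (use c L_closed R_closed in \<open>auto simp del: monoid_alg_simps\<close>)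

lemma gm_b1: "lin K T (\<lambda>b1. gm a u1 u2 v b1 b2)"
  unfolding gm_def
  by (rule lin_comp[OF bilinear_right[OF L_bilinear] lin_comp[OF GA.K.lin_mult_left tnL]])
    (use c L_closed R_closed in \<open>auto simp del: monoid_alg_simps\<close>)

lemma gm_u2: "lin B T (\<lambda>u2. gm a u1 u2 v b1 b2)"
  unfolding gm_def
  by (rule lin_comp[OF bilinear_left[OF R_bilinear] lin_comp[OF B.lin_mult_right tnR]])
    (use c L_closed R_closed in \<open>auto simp del: monoid_alg_simps\<close>)

lemma gm_b2: "lin K T (\<lambda>b2. gm a u1 u2 v b1 b2)"
  unfolding gm_def
  by (rule lin_comp[OF bilinear_right[OF R_bilinear] lin_comp[OF B.lin_mult_right tnR]])
    (use c L_closed R_closed in \<open>auto simp del: monoid_alg_simps\<close>)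

lemma gm_v: "lin B T (\<lambda>v. gm a u1 u2 v b1 b2)"
  unfolding gm_def
  by (rule lin_comp[OF B.lin_mult_left tnR])
    (use c L_closed R_closed in \<open>auto simp del: monoid_alg_simps\<close>)

end

lemma gm_bilinear: "a \<in> carrier K \<Longrightarrow> u1 \<in> carrier B \<Longrightarrow> u2 \<in> carrier B \<Longrightarrow> v \<in> carrier B \<Longrightarrow>
    bilinear_into K K T (gm a u1 u2 v)"
  by (rule bilinearI; rule gm_b1 gm_b2)

lemma ka_b: "a \<in> carrier K \<Longrightarrow> u1 \<in> carrier B \<Longrightarrow> u2 \<in> carrier B \<Longrightarrow> v \<in> carrier B \<Longrightarrow> lin K T (\<lambda>b. ka a u1 u2 b v)"
  unfolding ka_def by (rule lin_sw_A[OF vsT gm_bilinear])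

lemma ka_a: "b \<in> carrier K \<Longrightarrow> u1 \<in> carrier B \<Longrightarrow> u2 \<in> carrier B \<Longrightarrow> v \<in> carrier B \<Longrightarrow> lin K T (\<lambda>a. ka a u1 u2 b v)"
  unfolding ka_def by (rule lin_sw_A_param[OF GA.K.vs_axioms vsT gm_bilinear gm_a])

lemma ka_u1: "a \<in> carrier K \<Longrightarrow> b \<in> carrier K \<Longrightarrow> u2 \<in> carrier B \<Longrightarrow> v \<in> carrier B \<Longrightarrow> lin B T (\<lambda>u1. ka a u1 u2 b v)"
  unfolding ka_def by (rule lin_sw_A_param[OF B.vs_axioms vsT gm_bilinear gm_u1])

lemma ka_u2: "a \<in> carrier K \<Longrightarrow> b \<in> carrier K \<Longrightarrow> u1 \<in> carrier B \<Longrightarrow> v \<in> carrier B \<Longrightarrow> lin B T (\<lambda>u2. ka a u1 u2 b v)"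
  unfolding ka_def by (rule lin_sw_A_param[OF B.vs_axioms vsT gm_bilinear gm_u2])

lemma ka_v: "a \<in> carrier K \<Longrightarrow> b \<in> carrier K \<Longrightarrow> u1 \<in> carrier B \<Longrightarrow> u2 \<in> carrier B \<Longrightarrow> lin B T (\<lambda>v. ka a u1 u2 b v)"
  unfolding ka_def by (rule lin_sw_A_param[OF B.vs_axioms vsT gm_bilinear gm_v])

lemma ka_bilinear: "a \<in> carrier K \<Longrightarrow> b \<in> carrier K \<Longrightarrow> v \<in> carrier B \<Longrightarrow>
    bilinear_into B B T (\<lambda>u1 u2. ka a u1 u2 b v)"
  by (rule bilinearI; rule ka_u1 ka_u2)

lemma mm_u: "a \<in> carrier K \<Longrightarrow> b \<in> carrier K \<Longrightarrow> v \<in> carrier B \<Longrightarrow> lin B T (\<lambda>u. mm a u b v)"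
  unfolding mm_def by (rule lin_sw_B[OF vsT ka_bilinear])

lemma mm_a: "b \<in> carrier K \<Longrightarrow> u \<in> carrier B \<Longrightarrow> v \<in> carrier B \<Longrightarrow> lin K T (\<lambda>a. mm a u b v)"
  unfolding mm_def by (rule lin_sw_B_param[OF GA.K.vs_axioms vsT ka_bilinear ka_a])

lemma mm_b: "a \<in> carrier K \<Longrightarrow> u \<in> carrier B \<Longrightarrow> v \<in> carrier B \<Longrightarrow> lin K T (\<lambda>b. mm a u b v)"
  unfolding mm_def by (rule lin_sw_B_param[OF GA.K.vs_axioms vsT ka_bilinear ka_b])

lemma mm_v: "a \<in> carrier K \<Longrightarrow> b \<in> carrier K \<Longrightarrow> u \<in> carrier B \<Longrightarrow> lin B T (\<lambda>v. mm a u b v)"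
  unfolding mm_def by (rule lin_sw_B_param[OF B.vs_axioms vsT ka_bilinear ka_v])

lemma mm_delta: "a \<in> carrier K \<Longrightarrow> u \<in> carrier B \<Longrightarrow> v \<in> carrier B \<Longrightarrow> h \<in> carrier \<Gamma> \<Longrightarrow>
    mm a u (\<delta> h) v = tensor_lift T (\<lambda>u1 u2. ka a u1 u2 (\<delta> h) v) (comult H u)"
  by (simp add: mm_def sweedler_def)

lemma ka_delta: "a \<in> carrier K \<Longrightarrow> u1 \<in> carrier B \<Longrightarrow> u2 \<in> carrier B \<Longrightarrow> v \<in> carrier B \<Longrightarrow> h \<in> carrier \<Gamma> \<Longrightarrow>
   ka a u1 u2 (\<delta> h) v = tn (a \<otimes>\<^bsub>K\<^esub> L u1 (\<delta> h)) (R u2 (\<delta> h) \<otimes>\<^bsub>B\<^esub> v)"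
  unfolding ka_def by (subst sw_A_delta[OF vsT gm_bilinear]) (simp_all add: gm_def del: monoid_alg_simps)

abbreviation "E0 \<equiv> bicrossed_alg A H L R"
abbreviation "E \<equiv> bicrossed A H L R"

lemma E0_simps: "carrier E0 = carrier T" "zero E0 = zero T" "add E0 = add T" "module.smult E0 = module.smult T"
  "\<one>\<^bsub>E0\<^esub> = tn \<one>\<^bsub>K\<^esub> \<one>\<^bsub>B\<^esub>"
  "Y \<otimes>\<^bsub>E0\<^esub> Z = tensor_lift T (\<lambda>a u. tensor_lift T (\<lambda>b v. mm a u b v) Z) Y"
  by (simp_all add: bicrossed_alg_def Let_def tensor_AH mm_def ka_def gm_def[abs_def] GA.A_simps H_simps del: monoid_alg_simps)

lemma E_simps: "carrier E = carrier E0" "zero E = zero E0" "add E = add E0" "module.smult E = module.smult E0"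
  "one E = one E0" "mult E = mult E0"
  by (simp_all add: bicrossed_def Let_def module.extend_def)

lemma mm_bilinear: "a \<in> carrier K \<Longrightarrow> u \<in> carrier B \<Longrightarrow> bilinear_into K B T (\<lambda>b v. mm a u b v)"
  by (rule bilinearI; rule mm_b mm_v)

lemma mm_lift_bilinear: "Z \<in> carrier T \<Longrightarrow> bilinear_into K B T (\<lambda>a u. tensor_lift T (\<lambda>b v. mm a u b v) Z)"
  by (rule bilinearI; rule KB.lin_lift_param[OF _ vsT], simp_all only: mm_bilinear mm_a mm_u GA.K.vs_axioms B.vs_axioms)

lemma E_mult_tens: "a \<in> carrier K \<Longrightarrow> u \<in> carrier B \<Longrightarrow> b \<in> carrier K \<Longrightarrow> v \<in> carrier B \<Longrightarrow>
    tn a u \<otimes>\<^bsub>E0\<^esub> tn b v = mm a u b v"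
  unfolding E0_simps
  by (simp add: KB.tensor_lift_tens[OF vsT mm_lift_bilinear] KB.tens_closed KB.tensor_lift_tens[OF vsT mm_bilinear] del: monoid_alg_simps)

lemma E_mult_left: "Z \<in> carrier T \<Longrightarrow> lin T T (\<lambda>Y. Y \<otimes>\<^bsub>E0\<^esub> Z)"
  unfolding E0_simps by (rule KB.lin_tensor_lift[OF vsT mm_lift_bilinear])

lemma E_mult_right: "Y \<in> carrier T \<Longrightarrow> lin T T (\<lambda>Z. Y \<otimes>\<^bsub>E0\<^esub> Z)"
  unfolding E0_simps by (rule KB.lin_lift_param[OF vsT vsT mm_lift_bilinear KB.lin_tensor_lift[OF vsT mm_bilinear]])

lemma E_mult_closed: "Y \<in> carrier T \<Longrightarrow> Z \<in> carrier T \<Longrightarrow> Y \<otimes>\<^bsub>E0\<^esub> Z \<in> carrier T"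
  by (rule lin_closed[OF E_mult_left])

subsection \<open>The comparison map\<close>

abbreviation "j \<equiv> J.amap"

text \<open>
  The embedding of \<open>k[\<Gamma>]\<close>. Together with the embedding \<open>j\<close> of the Hopf algebra of \<open>G\<close> it provides
  the comparison map \<open>a \<bowtie> u \<mapsto> i(a) j(u)\<close>.
\<close>

definition i :: "('h \<Rightarrow>\<^sub>0 'k) \<Rightarrow> (('h \<times> 'g) letter list \<Rightarrow>\<^sub>0 'k) set" where
  "i = lin_ext D.B (\<lambda>h. D.\<tau> (h, \<one>\<^bsub>G\<^esub>))"

lemma lin_i: "lin K D.B i"
  unfolding i_def lin_monoid_alg by (rule lin_lin_ext[OF D.B.vs_axioms]) simp

lemma i_delta: "h \<in> carrier \<Gamma> \<Longrightarrow> i (\<delta> h) = D.\<tau> (h, \<one>\<^bsub>G\<^esub>)"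
  unfolding i_def by (rule lin_ext_delta[OF D.B.vs_axioms]) simp

lemma i_closed: "a \<in> carrier K \<Longrightarrow> i a \<in> carrier D.B"
  by (rule lin_closed[OF lin_i])

lemma i_mult: "a \<in> carrier K \<Longrightarrow> b \<in> carrier K \<Longrightarrow> i (a \<otimes>\<^bsub>K\<^esub> b) = i a \<otimes>\<^bsub>D.B\<^esub> i b"
proof -
  assume a: "a \<in> carrier K" and b: "b \<in> carrier K"
  have 1: "i (\<delta> h \<otimes>\<^bsub>K\<^esub> b) = i (\<delta> h) \<otimes>\<^bsub>D.B\<^esub> i b" if h: "h \<in> carrier \<Gamma>" for h
    by (rule lin_eqI[OF GA.K.vs_axioms D.B.vs_axioms GA.spans_K lin_comp[OF GA.K.lin_mult_left lin_i]
          lin_comp[OF lin_i D.B.lin_mult_left] _ b])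
      (use h in \<open>auto simp: monoid_alg_delta_mult i_delta D.tau_mult\<close>)
  show ?thesis
    by (rule lin_eqI[OF GA.K.vs_axioms D.B.vs_axioms GA.spans_K lin_comp[OF GA.K.lin_mult_right lin_i]
          lin_comp[OF lin_i D.B.lin_mult_right] _ a])
      (use b 1 i_closed in auto)
qed

lemma j_closed: "u \<in> carrier B \<Longrightarrow> j u \<in> carrier D.B"
  by (rule J.amap_closed)

lemma j_mult: "u \<in> carrier B \<Longrightarrow> v \<in> carrier B \<Longrightarrow> j (u \<otimes>\<^bsub>B\<^esub> v) = j u \<otimes>\<^bsub>D.B\<^esub> j v"
  by (rule alg_hom_mult[OF J.alg_hom_amap])

lemma lin_j: "lin B D.B j" by (rule alg_hom_lin[OF J.alg_hom_amap])

lemma j_one: "j \<one>\<^bsub>B\<^esub> = \<one>\<^bsub>D.B\<^esub>" by (rule alg_hom_one[OF J.alg_hom_amap])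

lemma i_one: "i \<one>\<^bsub>K\<^esub> = \<one>\<^bsub>D.B\<^esub>"
  unfolding monoid_alg_simps(5) i_delta[OF Gam.one_closed] using D.tau_one unfolding Lam_simps .

lemma ij_bilinear: "bilinear_into K B D.B (\<lambda>a u. i a \<otimes>\<^bsub>D.B\<^esub> j u)"
proof (rule bilinearI)
  show "lin K D.B (\<lambda>a. i a \<otimes>\<^bsub>D.B\<^esub> j u)" if "u \<in> carrier B" for u
    by (rule lin_comp[OF lin_i D.B.lin_mult_right[OF j_closed[OF that]]])
  show "lin B D.B (\<lambda>u. i a \<otimes>\<^bsub>D.B\<^esub> j u)" if "a \<in> carrier K" for a
    by (rule lin_comp[OF lin_j D.B.lin_mult_left[OF i_closed[OF that]]])
qed

definition phi :: "(('h \<Rightarrow>\<^sub>0 'k) \<times> ('g letter list \<Rightarrow>\<^sub>0 'k) set \<Rightarrow>\<^sub>0 'k) set \<Rightarrow> (('h \<times> 'g) letter list \<Rightarrow>\<^sub>0 'k) set" where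
  "phi = tensor_lift D.B (\<lambda>a u. i a \<otimes>\<^bsub>D.B\<^esub> j u)"

lemma lin_phi: "lin T D.B phi"
  unfolding phi_def by (rule KB.lin_tensor_lift[OF D.B.vs_axioms ij_bilinear])

lemma phi_tens: "a \<in> carrier K \<Longrightarrow> u \<in> carrier B \<Longrightarrow> phi (tn a u) = i a \<otimes>\<^bsub>D.B\<^esub> j u"
  unfolding phi_def by (rule KB.tensor_lift_tens[OF D.B.vs_axioms ij_bilinear])

lemma phi_closed: "e \<in> carrier T \<Longrightarrow> phi e \<in> carrier D.B"
  by (rule lin_closed[OF lin_phi])

lemma spans_T: "spans T {tn (\<delta> h) u | h u. h \<in> carrier \<Gamma> \<and> u \<in> carrier B}"
proof -
  have "spans B (carrier B)" by (simp add: spans_def)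
  from KB.spans_tensor_vs[OF GA.spans_K this]
  have s: "spans T {tn s t | s t. s \<in> \<delta> ` carrier \<Gamma> \<and> t \<in> carrier B}" .
  have "{tn s t | s t. s \<in> \<delta> ` carrier \<Gamma> \<and> t \<in> carrier B} = {tn (\<delta> h) u | h u. h \<in> carrier \<Gamma> \<and> u \<in> carrier B}"
    by blast
  then show ?thesis using s by simp
qed

lemma lin_T_eqI:
  assumes "vs P" "lin T P h1" "lin T P h2"
    "\<And>h u. h \<in> carrier \<Gamma> \<Longrightarrow> u \<in> carrier B \<Longrightarrow> h1 (tn (\<delta> h) u) = h2 (tn (\<delta> h) u)" "e \<in> carrier T"
  shows "h1 e = h2 e"
  by (rule lin_eqI[OF vsT assms(1) spans_T assms(2,3) _ assms(5)]) (use assms(4) in blast)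

subsection \<open>The exchange rule\<close>

text \<open>
  The summand of the exchange rule \<open>\<Sum> (u\<^sub>1 \<triangleright> k) (u\<^sub>2 \<triangleleft> k) = u k\<close>.
\<close>

definition be where "be k u1 u2 = i (L u1 (\<delta> k)) \<otimes>\<^bsub>D.B\<^esub> j (R u2 (\<delta> k))"

lemma be_bilinear: "k \<in> carrier \<Gamma> \<Longrightarrow> bilinear_into B B D.B (be k)"
proof (rule bilinearI)
  assume k: "k \<in> carrier \<Gamma>"
  show "lin B D.B (\<lambda>u1. be k u1 u2)" if "u2 \<in> carrier B" for u2
    unfolding be_def
    by (rule lin_comp[OF bilinear_left[OF L_bilinear dK[OF k]] lin_comp[OF lin_i D.B.lin_mult_right[OF j_closed[OF R_closed[OF that dK[OF k]]]]]])
  show "lin B D.B (\<lambda>u2. be k u1 u2)" if "u1 \<in> carrier B" for u1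
    unfolding be_def
    by (rule lin_comp[OF bilinear_left[OF R_bilinear dK[OF k]] lin_comp[OF lin_j D.B.lin_mult_left[OF i_closed[OF L_closed[OF that dK[OF k]]]]]])
qed

text \<open>
  \<open>(u x) \<triangleleft> k\<close> is a sum over \<open>\<Delta>(x) = x \<otimes> 1 + g \<otimes> x\<close>: the first summand vanishes as \<open>x \<triangleright> k = 0\<close>, and
  in the second \<open>g \<triangleright> k = k\<close>.
\<close>

lemma R_times_X:
  assumes u: "u \<in> carrier B" and k: "k \<in> carrier \<Gamma>"
  shows "R (u \<otimes>\<^bsub>B\<^esub> X) (\<delta> k) = R u (\<delta> k) \<otimes>\<^bsub>B\<^esub> R X (\<delta> k)"
proof -
  let ?w = "\<lambda>v1 v2 a1 a2. R u (L v1 a1) \<otimes>\<^bsub>B\<^esub> R v2 a2"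
  have b: "bilinear_into K K H (?w v1 v2)" if "v1 \<in> carrier B" "v2 \<in> carrier B" for v1 v2
    unfolding bilinear_H
  proof (rule bilinearI)
    show "lin K B (\<lambda>a1. ?w v1 v2 a1 a2)" if a: "a2 \<in> carrier K" for a2
      by (rule lin_comp[OF bilinear_right[OF L_bilinear] lin_comp[OF bilinear_right[OF R_bilinear u] B.lin_mult_right]])
        (use that \<open>v1 \<in> carrier B\<close> \<open>v2 \<in> carrier B\<close> R_closed in \<open>auto simp del: monoid_alg_simps\<close>)
    show "lin K B (\<lambda>a2. ?w v1 v2 a1 a2)" if a: "a1 \<in> carrier K" for a1
      by (rule lin_comp[OF bilinear_right[OF R_bilinear] B.lin_mult_left])
        (use that u \<open>v1 \<in> carrier B\<close> \<open>v2 \<in> carrier B\<close> R_closed L_closed in \<open>auto simp del: monoid_alg_simps\<close>)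
  qed
  have inner: "sweedler H A (\<delta> k) (?w v1 v2) = ?w v1 v2 (\<delta> k) (\<delta> k)" if "v1 \<in> carrier B" "v2 \<in> carrier B" for v1 v2
    by (rule sw_A_delta[OF vs_H b[OF that] k])
  have bl: "bilinear_into B B H (\<lambda>v1 v2. sweedler H A (\<delta> k) (?w v1 v2))"
    unfolding bilinear_H
  proof (rule bilinearI)
    show "lin B B (\<lambda>v1. sweedler H A (\<delta> k) (?w v1 v2))" if v2: "v2 \<in> carrier B" for v2
    proof (rule lin_cong[OF B.vs_axioms])
      show "lin B B (\<lambda>v1. ?w v1 v2 (\<delta> k) (\<delta> k))"
        by (rule lin_comp[OF bilinear_left[OF L_bilinear dK[OF k]] lin_comp[OF bilinear_right[OF R_bilinear u]
              B.lin_mult_right[OF R_closed[OF v2 dK[OF k]]]]])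
    qed (rule inner[OF _ v2])
    show "lin B B (\<lambda>v2. sweedler H A (\<delta> k) (?w v1 v2))" if v1: "v1 \<in> carrier B" for v1
    proof (rule lin_cong[OF B.vs_axioms])
      show "lin B B (\<lambda>v2. ?w v1 v2 (\<delta> k) (\<delta> k))"
        by (rule lin_comp[OF bilinear_left[OF R_bilinear dK[OF k]] B.lin_mult_left[OF R_closed[OF u L_closed[OF v1 dK[OF k]]]]])
    qed (rule inner[OF v1])
  qed
  note tl = BB.tensor_lift_tens[OF vs_H bl]
  have "R (u \<otimes>\<^bsub>B\<^esub> X) (\<delta> k) = tensor_lift H (\<lambda>v1 v2. sweedler H A (\<delta> k) (?w v1 v2)) cX"
    unfolding R_mult[OF u gen_closed(2) dK[OF k]] sweedler_def[of H H] comult_X ..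
  also have "\<dots> = sweedler H A (\<delta> k) (?w X \<one>\<^bsub>B\<^esub>) \<oplus>\<^bsub>H\<^esub> sweedler H A (\<delta> k) (?w (\<tau> g) X)"
    unfolding cX_def
    by (subst lin_add[OF BB.lin_tensor_lift'[OF vs_H bl]]) (simp_all add: tl)
  also have "sweedler H A (\<delta> k) (?w X \<one>\<^bsub>B\<^esub>) = \<zero>\<^bsub>B\<^esub>"
  proof -
    have "R u \<zero>\<^bsub>K\<^esub> = \<zero>\<^bsub>B\<^esub>" by (rule GA.K.lin_zero[OF B.vs_axioms bilinear_right[OF R_bilinear u]])
    then have "R u (L X (\<delta> k)) = \<zero>\<^bsub>B\<^esub>" using k by (simp add: L_X)
    then show ?thesis using k R_closed[OF _ dK[OF k], of "\<one>\<^bsub>B\<^esub>"] by (simp add: inner)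
  qed
  also have "sweedler H A (\<delta> k) (?w (\<tau> g) X) = R u (\<delta> k) \<otimes>\<^bsub>B\<^esub> R X (\<delta> k)"
    using k by (simp add: inner L_tau)
  also have "\<zero>\<^bsub>B\<^esub> \<oplus>\<^bsub>H\<^esub> R u (\<delta> k) \<otimes>\<^bsub>B\<^esub> R X (\<delta> k) = R u (\<delta> k) \<otimes>\<^bsub>B\<^esub> R X (\<delta> k)"
    using R_closed[OF _ dK[OF k]] u by (simp add: H_simps)
  finally show ?thesis .
qed

text \<open>
  Multiplying \<open>Y\<close> by \<open>\<Delta>(x) = x \<otimes> 1 + g \<otimes> x\<close>: the summand \<open>x \<otimes> 1\<close> contributes
  \<open>(u x) \<triangleright> k = u \<triangleright> (x \<triangleright> k) = 0\<close>, and \<open>g \<otimes> x\<close> leaves the left part unchanged and multiplies the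
  right part by \<open>x \<triangleleft> k\<close>.
\<close>

lemma exchange_step:
  assumes k: "k \<in> carrier \<Gamma>" and Y: "Y \<in> carrier TT"
  shows "tensor_lift D.B (be k) (Y \<otimes>\<^bsub>TT\<^esub> cX) = tensor_lift D.B (be k) Y \<otimes>\<^bsub>D.B\<^esub> j (R X (\<delta> k))"
proof (rule BB.lin_tensor_eqI'[OF D.B.vs_axioms _ _ _ Y])
  have L': "lin TT D.B (tensor_lift D.B (be k))"
    by (rule BB.lin_tensor_lift'[OF D.B.vs_axioms be_bilinear[OF k]])
  have RX: "R X (\<delta> k) \<in> carrier B" by (rule R_closed[OF gen_closed(2) dK[OF k]])
  show "lin TT D.B (\<lambda>Y. tensor_lift D.B (be k) (Y \<otimes>\<^bsub>TT\<^esub> cX))"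
    by (rule lin_comp[OF TT.lin_mult_right[OF cX_closed] L'])
  show "lin TT D.B (\<lambda>Y. tensor_lift D.B (be k) Y \<otimes>\<^bsub>D.B\<^esub> j (R X (\<delta> k)))"
    by (rule lin_comp[OF L' D.B.lin_mult_right[OF j_closed[OF RX]]])
  fix u v assume u: "u \<in> carrier B" and v: "v \<in> carrier B"
  note tl = BB.tensor_lift_tens[OF D.B.vs_axioms be_bilinear[OF k]]
  have e: "tens B B u v \<otimes>\<^bsub>TT\<^esub> cX = tens B B (u \<otimes>\<^bsub>B\<^esub> X) v \<oplus>\<^bsub>TT\<^esub> tens B B (u \<otimes>\<^bsub>B\<^esub> \<tau> g) (v \<otimes>\<^bsub>B\<^esub> X)"
    using u v by (simp add: cX_def TT.r_distr BB.tensor_mult_tens)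
  have 1: "be k (u \<otimes>\<^bsub>B\<^esub> X) v = \<zero>\<^bsub>D.B\<^esub>"
  proof -
    have "L (u \<otimes>\<^bsub>B\<^esub> X) (\<delta> k) = L u \<zero>\<^bsub>K\<^esub>" using u k by (simp add: L_mult L_X)
    also have "\<dots> = \<zero>\<^bsub>K\<^esub>" by (rule GA.K.lin_zero[OF GA.K.vs_axioms bilinear_right[OF L_bilinear u]])
    finally have "i (L (u \<otimes>\<^bsub>B\<^esub> X) (\<delta> k)) = \<zero>\<^bsub>D.B\<^esub>" using GA.K.lin_zero[OF D.B.vs_axioms lin_i] by simp
    then show ?thesis unfolding be_def using j_closed[OF R_closed[OF v dK[OF k]]] by simp
  qed
  have 2: "be k (u \<otimes>\<^bsub>B\<^esub> \<tau> g) (v \<otimes>\<^bsub>B\<^esub> X) = be k u v \<otimes>\<^bsub>D.B\<^esub> j (R X (\<delta> k))"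
  proof -
    have "L (u \<otimes>\<^bsub>B\<^esub> \<tau> g) (\<delta> k) = L u (\<delta> k)" using u k by (simp add: L_mult L_tau)
    moreover have "j (R (v \<otimes>\<^bsub>B\<^esub> X) (\<delta> k)) = j (R v (\<delta> k)) \<otimes>\<^bsub>D.B\<^esub> j (R X (\<delta> k))"
      unfolding R_times_X[OF v k] by (rule j_mult[OF R_closed[OF v dK[OF k]] RX])
    ultimately show ?thesis
      unfolding be_def
      using i_closed[OF L_closed[OF u dK[OF k]]] j_closed[OF R_closed[OF v dK[OF k]]] j_closed[OF RX]
      by (simp add: D.B.m_assoc)
  qed
  have bc: "be k u v \<in> carrier D.B"
    using be_bilinear[OF k] u v by (simp add: bilinear_into_def)
  show "tensor_lift D.B (be k) (tens B B u v \<otimes>\<^bsub>TT\<^esub> cX) = tensor_lift D.B (be k) (tens B B u v) \<otimes>\<^bsub>D.B\<^esub> j (R X (\<delta> k))"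
    unfolding e using u v bc j_closed[OF RX] by (simp add: lin_add[OF L'] tl 1 2)
qed

text \<open>
  \<open>x k = k (x \<triangleleft> k)\<close> in the algebra of \<open>\<Lambda>\<close>: since \<open>F(k, 1) = - \<gamma>(k)\<close>, the defining relation at
  \<open>(k, 1)\<close> is \<open>x k = k (x + \<gamma>(k) (1 - g))\<close>.
\<close>

lemma j_X_commute:
  assumes k: "k \<in> carrier \<Gamma>"
  shows "D.X \<otimes>\<^bsub>D.B\<^esub> D.\<tau> (k, \<one>\<^bsub>G\<^esub>) = D.\<tau> (k, \<one>\<^bsub>G\<^esub>) \<otimes>\<^bsub>D.B\<^esub> j (R X (\<delta> k))"
proof -
  let ?k = "(k, \<one>\<^bsub>G\<^esub>)" and ?g = "(\<one>\<^bsub>\<Gamma>\<^esub>, g)"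
  have kc: "?k \<in> carrier \<Lambda>" using k by simp
  have F: "F ?k = - \<gamma> k" by (simp add: assoc_fun_def)
  have j: "j (R X (\<delta> k)) = D.X \<oplus>\<^bsub>D.B\<^esub> \<gamma> k \<odot>\<^bsub>D.B\<^esub> (\<one>\<^bsub>D.B\<^esub> \<oplus>\<^bsub>D.B\<^esub> (-1) \<odot>\<^bsub>D.B\<^esub> D.\<tau> ?g)"
    using k by (simp add: R_X lin_add[OF lin_j] lin_smult[OF lin_j] J.amap_X j_tau j_one)
  have "D.X \<otimes>\<^bsub>D.B\<^esub> D.\<tau> ?k = (D.X \<otimes>\<^bsub>D.B\<^esub> D.\<tau> ?k \<oplus>\<^bsub>D.B\<^esub> (- \<gamma> k) \<odot>\<^bsub>D.B\<^esub> D.\<tau> ?k) \<oplus>\<^bsub>D.B\<^esub> \<gamma> k \<odot>\<^bsub>D.B\<^esub> D.\<tau> ?k"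
    using kc by (simp add: D.B.smult_minus_left D.B.a_assoc D.B.l_neg)
  also have "\<dots> = (D.\<tau> ?k \<otimes>\<^bsub>D.B\<^esub> D.X \<oplus>\<^bsub>D.B\<^esub> (- \<gamma> k) \<odot>\<^bsub>D.B\<^esub> D.\<tau> (?k \<otimes>\<^bsub>\<Lambda>\<^esub> ?g)) \<oplus>\<^bsub>D.B\<^esub> \<gamma> k \<odot>\<^bsub>D.B\<^esub> D.\<tau> ?k"
    using D.X_tau[OF kc] unfolding F by (simp only:)
  also have "\<dots> = D.\<tau> ?k \<otimes>\<^bsub>D.B\<^esub> j (R X (\<delta> k))"
    unfolding j using kc
    by (simp add: D.B.r_distr D.B.smult_r_distr D.B.smult_mult_right D.B.smult_smult D.tau_mult D.B.a_ac del: Lam_simps)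
  finally show ?thesis .
qed

text \<open>
  Both sides are linear in \<open>u\<close>. They agree on \<open>G\<close>, where the rule reads \<open>t k = (t \<triangleright> k) (t \<triangleleft> k)\<close>,
  and if they agree at \<open>v\<close> then also at \<open>v x\<close>; as the elements \<open>t q(x)\<close> span, they agree
  everywhere.
\<close>

lemma exchange:
  assumes k: "k \<in> carrier \<Gamma>" and u: "u \<in> carrier B"
  shows "tensor_lift D.B (be k) (comult H u) = j u \<otimes>\<^bsub>D.B\<^esub> D.\<tau> (k, \<one>\<^bsub>G\<^esub>)"
proof -
  let ?P = "\<lambda>u. tensor_lift D.B (be k) (comult H u)" and ?Q = "\<lambda>u. j u \<otimes>\<^bsub>D.B\<^esub> D.\<tau> (k, \<one>\<^bsub>G\<^esub>)"
  have kc: "(k, \<one>\<^bsub>G\<^esub>) \<in> carrier \<Lambda>" using k by simp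
  have L': "lin TT D.B (tensor_lift D.B (be k))"
    by (rule BB.lin_tensor_lift'[OF D.B.vs_axioms be_bilinear[OF k]])
  have lP: "lin B D.B ?P" by (rule lin_comp[OF alg_hom_lin[OF alg_hom_comult] L'])
  have lQ: "lin B D.B ?Q" by (rule lin_comp[OF lin_j D.B.lin_mult_right[OF D.gen_closed(1)[OF kc]]])
  have RX: "R X (\<delta> k) \<in> carrier B" by (rule R_closed[OF gen_closed(2) dK[OF k]])
  have step: "?P (v \<otimes>\<^bsub>B\<^esub> X) = ?Q (v \<otimes>\<^bsub>B\<^esub> X)" if v: "v \<in> carrier B" and eq: "?P v = ?Q v" for v
  proof -
    have "?P (v \<otimes>\<^bsub>B\<^esub> X) = ?P v \<otimes>\<^bsub>D.B\<^esub> j (R X (\<delta> k))"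
      unfolding alg_hom_mult[OF alg_hom_comult v gen_closed(2)] comult_X
      by (rule exchange_step[OF k alg_hom_closed[OF alg_hom_comult v]])
    also have "\<dots> = j v \<otimes>\<^bsub>D.B\<^esub> (D.\<tau> (k, \<one>\<^bsub>G\<^esub>) \<otimes>\<^bsub>D.B\<^esub> j (R X (\<delta> k)))"
      unfolding eq by (rule D.B.m_assoc[OF j_closed[OF v] D.gen_closed(1)[OF kc] j_closed[OF RX]])
    also have "\<dots> = ?Q (v \<otimes>\<^bsub>B\<^esub> X)"
      unfolding j_X_commute[OF k, symmetric] j_mult[OF v gen_closed(2)] J.amap_X
      by (rule D.B.m_assoc[OF j_closed[OF v] D.gen_closed(2) D.gen_closed(1)[OF kc], symmetric])
    finally show ?thesis .
  qed
  have base: "?P (\<tau> t) = ?Q (\<tau> t)" if t: "t \<in> carrier G" for t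
  proof -
    have "?P (\<tau> t) = be k (\<tau> t) (\<tau> t)"
      unfolding comult_tau[OF t] by (rule BB.tensor_lift_tens[OF D.B.vs_axioms be_bilinear[OF k] gen_closed(1)[OF t] gen_closed(1)[OF t]])
    also have "\<dots> = ?Q (\<tau> t)"
      unfolding be_def using t k by (simp add: L_tau R_tau i_delta j_tau D.tau_mult)
    finally show ?thesis .
  qed
  have all: "?P (\<tau> t \<otimes>\<^bsub>B\<^esub> pev B X q) = ?Q (\<tau> t \<otimes>\<^bsub>B\<^esub> pev B X q)" if t: "t \<in> carrier G" for t q
  proof (induction q)
    case 0
    show ?case using t B.lin_zero[OF D.B.vs_axioms lP] B.lin_zero[OF D.B.vs_axioms lQ] by simp
  next
    case (pCons a q)
    let ?w = "\<tau> t \<otimes>\<^bsub>B\<^esub> pev B X q"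
    have "X \<otimes>\<^bsub>B\<^esub> pev B X q = pev B X q \<otimes>\<^bsub>B\<^esub> X"
      by (rule B.pev_commute) simp_all
    then have "\<tau> t \<otimes>\<^bsub>B\<^esub> pev B X (pCons a q) = a \<odot>\<^bsub>B\<^esub> \<tau> t \<oplus>\<^bsub>B\<^esub> ?w \<otimes>\<^bsub>B\<^esub> X"
      using t by (simp add: B.pev_pCons B.r_distr B.smult_mult_right B.m_assoc)
    then show ?case
      using t base[OF t] step[OF _ pCons.IH]
      by (simp add: lin_add[OF lP] lin_add[OF lQ] lin_smult[OF lP] lin_smult[OF lQ])
  qed
  show ?thesis
    by (rule lin_eqI[OF B.vs_axioms D.B.vs_axioms spans_all lP lQ _ u]) (use all in blast)
qed

end

context bicross begin

subsection \<open>The comparison map is an isomorphism of Hopf algebras\<close>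

text \<open>
  Multiplicativity on \<open>a \<bowtie> u\<close> and \<open>k \<bowtie> v\<close>: pulling \<open>i(a)\<close> and \<open>j(v)\<close> out of the Sweedler sum
  leaves the exchange rule for \<open>u\<close> and \<open>k\<close>.
\<close>

lemma phi_mm:
  assumes a: "a \<in> carrier K" and u: "u \<in> carrier B" and k: "k \<in> carrier \<Gamma>" and v: "v \<in> carrier B"
  shows "phi (mm a u (\<delta> k) v) = phi (tn a u) \<otimes>\<^bsub>D.B\<^esub> phi (tn (\<delta> k) v)"
proof -
  let ?c = "comult H u"
  have c: "?c \<in> carrier TT" by (rule alg_hom_closed[OF alg_hom_comult u])
  note ia = i_closed[OF a] and jv = j_closed[OF v]
  have "phi (mm a u (\<delta> k) v) = tensor_lift D.B (\<lambda>u1 u2. phi (ka a u1 u2 (\<delta> k) v)) ?c"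
    unfolding mm_delta[OF a u v k]
    by (rule BB.tensor_lift_comp[OF vsT D.B.vs_axioms ka_bilinear[OF a dK[OF k] v] lin_phi c])
  also have "\<dots> = i a \<otimes>\<^bsub>D.B\<^esub> tensor_lift D.B (be k) ?c \<otimes>\<^bsub>D.B\<^esub> j v"
  proof (rule BB.lin_tensor_eqI'[OF D.B.vs_axioms _ _ _ c])
    have b: "bilinear_into B B D.B (\<lambda>u1 u2. phi (ka a u1 u2 (\<delta> k) v))"
      by (rule bilinear_comp[OF ka_bilinear[OF a dK[OF k] v] lin_phi])
    show "lin TT D.B (tensor_lift D.B (\<lambda>u1 u2. phi (ka a u1 u2 (\<delta> k) v)))"
      by (rule BB.lin_tensor_lift'[OF D.B.vs_axioms b])
    have L': "lin TT D.B (tensor_lift D.B (be k))"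
      by (rule BB.lin_tensor_lift'[OF D.B.vs_axioms be_bilinear[OF k]])
    show "lin TT D.B (\<lambda>Y. i a \<otimes>\<^bsub>D.B\<^esub> tensor_lift D.B (be k) Y \<otimes>\<^bsub>D.B\<^esub> j v)"
      by (rule lin_comp[OF L' lin_comp[OF D.B.lin_mult_left[OF ia] D.B.lin_mult_right[OF jv]]])
    fix u1 u2 assume u12: "u1 \<in> carrier B" "u2 \<in> carrier B"
    note Lc = L_closed[OF u12(1) dK[OF k]] and Rc = R_closed[OF u12(2) dK[OF k]]
    have "phi (ka a u1 u2 (\<delta> k) v) = i (a \<otimes>\<^bsub>K\<^esub> L u1 (\<delta> k)) \<otimes>\<^bsub>D.B\<^esub> j (R u2 (\<delta> k) \<otimes>\<^bsub>B\<^esub> v)"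
      unfolding ka_delta[OF a u12 v k]
      by (rule phi_tens[OF GA.K.m_closed[OF a Lc] B.m_closed[OF Rc v]])
    also have "\<dots> = i a \<otimes>\<^bsub>D.B\<^esub> be k u1 u2 \<otimes>\<^bsub>D.B\<^esub> j v"
      unfolding be_def i_mult[OF a Lc] j_mult[OF Rc v]
      using ia jv i_closed[OF Lc] j_closed[OF Rc] by (simp add: D.B.m_assoc)
    finally show "tensor_lift D.B (\<lambda>u1 u2. phi (ka a u1 u2 (\<delta> k) v)) (tens B B u1 u2) =
        i a \<otimes>\<^bsub>D.B\<^esub> tensor_lift D.B (be k) (tens B B u1 u2) \<otimes>\<^bsub>D.B\<^esub> j v"
      unfolding BB.tensor_lift_tens[OF D.B.vs_axioms b u12]
        BB.tensor_lift_tens[OF D.B.vs_axioms be_bilinear[OF k] u12] .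
  qed
  also have "\<dots> = phi (tn a u) \<otimes>\<^bsub>D.B\<^esub> phi (tn (\<delta> k) v)"
    unfolding exchange[OF k u] phi_tens[OF a u] phi_tens[OF dK[OF k] v] i_delta[OF k]
    using ia jv j_closed[OF u] k by (simp add: D.B.m_assoc)
  finally show ?thesis .
qed

lemma phi_mult:
  assumes Y: "Y \<in> carrier T" and Z: "Z \<in> carrier T"
  shows "phi (Y \<otimes>\<^bsub>E0\<^esub> Z) = phi Y \<otimes>\<^bsub>D.B\<^esub> phi Z"
proof -
  have 1: "phi (tn (\<delta> h) u \<otimes>\<^bsub>E0\<^esub> Z) = phi (tn (\<delta> h) u) \<otimes>\<^bsub>D.B\<^esub> phi Z" if h: "h \<in> carrier \<Gamma>" and u: "u \<in> carrier B" for h u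
  proof (rule lin_T_eqI[OF D.B.vs_axioms lin_comp[OF E_mult_right lin_phi] lin_comp[OF lin_phi D.B.lin_mult_left] _ Z])
    show "tn (\<delta> h) u \<in> carrier T" by (rule KB.tens_closed[OF dK[OF h] u])
    then show "phi (tn (\<delta> h) u) \<in> carrier D.B" by (rule phi_closed)
    fix k v assume k: "k \<in> carrier \<Gamma>" and v: "v \<in> carrier B"
    show "phi (tn (\<delta> h) u \<otimes>\<^bsub>E0\<^esub> tn (\<delta> k) v) = phi (tn (\<delta> h) u) \<otimes>\<^bsub>D.B\<^esub> phi (tn (\<delta> k) v)"
      unfolding E_mult_tens[OF dK[OF h] u dK[OF k] v] by (rule phi_mm[OF dK[OF h] u k v])
  qed
  show ?thesis
    by (rule lin_T_eqI[OF D.B.vs_axioms lin_comp[OF E_mult_left[OF Z] lin_phi]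
          lin_comp[OF lin_phi D.B.lin_mult_right[OF phi_closed[OF Z]]] 1 Y])
qed

lemma phi_one: "phi \<one>\<^bsub>E0\<^esub> = \<one>\<^bsub>D.B\<^esub>"
  unfolding E0_simps(5) phi_tens[OF GA.K.one_closed B.one_closed] i_one j_one by simp

text \<open>
  The inverse of the comparison map, read off from coordinates: \<open>(h, t) q(x) \<mapsto> h \<bowtie> t q(x)\<close>.
\<close>

definition psi :: "(('h \<times> 'g) letter list \<Rightarrow>\<^sub>0 'k) set \<Rightarrow> (('h \<Rightarrow>\<^sub>0 'k) \<times> ('g letter list \<Rightarrow>\<^sub>0 'k) set \<Rightarrow>\<^sub>0 'k) set" where
  "psi u = (\<Oplus>\<^bsub>T\<^esub>y\<in>carrier \<Lambda>. tn (\<delta> (fst y)) (\<tau> (snd y) \<otimes>\<^bsub>B\<^esub> pev B X (D.pcoord y u)))"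

lemma lin_psi: "lin D.B T psi"
  unfolding psi_def
proof (rule lin_finsum_fun[OF D.B.vs_axioms vsT])
  show "finite (carrier \<Lambda>)" by (rule D.finite_G)
  fix y assume y: "y \<in> carrier \<Lambda>"
  have 1: "lin D.B B (\<lambda>u. pev B X (D.pcoord y u))"
    by (rule linI) (simp_all add: D.pcoord_add D.pcoord_smult B.pev_add B.pev_smult)
  show "lin D.B T (\<lambda>u. tn (\<delta> (fst y)) (\<tau> (snd y) \<otimes>\<^bsub>B\<^esub> pev B X (D.pcoord y u)))"
    by (rule lin_comp[OF 1 lin_comp[OF B.lin_mult_left tnR]]) (use y in auto)
qed

lemma psi_basis:
  assumes h: "h \<in> carrier \<Gamma>" and t: "t \<in> carrier G" and q: "degree q < CHAR('k)"
  shows "psi (D.\<tau> (h, t) \<otimes>\<^bsub>D.B\<^esub> pev D.B D.X q) = tn (\<delta> h) (\<tau> t \<otimes>\<^bsub>B\<^esub> pev B X q)"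
proof -
  interpret T: vs T by (rule vsT)
  let ?y = "(h, t)"
  have c: "tn (\<delta> h) (\<tau> t \<otimes>\<^bsub>B\<^esub> pev B X q) \<in> carrier T"
    by (rule KB.tens_closed[OF dK[OF h]]) (use t in simp)
  have z: "tn (\<delta> k) \<zero>\<^bsub>B\<^esub> = \<zero>\<^bsub>T\<^esub>" if "k \<in> carrier \<Gamma>" for k
    by (rule B.lin_zero[OF vsT tnR[OF dK[OF that]]])
  have "psi (D.\<tau> ?y \<otimes>\<^bsub>D.B\<^esub> pev D.B D.X q) =
      (\<Oplus>\<^bsub>T\<^esub>y\<in>carrier \<Lambda>. if ?y = y then tn (\<delta> h) (\<tau> t \<otimes>\<^bsub>B\<^esub> pev B X q) else \<zero>\<^bsub>T\<^esub>)"
    unfolding psi_def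
  proof (rule T.finsum_cong')
    fix y assume y: "y \<in> carrier \<Lambda>"
    show "tn (\<delta> (fst y)) (\<tau> (snd y) \<otimes>\<^bsub>B\<^esub> pev B X (D.pcoord y (D.\<tau> ?y \<otimes>\<^bsub>D.B\<^esub> pev D.B D.X q))) =
        (if ?y = y then tn (\<delta> h) (\<tau> t \<otimes>\<^bsub>B\<^esub> pev B X q) else \<zero>\<^bsub>T\<^esub>)"
      using y h t q by (auto simp: D.pcoord_basis z)
  qed (use c in auto)
  also have "\<dots> = tn (\<delta> h) (\<tau> t \<otimes>\<^bsub>B\<^esub> pev B X q)"
    by (rule T.finsum_singleton) (use h t c D.finite_G in auto)
  finally show ?thesis .
qed

lemma phi_basis:
  assumes h: "h \<in> carrier \<Gamma>" and t: "t \<in> carrier G"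
  shows "phi (tn (\<delta> h) (\<tau> t \<otimes>\<^bsub>B\<^esub> pev B X q)) = D.\<tau> (h, t) \<otimes>\<^bsub>D.B\<^esub> pev D.B D.X q"
proof -
  have w: "\<tau> t \<otimes>\<^bsub>B\<^esub> pev B X q \<in> carrier B" using t by simp
  have "j (\<tau> t \<otimes>\<^bsub>B\<^esub> pev B X q) = D.\<tau> (\<one>\<^bsub>\<Gamma>\<^esub>, t) \<otimes>\<^bsub>D.B\<^esub> pev D.B D.X q"
    using t by (simp add: j_mult j_tau alg_hom_pev[OF kalg_B D.kalg_B J.alg_hom_amap] J.amap_X)
  moreover have "D.\<tau> (h, \<one>\<^bsub>G\<^esub>) \<otimes>\<^bsub>D.B\<^esub> D.\<tau> (\<one>\<^bsub>\<Gamma>\<^esub>, t) = D.\<tau> (h, t)"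
    using h t by (simp add: D.tau_mult)
  ultimately show ?thesis
    unfolding phi_tens[OF dK[OF h] w] i_delta[OF h] using h t by (simp flip: D.B.m_assoc)
qed

lemma phi_psi: "u \<in> carrier D.B \<Longrightarrow> phi (psi u) = u"
  by (rule lin_eqI[OF D.B.vs_axioms D.B.vs_axioms D.spans_red lin_comp[OF lin_psi lin_phi] lin_ident])
    (auto simp: psi_basis phi_basis)

lemma psi_phi: "e \<in> carrier T \<Longrightarrow> psi (phi e) = e"
  by (rule lin_eqI[OF vsT vsT KB.spans_tensor_vs[OF GA.spans_K spans_red] lin_comp[OF lin_phi lin_psi] lin_ident])
    (auto simp: psi_basis phi_basis)

lemma bij_phi: "bij_betw phi (carrier T) (carrier D.B)"
  by (rule bij_betw_byWitness[where f' = psi])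
    (use phi_psi psi_phi phi_closed lin_closed[OF lin_psi] in auto)

lemma vs_E0: "vs E0" by (rule vs_cong[OF vsT]) (rule E0_simps)+

lemma vs_E: "vs E" by (rule vs_cong[OF vs_E0]) (rule E_simps)+

lemma lin_E0: "lin E0 V = lin T V" "lin V E0 = lin V T" for V
  by (intro ext; simp add: lin_def E0_simps(1-4))+

sublocale EE: vs2 E0 E0 by (rule vs2.intro) (rule vs_E0)+

abbreviation "EET \<equiv> tensor E0 E0"

lemma vs_EET: "vs EET" by (rule vs_tensor[OF vs_E0 vs_E0])

lemma tensor_EE: "tensor E E = EET" "tens E E = tens E0 E0"
  by (rule tensor_cong; simp only: E_simps)+

text \<open>
  The summand \<open>et\<close> and the inner sum \<open>es\<close> of the coproduct of \<open>a \<bowtie> u\<close>.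
\<close>

definition et where "et a1 a2 u1 u2 = tens E0 E0 (tn a1 u1) (tn a2 u2)"
definition es where "es u a1 a2 = sweedler EET H u (et a1 a2)"

lemma et_closed': "a \<in> carrier K \<Longrightarrow> u \<in> carrier B \<Longrightarrow> tn a u \<in> carrier E0"
  unfolding E0_simps by (rule KB.tens_closed)

lemma et_a1: "a2 \<in> carrier K \<Longrightarrow> u1 \<in> carrier B \<Longrightarrow> u2 \<in> carrier B \<Longrightarrow> lin K EET (\<lambda>a1. et a1 a2 u1 u2)"
  unfolding et_def using lin_comp[OF tnL[unfolded lin_E0(2)[symmetric]] bilinear_left[OF EE.tensor_bilinear et_closed']] .

lemma et_a2: "a1 \<in> carrier K \<Longrightarrow> u1 \<in> carrier B \<Longrightarrow> u2 \<in> carrier B \<Longrightarrow> lin K EET (\<lambda>a2. et a1 a2 u1 u2)"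
  unfolding et_def using lin_comp[OF tnL[unfolded lin_E0(2)[symmetric]] bilinear_right[OF EE.tensor_bilinear et_closed']] .

lemma et_u1: "a1 \<in> carrier K \<Longrightarrow> a2 \<in> carrier K \<Longrightarrow> u2 \<in> carrier B \<Longrightarrow> lin B EET (\<lambda>u1. et a1 a2 u1 u2)"
  unfolding et_def using lin_comp[OF tnR[unfolded lin_E0(2)[symmetric]] bilinear_left[OF EE.tensor_bilinear et_closed']] .

lemma et_u2: "a1 \<in> carrier K \<Longrightarrow> a2 \<in> carrier K \<Longrightarrow> u1 \<in> carrier B \<Longrightarrow> lin B EET (\<lambda>u2. et a1 a2 u1 u2)"
  unfolding et_def using lin_comp[OF tnR[unfolded lin_E0(2)[symmetric]] bilinear_right[OF EE.tensor_bilinear et_closed']] .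

lemma et_bilinear: "a1 \<in> carrier K \<Longrightarrow> a2 \<in> carrier K \<Longrightarrow> bilinear_into B B EET (et a1 a2)"
  by (rule bilinearI; rule et_u1 et_u2)

lemma es_u: "a1 \<in> carrier K \<Longrightarrow> a2 \<in> carrier K \<Longrightarrow> lin B EET (\<lambda>u. es u a1 a2)"
  unfolding es_def by (rule lin_sw_B[OF vs_EET et_bilinear])

lemma es_a1: "u \<in> carrier B \<Longrightarrow> a2 \<in> carrier K \<Longrightarrow> lin K EET (\<lambda>a1. es u a1 a2)"
  unfolding es_def by (rule lin_sw_B_param[OF GA.K.vs_axioms vs_EET et_bilinear et_a1])

lemma es_a2: "u \<in> carrier B \<Longrightarrow> a1 \<in> carrier K \<Longrightarrow> lin K EET (\<lambda>a2. es u a1 a2)"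
  unfolding es_def by (rule lin_sw_B_param[OF GA.K.vs_axioms vs_EET et_bilinear et_a2])

lemma es_bilinear: "u \<in> carrier B \<Longrightarrow> bilinear_into K K EET (es u)"
  by (rule bilinearI; rule es_a1 es_a2)

lemma comult_E_bilinear: "bilinear_into K B EET (\<lambda>a u. sweedler EET A a (es u))"
proof (rule bilinearI)
  show "lin K EET (\<lambda>a. sweedler EET A a (es u))" if "u \<in> carrier B" for u
    by (rule lin_sw_A[OF vs_EET es_bilinear[OF that]])
  show "lin B EET (\<lambda>u. sweedler EET A a (es u))" if "a \<in> carrier K" for a
    by (rule lin_sw_A_param[OF B.vs_axioms vs_EET es_bilinear es_u that])
qed

lemma comult_E_eq: "comult E = tensor_lift EET (\<lambda>a u. sweedler EET A a (es u))"
  by (simp add: bicrossed_def Let_def module.extend_def hopf.fields_def es_def[abs_def] et_def[abs_def] tensor_AH)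

lemma lin_comult_E: "lin T EET (comult E)"
  unfolding comult_E_eq by (rule KB.lin_tensor_lift[OF vs_EET comult_E_bilinear])

lemma comult_E_tens:
  assumes h: "h \<in> carrier \<Gamma>" and u: "u \<in> carrier B"
  shows "comult E (tn (\<delta> h) u) = tensor_lift EET (et (\<delta> h) (\<delta> h)) (comult H u)"
proof -
  have "comult E (tn (\<delta> h) u) = sweedler EET A (\<delta> h) (es u)"
    unfolding comult_E_eq by (rule KB.tensor_lift_tens[OF vs_EET comult_E_bilinear dK[OF h] u])
  also have "\<dots> = es u (\<delta> h) (\<delta> h)" by (rule sw_A_delta[OF vs_EET es_bilinear[OF u] h])
  finally show ?thesis by (simp add: es_def sweedler_def)
qed

text \<open>
  On \<open>h \<bowtie> u\<close> both sides equal \<open>\<Delta>(h) \<Delta>(j(u))\<close>, as \<open>h\<close> is grouplike and \<open>j\<close> is a Hopf homomorphism.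
\<close>

lemma phi_comult:
  assumes e: "e \<in> carrier T"
  shows "comult D.H (phi e) = tmap D.B D.B phi phi (comult E e)"
proof -
  have lp: "lin E0 D.B phi" unfolding lin_E0 by (rule lin_phi)
  note tl = lin_tmap[OF EE.vs2_axioms D.BB.vs2_axioms lp lp]
  note tt = tmap_tens[OF EE.vs2_axioms D.BB.vs2_axioms lp lp]
  note jl = lin_tmap[OF BB.vs2_axioms D.BB.vs2_axioms lin_j lin_j]
  note jt = tmap_tens[OF BB.vs2_axioms D.BB.vs2_axioms lin_j lin_j]
  show ?thesis
  proof (rule lin_T_eqI[OF D.TT.vs_axioms lin_comp[OF lin_phi alg_hom_lin[OF D.alg_hom_comult]] lin_comp[OF lin_comult_E tl] _ e])
    fix h u assume h: "h \<in> carrier \<Gamma>" and u: "u \<in> carrier B"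
    let ?h = "D.\<tau> (h, \<one>\<^bsub>G\<^esub>)"
    have hc: "?h \<in> carrier D.B" using h by simp
    have uc: "comult H u \<in> carrier TT" by (rule alg_hom_closed[OF alg_hom_comult u])
    have b: "bilinear_into B B EET (et (\<delta> h) (\<delta> h))" by (rule et_bilinear[OF dK[OF h] dK[OF h]])
    have "tmap D.B D.B phi phi (comult E (tn (\<delta> h) u)) =
        tensor_lift D.TT (\<lambda>u1 u2. tmap D.B D.B phi phi (et (\<delta> h) (\<delta> h) u1 u2)) (comult H u)"
      unfolding comult_E_tens[OF h u]
      by (rule BB.tensor_lift_comp[OF vs_EET D.TT.vs_axioms b tl uc])
    also have "\<dots> = tens D.B D.B ?h ?h \<otimes>\<^bsub>D.TT\<^esub> tmap D.B D.B j j (comult H u)"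
    proof (rule BB.lin_tensor_eqI'[OF D.TT.vs_axioms _ _ _ uc])
      have b': "bilinear_into B B D.TT (\<lambda>u1 u2. tmap D.B D.B phi phi (et (\<delta> h) (\<delta> h) u1 u2))"
        by (rule bilinear_comp[OF b tl])
      show "lin TT D.TT (tensor_lift D.TT (\<lambda>u1 u2. tmap D.B D.B phi phi (et (\<delta> h) (\<delta> h) u1 u2)))"
        by (rule BB.lin_tensor_lift'[OF D.TT.vs_axioms b'])
      show "lin TT D.TT (\<lambda>Y. tens D.B D.B ?h ?h \<otimes>\<^bsub>D.TT\<^esub> tmap D.B D.B j j Y)"
        by (rule lin_comp[OF jl D.TT.lin_mult_left[OF D.BB.tensor_closed[OF hc hc]]])
      fix u1 u2 assume u12: "u1 \<in> carrier B" "u2 \<in> carrier B"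
      have "tmap D.B D.B phi phi (et (\<delta> h) (\<delta> h) u1 u2) = tens D.B D.B (?h \<otimes>\<^bsub>D.B\<^esub> j u1) (?h \<otimes>\<^bsub>D.B\<^esub> j u2)"
        unfolding et_def tt[OF et_closed'[OF dK[OF h] u12(1)] et_closed'[OF dK[OF h] u12(2)]]
          phi_tens[OF dK[OF h] u12(1)] phi_tens[OF dK[OF h] u12(2)] i_delta[OF h] ..
      also have "\<dots> = tens D.B D.B ?h ?h \<otimes>\<^bsub>D.TT\<^esub> tmap D.B D.B j j (tens B B u1 u2)"
        unfolding jt[OF u12] D.BB.tensor_mult_tens[OF hc hc j_closed[OF u12(1)] j_closed[OF u12(2)]] ..
      finally show "tensor_lift D.TT (\<lambda>u1 u2. tmap D.B D.B phi phi (et (\<delta> h) (\<delta> h) u1 u2)) (tens B B u1 u2) =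
         tens D.B D.B ?h ?h \<otimes>\<^bsub>D.TT\<^esub> tmap D.B D.B j j (tens B B u1 u2)"
        unfolding BB.tensor_lift_tens[OF D.TT.vs_axioms b' u12] .
    qed
    also have "tmap D.B D.B j j (comult H u) = comult D.H (j u)"
      using J.hopf_hom_amap u by (simp add: hopf_hom_iff H_simps tmap_def D.tensor_H)
    also have "tens D.B D.B ?h ?h \<otimes>\<^bsub>D.TT\<^esub> comult D.H (j u) = comult D.H (phi (tn (\<delta> h) u))"
      unfolding phi_tens[OF dK[OF h] u] i_delta[OF h] alg_hom_mult[OF D.alg_hom_comult hc j_closed[OF u]]
      using h by (simp add: D.comult_tau)
    finally show "comult D.H (phi (tn (\<delta> h) u)) = tmap D.B D.B phi phi (comult E (tn (\<delta> h) u))" by simp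
  qed
qed

lemma phi_counit:
  assumes e: "e \<in> carrier T"
  shows "counit D.H (phi e) = counit E e"
proof -
  have ce: "counit E = tensor_lift ground (\<lambda>a u. counit A a * counit H u)"
    by (simp add: bicrossed_def Let_def module.extend_def hopf.fields_def)
  have b: "bilinear_into K B ground (\<lambda>a u. counit A a * counit H u)"
    using GA.counit_A(1) alg_hom_lin[OF alg_hom_counit] by (simp add: bilinear_into_def lin_def algebra_simps)
  show ?thesis
    unfolding ce
  proof (rule lin_T_eqI[OF vs_ground lin_comp[OF lin_phi alg_hom_lin[OF D.alg_hom_counit]] KB.lin_tensor_lift[OF vs_ground b] _ e])
    fix h u assume h: "h \<in> carrier \<Gamma>" and u: "u \<in> carrier B"
    have "counit D.H (j u) = counit H u"
      using J.hopf_hom_amap u by (simp add: hopf_hom_iff H_simps)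
    then show "counit D.H (phi (tn (\<delta> h) u)) = tensor_lift ground (\<lambda>a u. counit A a * counit H u) (tn (\<delta> h) u)"
      unfolding KB.tensor_lift_tens[OF vs_ground b dK[OF h] u] phi_tens[OF dK[OF h] u] i_delta[OF h]
      using h j_closed[OF u] by (simp add: alg_hom_mult[OF D.alg_hom_counit] D.counit_tau GA.counit_A(2))
  qed
qed

definition ae where "ae a u = tn \<one>\<^bsub>K\<^esub> (antipode H u) \<otimes>\<^bsub>E0\<^esub> tn (antipode A a) \<one>\<^bsub>B\<^esub>"

lemma antipode_E_eq: "antipode E = tensor_lift E0 ae"
  by (simp add: bicrossed_def Let_def module.extend_def hopf.fields_def ae_def[abs_def] tensor_AH GA.A_simps H_simps del: monoid_alg_simps)

lemma antipode_H_closed: "u \<in> carrier B \<Longrightarrow> antipode H u \<in> carrier B"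
  using alg_hom_closed[OF alg_hom_antipode] by simp

lemma lin_antipode_H: "lin B B (antipode H)"
  using alg_hom_lin[OF alg_hom_antipode] by (simp add: lin_opp)

lemma ae_bilinear: "bilinear_into K B E0 ae"
proof (rule bilinearI)
  show "lin K E0 (\<lambda>a. ae a u)" if u: "u \<in> carrier B" for u
    unfolding ae_def lin_E0
    by (rule lin_comp[OF GA.antipode_A(1) lin_comp[OF tnL[OF B.one_closed]
          E_mult_right[OF KB.tens_closed[OF GA.K.one_closed antipode_H_closed[OF u]]]]])
  show "lin B E0 (\<lambda>u. ae a u)" if a: "a \<in> carrier K" for a
    unfolding ae_def lin_E0
    by (rule lin_comp[OF lin_antipode_H lin_comp[OF tnR[OF GA.K.one_closed]
          E_mult_left[OF KB.tens_closed[OF lin_closed[OF GA.antipode_A(1) a] B.one_closed]]]])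
qed

lemma lin_antipode_E: "lin T T (antipode E)"
  unfolding antipode_E_eq using KB.lin_tensor_lift[OF vs_E0 ae_bilinear] by (simp add: lin_E0)

lemma inv_Lam_left:
  assumes h: "h \<in> carrier \<Gamma>"
  shows "inv\<^bsub>\<Lambda>\<^esub> (h, \<one>\<^bsub>G\<^esub>) = (inv\<^bsub>\<Gamma>\<^esub> h, \<one>\<^bsub>G\<^esub>)"
proof -
  have 1: "(inv\<^bsub>\<Gamma>\<^esub> h, \<one>\<^bsub>G\<^esub>) \<otimes>\<^bsub>\<Lambda>\<^esub> (h, \<one>\<^bsub>G\<^esub>) = \<one>\<^bsub>\<Lambda>\<^esub>"
    unfolding Lam_simps l_one[OF h] r_at_one[OF h] Gam.l_inv[OF h] by simp
  have 2: "(h, \<one>\<^bsub>G\<^esub>) \<in> carrier \<Lambda>" "(inv\<^bsub>\<Gamma>\<^esub> h, \<one>\<^bsub>G\<^esub>) \<in> carrier \<Lambda>"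
    unfolding Lam_simps using h by simp_all
  show ?thesis by (rule group.inv_equality[OF group_Lam 1 2])
qed

text \<open>
  Both sides are \<open>S(j(u)) h^(-1)\<close> on \<open>h \<bowtie> u\<close>, because the antipode reverses products and \<open>j\<close>
  commutes with antipodes.
\<close>

lemma phi_antipode:
  assumes e: "e \<in> carrier T"
  shows "antipode D.H (phi e) = phi (antipode E e)"
proof (rule lin_T_eqI[OF D.B.vs_axioms _ lin_comp[OF lin_antipode_E lin_phi] _ e])
  have "lin D.B D.B (antipode D.H)"
    using alg_hom_lin[OF D.alg_hom_antipode] by (simp add: lin_opp)
  then show "lin T D.B (\<lambda>e. antipode D.H (phi e))" by (rule lin_comp[OF lin_phi])
  fix h u assume h: "h \<in> carrier \<Gamma>" and u: "u \<in> carrier B"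
  let ?h = "D.\<tau> (h, \<one>\<^bsub>G\<^esub>)"
  note Su = antipode_H_closed[OF u] and hi = dK[OF Gam.inv_closed[OF h]]
  note inv = inv_Lam_left[OF h]
  have "antipode E (tn (\<delta> h) u) = tn \<one>\<^bsub>K\<^esub> (antipode H u) \<otimes>\<^bsub>E0\<^esub> tn (\<delta> (inv\<^bsub>\<Gamma>\<^esub> h)) \<one>\<^bsub>B\<^esub>"
    unfolding antipode_E_eq KB.tensor_lift_tens[OF vs_E0 ae_bilinear dK[OF h] u]
    unfolding ae_def GA.antipode_A(2)[OF h] ..
  then have "phi (antipode E (tn (\<delta> h) u)) = phi (tn \<one>\<^bsub>K\<^esub> (antipode H u)) \<otimes>\<^bsub>D.B\<^esub> phi (tn (\<delta> (inv\<^bsub>\<Gamma>\<^esub> h)) \<one>\<^bsub>B\<^esub>)"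
    using phi_mult[OF KB.tens_closed[OF GA.K.one_closed Su] KB.tens_closed[OF hi B.one_closed]] by simp
  also have "\<dots> = j (antipode H u) \<otimes>\<^bsub>D.B\<^esub> D.\<tau> (inv\<^bsub>\<Gamma>\<^esub> h, \<one>\<^bsub>G\<^esub>)"
    unfolding phi_tens[OF GA.K.one_closed Su] phi_tens[OF hi B.one_closed] i_one j_one i_delta[OF Gam.inv_closed[OF h]]
    using j_closed[OF Su] h by simp
  also have "j (antipode H u) = antipode D.H (j u)"
    using J.hopf_hom_amap u by (simp add: hopf_hom_iff H_simps)
  also have "antipode D.H (j u) \<otimes>\<^bsub>D.B\<^esub> D.\<tau> (inv\<^bsub>\<Gamma>\<^esub> h, \<one>\<^bsub>G\<^esub>) = antipode D.H (phi (tn (\<delta> h) u))"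
    unfolding phi_tens[OF dK[OF h] u] i_delta[OF h]
    using alg_hom_mult[OF D.alg_hom_antipode, of ?h "j u"] h j_closed[OF u] D.antipode_tau[of "(h, \<one>\<^bsub>G\<^esub>)"] inv
    by simp
  finally show "antipode D.H (phi (tn (\<delta> h) u)) = phi (antipode E (tn (\<delta> h) u))" by simp
qed

theorem hopf_iso_phi: "phi \<in> hopf_iso E D.H"
proof -
  have cE: "carrier E = carrier T" by (simp add: E_simps E0_simps)
  have l: "lin E D.H phi" using lin_phi by (simp add: lin_def E_simps E0_simps(1-4) D.H_simps)
  have "alg_hom E D.H phi"
    unfolding alg_hom_def
  proof (intro conjI ballI)
    show "lin E D.H phi" by (rule l)
    show "phi \<one>\<^bsub>E\<^esub> = \<one>\<^bsub>D.H\<^esub>" unfolding E_simps D.H_simps by (rule phi_one)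
    show "phi (a \<otimes>\<^bsub>E\<^esub> b) = phi a \<otimes>\<^bsub>D.H\<^esub> phi b" if "a \<in> carrier E" "b \<in> carrier E" for a b
      using phi_mult that unfolding E_simps D.H_simps E0_simps(1) by blast
  qed
  moreover have "tmap D.H D.H phi phi = tmap D.B D.B phi phi"
    by (simp add: tmap_def[abs_def] D.tensor_H)
  ultimately have "phi \<in> hopf_hom E D.H"
    unfolding hopf_hom_iff cE by (simp add: phi_comult phi_counit phi_antipode)
  then show ?thesis
    using bij_phi by (simp add: hopf_iso_def cE D.H_simps)
qed

lemma hopf_closed_E: "hopf_closed E"
proof -
  have cE: "carrier E = carrier T" by (simp add: E_simps E0_simps)
  show ?thesis
    unfolding hopf_closed_def cE tensor_EE
    using vs_E lin_closed[OF lin_comult_E] lin_closed[OF lin_antipode_E] E_mult_closed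
      KB.tens_closed[OF GA.K.one_closed B.one_closed]
    by (simp add: E_simps E0_simps(5) del: monoid_alg_simps)
qed

end

section \<open>Factor-preserving isomorphisms\<close>

context bicross begin

lemma factor_left_eq: "factor_left A H = (\<lambda>a. tn a \<one>\<^bsub>B\<^esub>) ` carrier K"
  and factor_right_eq: "factor_right A H = (\<lambda>u. tn \<one>\<^bsub>K\<^esub> u) ` carrier B"
  by (simp_all only: factor_left_def factor_right_def tensor_AH H_simps GA.A_simps)

lemma phi_left: "a \<in> carrier K \<Longrightarrow> phi (tn a \<one>\<^bsub>B\<^esub>) = i a"
  by (subst phi_tens) (simp_all add: j_one i_closed del: monoid_alg_simps)

lemma phi_right: "u \<in> carrier B \<Longrightarrow> phi (tn \<one>\<^bsub>K\<^esub> u) = j u"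
  by (subst phi_tens) (simp_all add: i_one j_closed del: monoid_alg_simps)

text \<open>
  A group element of \<open>\<Lambda>\<close> that lies in the image of \<open>k[\<Gamma>]\<close> has trivial component in \<open>G\<close>, because
  the other coordinates vanish on this image; the next lemma is the analogue for the image of \<open>j\<close>.
\<close>

lemma pcoord_i:
  assumes y: "y \<in> carrier \<Lambda>" "snd y \<noteq> \<one>\<^bsub>G\<^esub>" and a: "a \<in> carrier K"
  shows "D.pcoord y (i a) = 0"
proof (rule spans_induct[OF GA.spans_K _ _ a])
  show "subsp K {a \<in> carrier K. D.pcoord y (i a) = 0}"
    using GA.K.lin_zero[OF D.B.vs_axioms lin_i] D.pcoord_zero[of y]
    by (auto simp: subsp_def lin_add[OF lin_i] lin_smult[OF lin_i] i_closed D.pcoord_add D.pcoord_smult simp del: monoid_alg_simps)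
  show "D.pcoord y (i s) = 0" if "s \<in> \<delta> ` carrier \<Gamma>" for s
    using that y by (auto simp: i_delta D.pcoord_tau)
qed

lemma pcoord_j:
  assumes y: "y \<in> carrier \<Lambda>" "fst y \<noteq> \<one>\<^bsub>\<Gamma>\<^esub>" and u: "u \<in> carrier B"
  shows "D.pcoord y (j u) = 0"
proof (rule spans_induct[OF spans_red _ _ u])
  show "subsp B {u \<in> carrier B. D.pcoord y (j u) = 0}"
    using B.lin_zero[OF D.B.vs_axioms lin_j] D.pcoord_zero[of y]
    by (auto simp: subsp_def lin_add[OF lin_j] lin_smult[OF lin_j] j_closed D.pcoord_add D.pcoord_smult)
  fix s assume "s \<in> {\<tau> t \<otimes>\<^bsub>B\<^esub> pev B X q |t q. t \<in> carrier G \<and> degree q < CHAR('k)}"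
  then obtain t q where s: "s = \<tau> t \<otimes>\<^bsub>B\<^esub> pev B X q" "t \<in> carrier G" "degree q < CHAR('k)" by blast
  have "j s = D.\<tau> (\<one>\<^bsub>\<Gamma>\<^esub>, t) \<otimes>\<^bsub>D.B\<^esub> pev D.B D.X q"
    using s by (simp add: j_mult j_tau alg_hom_pev[OF kalg_B D.kalg_B J.alg_hom_amap] J.amap_X)
  then show "D.pcoord y (j s) = 0"
    using y s by (auto simp: D.pcoord_basis)
qed

lemma left_trivial_imp:
  assumes "left_trivial A H L" "t \<in> carrier G" "h \<in> carrier \<Gamma>"
  shows "l t h = h"
proof -
  have "L (\<tau> t) (\<delta> h) = counit H (\<tau> t) \<odot>\<^bsub>A\<^esub> \<delta> h"
    using assms by (simp add: left_trivial_def H_simps GA.A_simps)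
  then have "(\<delta> (l t h) :: 'h \<Rightarrow>\<^sub>0 'k) = \<delta> h"
    using assms(2,3) by (simp add: L_tau counit_tau GA.A_simps scale_single)
  then have "Poly_Mapping.keys (\<delta> (l t h) :: 'h \<Rightarrow>\<^sub>0 'k) = Poly_Mapping.keys (\<delta> h :: 'h \<Rightarrow>\<^sub>0 'k)" by (rule arg_cong)
  then show ?thesis by simp
qed

lemma inv_phi: "e \<in> carrier T \<Longrightarrow> inv_into (carrier E) phi (phi e) = e"
  using bij_phi by (simp add: E_simps E0_simps(1) bij_betw_inv_into_left)

end

locale bicross_pair = X: bicross \<Gamma> G g f l r \<gamma> L R + Y: bicross \<Gamma> G g f l' r' \<gamma>' L' R'
  for \<Gamma> :: "'h monoid" and G :: "'g monoid" and g and f :: "'g \<Rightarrow> 'k::field"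
    and l r \<gamma> L R and l' r' \<gamma>' L' R'
begin

sublocale P: third_type_pair X.\<Lambda> "(\<one>\<^bsub>\<Gamma>\<^esub>, g)" X.F Y.\<Lambda> "(\<one>\<^bsub>\<Gamma>\<^esub>, g)" Y.F ..

lemma E_iso_D: "hopf_isomorphic X.E X.D.H" "hopf_isomorphic Y.E Y.D.H"
  using X.hopf_iso_phi Y.hopf_iso_phi by (auto simp: hopf_isomorphic_def)

text \<open>
  Hopf isomorphisms between the bicrossed products correspond to those between the Hopf algebras
  of the two groups, by conjugation with the comparison maps.
\<close>

lemma transport:
  "\<Phi> \<in> hopf_iso X.E Y.E \<Longrightarrow> (\<lambda>u. Y.phi (\<Phi> (inv_into (carrier X.E) X.phi u))) \<in> hopf_iso X.D.H Y.D.H"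
  by (rule hopf_iso_comp[OF X.D.hopf_closed_H X.hopf_closed_E Y.D.hopf_closed_H
        hopf_iso_inv[OF X.hopf_closed_E X.D.hopf_closed_H X.hopf_iso_phi]
        hopf_iso_comp[OF X.hopf_closed_E Y.hopf_closed_E Y.D.hopf_closed_H _ Y.hopf_iso_phi]])

lemma transport':
  "\<chi> \<in> hopf_iso X.D.H Y.D.H \<Longrightarrow> (\<lambda>e. inv_into (carrier Y.E) Y.phi (\<chi> (X.phi e))) \<in> hopf_iso X.E Y.E"
  by (rule hopf_iso_comp[OF X.hopf_closed_E Y.D.hopf_closed_H Y.hopf_closed_E
        hopf_iso_comp[OF X.hopf_closed_E X.D.hopf_closed_H Y.D.hopf_closed_H X.hopf_iso_phi]
        hopf_iso_inv[OF Y.hopf_closed_E Y.D.hopf_closed_H Y.hopf_iso_phi]])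

lemma E_isomorphic_iff: "hopf_isomorphic X.E Y.E \<longleftrightarrow> hopf_isomorphic X.D.H Y.D.H"
  unfolding hopf_isomorphic_def using transport transport' by blast

text \<open>
  Let \<open>\<Theta>\<close> be the group isomorphism belonging to the transported map. Preservation of the factors
  means \<open>\<Theta>(h, 1) = (\<psi>(h), 1)\<close> and \<open>\<Theta>(1, t) = (1, \<sigma>(t))\<close>. Injectivity passes to \<open>\<psi>\<close> and \<open>\<sigma>\<close>, and
  surjectivity follows as the groups are finite. Since \<open>t h = h (t \<triangleleft> h)\<close> in \<open>\<Lambda>\<close> for trivial left
  action, applying \<open>\<Theta>\<close> gives \<open>\<sigma>(t) \<triangleleft>' \<psi>(h) = \<sigma>(t \<triangleleft> h)\<close>.
\<close>

lemma factor_iso_imp_params: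
  assumes lt: "left_trivial X.A X.H L" "left_trivial X.A X.H L'"
    and \<Phi>: "\<Phi> \<in> hopf_iso X.E Y.E" "factor_preserving X.A X.H \<Phi>"
  shows "\<exists>\<sigma>\<in>Aut_gf G g f. \<exists>\<psi>\<in>iso \<Gamma> \<Gamma>. \<forall>h\<in>carrier \<Gamma>.
     (\<forall>t\<in>carrier G. r' t h = \<sigma> (r (inv_into (carrier G) \<sigma> t) (inv_into (carrier \<Gamma>) \<psi> h))) \<and>
     \<gamma>' h = \<gamma> (inv_into (carrier \<Gamma>) \<psi> h)"
proof -
  note lx = X.left_trivial_imp[OF lt(1)] and ly = Y.left_trivial_imp[OF lt(2)]
  from P.hopf_iso_imp_group_iso[OF transport[OF \<Phi>(1)]]
  obtain \<Theta> where iso: "\<Theta> \<in> iso X.\<Lambda> Y.\<Lambda>" and \<Theta>g: "\<Theta> (\<one>\<^bsub>\<Gamma>\<^esub>, g) = (\<one>\<^bsub>\<Gamma>\<^esub>, g)"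
    and \<Theta>F: "\<And>y. y \<in> carrier X.\<Lambda> \<Longrightarrow> Y.F (\<Theta> y) = X.F y"
    and \<Theta>\<tau>: "\<And>y. y \<in> carrier X.\<Lambda> \<Longrightarrow> Y.phi (\<Phi> (inv_into (carrier X.E) X.phi (X.D.\<tau> y))) = Y.D.\<tau> (\<Theta> y)"
    by blast
  have \<Theta>c: "\<Theta> y \<in> carrier Y.\<Lambda>" if "y \<in> carrier X.\<Lambda>" for y
    using iso that by (auto simp: iso_def hom_def)
  have \<Theta>m: "\<Theta> (y \<otimes>\<^bsub>X.\<Lambda>\<^esub> z) = \<Theta> y \<otimes>\<^bsub>Y.\<Lambda>\<^esub> \<Theta> z" if "y \<in> carrier X.\<Lambda>" "z \<in> carrier X.\<Lambda>" for y z
    using iso that by (auto simp: iso_def hom_def)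
  have \<Theta>i: "\<Theta> y = \<Theta> z \<longleftrightarrow> y = z" if "y \<in> carrier X.\<Lambda>" "z \<in> carrier X.\<Lambda>" for y z
    using iso that by (auto simp: iso_def bij_betw_def inj_on_eq_iff)
  define \<psi> where "\<psi> h = fst (\<Theta> (h, \<one>\<^bsub>G\<^esub>))" for h
  define \<sigma> where "\<sigma> t = snd (\<Theta> (\<one>\<^bsub>\<Gamma>\<^esub>, t))" for t
  have \<Theta>h: "\<Theta> (h, \<one>\<^bsub>G\<^esub>) = (\<psi> h, \<one>\<^bsub>G\<^esub>)" if h: "h \<in> carrier \<Gamma>" for h
  proof -
    let ?y = "(h, \<one>\<^bsub>G\<^esub>)"
    have y: "?y \<in> carrier X.\<Lambda>" using h by simp
    have e: "X.tn (\<delta> h) \<one>\<^bsub>X.B\<^esub> \<in> carrier X.T" by (rule X.KB.tens_closed[OF X.dK[OF h] X.B.one_closed])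
    have "X.D.\<tau> ?y = X.phi (X.tn (\<delta> h) \<one>\<^bsub>X.B\<^esub>)"
      using h by (simp add: X.phi_left[OF X.dK[OF h]] X.i_delta)
    then have iv: "inv_into (carrier X.E) X.phi (X.D.\<tau> ?y) = X.tn (\<delta> h) \<one>\<^bsub>X.B\<^esub>"
      using X.inv_phi[OF e] by simp
    have "X.tn (\<delta> h) \<one>\<^bsub>X.B\<^esub> \<in> factor_left X.A X.H"
      unfolding X.factor_left_eq by (rule imageI[OF X.dK[OF h]])
    then have "\<Phi> (X.tn (\<delta> h) \<one>\<^bsub>X.B\<^esub>) \<in> factor_left X.A X.H"
      using \<Phi>(2) unfolding factor_preserving_def by blast
    then obtain a where a: "a \<in> carrier X.K" "\<Phi> (X.tn (\<delta> h) \<one>\<^bsub>X.B\<^esub>) = X.tn a \<one>\<^bsub>X.B\<^esub>"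
      unfolding X.factor_left_eq by blast
    have "Y.D.\<tau> (\<Theta> ?y) = Y.i a"
      using \<Theta>\<tau>[OF y] unfolding iv a(2) Y.phi_left[OF a(1)] by simp
    then have "snd (\<Theta> ?y) = \<one>\<^bsub>G\<^esub>"
      using Y.pcoord_i[OF \<Theta>c[OF y] _ a(1)] Y.D.pcoord_tau[OF \<Theta>c[OF y] \<Theta>c[OF y]] by force
    then show ?thesis unfolding \<psi>_def by (metis prod.collapse)
  qed
  have \<Theta>t: "\<Theta> (\<one>\<^bsub>\<Gamma>\<^esub>, t) = (\<one>\<^bsub>\<Gamma>\<^esub>, \<sigma> t)" if t: "t \<in> carrier G" for t
  proof -
    let ?y = "(\<one>\<^bsub>\<Gamma>\<^esub>, t)"
    have y: "?y \<in> carrier X.\<Lambda>" using t by simp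
    have tc: "X.\<tau> t \<in> carrier X.B" using t by simp
    have e: "X.tn \<one>\<^bsub>X.K\<^esub> (X.\<tau> t) \<in> carrier X.T" by (rule X.KB.tens_closed[OF X.GA.K.one_closed tc])
    have "X.D.\<tau> ?y = X.phi (X.tn \<one>\<^bsub>X.K\<^esub> (X.\<tau> t))"
      using t by (simp add: X.phi_right[OF tc] X.j_tau del: monoid_alg_simps)
    then have iv: "inv_into (carrier X.E) X.phi (X.D.\<tau> ?y) = X.tn \<one>\<^bsub>X.K\<^esub> (X.\<tau> t)"
      using X.inv_phi[OF e] by simp
    have "X.tn \<one>\<^bsub>X.K\<^esub> (X.\<tau> t) \<in> factor_right X.A X.H"
      unfolding X.factor_right_eq by (rule imageI[OF tc])
    then have "\<Phi> (X.tn \<one>\<^bsub>X.K\<^esub> (X.\<tau> t)) \<in> factor_right X.A X.H"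
      using \<Phi>(2) unfolding factor_preserving_def by blast
    then obtain u where u: "u \<in> carrier X.B" "\<Phi> (X.tn \<one>\<^bsub>X.K\<^esub> (X.\<tau> t)) = X.tn \<one>\<^bsub>X.K\<^esub> u"
      unfolding X.factor_right_eq by blast
    have "Y.D.\<tau> (\<Theta> ?y) = Y.j u"
      using \<Theta>\<tau>[OF y] unfolding iv u(2) Y.phi_right[OF u(1)] by simp
    then have "fst (\<Theta> ?y) = \<one>\<^bsub>\<Gamma>\<^esub>"
      using Y.pcoord_j[OF \<Theta>c[OF y] _ u(1)] Y.D.pcoord_tau[OF \<Theta>c[OF y] \<Theta>c[OF y]] by force
    then show ?thesis unfolding \<sigma>_def by (metis prod.collapse)
  qed
  have \<psi>c: "\<psi> h \<in> carrier \<Gamma>" if "h \<in> carrier \<Gamma>" for h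
    using \<Theta>c[of "(h, \<one>\<^bsub>G\<^esub>)"] that \<Theta>h[OF that] by simp
  have \<sigma>c: "\<sigma> t \<in> carrier G" if "t \<in> carrier G" for t
    using \<Theta>c[of "(\<one>\<^bsub>\<Gamma>\<^esub>, t)"] that \<Theta>t[OF that] by simp
  have \<psi>m: "\<psi> (h \<otimes>\<^bsub>\<Gamma>\<^esub> k) = \<psi> h \<otimes>\<^bsub>\<Gamma>\<^esub> \<psi> k" if "h \<in> carrier \<Gamma>" "k \<in> carrier \<Gamma>" for h k
    using \<Theta>m[of "(h, \<one>\<^bsub>G\<^esub>)" "(k, \<one>\<^bsub>G\<^esub>)"] that by (simp add: \<Theta>h \<psi>c)
  have \<sigma>m: "\<sigma> (s \<otimes>\<^bsub>G\<^esub> t) = \<sigma> s \<otimes>\<^bsub>G\<^esub> \<sigma> t" if "s \<in> carrier G" "t \<in> carrier G" for s t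
    using \<Theta>m[of "(\<one>\<^bsub>\<Gamma>\<^esub>, s)" "(\<one>\<^bsub>\<Gamma>\<^esub>, t)"] that by (simp add: \<Theta>t \<sigma>c)
  have \<psi>i: "inj_on \<psi> (carrier \<Gamma>)"
    by (rule inj_onI) (use \<Theta>i[of "(h, \<one>\<^bsub>G\<^esub>)" "(k, \<one>\<^bsub>G\<^esub>)" for h k] \<Theta>h in auto)
  have \<sigma>i: "inj_on \<sigma> (carrier G)"
    by (rule inj_onI) (use \<Theta>i[of "(\<one>\<^bsub>\<Gamma>\<^esub>, s)" "(\<one>\<^bsub>\<Gamma>\<^esub>, t)" for s t] \<Theta>t in auto)
  have \<psi>b: "bij_betw \<psi> (carrier \<Gamma>) (carrier \<Gamma>)"
    using endo_inj_surj[OF X.fin_Gam _ \<psi>i] \<psi>c \<psi>i by (auto simp: bij_betw_def)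
  have \<sigma>b: "bij_betw \<sigma> (carrier G) (carrier G)"
    using endo_inj_surj[OF X.finite_G _ \<sigma>i] \<sigma>c \<sigma>i by (auto simp: bij_betw_def)
  have \<psi>iso: "\<psi> \<in> iso \<Gamma> \<Gamma>" using \<psi>b \<psi>c \<psi>m by (auto simp: iso_def hom_def)
  have "\<sigma> \<in> iso G G" using \<sigma>b \<sigma>c \<sigma>m by (auto simp: iso_def hom_def)
  moreover have "\<sigma> g = g" using \<Theta>g \<Theta>t[OF X.g_closed] by simp
  moreover have "f (\<sigma> t) = f t" if "t \<in> carrier G" for t
    using \<Theta>F[of "(\<one>\<^bsub>\<Gamma>\<^esub>, t)"] that by (simp add: \<Theta>t assoc_fun_def)
  ultimately have \<sigma>aut: "\<sigma> \<in> Aut_gf G g f" by (simp add: Aut_gf_def)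
  have \<gamma>: "\<gamma>' (\<psi> h) = \<gamma> h" if "h \<in> carrier \<Gamma>" for h
    using \<Theta>F[of "(h, \<one>\<^bsub>G\<^esub>)"] that by (simp add: \<Theta>h assoc_fun_def)
  have r: "r' (\<sigma> t) (\<psi> h) = \<sigma> (r t h)" if h: "h \<in> carrier \<Gamma>" and t: "t \<in> carrier G" for h t
  proof -
    have "(\<one>\<^bsub>\<Gamma>\<^esub>, t) \<otimes>\<^bsub>X.\<Lambda>\<^esub> (h, \<one>\<^bsub>G\<^esub>) = (h, \<one>\<^bsub>G\<^esub>) \<otimes>\<^bsub>X.\<Lambda>\<^esub> (\<one>\<^bsub>\<Gamma>\<^esub>, r t h)"
      using h t by (simp add: lx)
    then have "\<Theta> (\<one>\<^bsub>\<Gamma>\<^esub>, t) \<otimes>\<^bsub>Y.\<Lambda>\<^esub> \<Theta> (h, \<one>\<^bsub>G\<^esub>) = \<Theta> (h, \<one>\<^bsub>G\<^esub>) \<otimes>\<^bsub>Y.\<Lambda>\<^esub> \<Theta> (\<one>\<^bsub>\<Gamma>\<^esub>, r t h)"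
      using h t by (simp flip: \<Theta>m)
    then show ?thesis using h t by (simp add: \<Theta>h \<Theta>t \<psi>c \<sigma>c)
  qed
  show ?thesis
  proof (intro bexI[OF _ \<sigma>aut] bexI[OF _ \<psi>iso] ballI conjI)
    fix h assume h: "h \<in> carrier \<Gamma>"
    let ?h = "inv_into (carrier \<Gamma>) \<psi> h"
    have h': "?h \<in> carrier \<Gamma>" "\<psi> ?h = h"
      using bij_betwE[OF bij_betw_inv_into[OF \<psi>b]] h bij_betw_inv_into_right[OF \<psi>b h] by auto
    show "\<gamma>' h = \<gamma> ?h" using \<gamma>[OF h'(1)] h'(2) by simp
    fix t assume t: "t \<in> carrier G"
    let ?t = "inv_into (carrier G) \<sigma> t"
    have t': "?t \<in> carrier G" "\<sigma> ?t = t"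
      using bij_betwE[OF bij_betw_inv_into[OF \<sigma>b]] t bij_betw_inv_into_right[OF \<sigma>b t] by auto
    show "r' t h = \<sigma> (r ?t ?h)" using r[OF h'(1) t'(1)] h'(2) t'(2) by simp
  qed
qed

text \<open>
  The product map \<open>\<Theta> = \<psi> \<times> \<sigma>\<close> is an isomorphism of the groups compatible with the data. The
  induced Hopf isomorphism restricts to the linear extension of \<open>\<psi>\<close> on \<open>k[\<Gamma>]\<close> and to the
  automorphism induced by \<open>\<sigma>\<close> on the other factor, and both of these are surjective.
\<close>

lemma params_imp_factor_iso:
  assumes lt: "left_trivial X.A X.H L" "left_trivial X.A X.H L'"
    and \<sigma>: "\<sigma> \<in> Aut_gf G g f" and \<psi>: "\<psi> \<in> iso \<Gamma> \<Gamma>"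
    and par: "\<And>t h. t \<in> carrier G \<Longrightarrow> h \<in> carrier \<Gamma> \<Longrightarrow>
      r' t h = \<sigma> (r (inv_into (carrier G) \<sigma> t) (inv_into (carrier \<Gamma>) \<psi> h))"
      "\<And>h. h \<in> carrier \<Gamma> \<Longrightarrow> \<gamma>' h = \<gamma> (inv_into (carrier \<Gamma>) \<psi> h)"
  shows "\<exists>\<Phi>\<in>hopf_iso X.E Y.E. factor_preserving X.A X.H \<Phi>"
proof -
  note lx = X.left_trivial_imp[OF lt(1)] and ly = Y.left_trivial_imp[OF lt(2)]
  have \<psi>b: "bij_betw \<psi> (carrier \<Gamma>) (carrier \<Gamma>)" using \<psi> by (simp add: iso_def)
  have \<sigma>i: "\<sigma> \<in> iso G G" using \<sigma> by (simp add: Aut_gf_def)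
  have \<sigma>b: "bij_betw \<sigma> (carrier G) (carrier G)" using \<sigma>i by (simp add: iso_def)
  have \<psi>c: "\<psi> h \<in> carrier \<Gamma>" if "h \<in> carrier \<Gamma>" for h using \<psi> that by (auto simp: iso_def hom_def)
  have \<sigma>c: "\<sigma> t \<in> carrier G" if "t \<in> carrier G" for t using \<sigma>i that by (auto simp: iso_def hom_def)
  have \<psi>m: "\<psi> (h \<otimes>\<^bsub>\<Gamma>\<^esub> k) = \<psi> h \<otimes>\<^bsub>\<Gamma>\<^esub> \<psi> k" if "h \<in> carrier \<Gamma>" "k \<in> carrier \<Gamma>" for h k
    using \<psi> that by (auto simp: iso_def hom_def)
  have \<sigma>m: "\<sigma> (s \<otimes>\<^bsub>G\<^esub> t) = \<sigma> s \<otimes>\<^bsub>G\<^esub> \<sigma> t" if "s \<in> carrier G" "t \<in> carrier G" for s t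
    using \<sigma>i that by (auto simp: iso_def hom_def)
  have \<sigma>g: "\<sigma> g = g" and \<sigma>f: "\<And>t. t \<in> carrier G \<Longrightarrow> f (\<sigma> t) = f t" using \<sigma> by (simp_all add: Aut_gf_def)
  have r: "r' (\<sigma> t) (\<psi> h) = \<sigma> (r t h)" if h: "h \<in> carrier \<Gamma>" and t: "t \<in> carrier G" for h t
    using par(1)[OF \<sigma>c[OF t] \<psi>c[OF h]] by (simp add: bij_betw_inv_into_left[OF \<psi>b h] bij_betw_inv_into_left[OF \<sigma>b t])
  have \<gamma>: "\<gamma>' (\<psi> h) = \<gamma> h" if h: "h \<in> carrier \<Gamma>" for h
    using par(2)[OF \<psi>c[OF h]] by (simp add: bij_betw_inv_into_left[OF \<psi>b h])
  define \<Theta> where "\<Theta> = map_prod \<psi> \<sigma>"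
  have hom: "\<Theta> \<in> hom X.\<Lambda> Y.\<Lambda>"
    by (auto simp: hom_def \<Theta>_def \<psi>c \<sigma>c \<psi>m \<sigma>m lx ly r)
  have iso: "\<Theta> \<in> iso X.\<Lambda> Y.\<Lambda>"
    using hom bij_betw_map_prod[OF \<psi>b \<sigma>b] by (simp add: iso_def \<Theta>_def)
  interpret M: third_type_map X.\<Lambda> "(\<one>\<^bsub>\<Gamma>\<^esub>, g)" X.F Y.\<Lambda> "(\<one>\<^bsub>\<Gamma>\<^esub>, g)" Y.F \<Theta>
  proof unfold_locales
    have "\<psi> \<one>\<^bsub>\<Gamma>\<^esub> = \<one>\<^bsub>\<Gamma>\<^esub>" using \<psi> X.Gam.is_group hom_one[of \<psi> \<Gamma> \<Gamma>] by (simp add: iso_def)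
    then show "\<Theta> (\<one>\<^bsub>\<Gamma>\<^esub>, g) = (\<one>\<^bsub>\<Gamma>\<^esub>, g)" by (simp add: \<Theta>_def \<sigma>g)
    show "Y.F (\<Theta> y) = X.F y" if "y \<in> carrier X.\<Lambda>" for y
      using that by (auto simp: \<Theta>_def assoc_fun_def \<sigma>f \<gamma>)
  qed (rule hom)
  interpret N: third_type_map G g f G g f \<sigma>
    by unfold_locales (use \<sigma>i \<sigma>g \<sigma>f in \<open>auto simp: iso_def\<close>)
  define \<Phi> where "\<Phi> e = inv_into (carrier Y.E) Y.phi (M.amap (X.phi e))" for e
  have \<Phi>: "\<Phi> \<in> hopf_iso X.E Y.E"
    unfolding \<Phi>_def by (rule transport'[OF M.hopf_iso_amap[OF iso]])
  note vK = X.GA.K.vs_axioms and sK = X.GA.spans_K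
  \<comment> \<open>the endomorphism of \<open>k[\<Gamma>]\<close> that extends a self-map of \<open>\<Gamma>\<close>\<close>
  define \<rho> where "\<rho> \<pi> = lin_ext X.K (\<lambda>h. \<delta> (\<pi> h))" for \<pi> :: "'h \<Rightarrow> 'h"
  have l\<rho>: "lin X.K X.K (\<rho> \<pi>)" if "\<And>h. h \<in> carrier \<Gamma> \<Longrightarrow> \<pi> h \<in> carrier \<Gamma>" for \<pi>
  proof -
    have "lin (free_vs (carrier \<Gamma>)) X.K (lin_ext X.K (\<lambda>h. \<delta> (\<pi> h)))"
      by (rule lin_lin_ext[OF vK X.dK[OF that]])
    then show ?thesis unfolding \<rho>_def by (simp only: lin_monoid_alg)
  qed
  have \<rho>\<delta>: "\<rho> \<pi> (\<delta> h) = \<delta> (\<pi> h)" if "\<pi> h \<in> carrier \<Gamma>" for \<pi> h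
    unfolding \<rho>_def by (rule lin_ext_delta[OF vK]) (rule X.dK[OF that])
  note l\<psi> = l\<rho>[of \<psi>, OF \<psi>c]
  have \<rho>surj: "\<rho> \<psi> ` carrier X.K = carrier X.K"
  proof
    show "\<rho> \<psi> ` carrier X.K \<subseteq> carrier X.K" using lin_closed[OF l\<psi>] by blast
    let ?\<iota> = "inv_into (carrier \<Gamma>) \<psi>"
    have \<iota>c: "?\<iota> h \<in> carrier \<Gamma>" if "h \<in> carrier \<Gamma>" for h
      using bij_betwE[OF bij_betw_inv_into[OF \<psi>b]] that by blast
    show "carrier X.K \<subseteq> \<rho> \<psi> ` carrier X.K"
    proof
      fix a assume a: "a \<in> carrier X.K"
      have "\<rho> \<psi> (\<rho> ?\<iota> a) = a"
      proof (rule lin_eqI[OF vK vK sK lin_comp[OF l\<rho>[OF \<iota>c] l\<psi>] lin_ident _ a])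
        fix s :: "'h \<Rightarrow>\<^sub>0 'k" assume "s \<in> \<delta> ` carrier \<Gamma>"
        then obtain h where h: "s = \<delta> h" "h \<in> carrier \<Gamma>" by blast
        show "\<rho> \<psi> (\<rho> ?\<iota> s) = s"
          unfolding h(1) \<rho>\<delta>[of ?\<iota>, OF \<iota>c[OF h(2)]] \<rho>\<delta>[of \<psi>, OF \<psi>c[OF \<iota>c[OF h(2)]]] bij_betw_inv_into_right[OF \<psi>b h(2)] ..
      qed
      then show "a \<in> \<rho> \<psi> ` carrier X.K"
        by (rule image_eqI[OF sym lin_closed[OF l\<rho>[OF \<iota>c] a]])
    qed
  qed
  have left: "\<Phi> (X.tn a \<one>\<^bsub>X.B\<^esub>) = X.tn (\<rho> \<psi> a) \<one>\<^bsub>X.B\<^esub>" if a: "a \<in> carrier X.K" for a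
  proof -
    have c: "\<rho> \<psi> a \<in> carrier X.K" by (rule lin_closed[OF l\<psi> a])
    have "M.amap (X.i a) = Y.i (\<rho> \<psi> a)"
    proof (rule lin_eqI[OF vK Y.D.B.vs_axioms sK lin_comp[OF X.lin_i alg_hom_lin[OF M.alg_hom_amap]] lin_comp[OF l\<psi> Y.lin_i] _ a])
      fix s :: "'h \<Rightarrow>\<^sub>0 'k" assume "s \<in> \<delta> ` carrier \<Gamma>"
      then obtain h where h: "s = \<delta> h" "h \<in> carrier \<Gamma>" by blast
      have "M.amap (X.D.\<tau> (h, \<one>\<^bsub>G\<^esub>)) = Y.D.\<tau> (\<Theta> (h, \<one>\<^bsub>G\<^esub>))"
        using h(2) by (intro M.amap_tau) simp
      also have "\<Theta> (h, \<one>\<^bsub>G\<^esub>) = (\<psi> h, \<one>\<^bsub>G\<^esub>)" by (simp add: \<Theta>_def N.gh.hom_one)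
      finally show "M.amap (X.i s) = Y.i (\<rho> \<psi> s)"
        unfolding h(1) \<rho>\<delta>[of \<psi>, OF \<psi>c[OF h(2)]] X.i_delta[OF h(2)] Y.i_delta[OF \<psi>c[OF h(2)]] .
    qed
    then show ?thesis
      unfolding \<Phi>_def X.phi_left[OF a]
      using Y.inv_phi[OF X.KB.tens_closed[OF c X.B.one_closed]] Y.phi_left[OF c] by simp
  qed
  have right: "\<Phi> (X.tn \<one>\<^bsub>X.K\<^esub> u) = X.tn \<one>\<^bsub>X.K\<^esub> (N.amap u)" if u: "u \<in> carrier X.B" for u
  proof -
    have c: "N.amap u \<in> carrier X.B" by (rule N.amap_closed[OF u])
    have "\<psi> \<one>\<^bsub>\<Gamma>\<^esub> = \<one>\<^bsub>\<Gamma>\<^esub>" using \<psi> X.Gam.is_group hom_one[of \<psi> \<Gamma> \<Gamma>] by (simp add: iso_def)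
    then have \<Theta>G: "\<Theta> (\<one>\<^bsub>\<Gamma>\<^esub>, t) = (\<one>\<^bsub>\<Gamma>\<^esub>, \<sigma> t)" for t by (simp add: \<Theta>_def)
    have "M.amap (X.j u) = Y.j (N.amap u)"
      by (intro X.alg_hom_eqI[OF Y.D.kalg_B alg_hom_comp[OF X.J.alg_hom_amap M.alg_hom_amap]
            alg_hom_comp[OF N.alg_hom_amap Y.J.alg_hom_amap] _ _ u])
        (simp_all add: X.j_tau Y.j_tau M.amap_tau N.amap_tau X.J.amap_X Y.J.amap_X M.amap_X N.amap_X \<Theta>G)
    then show ?thesis
      unfolding \<Phi>_def X.phi_right[OF u]
      using Y.inv_phi[OF X.KB.tens_closed[OF X.GA.K.one_closed c]] Y.phi_right[OF c] by simp
  qed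
  have surj: "N.amap ` carrier X.B = carrier X.B"
    using N.hopf_iso_amap[OF \<sigma>i] by (simp add: hopf_iso_def bij_betw_def X.H_simps)
  have "\<Phi> ` factor_left X.A X.H = (\<lambda>a. X.tn a \<one>\<^bsub>X.B\<^esub>) ` (\<rho> \<psi> ` carrier X.K)"
    unfolding X.factor_left_eq image_image by (rule image_cong[OF refl left])
  moreover have "\<Phi> ` factor_right X.A X.H = (\<lambda>u. X.tn \<one>\<^bsub>X.K\<^esub> u) ` (N.amap ` carrier X.B)"
    unfolding X.factor_right_eq image_image by (rule image_cong[OF refl right])
  ultimately have "factor_preserving X.A X.H \<Phi>"
    unfolding factor_preserving_def \<rho>surj surj X.factor_left_eq X.factor_right_eq by simp
  then show ?thesis using \<Phi> by blast
qed

end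

theorem theorem1p2:
  fixes \<Gamma> :: "'h monoid" and G :: "'g monoid" and g :: 'g
    and f :: "'g \<Rightarrow> 'k::alg_closed_field"
    and l l' :: "'g \<Rightarrow> 'h \<Rightarrow> 'h" and r r' :: "'g \<Rightarrow> 'h \<Rightarrow> 'g" and \<gamma> \<gamma>' :: "'h \<Rightarrow> 'k"
    and A :: "('k, 'h \<Rightarrow>\<^sub>0 'k) hopf" and H :: "('k, ('g letter list \<Rightarrow>\<^sub>0 'k) set) hopf"
    and \<Lambda> \<Lambda>' :: "('h \<times> 'g) monoid" and F F' :: "'h \<times> 'g \<Rightarrow> 'k"
  assumes "CHAR('k) > 0"
    and "group \<Gamma>" and "finite (carrier \<Gamma>)"
    and "third_type_datum G g f"
    and "A = group_hopf \<Gamma>" and "H = A3 G g f"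
    and "matched_pair_datum \<Gamma> G g f l r \<gamma>"
    and "matched_pair_datum \<Gamma> G g f l' r' \<gamma>'"
    and "\<Lambda> = group_bicrossed \<Gamma> G l r" and "F = assoc_fun f \<gamma>"
    and "\<Lambda>' = group_bicrossed \<Gamma> G l' r'" and "F' = assoc_fun f \<gamma>'"
  shows
    "(hopf_isomorphic (A3 \<Lambda> (\<one>\<^bsub>\<Gamma>\<^esub>, g) F) (A3 \<Lambda>' (\<one>\<^bsub>\<Gamma>\<^esub>, g) F') \<longleftrightarrow>
        (\<exists>\<Theta>\<in>iso \<Lambda> \<Lambda>'. \<Theta> (\<one>\<^bsub>\<Gamma>\<^esub>, g) = (\<one>\<^bsub>\<Gamma>\<^esub>, g) \<and> (\<forall>y\<in>carrier \<Lambda>. F' (\<Theta> y) = F y))) \<and>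
     (\<forall>L R L' R'.
        corresponding_matched_pair \<Gamma> G g f l r \<gamma> L R \<longrightarrow>
        corresponding_matched_pair \<Gamma> G g f l' r' \<gamma>' L' R' \<longrightarrow>
        (let E = bicrossed A H L R; E' = bicrossed A H L' R' in
          hopf_isomorphic E (A3 \<Lambda> (\<one>\<^bsub>\<Gamma>\<^esub>, g) F) \<and>
          hopf_isomorphic E' (A3 \<Lambda>' (\<one>\<^bsub>\<Gamma>\<^esub>, g) F') \<and>
          (hopf_isomorphic E E' \<longleftrightarrow>
            (\<exists>\<Theta>\<in>iso \<Lambda> \<Lambda>'. \<Theta> (\<one>\<^bsub>\<Gamma>\<^esub>, g) = (\<one>\<^bsub>\<Gamma>\<^esub>, g) \<and> (\<forall>y\<in>carrier \<Lambda>. F' (\<Theta> y) = F y))) \<and>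
          (left_trivial A H L \<and> left_trivial A H L' \<longrightarrow>
            ((\<exists>\<phi>\<in>hopf_iso E E'. factor_preserving A H \<phi>) \<longleftrightarrow>
             (\<exists>\<sigma>\<in>Aut_gf G g f. \<exists>\<psi>\<in>iso \<Gamma> \<Gamma>. \<forall>h\<in>carrier \<Gamma>.
                (\<forall>t\<in>carrier G.
                   r' t h = \<sigma> (r (inv_into (carrier G) \<sigma> t) (inv_into (carrier \<Gamma>) \<psi> h))) \<and>
                \<gamma>' h = \<gamma> (inv_into (carrier \<Gamma>) \<psi> h))))))"
proof -
  have prime: "prime CHAR('k)" using assms(1) by (rule prime_CHAR_semidom)
  have "group G" using assms(4) by (simp add: third_type_datum_def)
  then have tt: "third_type G g f"
    by (intro third_type.intro third_type_axioms.intro assms(4) prime)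
  have md: "matched_datum \<Gamma> G g f l r \<gamma>" "matched_datum \<Gamma> G g f l' r' \<gamma>'"
    by (intro matched_datum.intro matched_datum_axioms.intro assms(2,3,7,8) tt)+
  interpret X: matched_datum \<Gamma> G g f l r \<gamma> by (rule md(1))
  interpret Y: matched_datum \<Gamma> G g f l' r' \<gamma>' by (rule md(2))
  interpret P: third_type_pair X.\<Lambda> "(\<one>\<^bsub>\<Gamma>\<^esub>, g)" X.F Y.\<Lambda> "(\<one>\<^bsub>\<Gamma>\<^esub>, g)" Y.F ..
  have iso: "hopf_isomorphic (A3 \<Lambda> (\<one>\<^bsub>\<Gamma>\<^esub>, g) F) (A3 \<Lambda>' (\<one>\<^bsub>\<Gamma>\<^esub>, g) F') \<longleftrightarrow>
        (\<exists>\<Theta>\<in>iso \<Lambda> \<Lambda>'. \<Theta> (\<one>\<^bsub>\<Gamma>\<^esub>, g) = (\<one>\<^bsub>\<Gamma>\<^esub>, g) \<and> (\<forall>y\<in>carrier \<Lambda>. F' (\<Theta> y) = F y))"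
    unfolding assms(9-12) by (rule P.hopf_isomorphic_iff)
  show ?thesis
  proof (intro conjI allI impI)
    fix L R L' R'
    assume corr: "corresponding_matched_pair \<Gamma> G g f l r \<gamma> L R"
      "corresponding_matched_pair \<Gamma> G g f l' r' \<gamma>' L' R'"
    interpret Q: bicross_pair \<Gamma> G g f l r \<gamma> L R l' r' \<gamma>' L' R'
      by (intro bicross_pair.intro bicross.intro bicross_axioms.intro md corr)
    show "let E = bicrossed A H L R; E' = bicrossed A H L' R' in
          hopf_isomorphic E (A3 \<Lambda> (\<one>\<^bsub>\<Gamma>\<^esub>, g) F) \<and>
          hopf_isomorphic E' (A3 \<Lambda>' (\<one>\<^bsub>\<Gamma>\<^esub>, g) F') \<and>
          (hopf_isomorphic E E' \<longleftrightarrow>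
            (\<exists>\<Theta>\<in>iso \<Lambda> \<Lambda>'. \<Theta> (\<one>\<^bsub>\<Gamma>\<^esub>, g) = (\<one>\<^bsub>\<Gamma>\<^esub>, g) \<and> (\<forall>y\<in>carrier \<Lambda>. F' (\<Theta> y) = F y))) \<and>
          (left_trivial A H L \<and> left_trivial A H L' \<longrightarrow>
            ((\<exists>\<phi>\<in>hopf_iso E E'. factor_preserving A H \<phi>) \<longleftrightarrow>
             (\<exists>\<sigma>\<in>Aut_gf G g f. \<exists>\<psi>\<in>iso \<Gamma> \<Gamma>. \<forall>h\<in>carrier \<Gamma>.
                (\<forall>t\<in>carrier G.
                   r' t h = \<sigma> (r (inv_into (carrier G) \<sigma> t) (inv_into (carrier \<Gamma>) \<psi> h))) \<and>
                \<gamma>' h = \<gamma> (inv_into (carrier \<Gamma>) \<psi> h))))"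
      unfolding Let_def assms(5,6)
    proof (intro conjI impI)
      show "hopf_isomorphic (bicrossed (group_hopf \<Gamma>) (A3 G g f) L R) (A3 \<Lambda> (\<one>\<^bsub>\<Gamma>\<^esub>, g) F)" unfolding assms(9,10) by (rule Q.E_iso_D)
      show "hopf_isomorphic (bicrossed (group_hopf \<Gamma>) (A3 G g f) L' R') (A3 \<Lambda>' (\<one>\<^bsub>\<Gamma>\<^esub>, g) F')" unfolding assms(11,12) by (rule Q.E_iso_D)
      show "hopf_isomorphic (bicrossed (group_hopf \<Gamma>) (A3 G g f) L R) (bicrossed (group_hopf \<Gamma>) (A3 G g f) L' R') \<longleftrightarrow>
            (\<exists>\<Theta>\<in>iso \<Lambda> \<Lambda>'. \<Theta> (\<one>\<^bsub>\<Gamma>\<^esub>, g) = (\<one>\<^bsub>\<Gamma>\<^esub>, g) \<and> (\<forall>y\<in>carrier \<Lambda>. F' (\<Theta> y) = F y))"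
        unfolding Q.E_isomorphic_iff iso[symmetric] unfolding assms(9-12) ..
      assume lt: "left_trivial (group_hopf \<Gamma>) (A3 G g f) L \<and> left_trivial (group_hopf \<Gamma>) (A3 G g f) L'"
      note lt1 = conjunct1[OF lt] and lt2 = conjunct2[OF lt]
      show "(\<exists>\<phi>\<in>hopf_iso (bicrossed (group_hopf \<Gamma>) (A3 G g f) L R) (bicrossed (group_hopf \<Gamma>) (A3 G g f) L' R'). factor_preserving (group_hopf \<Gamma>) (A3 G g f) \<phi>) \<longleftrightarrow>
             (\<exists>\<sigma>\<in>Aut_gf G g f. \<exists>\<psi>\<in>iso \<Gamma> \<Gamma>. \<forall>h\<in>carrier \<Gamma>.
                (\<forall>t\<in>carrier G.
                   r' t h = \<sigma> (r (inv_into (carrier G) \<sigma> t) (inv_into (carrier \<Gamma>) \<psi> h))) \<and>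
                \<gamma>' h = \<gamma> (inv_into (carrier \<Gamma>) \<psi> h))" (is "?L \<longleftrightarrow> ?R")
      proof
        assume ?L
        then show ?R by (elim bexE) (rule Q.factor_iso_imp_params[OF lt1 lt2])
      next
        assume ?R
        then show ?L
          by (elim bexE) (rule Q.params_imp_factor_iso[OF lt1 lt2], assumption+, drule (1) bspec, drule conjunct1, drule (1) bspec, assumption, drule (1) bspec, erule conjunct2)
      qed
    qed
  qed (rule iso)
qed

end
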